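(* Let $\mathbf A$ be an algebra with exactly three elements. Then $\mathbf A\in\mathcal K_{\mathrm{surj}}$ if and only if every minimal congruence $\alpha$ of $\mathbf A$ satisfies $\mathrm{typ}(0_A,\alpha)\neq1$. Moreover, if $\mathbf A\in\mathcal K_{\mathrm{surj}}$, then $\mathbf A\in\mathcal K_{\mathrm{surj}}^{\mathrm{eff}}$.
   Context: A minimal congruence is a congruence $\alpha\ne0_A$ (where $0_A$ is equality) containing no other congruence except $0_A$. A polynomial operation of $\mathbf A$ is a term operation with some arguments fixed to elements of $A$; $\mathbf A|_N$ is the algebra on $N\subseteq A$ whose operations are the polynomial operations of $\mathbf A$ preserving $N$. For a minimal congruence $\alpha$: let $U$ be minimal under inclusion among sets $p(A)$, $p$ a unary polynomial with $p(x)\ne p(y)$ for some $(x,y)\in\alpha$; for $a\in U$ with $|a/\alpha\cap U|\ge2$, $N=a/\alpha\cap U$ is a $(0_A,\alpha)$-trace and $\mathbf A|_N$ is a minimal algebra (each unary polynomial is constant or a permutation), polynomially equivalent to one of: (1) an algebra all of whose operations are unary permutations; (2) a vector space over a finite field; (3) a two-element Boolean algebra; (4) a two-element lattice; (5) a two-element semilattice; the index (independent of choices) is $\mathrm{typ}(0_A,\alpha)$. $\mathcal K_{\mathrm{surj}}$: finite algebras $\mathbf C$ with a polynomial $p$ bounding, for every finite $\mathbf X$ of the same signature, the number of surjective homomorphisms $\mathbf X\to\mathbf C$ by $p(|X|)$; $\mathcal K_{\mathrm{surj}}^{\mathrm{eff}}$ additionally requires these to be enumerable in time polynomial in $|X|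$.
   Formalization: The "moreover" clause (membership in K_surj^eff) is stated for algebras with finitely many basic operations, since otherwise the input X is not a finite object and "time polynomial in |X|" has no meaning; the equivalence is stated for arbitrary signatures. *)

theory Defs
  imports Complex_Main "HOL-Library.FuncSet" "HOL-Algebra.Module"
    "HOL-Computational_Algebra.Polynomial"
begin

section \<open>Algebras, homomorphisms, congruences\<close>

record ('f, 'a) ualg =
  syms :: "'f set"
  arity :: "'f \<Rightarrow> nat"
  univ :: "'a set"
  interp :: "'f \<Rightarrow> 'a list \<Rightarrow> 'a"

definition tuples :: "'a set \<Rightarrow> nat \<Rightarrow> 'a list set" where
  "tuples B n = {xs. length xs = n \<and> set xs \<subseteq> B}"

definition is_ualg :: "('f, 'a) ualg \<Rightarrow> bool" where
  "is_ualg A \<longleftrightarrow> univ A \<noteq> {} \<and>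
     (\<forall>f\<in>syms A. \<forall>xs\<in>tuples (univ A) (arity A f). interp A f xs \<in> univ A)"

definition same_signature :: "('f, 'a) ualg \<Rightarrow> ('f, 'b) ualg \<Rightarrow> bool" where
  "same_signature A B \<longleftrightarrow> syms A = syms B \<and> (\<forall>f\<in>syms A. arity A f = arity B f)"

text \<open>Homomorphisms are taken extensional on the universe, so that they can be counted.\<close>

definition homs :: "('f, 'a) ualg \<Rightarrow> ('f, 'b) ualg \<Rightarrow> ('a \<Rightarrow> 'b) set" where
  "homs X C = {h \<in> univ X \<rightarrow>\<^sub>E univ C.
     \<forall>f\<in>syms X. \<forall>xs\<in>tuples (univ X) (arity X f).
       h (interp X f xs) = interp C f (map h xs)}"

definition surj_homs :: "('f, 'a) ualg \<Rightarrow> ('f, 'b) ualg \<Rightarrow> ('a \<Rightarrow> 'b) set" where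
  "surj_homs X C = {h \<in> homs X C. h ` univ X = univ C}"

definition congruence :: "('f, 'a) ualg \<Rightarrow> ('a \<times> 'a) set \<Rightarrow> bool" where
  "congruence A \<alpha> \<longleftrightarrow> \<alpha> \<subseteq> univ A \<times> univ A \<and> equiv (univ A) \<alpha> \<and>
     (\<forall>f\<in>syms A. \<forall>xs\<in>tuples (univ A) (arity A f). \<forall>ys\<in>tuples (univ A) (arity A f).
        list_all2 (\<lambda>x y. (x, y) \<in> \<alpha>) xs ys \<longrightarrow> (interp A f xs, interp A f ys) \<in> \<alpha>)"

definition minimal_congruence :: "('f, 'a) ualg \<Rightarrow> ('a \<times> 'a) set \<Rightarrow> bool" where
  "minimal_congruence A \<alpha> \<longleftrightarrow> congruence A \<alpha> \<and> \<alpha> \<noteq> Id_on (univ A) \<and>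
     (\<forall>\<beta>. congruence A \<beta> \<and> \<beta> \<subseteq> \<alpha> \<longrightarrow> \<beta> = Id_on (univ A) \<or> \<beta> = \<alpha>)"

section \<open>Polynomial operations and induced algebras\<close>

datatype 'f trm = Var nat | App 'f "'f trm list"

fun wf_trm :: "('f, 'a) ualg \<Rightarrow> nat \<Rightarrow> 'f trm \<Rightarrow> bool" where
  "wf_trm A m (Var i) \<longleftrightarrow> i < m"
| "wf_trm A m (App f ts) \<longleftrightarrow>
     f \<in> syms A \<and> length ts = arity A f \<and> (\<forall>t\<in>set ts. wf_trm A m t)"

fun eval_trm :: "('f, 'a) ualg \<Rightarrow> 'a list \<Rightarrow> 'f trm \<Rightarrow> 'a" where
  "eval_trm A xs (Var i) = xs ! i"
| "eval_trm A xs (App f ts) = interp A f (map (eval_trm A xs) ts)"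

text \<open>The \<open>n\<close>-ary polynomial operations: the arguments of a term operation beyond the first
  \<open>n\<close> are fixed to elements \<open>cs\<close>. They are extensional on the \<open>n\<close>-tuples, so that
  equality of operations is equality of functions.\<close>

definition polys :: "('f, 'a) ualg \<Rightarrow> nat \<Rightarrow> ('a list \<Rightarrow> 'a) set" where
  "polys A n = {restrict (\<lambda>xs. eval_trm A (xs @ cs) t) (tuples (univ A) n) | t cs.
     set cs \<subseteq> univ A \<and> wf_trm A (n + length cs) t}"

text \<open>The operation symbols of the induced algebra are the polynomial operations
  themselves, tagged with their arity.\<close>

definition induced :: "('f, 'a) ualg \<Rightarrow> 'a set \<Rightarrow> (nat \<times> ('a list \<Rightarrow> 'a), 'a) ualg" where
  "induced A N = \<lparr>syms = {(n, p). p \<in> polys A n \<and> (\<forall>xs\<in>tuples N n. p xs \<in> N)},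
     arity = fst, univ = N, interp = snd\<rparr>"

definition poly_equivalent :: "('f, 'a) ualg \<Rightarrow> ('g, 'a) ualg \<Rightarrow> bool" where
  "poly_equivalent A B \<longleftrightarrow> univ A = univ B \<and> (\<forall>n. polys A n = polys B n)"

section \<open>Traces and types of minimal congruences\<close>

definition separating_images :: "('f, 'a) ualg \<Rightarrow> ('a \<times> 'a) set \<Rightarrow> 'a set set" where
  "separating_images A \<alpha> = {(\<lambda>x. p [x]) ` univ A | p.
     p \<in> polys A 1 \<and> (\<exists>(x, y)\<in>\<alpha>. p [x] \<noteq> p [y])}"

definition minimal_set :: "('f, 'a) ualg \<Rightarrow> ('a \<times> 'a) set \<Rightarrow> 'a set \<Rightarrow> bool" where
  "minimal_set A \<alpha> U \<longleftrightarrow> U \<in> separating_images A \<alpha> \<and>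
     (\<forall>V\<in>separating_images A \<alpha>. V \<subseteq> U \<longrightarrow> V = U)"

definition trace :: "('f, 'a) ualg \<Rightarrow> ('a \<times> 'a) set \<Rightarrow> 'a set \<Rightarrow> bool" where
  "trace A \<alpha> N \<longleftrightarrow> (\<exists>U. minimal_set A \<alpha> U \<and>
     (\<exists>a\<in>U. N = \<alpha> `` {a} \<inter> U \<and> card N \<ge> 2))"

definition unary_alg :: "'a set \<Rightarrow> ('a \<Rightarrow> 'a) set \<Rightarrow> ('a \<Rightarrow> 'a, 'a) ualg" where
  "unary_alg N G = \<lparr>syms = G, arity = (\<lambda>_. 1), univ = N, interp = (\<lambda>g xs. g (hd xs))\<rparr>"

datatype 'k vs_sym = VZero | VNeg | VAdd | VScale 'k

fun vs_arity :: "'k vs_sym \<Rightarrow> nat" where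
  "vs_arity VZero = 0"
| "vs_arity VNeg = 1"
| "vs_arity VAdd = 2"
| "vs_arity (VScale k) = 1"

fun vs_interp :: "('k, 'a) module \<Rightarrow> 'k vs_sym \<Rightarrow> 'a list \<Rightarrow> 'a" where
  "vs_interp M VZero xs = \<zero>\<^bsub>M\<^esub>"
| "vs_interp M VNeg xs = \<ominus>\<^bsub>M\<^esub> (xs ! 0)"
| "vs_interp M VAdd xs = xs ! 0 \<oplus>\<^bsub>M\<^esub> xs ! 1"
| "vs_interp M (VScale k) xs = k \<odot>\<^bsub>M\<^esub> xs ! 0"

definition vector_space_alg :: "'k ring \<Rightarrow> ('k, 'a) module \<Rightarrow> ('k vs_sym, 'a) ualg" where
  "vector_space_alg K M = \<lparr>syms = {VZero, VNeg, VAdd} \<union> VScale ` carrier K,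
     arity = vs_arity, univ = carrier M, interp = vs_interp M\<rparr>"

datatype bool_sym = BBot | BTop | BNot | BMeet | BJoin

fun bool_arity :: "bool_sym \<Rightarrow> nat" where
  "bool_arity BBot = 0"
| "bool_arity BTop = 0"
| "bool_arity BNot = 1"
| "bool_arity BMeet = 2"
| "bool_arity BJoin = 2"

fun bool_interp :: "'a \<Rightarrow> 'a \<Rightarrow> bool_sym \<Rightarrow> 'a list \<Rightarrow> 'a" where
  "bool_interp u v BBot xs = u"
| "bool_interp u v BTop xs = v"
| "bool_interp u v BNot xs = (if xs ! 0 = v then u else v)"
| "bool_interp u v BMeet xs = (if xs ! 0 = v \<and> xs ! 1 = v then v else u)"
| "bool_interp u v BJoin xs = (if xs ! 0 = v \<or> xs ! 1 = v then v else u)"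

text \<open>The reduct to the symbols \<open>F\<close> of the Boolean algebra on \<open>{u, v}\<close> with bottom \<open>u\<close> and
  top \<open>v\<close>.\<close>

definition two_element_alg :: "bool_sym set \<Rightarrow> 'a \<Rightarrow> 'a \<Rightarrow> (bool_sym, 'a) ualg" where
  "two_element_alg F u v =
     \<lparr>syms = F, arity = bool_arity, univ = {u, v}, interp = bool_interp u v\<rparr>"

text \<open>Every finite field is isomorphic to one whose carrier is a set of natural numbers.
  In the last case, the order of \<open>u\<close> and \<open>v\<close> is free, so join semilattices are included.\<close>

inductive minimal_alg_type :: "('f, 'a) ualg \<Rightarrow> nat \<Rightarrow> bool" for B :: "('f, 'a) ualg" where
  unary: "\<forall>g\<in>G. bij_betw g (univ B) (univ B) \<Longrightarrow>
    poly_equivalent B (unary_alg (univ B) G) \<Longrightarrow> minimal_alg_type B 1"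
| vector_space: "Ring.field (K :: nat ring) \<Longrightarrow> finite (carrier K) \<Longrightarrow> Module.module K M \<Longrightarrow>
    poly_equivalent B (vector_space_alg K M) \<Longrightarrow> minimal_alg_type B 2"
| boolean: "u \<noteq> v \<Longrightarrow>
    poly_equivalent B (two_element_alg {BBot, BTop, BNot, BMeet, BJoin} u v) \<Longrightarrow>
    minimal_alg_type B 3"
| lattice: "u \<noteq> v \<Longrightarrow> poly_equivalent B (two_element_alg {BMeet, BJoin} u v) \<Longrightarrow>
    minimal_alg_type B 4"
| semilattice: "u \<noteq> v \<Longrightarrow> poly_equivalent B (two_element_alg {BMeet} u v) \<Longrightarrow>
    minimal_alg_type B 5"

definition tct_type :: "('f, 'a) ualg \<Rightarrow> ('a \<times> 'a) set \<Rightarrow> nat" where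
  "tct_type A \<alpha> = (THE i. \<exists>N. trace A \<alpha> N \<and> minimal_alg_type (induced A N) i)"

section \<open>Few surjective homomorphisms\<close>

text \<open>Up to isomorphism, the universe of a finite algebra is a set of natural numbers.\<close>

definition in_K_surj :: "('f, 'a) ualg \<Rightarrow> bool" where
  "in_K_surj C \<longleftrightarrow> is_ualg C \<and> finite (univ C) \<and>
     (\<exists>p :: real poly. \<forall>X :: ('f, nat) ualg.
        is_ualg X \<and> finite (univ X) \<and> same_signature X C \<longrightarrow>
          real (card (surj_homs X C)) \<le> poly p (real (card (univ X))))"

section \<open>Polynomial-time enumeration\<close>

text \<open>The machine model is a random access machine programmed by while programs over
  finitely many registers and multi-dimensional arrays of natural numbers. Every node of an
  expression costs one time unit. The arithmetic is addition and truncated subtraction only,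
  so numbers have at most linearly many bits in the running time and the initial register
  contents, and polynomial time agrees with polynomial time on Turing machines.
  The input is an algebra with universe \<open>{..<n}\<close>, given by \<open>n\<close> (in register 0) and its
  operation tables, which are read by \<open>Lookup\<close>.\<close>

datatype 'f exp =
    Num nat
  | Reg nat
  | Plus "'f exp" "'f exp"
  | Monus "'f exp" "'f exp"
  | Read nat "'f exp list"
  | Lookup 'f "'f exp list"

datatype 'f com =
    Skip
  | Assign nat "'f exp"
  | Store nat "'f exp list" "'f exp"
  | Output "'f exp"
  | Seq "'f com" "'f com"
  | Cond "'f exp" "'f com" "'f com"
  | While "'f exp" "'f com"

record state =
  regs :: "nat \<Rightarrow> nat"
  arrays :: "nat \<Rightarrow> nat list \<Rightarrow> nat"
  outp :: "nat list"

fun eval_exp :: "('f \<Rightarrow> nat list \<Rightarrow> nat) \<Rightarrow> state \<Rightarrow> 'f exp \<Rightarrow> nat" where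
  "eval_exp T s (Num k) = k"
| "eval_exp T s (Reg r) = regs s r"
| "eval_exp T s (Plus e1 e2) = eval_exp T s e1 + eval_exp T s e2"
| "eval_exp T s (Monus e1 e2) = eval_exp T s e1 - eval_exp T s e2"
| "eval_exp T s (Read a es) = arrays s a (map (eval_exp T s) es)"
| "eval_exp T s (Lookup f es) = T f (map (eval_exp T s) es)"

fun exp_cost :: "'f exp \<Rightarrow> nat" where
  "exp_cost (Num k) = 1"
| "exp_cost (Reg r) = 1"
| "exp_cost (Plus e1 e2) = 1 + exp_cost e1 + exp_cost e2"
| "exp_cost (Monus e1 e2) = 1 + exp_cost e1 + exp_cost e2"
| "exp_cost (Read a es) = 1 + sum_list (map exp_cost es)"
| "exp_cost (Lookup f es) = 1 + sum_list (map exp_cost es)"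

text \<open>\<open>exec T c s t s'\<close>: with operation tables \<open>T\<close>, the program \<open>c\<close> started in \<open>s\<close> halts in
  \<open>s'\<close> after \<open>t\<close> time units. Guards are true iff nonzero.\<close>

inductive exec :: "('f \<Rightarrow> nat list \<Rightarrow> nat) \<Rightarrow> 'f com \<Rightarrow> state \<Rightarrow> nat \<Rightarrow> state \<Rightarrow> bool"
  for T :: "'f \<Rightarrow> nat list \<Rightarrow> nat" where
  Skip: "exec T Skip s 1 s"
| Assign: "exec T (Assign r e) s (1 + exp_cost e)
    (s\<lparr>regs := (regs s)(r := eval_exp T s e)\<rparr>)"
| Store: "exec T (Store a es e) s (1 + sum_list (map exp_cost es) + exp_cost e)
    (s\<lparr>arrays := (arrays s)(a :=
        (arrays s a)(map (eval_exp T s) es := eval_exp T s e))\<rparr>)"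
| Output: "exec T (Output e) s (1 + exp_cost e) (s\<lparr>outp := outp s @ [eval_exp T s e]\<rparr>)"
| Seq: "exec T c1 s t1 s1 \<Longrightarrow> exec T c2 s1 t2 s2 \<Longrightarrow> exec T (Seq c1 c2) s (t1 + t2) s2"
| CondTrue: "eval_exp T s b \<noteq> 0 \<Longrightarrow> exec T c1 s t s1 \<Longrightarrow>
    exec T (Cond b c1 c2) s (1 + exp_cost b + t) s1"
| CondFalse: "eval_exp T s b = 0 \<Longrightarrow> exec T c2 s t s1 \<Longrightarrow>
    exec T (Cond b c1 c2) s (1 + exp_cost b + t) s1"
| WhileTrue: "eval_exp T s b \<noteq> 0 \<Longrightarrow> exec T c s t1 s1 \<Longrightarrow> exec T (While b c) s1 t2 s2 \<Longrightarrow>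
    exec T (While b c) s (1 + exp_cost b + t1 + t2) s2"
| WhileFalse: "eval_exp T s b = 0 \<Longrightarrow> exec T (While b c) s (1 + exp_cost b) s"

definition op_table :: "('f, nat) ualg \<Rightarrow> 'f \<Rightarrow> nat list \<Rightarrow> nat" where
  "op_table X f xs =
     (if f \<in> syms X \<and> xs \<in> tuples (univ X) (arity X f) then interp X f xs else 0)"

definition init_state :: "nat \<Rightarrow> state" where
  "init_state n = \<lparr>regs = (\<lambda>_. 0)(0 := n), arrays = (\<lambda>_ _. 0), outp = []\<rparr>"

text \<open>The elements of the fixed algebra \<open>C\<close> are printed through a fixed injective numbering
  \<open>code\<close>; a map \<open>h\<close> on \<open>{..<n}\<close> is printed as the sequence of its \<open>n\<close> values.\<close>

definition surj_homs_poly_time_enumerable :: "('f, 'a) ualg \<Rightarrow> bool" where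
  "surj_homs_poly_time_enumerable C \<longleftrightarrow>
     (\<exists>(c :: 'f com) (code :: 'a \<Rightarrow> nat) (p :: real poly). inj_on code (univ C) \<and>
        (\<forall>(X :: ('f, nat) ualg) n.
           is_ualg X \<and> univ X = {..<n} \<and> same_signature X C \<longrightarrow>
             (\<exists>t s hs. exec (op_table X) c (init_state n) t s \<and> real t \<le> poly p (real n) \<and>
                distinct hs \<and> set hs = surj_homs X C \<and>
                outp s = concat (map (\<lambda>h. map (\<lambda>x. code (h x)) [0..<n]) hs))))"

definition in_K_surj_eff :: "('f, 'a) ualg \<Rightarrow> bool" where
  "in_K_surj_eff C \<longleftrightarrow> in_K_surj C \<and> surj_homs_poly_time_enumerable C"

end

theory Submission
  imports Defs
begin

text \<open>
  The type of a trace is read off its unary and binary polynomials. In type 1 every polynomial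
  restricted to a trace \<open>N\<close> depends on at most one variable, so the \<open>k\<close>-ary polynomials restricted to
  \<open>N\<close> form an algebra of size linear in \<open>k\<close>, while evaluation at the points of \<open>N\<^sup>k\<close> gives
  exponentially many surjective homomorphisms from it.

  Conversely, given a homomorphism \<open>h\<close> from \<open>X\<close> onto \<open>A\<close>, fix a preimage of each element of \<open>A\<close>; there
  are at most \<open>|X|\<^sup>3\<close> choices. Polynomials of \<open>A\<close> then lift to polynomials of \<open>X\<close> and \<open>h\<close> is
  compatible with them. If the type is not 1, a lifted meet, join or addition on a trace forces the
  number of such \<open>h\<close> to be polynomial.

  For the enumeration, partial homomorphisms with the three preimages fixed are extended
  along the elements of \<open>X\<close> in order, each time closing the domain under the operations. Restricted to
  their common domain, the partial homomorphisms of one stage are distinct surjective homomorphisms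
  of a subalgebra of \<open>X\<close>, so the bound just proved keeps every stage polynomially small.
\<close>

section \<open>Polynomial operations\<close>

text \<open>The type is a definite description over all traces, so every trace must be shown to have
  exactly one type, and all traces the same one. This takes a hand-made case of Palfy's theorem for
  two and three elements, with \<open>kind\<close> as an invariant of the polynomial clone that
  separates the five models. Three elements help in two further places: two subsets of size two
  always meet, so a minimal set contains a single trace, and a binary polynomial depending on both
  variables over a trace of type 1 would need four values. In the upper bound the obstacle is that
  operations on a trace may see h only modulo a congruence \<theta>. It meets \<alpha> in equality
  alone, and unless it is equality it is again minimal, so the hypothesis on types applies to
  \<theta> too and recovers what was lost. In the enumeration the obstacle is that extendability of
  a partial homomorphism is not tested, so dead ends survive; they are harmless because they, too,
  are homomorphisms of a subalgebra and are covered by the same bound.\<close>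

definition pol :: "('f, 'a) ualg \<Rightarrow> nat \<Rightarrow> ('a list \<Rightarrow> 'a) \<Rightarrow> bool" where
  "pol A n F \<longleftrightarrow> restrict F (tuples (univ A) n) \<in> polys A n"

lemma tuples_nth: "xs \<in> tuples B n \<Longrightarrow> i < n \<Longrightarrow> xs ! i \<in> B"
  by (auto simp: tuples_def)

lemma tuples_length: "xs \<in> tuples B n \<Longrightarrow> length xs = n"
  by (simp add: tuples_def)

lemma tuples_map_upt: "(\<And>i. i < n \<Longrightarrow> g i \<in> B) \<Longrightarrow> map g [0..<n] \<in> tuples B n"
  by (auto simp: tuples_def)

lemma tuples_update: "xs \<in> tuples B n \<Longrightarrow> y \<in> B \<Longrightarrow> xs[j := y] \<in> tuples B n"
  using set_update_subset_insert[of xs j y] by (auto simp: tuples_def)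

lemma tuples_mono: "B \<subseteq> C \<Longrightarrow> xs \<in> tuples B n \<Longrightarrow> xs \<in> tuples C n"
  by (auto simp: tuples_def)

lemma tuples_Nil: "xs \<in> tuples B 0 \<longleftrightarrow> xs = []"
  by (auto simp: tuples_def)

lemma tuples_Suc: "xs \<in> tuples B (Suc n) \<longleftrightarrow> (\<exists>y ys. xs = y # ys \<and> y \<in> B \<and> ys \<in> tuples B n)"
  by (auto simp: tuples_def length_Suc_conv)

lemma tuples_Cons: "y # ys \<in> tuples B (Suc n) \<longleftrightarrow> y \<in> B \<and> ys \<in> tuples B n"
  by (auto simp: tuples_def)

lemma tuples_one: "xs \<in> tuples B (Suc 0) \<longleftrightarrow> (\<exists>x\<in>B. xs = [x])"
  by (auto simp: tuples_Suc tuples_Nil)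

lemma tuples_two: "xs \<in> tuples B (Suc (Suc 0)) \<longleftrightarrow> (\<exists>x\<in>B. \<exists>y\<in>B. xs = [x, y])"
  by (auto simp: tuples_Suc tuples_Nil)

lemma tuples_replicate: "z \<in> B \<Longrightarrow> replicate n z \<in> tuples B n"
  by (auto simp: tuples_def)

text \<open>The walk from \<open>zs\<close> to \<open>ws\<close> goes through the tuples that agree
  with \<open>ws\<close> on a prefix and with \<open>zs\<close> on the rest. It spreads a property
  known at one point of a power to the whole power.\<close>

lemma tuples_change_induct:
  assumes "zs \<in> tuples B n" "ws \<in> tuples B n" "P zs"
    and step: "\<And>xs j y. xs \<in> tuples B n \<Longrightarrow> P xs \<Longrightarrow> j < n \<Longrightarrow> y \<in> B \<Longrightarrow> P (xs[j := y])"
  shows "P ws"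
proof -
  have "k \<le> n \<Longrightarrow> take k ws @ drop k zs \<in> tuples B n \<and> P (take k ws @ drop k zs)" for k
  proof (induction k)
    case 0
    then show ?case using assms by simp
  next
    case (Suc k)
    let ?xs = "take k ws @ drop k zs"
    have len: "length ws = n" "length zs = n" using assms by (auto simp: tuples_def)
    have "take (Suc k) ws @ drop (Suc k) zs = ?xs[k := ws ! k]"
      using Suc.prems len
      by (intro nth_equalityI) (auto simp: nth_append nth_list_update less_Suc_eq min_def)
    moreover have "ws ! k \<in> B" using assms(2) Suc.prems by (auto intro: tuples_nth)
    ultimately show ?case
      using Suc step[of ?xs k "ws ! k"] tuples_update[of ?xs B n "ws ! k" k] by simp
  qed
  from this[of n] show ?thesis using assms by (simp add: tuples_def)
qed

fun rename_trm :: "(nat \<Rightarrow> nat) \<Rightarrow> 'f trm \<Rightarrow> 'f trm" where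
  "rename_trm r (Var i) = Var (r i)"
| "rename_trm r (App f ts) = App f (map (rename_trm r) ts)"

lemma wf_rename_trm:
  "wf_trm A m t \<Longrightarrow> (\<And>i. i < m \<Longrightarrow> r i < m') \<Longrightarrow> wf_trm A m' (rename_trm r t)"
  by (induction t) auto

lemma eval_rename_trm:
  "wf_trm A m t \<Longrightarrow> (\<And>i. i < m \<Longrightarrow> ys ! (r i) = xs ! i) \<Longrightarrow>
   eval_trm A ys (rename_trm r t) = eval_trm A xs t"
proof (induction t)
  case (App f ts)
  have "map (eval_trm A ys \<circ> rename_trm r) ts = map (eval_trm A xs) ts"
    using App by auto
  then show ?case unfolding rename_trm.simps eval_trm.simps map_map by (rule arg_cong)
qed simp

text \<open>Each polynomial brings its own list of constants, which obstructs putting several of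
  them under one operation symbol. With a single list \<open>cs0\<close> that exhausts the universe,
  all polynomials are terms over the same variables.\<close>

lemma pol_trm_iff:
  assumes cs0: "set cs0 = univ A"
  shows "pol A n F \<longleftrightarrow> (\<exists>t. wf_trm A (n + length cs0) t \<and>
     (\<forall>xs\<in>tuples (univ A) n. F xs = eval_trm A (xs @ cs0) t))"
proof
  assume "pol A n F"
  then obtain t cs where t: "set cs \<subseteq> univ A" "wf_trm A (n + length cs) t"
    "restrict F (tuples (univ A) n) = restrict (\<lambda>xs. eval_trm A (xs @ cs) t) (tuples (univ A) n)"
    unfolding pol_def polys_def by blast
  have "\<forall>i<length cs. \<exists>j<length cs0. cs0 ! j = cs ! i"
    using t(1) cs0 by (metis in_set_conv_nth nth_mem subsetD)
  then obtain d where d: "\<And>i. i < length cs \<Longrightarrow> d i < length cs0 \<and> cs0 ! d i = cs ! i" by metis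
  \<comment> \<open>Proper variables stay, and a constant moves to a place where \<open>cs0\<close>
    holds the same element.\<close>
  define r where "r i = (if i < n then i else n + d (i - n))" for i
  have "wf_trm A (n + length cs0) (rename_trm r t)"
    using t(2) by (rule wf_rename_trm) (use d in \<open>auto simp: r_def\<close>)
  moreover have "F xs = eval_trm A (xs @ cs0) (rename_trm r t)" if "xs \<in> tuples (univ A) n" for xs
  proof -
    have "F xs = eval_trm A (xs @ cs) t" using fun_cong[OF t(3), of xs] that by simp
    also have "\<dots> = eval_trm A (xs @ cs0) (rename_trm r t)"
      by (rule eval_rename_trm[symmetric, OF t(2)])
        (use that d in \<open>auto simp: r_def nth_append tuples_length\<close>)
    finally show ?thesis .
  qed
  ultimately show "\<exists>t. wf_trm A (n + length cs0) t \<and>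
     (\<forall>xs\<in>tuples (univ A) n. F xs = eval_trm A (xs @ cs0) t)" by blast
next
  assume "\<exists>t. wf_trm A (n + length cs0) t \<and>
     (\<forall>xs\<in>tuples (univ A) n. F xs = eval_trm A (xs @ cs0) t)"
  then show "pol A n F"
    unfolding pol_def polys_def using cs0 by (fastforce intro!: restrict_ext)
qed

lemma polys_pol: "p \<in> polys A n \<Longrightarrow> pol A n p"
  unfolding pol_def by (auto simp: polys_def) blast

lemma pol_polys: "pol A n F \<Longrightarrow> restrict F (tuples (univ A) n) \<in> polys A n"
  by (simp add: pol_def)

lemma pol_cong: "(\<And>xs. xs \<in> tuples (univ A) n \<Longrightarrow> F xs = G xs) \<Longrightarrow> pol A n F \<longleftrightarrow> pol A n G"
  unfolding pol_def by (metis restrict_ext)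

lemma pol_congI: "pol A n F \<Longrightarrow> (\<And>xs. xs \<in> tuples (univ A) n \<Longrightarrow> F xs = G xs) \<Longrightarrow> pol A n G"
  using pol_cong[of A n F G] by blast

lemma polys_eq_iff:
  assumes "univ A = univ B"
  shows "polys A n = polys B n \<longleftrightarrow> (\<forall>F. pol A n F \<longleftrightarrow> pol B n F)"
proof
  assume "\<forall>F. pol A n F \<longleftrightarrow> pol B n F"
  then have "p \<in> polys A n \<longleftrightarrow> p \<in> polys B n" for p
  proof -
    have "restrict p (tuples (univ A) n) = p" if "p \<in> polys A n \<or> p \<in> polys B n"
      using that assms by (auto simp: polys_def)
    then show ?thesis
      using \<open>\<forall>F. pol A n F \<longleftrightarrow> pol B n F\<close> assms unfolding pol_def by metis
  qed
  then show "polys A n = polys B n" by blast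
qed (use assms in \<open>simp add: pol_def\<close>)

context
  fixes A :: "('f, 'a) ualg"
  assumes fin: "finite (univ A)"
begin

lemma pol_proj: "i < n \<Longrightarrow> pol A n (\<lambda>xs. xs ! i)"
proof -
  assume "i < n"
  obtain cs0 where cs0: "set cs0 = univ A" using finite_list[OF fin] by blast
  show ?thesis unfolding pol_trm_iff[OF cs0]
    by (rule exI[of _ "Var i"]) (use \<open>i < n\<close> in \<open>auto simp: tuples_length nth_append\<close>)
qed

lemma pol_const: "c \<in> univ A \<Longrightarrow> pol A n (\<lambda>_. c)"
proof -
  assume "c \<in> univ A"
  obtain cs0 where cs0: "set cs0 = univ A" using finite_list[OF fin] by blast
  then obtain j where "j < length cs0" "cs0 ! j = c" using \<open>c \<in> univ A\<close> by (metis in_set_conv_nth)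
  then show ?thesis unfolding pol_trm_iff[OF cs0]
    by (intro exI[of _ "Var (n + j)"]) (auto simp: tuples_length nth_append)
qed

lemma pol_app:
  assumes "f \<in> syms A" and "\<And>i. i < arity A f \<Longrightarrow> pol A n (G i)"
  shows "pol A n (\<lambda>xs. interp A f (map (\<lambda>i. G i xs) [0..<arity A f]))"
proof -
  obtain cs0 where cs0: "set cs0 = univ A" using finite_list[OF fin] by blast
  have "\<forall>i<arity A f. \<exists>t. wf_trm A (n + length cs0) t \<and>
     (\<forall>xs\<in>tuples (univ A) n. G i xs = eval_trm A (xs @ cs0) t)"
    using assms(2) unfolding pol_trm_iff[OF cs0] by blast
  then obtain t where t: "\<And>i. i < arity A f \<Longrightarrow> wf_trm A (n + length cs0) (t i)"
    "\<And>i xs. i < arity A f \<Longrightarrow> xs \<in> tuples (univ A) n \<Longrightarrow> G i xs = eval_trm A (xs @ cs0) (t i)"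
    by metis
  show ?thesis unfolding pol_trm_iff[OF cs0]
  proof (intro exI conjI ballI)
    show "wf_trm A (n + length cs0) (App f (map t [0..<arity A f]))"
      using assms(1) t(1) by auto
    fix xs assume "xs \<in> tuples (univ A) n"
    then have "map (\<lambda>i. G i xs) [0..<arity A f] =
        map (eval_trm A (xs @ cs0)) (map t [0..<arity A f])"
      using t(2) by auto
    then show "interp A f (map (\<lambda>i. G i xs) [0..<arity A f]) =
      eval_trm A (xs @ cs0) (App f (map t [0..<arity A f]))"
      unfolding eval_trm.simps by (rule arg_cong)
  qed
qed

end

text \<open>Polynomials as the clone generated by projections and constants. The case
  \<open>cong\<close> is there because \<open>pol\<close> looks at a function only on tuples over
  the universe, while terms produce one particular representative.\<close>

lemma pol_induct [consumes 2, case_names proj const app cong]: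
  assumes fin: "finite (univ A)" and "pol A n F"
    and proj: "\<And>i. i < n \<Longrightarrow> Q (\<lambda>xs. xs ! i)"
    and const: "\<And>c. c \<in> univ A \<Longrightarrow> Q (\<lambda>_. c)"
    and app: "\<And>f G. f \<in> syms A \<Longrightarrow> (\<And>i. i < arity A f \<Longrightarrow> pol A n (G i)) \<Longrightarrow>
       (\<And>i. i < arity A f \<Longrightarrow> Q (G i)) \<Longrightarrow>
       Q (\<lambda>xs. interp A f (map (\<lambda>i. G i xs) [0..<arity A f]))"
    and cong: "\<And>F G. Q F \<Longrightarrow> (\<And>xs. xs \<in> tuples (univ A) n \<Longrightarrow> F xs = G xs) \<Longrightarrow> Q G"
  shows "Q F"
proof -
  obtain cs0 where cs0: "set cs0 = univ A" using finite_list[OF fin] by blast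
  have "wf_trm A (n + length cs0) t \<Longrightarrow>
      pol A n (\<lambda>xs. eval_trm A (xs @ cs0) t) \<and> Q (\<lambda>xs. eval_trm A (xs @ cs0) t)" for t
  proof (induction t)
    case (Var i)
    then have "pol A n (\<lambda>xs. eval_trm A (xs @ cs0) (Var i))"
      unfolding pol_trm_iff[OF cs0] by (intro exI[of _ "Var i"]) auto
    moreover have "Q (\<lambda>xs. eval_trm A (xs @ cs0) (Var i))"
    proof (cases "i < n")
      case True
      show ?thesis by (rule cong[OF proj[OF True]]) (auto simp: nth_append tuples_length True)
    next
      case False
      then have "cs0 ! (i - n) \<in> univ A" using Var cs0 by (metis add.commute less_diff_conv2
            linorder_not_less nth_mem wf_trm.simps(1))
      then show ?thesis
        by (rule cong[OF const]) (auto simp: nth_append tuples_length False)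
    qed
    ultimately show ?case ..
  next
    case (App f ts)
    then have f: "f \<in> syms A" "length ts = arity A f" by auto
    have IH: "pol A n (\<lambda>xs. eval_trm A (xs @ cs0) (ts ! i)) \<and> Q (\<lambda>xs. eval_trm A (xs @ cs0) (ts ! i))"
      if "i < arity A f" for i
      using App f that by auto
    have eq: "map (\<lambda>i. eval_trm A (xs @ cs0) (ts ! i)) [0..<arity A f] =
        map (eval_trm A (xs @ cs0)) ts" for xs
      using f(2) by (auto intro: nth_equalityI)
    have "pol A n (\<lambda>xs. interp A f (map (\<lambda>i. eval_trm A (xs @ cs0) (ts ! i)) [0..<arity A f]))"
      by (rule pol_app[OF fin f(1)]) (use IH in blast)
    moreover have "Q (\<lambda>xs. interp A f (map (\<lambda>i. eval_trm A (xs @ cs0) (ts ! i)) [0..<arity A f]))"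
      by (rule app[OF f(1)]) (use IH in blast)+
    ultimately show ?case by (simp add: eq)
  qed
  then show ?thesis
    using assms(2) cong unfolding pol_trm_iff[OF cs0] by fastforce
qed

context
  fixes A :: "('f, 'a) ualg"
  assumes fin: "finite (univ A)"
begin

lemma pol_closed:
  assumes "pol A n F" "is_ualg A" "xs \<in> tuples (univ A) n"
  shows "F xs \<in> univ A"
proof -
  have "\<forall>xs\<in>tuples (univ A) n. F xs \<in> univ A"
    using fin assms(1)
  proof (induction rule: pol_induct)
    case (app f G)
    then have "map (\<lambda>i. G i xs) [0..<arity A f] \<in> tuples (univ A) (arity A f)"
      if "xs \<in> tuples (univ A) n" for xs
      using that by (intro tuples_map_upt) blast
    then show ?case using assms(2) app(1) unfolding is_ualg_def by blast
  qed (auto intro: tuples_nth)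
  then show ?thesis using assms(3) by blast
qed

lemma pol_comp:
  assumes "pol A m F" and G: "\<And>i. i < m \<Longrightarrow> pol A n (G i)"
    and cl: "is_ualg A"
  shows "pol A n (\<lambda>xs. F (map (\<lambda>i. G i xs) [0..<m]))"
  using fin assms(1)
proof (induction rule: pol_induct)
  case (proj i)
  then show ?case using G[of i] by simp
next
  case (const c)
  then show ?case by (rule pol_const[OF fin])
next
  case (app f H)
  then show ?case
    using pol_app[OF fin app(1), of n "\<lambda>i xs. H i (map (\<lambda>i. G i xs) [0..<m])"] by blast
next
  case (cong F F')
  have "F (map (\<lambda>i. G i xs) [0..<m]) = F' (map (\<lambda>i. G i xs) [0..<m])"
    if "xs \<in> tuples (univ A) n" for xs
    by (rule cong(2)) (intro tuples_map_upt pol_closed[OF G cl that])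
  then show ?case by (rule pol_congI[OF cong(1)])
qed

lemma pol_comp1:
  assumes "pol A 1 F" "pol A n G" "is_ualg A"
  shows "pol A n (\<lambda>xs. F [G xs])"
  using pol_comp[OF assms(1), of n "\<lambda>_. G"] assms by simp

lemma pol_comp2:
  assumes "pol A 2 F" "pol A n G" "pol A n H" "is_ualg A"
  shows "pol A n (\<lambda>xs. F [G xs, H xs])"
proof -
  have "pol A n (\<lambda>xs. F (map (\<lambda>i. (if i = 0 then G else H) xs) [0..<2]))"
    by (rule pol_comp[OF assms(1)]) (use assms in auto)
  then show ?thesis by (simp add: upt_rec)
qed

lemma pol_basic:
  assumes "f \<in> syms A" "is_ualg A"
  shows "pol A (arity A f) (interp A f)"
proof -
  have "pol A (arity A f) (\<lambda>xs. interp A f (map (\<lambda>i. xs ! i) [0..<arity A f]))"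
    using pol_app[OF fin assms(1), of "arity A f" "\<lambda>i xs. xs ! i"] pol_proj[OF fin] by blast
  moreover have "map ((!) xs) [0..<arity A f] = xs" if "xs \<in> tuples (univ A) (arity A f)" for xs
    using tuples_length[OF that] map_nth[of xs] by simp
  ultimately show ?thesis by (auto intro: pol_congI)
qed

lemma pol_Cons:
  assumes "pol A (Suc n) F" "c \<in> univ A" "is_ualg A"
  shows "pol A n (\<lambda>xs. F (c # xs))"
proof -
  define G where "G i = (if i = 0 then (\<lambda>_. c) else (\<lambda>xs :: 'a list. xs ! (i - 1)))" for i :: nat
  have "pol A n (G i)" if "i < Suc n" for i
    using that assms(2) pol_const[OF fin, of c n] pol_proj[OF fin, of "i - 1" n] by (auto simp: G_def)
  then have *: "pol A n (\<lambda>xs. F (map (\<lambda>i. G i xs) [0..<Suc n]))"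
    by (intro pol_comp[OF assms(1)] assms(3))
  have "map (\<lambda>i. G i xs) [0..<Suc n] = c # xs" if "xs \<in> tuples (univ A) n" for xs
    by (rule nth_equalityI) (use that in \<open>auto simp: G_def tuples_length nth_Cons' simp del: upt_Suc\<close>)
  then show ?thesis by (intro pol_congI[OF *]) simp
qed

lemma pol_tl:
  assumes "pol A n F" "is_ualg A"
  shows "pol A (Suc n) (\<lambda>xs. F (tl xs))"
proof -
  have "pol A (Suc n) (\<lambda>xs. xs ! Suc i)" if "i < n" for i
    using that by (intro pol_proj[OF fin]) simp
  then have *: "pol A (Suc n) (\<lambda>xs. F (map (\<lambda>i. xs ! Suc i) [0..<n]))"
    using pol_comp[OF assms(1), of "Suc n" "\<lambda>i xs. xs ! Suc i"] assms(2) by blast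
  have "map (\<lambda>i. xs ! Suc i) [0..<n] = tl xs" if "xs \<in> tuples (univ A) (Suc n)" for xs
    by (rule nth_equalityI) (use that in \<open>auto simp: tuples_length nth_tl\<close>)
  then show ?thesis by (intro pol_congI[OF *]) simp
qed

lemma pol_update:
  assumes "pol A n F" "is_ualg A" "zs \<in> tuples (univ A) n" "pol A m G"
  shows "pol A m (\<lambda>xs. F (zs[i := G xs]))"
proof -
  define H where "H k = (if k = i then G else (\<lambda>_. zs ! k))" for k
  have "pol A m (H k)" if "k < n" for k
    using that assms pol_const[OF fin, of "zs ! k" m] by (auto simp: H_def tuples_nth)
  then have *: "pol A m (\<lambda>xs. F (map (\<lambda>i. H i xs) [0..<n]))"
    by (intro pol_comp[OF assms(1)] assms(2))
  have "map (\<lambda>i. H i xs) [0..<n] = zs[i := G xs]" for xs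
    by (rule nth_equalityI) (use assms(3) in \<open>auto simp: H_def tuples_length nth_list_update\<close>)
  then show ?thesis using * by simp
qed

lemma pol_update2:
  assumes "pol A n F" "is_ualg A" "zs \<in> tuples (univ A) n" "pol A m G" "pol A m G'"
  shows "pol A m (\<lambda>xs. F (zs[i := G xs, j := G' xs]))"
proof -
  define H where "H k = (if k = j then G' else if k = i then G else (\<lambda>_. zs ! k))" for k
  have "pol A m (H k)" if "k < n" for k
    using that assms pol_const[OF fin, of "zs ! k" m] by (auto simp: H_def tuples_nth)
  then have *: "pol A m (\<lambda>xs. F (map (\<lambda>i. H i xs) [0..<n]))"
    by (intro pol_comp[OF assms(1)] assms(2))
  have "map (\<lambda>i. H i xs) [0..<n] = zs[i := G xs, j := G' xs]" for xs
    by (rule nth_equalityI) (use assms(3) in \<open>auto simp: H_def tuples_length nth_list_update\<close>)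
  then show ?thesis using * by simp
qed

end

lemma pol_subset:
  assumes "finite (univ A)" "is_ualg A" "is_ualg D" "univ D = univ A"
    and "\<And>f. f \<in> syms D \<Longrightarrow> pol A (arity D f) (interp D f)"
    and "pol D n F"
  shows "pol A n F"
proof -
  have finD: "finite (univ D)" using assms by simp
  from finD assms(6) show ?thesis
  proof (induction rule: pol_induct)
    case (proj i)
    then show ?case by (rule pol_proj[OF assms(1)])
  next
    case (const c)
    then show ?case using assms by (intro pol_const) auto
  next
    case (app f G)
    then show ?case using pol_comp[OF assms(1) assms(5)[OF app(1)], of n G] assms(2) by blast
  next
    case (cong F G)
    then show ?case using pol_cong[of A n F G] assms(4) by simp
  qed
qed

section \<open>Induced algebras\<close>

lemma is_ualg_induced: "N \<noteq> {} \<Longrightarrow> is_ualg (induced A N)"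
  by (auto simp: is_ualg_def induced_def)

lemma univ_induced [simp]: "univ (induced A N) = N"
  by (simp add: induced_def)

text \<open>All polynomials preserving N are already basic operations of the induced algebra, and
  such polynomials are closed under composition, so passing to its polynomials adds nothing
  new.\<close>

lemma pol_induced:
  assumes "finite (univ A)" "is_ualg A" "N \<subseteq> univ A" "N \<noteq> {}"
  shows "pol (induced A N) n F \<longleftrightarrow>
    (\<exists>p. pol A n p \<and> (\<forall>xs\<in>tuples N n. p xs \<in> N \<and> F xs = p xs))"
proof
  have finN: "finite (univ (induced A N))" using assms finite_subset by auto
  assume "pol (induced A N) n F"
  with finN show "\<exists>p. pol A n p \<and> (\<forall>xs\<in>tuples N n. p xs \<in> N \<and> F xs = p xs)"
  proof (induction rule: pol_induct)
    case (proj i)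
    then show ?case using pol_proj[OF assms(1), of i n] by (auto intro!: exI[of _ "\<lambda>xs. xs ! i"] tuples_nth)
  next
    case (const c)
    then show ?case using pol_const[OF assms(1), of c n] assms by (auto intro!: exI[of _ "\<lambda>xs. c"])
  next
    case (app f G)
    obtain m q where f: "f = (m, q)" by (cases f)
    have q: "q \<in> polys A m" "\<forall>xs\<in>tuples N m. q xs \<in> N" and m: "arity (induced A N) f = m"
      using app(1) f by (auto simp: induced_def)
    have "\<forall>i<m. \<exists>p. pol A n p \<and> (\<forall>xs\<in>tuples N n. p xs \<in> N \<and> G i xs = p xs)"
      using app(3) m by auto
    then obtain P where P: "\<And>i. i < m \<Longrightarrow> pol A n (P i)"
      "\<And>i xs. i < m \<Longrightarrow> xs \<in> tuples N n \<Longrightarrow> P i xs \<in> N \<and> G i xs = P i xs" by metis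
    have "pol A n (\<lambda>xs. q (map (\<lambda>i. P i xs) [0..<m]))"
      by (rule pol_comp[OF assms(1) polys_pol[OF q(1)] P(1) assms(2)])
    moreover have "q (map (\<lambda>i. P i xs) [0..<m]) \<in> N"
      "interp (induced A N) f (map (\<lambda>i. G i xs) [0..<m]) = q (map (\<lambda>i. P i xs) [0..<m])"
      if "xs \<in> tuples N n" for xs
    proof -
      show "q (map (\<lambda>i. P i xs) [0..<m]) \<in> N"
        using q(2) P(2) that by (auto intro!: bspec[OF q(2)] tuples_map_upt)
      have eq: "map (\<lambda>i. G i xs) [0..<m] = map (\<lambda>i. P i xs) [0..<m]" using P(2) that by auto
      have q': "interp (induced A N) f = q" by (simp add: induced_def f)
      show "interp (induced A N) f (map (\<lambda>i. G i xs) [0..<m]) = q (map (\<lambda>i. P i xs) [0..<m])"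
        unfolding q' eq ..
    qed
    ultimately show ?case using m by auto
  next
    case (cong F G)
    then show ?case by auto
  qed
next
  have finN: "finite (univ (induced A N))" using assms finite_subset by auto
  assume "\<exists>p. pol A n p \<and> (\<forall>xs\<in>tuples N n. p xs \<in> N \<and> F xs = p xs)"
  then obtain p where p: "pol A n p" "\<And>xs. xs \<in> tuples N n \<Longrightarrow> p xs \<in> N \<and> F xs = p xs" by blast
  let ?q = "restrict p (tuples (univ A) n)"
  have eq: "?q xs = p xs" if "xs \<in> tuples N n" for xs
    using tuples_mono[OF assms(3) that] by simp
  have "(n, ?q) \<in> syms (induced A N)"
    using p eq by (auto simp: induced_def pol_def)
  from pol_basic[OF finN this is_ualg_induced[OF assms(4)]]
  have "pol (induced A N) n ?q" by (simp add: induced_def)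
  then show "pol (induced A N) n F"
    using pol_cong[of "induced A N" n F ?q] p eq by simp
qed

section \<open>Kinds of polynomial clones\<close>

definition one_var :: "'a set \<Rightarrow> ('a list \<Rightarrow> 'b) \<Rightarrow> bool" where
  "one_var N F \<longleftrightarrow> (\<forall>x\<in>N. \<forall>x'\<in>N. \<forall>y\<in>N. F [x, y] = F [x', y]) \<or>
     (\<forall>x\<in>N. \<forall>y\<in>N. \<forall>y'\<in>N. F [x, y] = F [x, y'])"

lemma one_varI_nth:
  "i < 2 \<Longrightarrow> \<forall>xs\<in>tuples N 2. F xs = g (xs ! i) \<Longrightarrow> one_var N F"
  by (auto simp: one_var_def numeral_2_eq_2 tuples_two less_Suc_eq)

text \<open>If \<open>F\<close> depends on coordinate \<open>i\<close> at \<open>zs\<close>, then changing another coordinate of \<open>zs\<close> does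
  not change the map \<open>w \<mapsto> F (zs[i := w])\<close>.\<close>

lemma essentially_unary:
  assumes one: "\<And>zs i j. zs \<in> tuples N n \<Longrightarrow> i < n \<Longrightarrow> j < n \<Longrightarrow> i \<noteq> j \<Longrightarrow>
      one_var N (\<lambda>xs. F (zs[i := xs ! 0, j := xs ! 1]))"
  shows "(\<exists>c. \<forall>xs\<in>tuples N n. F xs = c) \<or>
    (\<exists>i<n. \<exists>zs\<in>tuples N n. \<forall>xs\<in>tuples N n. F xs = F (zs[i := xs ! i]))"
proof (cases "\<exists>zs\<in>tuples N n. \<exists>i<n. \<exists>x\<in>N. F (zs[i := x]) \<noteq> F zs")
  case True
  then obtain zs i x where zs: "zs \<in> tuples N n" "i < n" "x \<in> N" "F (zs[i := x]) \<noteq> F zs" by blast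
  have "\<forall>w\<in>N. F (ws[i := w]) = F (zs[i := w])" if ws: "ws \<in> tuples N n" for ws
    using zs(1) ws
  proof (rule tuples_change_induct)
    fix xs j y assume xs: "xs \<in> tuples N n" "\<forall>w\<in>N. F (xs[i := w]) = F (zs[i := w])"
      and j: "j < n" "y \<in> N"
    show "\<forall>w\<in>N. F (xs[j := y, i := w]) = F (zs[i := w])"
    proof (cases "j = i")
      case False
      let ?G = "\<lambda>ys. F (xs[i := ys ! 0, j := ys ! 1])"
      have "?G [x, xs ! j] = F (xs[i := x])" "?G [zs ! i, xs ! j] = F (xs[i := zs ! i])"
        using False by (simp_all add: list_update_swap[of i j])
      then have "?G [x, xs ! j] \<noteq> ?G [zs ! i, xs ! j]"
        using xs(2) zs by (simp add: tuples_nth)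
      moreover have "one_var N ?G" using one[OF xs(1) zs(2) j(1)] False by auto
      \<comment> \<open>\<open>?G\<close> depends on its first argument, so the surviving
        alternative of \<open>one_var\<close> says that the second one does not matter.\<close>
      ultimately have "?G [w, y] = ?G [w, xs ! j]" if "w \<in> N" for w
        using that zs xs j unfolding one_var_def by (meson tuples_nth)
      then show ?thesis using xs False by (simp add: list_update_swap[of i j])
    qed (use xs in simp)
  qed simp
  then have "F xs = F (zs[i := xs ! i])" if "xs \<in> tuples N n" for xs
    using that zs(2) by (metis list_update_id tuples_nth)
  then show ?thesis using zs by blast
next
  case False
  have "F ws = F zs" if "zs \<in> tuples N n" "ws \<in> tuples N n" for zs ws
    using that by (rule tuples_change_induct) (use False in auto)
  then show ?thesis by blast
qed

text \<open>Testing binary polynomials decides all arities: if two variables mattered, fixing the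
  others would give a binary counterexample (\<open>ess_unary_pol\<close>).\<close>

definition ess_unary :: "('f, 'a) ualg \<Rightarrow> bool" where
  "ess_unary B \<longleftrightarrow> (\<forall>F. pol B 2 F \<longrightarrow> one_var (univ B) F)"

text \<open>The term condition of commutator theory, i.e. abelianness, tested on binary polynomials.
  It separates unary and affine algebras from those with a semilattice polynomial.\<close>

definition term_condition :: "('f, 'a) ualg \<Rightarrow> bool" where
  "term_condition B \<longleftrightarrow> (\<forall>F. pol B 2 F \<longrightarrow> (\<forall>x\<in>univ B. \<forall>w\<in>univ B. \<forall>y\<in>univ B. \<forall>z\<in>univ B.
     F [x, y] = F [x, z] \<longrightarrow> F [w, y] = F [w, z]))"

definition has_swap :: "('f, 'a) ualg \<Rightarrow> bool" where
  "has_swap B \<longleftrightarrow> (\<exists>F. pol B 1 F \<and>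
     (\<exists>x\<in>univ B. \<exists>y\<in>univ B. x \<noteq> y \<and> F [x] = y \<and> F [y] = x))"

definition has_meet :: "('f, 'a) ualg \<Rightarrow> 'a \<Rightarrow> 'a \<Rightarrow> bool" where
  "has_meet B u v \<longleftrightarrow>
     (\<exists>F. pol B 2 F \<and> F [u, u] = u \<and> F [u, v] = u \<and> F [v, u] = u \<and> F [v, v] = v)"

definition lattice_like :: "('f, 'a) ualg \<Rightarrow> bool" where
  "lattice_like B \<longleftrightarrow> (\<exists>u\<in>univ B. \<exists>v\<in>univ B. u \<noteq> v \<and> has_meet B u v \<and> has_meet B v u)"

text \<open>A decision list, each test relying on the failure of the earlier ones. Unary and affine
  clones satisfy the term condition; of the others only the Boolean one has a swap, and only the
  lattice has a meet for both orders. Everything is stated through \<open>pol\<close>, so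
  polynomially equivalent algebras have the same kind.\<close>

definition kind :: "('f, 'a) ualg \<Rightarrow> nat" where
  "kind B = (if ess_unary B then 1 else if term_condition B then 2
     else if has_swap B then 3 else if lattice_like B then 4 else 5)"

lemma ess_unary_term_condition: "ess_unary B \<Longrightarrow> term_condition B"
  unfolding ess_unary_def term_condition_def one_var_def by metis

lemma poly_equivalent_pol:
  "poly_equivalent B D \<longleftrightarrow> univ B = univ D \<and> (\<forall>n F. pol B n F \<longleftrightarrow> pol D n F)"
  unfolding poly_equivalent_def using polys_eq_iff by blast

lemma pol_unary_alg:
  assumes "finite N" "pol (unary_alg N G) n F"
  shows "(\<exists>c. \<forall>xs\<in>tuples N n. F xs = c) \<or> (\<exists>i<n. \<exists>g. \<forall>xs\<in>tuples N n. F xs = g (xs ! i))"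
proof -
  have fin: "finite (univ (unary_alg N G))" using assms by (simp add: unary_alg_def)
  from fin assms(2) show ?thesis
  proof (induction rule: pol_induct)
    case (proj i)
    then show ?case by (intro disjI2 exI[of _ i] conjI exI[of _ "\<lambda>x. x"]) auto
  next
    case (app f H)
    have "(\<exists>c. \<forall>xs\<in>tuples N n. H 0 xs = c) \<or> (\<exists>i<n. \<exists>g. \<forall>xs\<in>tuples N n. H 0 xs = g (xs ! i))"
      using app(3)[of 0] by (simp add: unary_alg_def)
    then show ?case
    proof (elim disjE exE conjE)
      fix c assume "\<forall>xs\<in>tuples N n. H 0 xs = c"
      then show ?thesis by (intro disjI1 exI[of _ "f c"]) (simp add: unary_alg_def)
    next
      fix i g assume "i < n" "\<forall>xs\<in>tuples N n. H 0 xs = g (xs ! i)"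
      then show ?thesis
        by (intro disjI2 exI[of _ i] conjI exI[of _ "\<lambda>x. f (g x)"]) (simp_all add: unary_alg_def)
    qed
  next
    case (cong F G)
    then show ?case by (simp add: unary_alg_def)
  qed auto
qed

lemma kind_unary:
  assumes "finite (univ B)" "poly_equivalent B (unary_alg (univ B) G)"
  shows "kind B = 1"
proof -
  have "one_var (univ B) F" if "pol B 2 F" for F
    using pol_unary_alg[OF assms(1), of G 2 F] that assms(2)
    by (auto simp: poly_equivalent_pol intro: one_varI_nth one_varI_nth[of 0 _ _ "\<lambda>_. c" for c])
  then show ?thesis by (simp add: kind_def ess_unary_def)
qed

text \<open>Polynomials of a vector space are affine maps. This parallelogram law expresses it
  without naming coefficients and is inherited through zero, negation, sums and scalings; the
  induction has to carry along that values stay in the carrier.\<close>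

lemma pol_vector_space:
  assumes "Module.module K M" "finite (carrier M)" "pol (vector_space_alg K M) 2 F"
    "x \<in> carrier M" "y \<in> carrier M" "w \<in> carrier M" "z \<in> carrier M"
  shows "F [x, y] \<oplus>\<^bsub>M\<^esub> F [w, z] = F [x, z] \<oplus>\<^bsub>M\<^esub> F [w, y]"
proof -
  interpret Module.module K M by fact
  have fin: "finite (univ (vector_space_alg K M))" using assms by (simp add: vector_space_alg_def)
  have U: "univ (vector_space_alg K M) = carrier M" by (simp add: vector_space_alg_def)
  from fin assms(3) have "(\<forall>x\<in>carrier M. \<forall>y\<in>carrier M. F [x, y] \<in> carrier M) \<and>
    (\<forall>x\<in>carrier M. \<forall>y\<in>carrier M. \<forall>w\<in>carrier M. \<forall>z\<in>carrier M.
      F [x, y] \<oplus>\<^bsub>M\<^esub> F [w, z] = F [x, z] \<oplus>\<^bsub>M\<^esub> F [w, y])"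
  proof (induction rule: pol_induct)
    case (proj i)
    then show ?case by (auto simp: less_2_cases_iff M.a_comm)
  next
    case (const c)
    then show ?case by (auto simp: U)
  next
    case (app f G)
    show ?case
    proof (cases f)
      case VZero
      then show ?thesis by (simp add: vector_space_alg_def)
    next
      case VNeg
      then have "(\<forall>x\<in>carrier M. \<forall>y\<in>carrier M. G 0 [x, y] \<in> carrier M)"
        "(\<forall>x\<in>carrier M. \<forall>y\<in>carrier M. \<forall>w\<in>carrier M. \<forall>z\<in>carrier M.
          G 0 [x, y] \<oplus>\<^bsub>M\<^esub> G 0 [w, z] = G 0 [x, z] \<oplus>\<^bsub>M\<^esub> G 0 [w, y])"
        using app(3)[of 0] by (simp_all add: vector_space_alg_def)
      then show ?thesis using VNeg by (simp add: vector_space_alg_def flip: M.minus_add)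
    next
      case VAdd
      then have "(\<forall>x\<in>carrier M. \<forall>y\<in>carrier M. G i [x, y] \<in> carrier M) \<and>
        (\<forall>x\<in>carrier M. \<forall>y\<in>carrier M. \<forall>w\<in>carrier M. \<forall>z\<in>carrier M.
          G i [x, y] \<oplus>\<^bsub>M\<^esub> G i [w, z] = G i [x, z] \<oplus>\<^bsub>M\<^esub> G i [w, y])" if "i < 2" for i
        using app(3)[of i] that by (simp add: vector_space_alg_def)
      from this[of 0] this[of 1]
      have *: "(\<forall>x\<in>carrier M. \<forall>y\<in>carrier M. G 0 [x, y] \<in> carrier M)"
        "(\<forall>x\<in>carrier M. \<forall>y\<in>carrier M. G 1 [x, y] \<in> carrier M)"
        "(\<forall>x\<in>carrier M. \<forall>y\<in>carrier M. \<forall>w\<in>carrier M. \<forall>z\<in>carrier M.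
          G 0 [x, y] \<oplus>\<^bsub>M\<^esub> G 0 [w, z] = G 0 [x, z] \<oplus>\<^bsub>M\<^esub> G 0 [w, y])"
        "(\<forall>x\<in>carrier M. \<forall>y\<in>carrier M. \<forall>w\<in>carrier M. \<forall>z\<in>carrier M.
          G 1 [x, y] \<oplus>\<^bsub>M\<^esub> G 1 [w, z] = G 1 [x, z] \<oplus>\<^bsub>M\<^esub> G 1 [w, y])" by auto
      have four: "(a \<oplus>\<^bsub>M\<^esub> b) \<oplus>\<^bsub>M\<^esub> (c \<oplus>\<^bsub>M\<^esub> d) = (a \<oplus>\<^bsub>M\<^esub> c) \<oplus>\<^bsub>M\<^esub> (b \<oplus>\<^bsub>M\<^esub> d)"
        if "a \<in> carrier M" "b \<in> carrier M" "c \<in> carrier M" "d \<in> carrier M" for a b c d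
        using that by (simp add: M.a_ac)
      have eq: "interp (vector_space_alg K M) f
          (map (\<lambda>i. G i xs) [0..<arity (vector_space_alg K M) f]) = G 0 xs \<oplus>\<^bsub>M\<^esub> G 1 xs" for xs
        using VAdd by (simp add: vector_space_alg_def numeral_2_eq_2)
      show ?thesis unfolding eq using * by (simp add: four)
    next
      case (VScale k)
      then have k: "k \<in> carrier K" using app(1) by (auto simp: vector_space_alg_def)
      have "(\<forall>x\<in>carrier M. \<forall>y\<in>carrier M. G 0 [x, y] \<in> carrier M)"
        "(\<forall>x\<in>carrier M. \<forall>y\<in>carrier M. \<forall>w\<in>carrier M. \<forall>z\<in>carrier M.
          G 0 [x, y] \<oplus>\<^bsub>M\<^esub> G 0 [w, z] = G 0 [x, z] \<oplus>\<^bsub>M\<^esub> G 0 [w, y])"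
        using app(3)[of 0] VScale by (simp_all add: vector_space_alg_def)
      then show ?thesis using VScale k
        by (simp add: vector_space_alg_def flip: smult_r_distr)
    qed
  next
    case (cong F G)
    have "F [x, y] = G [x, y]" if "x \<in> carrier M" "y \<in> carrier M" for x y
      using that cong(2)[of "[x, y]"] by (simp add: U numeral_2_eq_2 tuples_two)
    then show ?case using cong(1) by simp
  qed
  then show ?thesis using assms by blast
qed

lemma is_ualg_vector_space_alg:
  assumes "Module.module K M"
  shows "is_ualg (vector_space_alg K M)"
proof -
  interpret Module.module K M by fact
  show ?thesis unfolding is_ualg_def
  proof (intro conjI ballI)
    fix f xs assume "f \<in> syms (vector_space_alg K M)"
      "xs \<in> tuples (univ (vector_space_alg K M)) (arity (vector_space_alg K M) f)"
    then show "interp (vector_space_alg K M) f xs \<in> univ (vector_space_alg K M)"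
      by (cases f) (auto simp: vector_space_alg_def tuples_nth)
  qed (use M.zero_closed in \<open>auto simp: vector_space_alg_def\<close>)
qed

lemma kind_vector_space:
  assumes "Module.module K M" "poly_equivalent B (vector_space_alg K M)" "card (univ B) \<ge> 2"
  shows "kind B = 2"
proof -
  interpret Module.module K M by fact
  have U: "univ B = carrier M" "univ (vector_space_alg K M) = carrier M"
    using assms(2) by (auto simp: poly_equivalent_pol vector_space_alg_def)
  have fin: "finite (carrier M)" using assms(3) U by (metis card.infinite not_numeral_le_zero)
  have pol: "pol B n F \<longleftrightarrow> pol (vector_space_alg K M) n F" for n F
    using assms(2) by (simp add: poly_equivalent_pol)
  have "term_condition B"
    unfolding term_condition_def pol U
  proof (intro allI impI ballI)
    fix F x w y z
    assume F: "pol (vector_space_alg K M) 2 F" and e: "F [x, y] = F [x, z]"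
      and c: "x \<in> carrier M" "w \<in> carrier M" "y \<in> carrier M" "z \<in> carrier M"
    have cl: "F [a, b] \<in> carrier M" if "a \<in> carrier M" "b \<in> carrier M" for a b
      using pol_closed[OF _ F is_ualg_vector_space_alg[OF assms(1)], of "[a, b]"] that fin
      by (simp add: U numeral_2_eq_2 tuples_two)
    show "F [w, y] = F [w, z]"
      using pol_vector_space[OF assms(1) fin F c(1,3,2,4)] e c cl by simp
  qed
  moreover have "\<not> ess_unary B"
  proof
    assume ess: "ess_unary B"
    obtain a where a: "a \<in> carrier M" "a \<noteq> \<zero>\<^bsub>M\<^esub>"
    proof -
      have "\<not> carrier M \<subseteq> {\<zero>\<^bsub>M\<^esub>}"
        using assms(3) U card_mono[of "{\<zero>\<^bsub>M\<^esub>}" "carrier M"] by auto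
      then show ?thesis using that by blast
    qed
    have "pol (vector_space_alg K M) 2 (vs_interp M VAdd)"
      using pol_basic[of "vector_space_alg K M" VAdd] is_ualg_vector_space_alg[OF assms(1)] fin
      by (simp add: vector_space_alg_def)
    moreover have "vs_interp M VAdd = (\<lambda>xs. xs ! 0 \<oplus>\<^bsub>M\<^esub> xs ! 1)" by auto
    ultimately have "pol (vector_space_alg K M) 2 (\<lambda>xs. xs ! 0 \<oplus>\<^bsub>M\<^esub> xs ! 1)" by simp
    then have "one_var (carrier M) (\<lambda>xs. xs ! 0 \<oplus>\<^bsub>M\<^esub> xs ! 1)"
      using ess pol U by (auto simp: ess_unary_def)
    then have "\<zero>\<^bsub>M\<^esub> \<oplus>\<^bsub>M\<^esub> \<zero>\<^bsub>M\<^esub> = a \<oplus>\<^bsub>M\<^esub> \<zero>\<^bsub>M\<^esub> \<or> \<zero>\<^bsub>M\<^esub> \<oplus>\<^bsub>M\<^esub> \<zero>\<^bsub>M\<^esub> = \<zero>\<^bsub>M\<^esub> \<oplus>\<^bsub>M\<^esub> a"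
      using a(1) M.zero_closed unfolding one_var_def by (metis nth_Cons_0 nth_Cons_Suc One_nat_def)
    then show False using a by simp
  qed
  ultimately show ?thesis by (simp add: kind_def)
qed

lemma univ_two_element_alg [simp]: "univ (two_element_alg S u v) = {u, v}"
  by (simp add: two_element_alg_def)

lemma is_ualg_two_element_alg: "is_ualg (two_element_alg S u v)"
  unfolding is_ualg_def two_element_alg_def
proof (intro conjI ballI; simp)
  fix f xs assume "f \<in> S" "xs \<in> tuples {u, v} (bool_arity f)"
  then show "bool_interp u v f xs = u \<or> bool_interp u v f xs = v" by (cases f) auto
qed

lemma pol_two_element_alg:
  assumes "f \<in> S"
  shows "pol (two_element_alg S u v) (bool_arity f) (bool_interp u v f)"
  using pol_basic[of "two_element_alg S u v" f] assms is_ualg_two_element_alg[of S u v]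
  by (simp add: two_element_alg_def)

text \<open>The row of \<open>u\<close> is constant while the row of \<open>v\<close> is
  not.\<close>

lemma meet_not_term_condition:
  assumes "has_meet B u v" "u \<noteq> v" "u \<in> univ B" "v \<in> univ B"
  shows "\<not> term_condition B" "\<not> ess_unary B"
proof -
  show "\<not> term_condition B"
    using assms unfolding has_meet_def term_condition_def by metis
  then show "\<not> ess_unary B" using ess_unary_term_condition by blast
qed

lemma has_meet_two_element_alg:
  "BMeet \<in> S \<Longrightarrow> u \<noteq> v \<Longrightarrow> has_meet (two_element_alg S u v) u v"
  "BJoin \<in> S \<Longrightarrow> u \<noteq> v \<Longrightarrow> has_meet (two_element_alg S u v) v u"
  using pol_two_element_alg[of BMeet S u v] pol_two_element_alg[of BJoin S u v]
  unfolding has_meet_def by auto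

lemma has_swap_two_element_alg:
  "BNot \<in> S \<Longrightarrow> u \<noteq> v \<Longrightarrow> has_swap (two_element_alg S u v)"
  using pol_two_element_alg[of BNot S u v]
  unfolding has_swap_def by (auto intro!: exI[of _ "bool_interp u v BNot"])

text \<open>Without negation all unary polynomials are monotone for the order with \<open>u\<close>
  below \<open>v\<close>, and a swap is not.\<close>

lemma not_has_swap_two_element_alg:
  assumes "S \<subseteq> {BBot, BTop, BMeet, BJoin}" "u \<noteq> v"
  shows "\<not> has_swap (two_element_alg S u v)"
proof -
  have "F [u] = v \<longrightarrow> F [v] = v" if "pol (two_element_alg S u v) 1 F" for F
  proof -
    have "finite (univ (two_element_alg S u v))" by simp
    then have "F [u] \<in> {u, v} \<and> F [v] \<in> {u, v} \<and> (F [u] = v \<longrightarrow> F [v] = v)" using that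
    proof (induction rule: pol_induct)
      case (app f G)
      then have f: "f = BBot \<or> f = BTop \<or> f = BMeet \<or> f = BJoin"
        using assms by (auto simp: two_element_alg_def)
      then show ?case
      proof (elim disjE)
        assume f: "f = BMeet"
        have "G i [u] \<in> {u, v} \<and> G i [v] \<in> {u, v} \<and> (G i [u] = v \<longrightarrow> G i [v] = v)" if "i < 2" for i
          using app(3)[of i] that by (simp add: two_element_alg_def f)
        from this[of 0] this[of 1] show ?thesis
          using assms(2) by (simp add: two_element_alg_def f numeral_2_eq_2)
      next
        assume f: "f = BJoin"
        have "G i [u] \<in> {u, v} \<and> G i [v] \<in> {u, v} \<and> (G i [u] = v \<longrightarrow> G i [v] = v)" if "i < 2" for i
          using app(3)[of i] that by (simp add: two_element_alg_def f)
        from this[of 0] this[of 1] show ?thesis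
          using assms(2) by (simp add: two_element_alg_def f numeral_2_eq_2)
      qed (simp_all add: two_element_alg_def)
    next
      case (cong F G)
      then show ?case by (simp add: tuples_one)
    qed auto
    then show ?thesis by blast
  qed
  then show ?thesis using assms(2) unfolding has_swap_def by fastforce
qed

text \<open>Normal form: the constant bottom or a meet of variables. The empty set J stands for the
  constant top.\<close>

lemma pol_semilattice:
  assumes "u \<noteq> v" "pol (two_element_alg {BMeet} u v) n F"
  shows "(\<forall>xs\<in>tuples {u, v} n. F xs = u) \<or>
    (\<exists>J\<subseteq>{..<n}. \<forall>xs\<in>tuples {u, v} n. F xs = (if \<forall>j\<in>J. xs ! j = v then v else u))"
proof -
  have "finite (univ (two_element_alg {BMeet} u v))" by simp
  from this assms(2) show ?thesis
  proof (induction rule: pol_induct)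
    case (proj i)
    have "xs ! i = u \<or> xs ! i = v" if "xs \<in> tuples {u, v} n" for xs
      using tuples_nth[OF that proj] by simp
    then show ?case using proj by (intro disjI2 exI[of _ "{i}"]) auto
  next
    case (const c)
    then show ?case by (cases "c = u") (simp, intro disjI2 exI[of _ "{}"], simp)
  next
    case (app f G)
    have f: "f = BMeet" using app(1) by (simp add: two_element_alg_def)
    have eq: "interp (two_element_alg {BMeet} u v) f
       (map (\<lambda>i. G i xs) [0..<arity (two_element_alg {BMeet} u v) f]) =
       (if G 0 xs = v \<and> G 1 xs = v then v else u)" for xs
      by (simp add: two_element_alg_def f numeral_2_eq_2)
    have IH: "(\<forall>xs\<in>tuples {u, v} n. G i xs = u) \<or>
      (\<exists>J\<subseteq>{..<n}. \<forall>xs\<in>tuples {u, v} n. G i xs = (if \<forall>j\<in>J. xs ! j = v then v else u))" if "i < 2" for i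
      using app(3)[of i] that by (simp add: two_element_alg_def f)
    show ?case
    proof (cases "(\<forall>xs\<in>tuples {u, v} n. G 0 xs = u) \<or> (\<forall>xs\<in>tuples {u, v} n. G 1 xs = u)")
      case True
      then show ?thesis unfolding eq using assms(1) by (intro disjI1) auto
    next
      case False
      obtain J where "J \<subseteq> {..<n}"
        "\<forall>xs\<in>tuples {u, v} n. G 0 xs = (if \<forall>j\<in>J. xs ! j = v then v else u)"
        using disjE[OF IH[of 0]] False by (metis zero_less_numeral)
      moreover obtain J' where "J' \<subseteq> {..<n}"
        "\<forall>xs\<in>tuples {u, v} n. G 1 xs = (if \<forall>j\<in>J'. xs ! j = v then v else u)"
        using disjE[OF IH[of 1]] False by (metis one_less_numeral_iff semiring_norm(76))
      ultimately have J: "J \<subseteq> {..<n}" "J' \<subseteq> {..<n}"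
        "\<forall>xs\<in>tuples {u, v} n. G 0 xs = (if \<forall>j\<in>J. xs ! j = v then v else u)"
        "\<forall>xs\<in>tuples {u, v} n. G 1 xs = (if \<forall>j\<in>J'. xs ! j = v then v else u)"
        by blast+
      have "(if G 0 xs = v \<and> G 1 xs = v then v else u) = (if \<forall>j\<in>J \<union> J'. xs ! j = v then v else u)"
        if "xs \<in> tuples {u, v} n" for xs
        using bspec[OF J(3) that] bspec[OF J(4) that] assms(1) by (simp add: ball_Un)
      then show ?thesis unfolding eq using J(1,2)
        by (intro disjI2 exI[of _ "J \<union> J'"]) blast
    qed
  next
    case (cong F G)
    then show ?case by simp
  qed
qed

text \<open>In the normal form a join takes the value \<open>v\<close> at [v, u] and at [u, v],
  which removes 1 and 0 from J. The empty meet is constantly \<open>v\<close>, yet the join is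
  \<open>u\<close> at [u, u].\<close>

lemma not_lattice_like_semilattice:
  assumes "u \<noteq> v"
  shows "\<not> lattice_like (two_element_alg {BMeet} u v)"
proof -
  have "\<not> has_meet (two_element_alg {BMeet} u v) v u"
  proof
    assume "has_meet (two_element_alg {BMeet} u v) v u"
    then obtain F where F: "pol (two_element_alg {BMeet} u v) 2 F"
      "F [v, v] = v" "F [v, u] = v" "F [u, v] = v" "F [u, u] = u"
      unfolding has_meet_def by blast
    have T: "[v, v] \<in> tuples {u, v} 2" "[v, u] \<in> tuples {u, v} 2" "[u, v] \<in> tuples {u, v} 2"
      "[u, u] \<in> tuples {u, v} 2" by (auto simp: tuples_def)
    from pol_semilattice[OF assms F(1)] show False
    proof
      assume "\<forall>xs\<in>tuples {u, v} 2. F xs = u"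
      then show False using F T assms by auto
    next
      assume "\<exists>J\<subseteq>{..<2}. \<forall>xs\<in>tuples {u, v} 2. F xs = (if \<forall>j\<in>J. xs ! j = v then v else u)"
      then obtain J where J: "J \<subseteq> {..<2}"
        "\<And>xs. xs \<in> tuples {u, v} 2 \<Longrightarrow> F xs = (if \<forall>j\<in>J. xs ! j = v then v else u)" by blast
      have "\<forall>j\<in>J. [v, u] ! j = v" using J(2)[OF T(2)] F(3) assms by metis
      then have "1 \<notin> J" using assms by force
      moreover have "\<forall>j\<in>J. [u, v] ! j = v" using J(2)[OF T(3)] F(4) assms by metis
      then have "0 \<notin> J" using assms by force
      moreover have "j = 0 \<or> j = 1" if "j \<in> J" for j using J(1) that by force
      ultimately have "J = {}" by blast
      then show False using J(2)[OF T(4)] F assms by auto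
    qed
  qed
  then show ?thesis unfolding lattice_like_def by auto
qed

lemma kind_poly_equivalent:
  assumes "poly_equivalent B D"
  shows "kind B = kind D"
proof -
  have eq: "univ B = univ D" "pol B = pol D"
    using assms by (auto simp: poly_equivalent_pol fun_eq_iff)
  show ?thesis
    unfolding kind_def ess_unary_def term_condition_def has_swap_def lattice_like_def has_meet_def eq ..
qed

text \<open>The uniqueness half of the definition of the type: the five models have five different
  kinds. Size at least two excludes the one-element vector space, which is also unary.\<close>

lemma minimal_alg_type_kind:
  assumes "minimal_alg_type B i" "card (univ B) \<ge> 2"
  shows "i = kind B"
  using assms(1)
proof cases
  case (unary G)
  have "finite (univ B)" using assms(2) by (metis card.infinite not_numeral_le_zero)
  then show ?thesis using unary kind_unary by metis
next
  case (vector_space K M)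
  then show ?thesis using kind_vector_space assms(2) by metis
next
  case (boolean u v)
  let ?D = "two_element_alg {BBot, BTop, BNot, BMeet, BJoin} u v"
  have m: "has_meet ?D u v" "has_swap ?D"
    using boolean by (auto intro: has_meet_two_element_alg has_swap_two_element_alg)
  then show ?thesis
    using kind_poly_equivalent[OF boolean(3)] meet_not_term_condition[OF m(1)] boolean
    by (simp add: kind_def)
next
  case (lattice u v)
  let ?D = "two_element_alg {BMeet, BJoin} u v"
  have m: "has_meet ?D u v" "has_meet ?D v u" using lattice by (auto intro: has_meet_two_element_alg)
  then have "lattice_like ?D" using lattice(2) unfolding lattice_like_def by auto
  then show ?thesis
    using kind_poly_equivalent[OF lattice(3)] meet_not_term_condition[OF m(1)] lattice
      not_has_swap_two_element_alg[of "{BMeet, BJoin}" u v]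
    by (simp add: kind_def)
next
  case (semilattice u v)
  let ?D = "two_element_alg {BMeet} u v"
  have m: "has_meet ?D u v" using semilattice by (auto intro: has_meet_two_element_alg)
  then show ?thesis
    using kind_poly_equivalent[OF semilattice(3)] meet_not_term_condition[OF m(1)] semilattice
      not_has_swap_two_element_alg[of "{BMeet}" u v] not_lattice_like_semilattice[of u v]
    by (simp add: kind_def)
qed

section \<open>Minimal algebras with two or three elements\<close>

abbreviation pol1 :: "('f, 'a) ualg \<Rightarrow> ('a \<Rightarrow> 'a) \<Rightarrow> bool" where
  "pol1 A f \<equiv> pol A 1 (\<lambda>xs. f (xs ! 0))"

abbreviation pol2 :: "('f, 'a) ualg \<Rightarrow> ('a \<Rightarrow> 'a \<Rightarrow> 'a) \<Rightarrow> bool" where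
  "pol2 A g \<equiv> pol A 2 (\<lambda>xs. g (xs ! 0) (xs ! 1))"

lemma pol1_iff: "pol A 1 F \<longleftrightarrow> pol1 A (\<lambda>x. F [x])"
  by (rule pol_cong) (auto simp: tuples_one)

lemma pol2_iff: "pol A 2 F \<longleftrightarrow> pol2 A (\<lambda>x y. F [x, y])"
  by (rule pol_cong) (auto simp: tuples_two numeral_2_eq_2)

text \<open>Pigeonhole among the self-maps of a finite set: two powers coincide, and injectivity
  cancels the smaller one. The exponent is positive, so one power less is the inverse.\<close>

lemma bij_betw_power_id:
  assumes "finite S" "bij_betw f S S"
  shows "\<exists>k. \<forall>x\<in>S. (f ^^ Suc k) x = x"
proof -
  have im: "(f ^^ i) x \<in> S" if "x \<in> S" for i x
    using that assms(2) by (induction i) (auto simp: bij_betw_def)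
  let ?r = "\<lambda>i. restrict (f ^^ i) S"
  have "range ?r \<subseteq> S \<rightarrow>\<^sub>E S" using im by auto
  then have "finite (range ?r)" using assms(1) finite_PiE[of S "\<lambda>_. S"] finite_subset by blast
  then have "\<not> inj ?r" using finite_imageD infinite_UNIV_nat by blast
  then obtain i j where "?r i = ?r j" "i < j" unfolding inj_def by (metis linorder_neqE_nat)
  then have eq: "(f ^^ i) x = (f ^^ j) x" if "x \<in> S" for x
    using that by (metis restrict_apply')
  obtain k where k: "j = i + Suc k" using \<open>i < j\<close> less_imp_Suc_add by auto
  have inj: "inj_on (f ^^ i) S"
    using bij_betw_funpow[OF assms(2), of i] by (auto simp: bij_betw_def)
  have "(f ^^ Suc k) x = x" if "x \<in> S" for x
  proof -
    have "(f ^^ i) ((f ^^ Suc k) x) = (f ^^ i) x"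
      using eq[OF that] unfolding k funpow_add by simp
    then show ?thesis using inj that im[of x "Suc k"] by (meson inj_onD)
  qed
  then show ?thesis by blast
qed

locale finite_ualg =
  fixes A :: "('f, 'a) ualg"
  assumes ualg: "is_ualg A" and fin: "finite (univ A)"
begin

lemma pol1_id: "pol1 A (\<lambda>x. x)"
  by (rule pol_proj[OF fin]) simp

lemma pol1_const: "c \<in> univ A \<Longrightarrow> pol1 A (\<lambda>_. c)"
  by (rule pol_const[OF fin])

lemma pol1_closed: "pol1 A f \<Longrightarrow> x \<in> univ A \<Longrightarrow> f x \<in> univ A"
  using pol_closed[OF fin _ ualg, of 1 "\<lambda>xs. f (xs ! 0)" "[x]"] by (simp add: tuples_one)

lemma pol2_closed: "pol2 A g \<Longrightarrow> x \<in> univ A \<Longrightarrow> y \<in> univ A \<Longrightarrow> g x y \<in> univ A"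
  using pol_closed[OF fin _ ualg, of 2 "\<lambda>xs. g (xs ! 0) (xs ! 1)" "[x, y]"]
  by (simp add: tuples_two numeral_2_eq_2)

lemma pol_pol1: "pol1 A f \<Longrightarrow> pol A n F \<Longrightarrow> pol A n (\<lambda>xs. f (F xs))"
  using pol_comp1[OF fin _ _ ualg, of "\<lambda>xs. f (xs ! 0)" n F] by simp

lemma pol_pol2: "pol2 A g \<Longrightarrow> pol A n F \<Longrightarrow> pol A n G \<Longrightarrow> pol A n (\<lambda>xs. g (F xs) (G xs))"
  using pol_comp2[OF fin _ _ _ ualg, of "\<lambda>xs. g (xs ! 0) (xs ! 1)" n F G] by simp

lemma pol1_comp: "pol1 A f \<Longrightarrow> pol1 A g \<Longrightarrow> pol1 A (\<lambda>x. f (g x))"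
  by (rule pol_pol1)

lemma pol1_funpow: "pol1 A f \<Longrightarrow> pol1 A (f ^^ k)"
  by (induction k) (auto simp: pol1_id[simplified] intro: pol_pol1)

lemma pol1_pol2: "pol2 A g \<Longrightarrow> pol1 A f \<Longrightarrow> pol1 A h \<Longrightarrow> pol1 A (\<lambda>x. g (f x) (h x))"
  by (rule pol_pol2)

text \<open>The inverse of a permutation of a finite set is one of its powers, hence again a
  polynomial. This is how non-constant unary polynomials are undone throughout.\<close>

lemma pol1_inverse:
  assumes "pol1 A f" "S \<subseteq> univ A" "bij_betw f S S"
  obtains g where "pol1 A g" "\<And>x. x \<in> S \<Longrightarrow> g x \<in> S" "\<And>x. x \<in> S \<Longrightarrow> g (f x) = x" "\<And>x. x \<in> S \<Longrightarrow> f (g x) = x"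
proof -
  have "finite S" using fin assms(2) finite_subset by blast
  then obtain k where k: "\<And>x. x \<in> S \<Longrightarrow> (f ^^ Suc k) x = x"
    using bij_betw_power_id[OF _ assms(3)] by blast
  show ?thesis
  proof
    show "pol1 A (f ^^ k)" by (rule pol1_funpow[OF assms(1)])
    show "(f ^^ k) x \<in> S" if "x \<in> S" for x
      using that assms(3) by (induction k) (auto simp: bij_betw_def)
    show "(f ^^ k) (f x) = x" if "x \<in> S" for x using k[OF that] by (simp add: funpow_swap1)
    show "f ((f ^^ k) x) = x" if "x \<in> S" for x using k[OF that] by simp
  qed
qed

lemma ess_unary_pol:
  assumes "ess_unary A" "pol A n F"
  shows "(\<exists>c\<in>univ A. \<forall>xs\<in>tuples (univ A) n. F xs = c) \<or>
    (\<exists>i<n. \<exists>g. pol1 A g \<and> (\<forall>xs\<in>tuples (univ A) n. F xs = g (xs ! i)))"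
proof -
  have "one_var (univ A) (\<lambda>xs. F (zs[i := xs ! 0, j := xs ! 1]))"
    if "zs \<in> tuples (univ A) n" for zs i j
  proof -
    have "pol A 2 (\<lambda>xs. F (zs[i := xs ! 0, j := xs ! 1]))"
      by (rule pol_update2[OF fin assms(2) ualg that]) (auto intro: pol_proj[OF fin])
    then show ?thesis using assms(1) by (simp add: ess_unary_def)
  qed
  then consider c where "\<forall>xs\<in>tuples (univ A) n. F xs = c" |
    i zs where "i < n" "zs \<in> tuples (univ A) n" "\<forall>xs\<in>tuples (univ A) n. F xs = F (zs[i := xs ! i])"
    using essentially_unary[of "univ A" n F] by blast
  then show ?thesis
  proof cases
    case 1
    obtain z where "z \<in> univ A" using ualg by (auto simp: is_ualg_def)
    then have "replicate n z \<in> tuples (univ A) n" by (rule tuples_replicate)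
    then have "c \<in> univ A" using 1 pol_closed[OF fin assms(2) ualg] by metis
    then show ?thesis using 1 by blast
  next
    case 2
    have "pol1 A (\<lambda>x. F (zs[i := x]))"
      by (rule pol_update[OF fin assms(2) ualg 2(2)]) (rule pol1_id)
    then show ?thesis using 2 by (intro disjI2 exI[of _ i] exI[of _ "\<lambda>x. F (zs[i := x])"]) auto
  qed
qed

definition min_unary :: bool where
  "min_unary \<longleftrightarrow> (\<forall>f. pol1 A f \<longrightarrow>
     (\<forall>x\<in>univ A. \<forall>y\<in>univ A. f x = f y) \<or> bij_betw f (univ A) (univ A))"

lemma minimal_alg_type_unary:
  assumes "ess_unary A" min_unary
  shows "minimal_alg_type A 1"
proof -
  \<comment> \<open>Constant polynomials need no symbol here, since polynomials of the model may use
    constants anyway.\<close>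
  define G where "G = {g. bij_betw g (univ A) (univ A) \<and> pol1 A g}"
  let ?D = "unary_alg (univ A) G"
  have U: "univ ?D = univ A" by (simp add: unary_alg_def)
  have D: "is_ualg ?D"
    using ualg bij_betwE by (fastforce simp: is_ualg_def unary_alg_def G_def tuples_one)
  have finD: "finite (univ ?D)" using fin U by simp
  interpret D: finite_ualg ?D by unfold_locales (use D finD in auto)
  have pD: "pol1 ?D g" if "g \<in> G" for g
  proof -
    have "pol ?D (arity ?D g) (interp ?D g)"
      by (rule pol_basic) (use that D finD in \<open>auto simp: unary_alg_def\<close>)
    then have "pol ?D 1 (\<lambda>xs. g (hd xs))" by (simp add: unary_alg_def)
    then show ?thesis by (rule pol_congI) (auto simp: tuples_one)
  qed
  have "pol ?D n F \<longleftrightarrow> pol A n F" for n F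
  proof
    assume F: "pol ?D n F"
    show "pol A n F"
    proof (rule pol_subset[OF fin ualg D U _ F])
      fix g assume "g \<in> syms ?D"
      then have "pol1 A g" by (simp add: unary_alg_def G_def)
      then have "pol A 1 (\<lambda>xs. g (hd xs))" by (rule pol_congI) (auto simp: tuples_one)
      then show "pol A (arity ?D g) (interp ?D g)" by (simp add: unary_alg_def)
    qed
  next
    assume "pol A n F"
    from ess_unary_pol[OF assms(1) this] show "pol ?D n F"
    proof (elim disjE bexE exE conjE)
      fix c assume "c \<in> univ A" "\<forall>xs\<in>tuples (univ A) n. F xs = c"
      then show ?thesis using pol_const[OF finD, of c n] U by (auto elim!: pol_congI)
    next
      fix i g assume i: "i < n" and g: "pol1 A g" and F: "\<forall>xs\<in>tuples (univ A) n. F xs = g (xs ! i)"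
      from g assms(2) consider "\<forall>x\<in>univ A. \<forall>y\<in>univ A. g x = g y" | "bij_betw g (univ A) (univ A)"
        unfolding min_unary_def by blast
      then show ?thesis
      proof cases
        case 1
        obtain z where z: "z \<in> univ A" using ualg by (auto simp: is_ualg_def)
        then have "g z \<in> univ ?D" using pol1_closed[OF g] U by simp
        then have "pol ?D n (\<lambda>_. g z)" by (rule pol_const[OF finD])
        then show ?thesis
        proof (rule pol_congI)
          fix xs assume "xs \<in> tuples (univ ?D) n"
          then show "g z = F xs" using F 1 z i U by (metis tuples_nth)
        qed
      next
        case 2
        then have "pol1 ?D g" using g by (intro pD) (simp add: G_def)
        from D.pol_pol1[OF this pol_proj[OF finD i]] show ?thesis
          by (rule pol_congI) (use F U in auto)
      qed
    qed
  qed
  then have "poly_equivalent A ?D" using U by (auto simp: poly_equivalent_pol)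
  then show ?thesis by (rule minimal_alg_type.unary[rotated]) (simp add: G_def)
qed

text \<open>A scheme for showing that a model D has all polynomials of A: the step rebuilds F from
  its sections with the first argument fixed, which have one variable less. Nullary polynomials are
  constants.\<close>

lemma pol_arity_induct:
  assumes D: "finite_ualg D" "univ D = univ A"
    and step: "\<And>n F. (\<And>G. pol A n G \<Longrightarrow> pol D n G) \<Longrightarrow> pol A (Suc n) F \<Longrightarrow> pol D (Suc n) F"
  shows "pol A n F \<Longrightarrow> pol D n F"
proof (induction n arbitrary: F)
  case 0
  interpret D: finite_ualg D by (rule D)
  have "F [] \<in> univ D" using pol_closed[OF fin 0 ualg] D(2) by (simp add: tuples_Nil)
  then have "pol D 0 (\<lambda>_. F [])" by (rule pol_const[OF D.fin])
  then show ?case by (rule pol_congI) (simp add: tuples_Nil)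
next
  case (Suc n)
  then show ?case using step by blast
qed

lemma poly_equivalentI:
  assumes "finite_ualg D" "univ D = univ A"
    and "\<And>f. f \<in> syms D \<Longrightarrow> pol A (arity D f) (interp D f)"
    and "\<And>n F. pol A n F \<Longrightarrow> pol D n F"
  shows "poly_equivalent A D"
proof -
  interpret D: finite_ualg D by (rule assms(1))
  have "pol D n F \<Longrightarrow> pol A n F" for n F
    by (rule pol_subset[OF fin ualg D.ualg assms(2) assms(3)])
  then show ?thesis using assms(2,4) by (auto simp: poly_equivalent_pol)
qed

end

lemma finite_ualg_two_element_alg: "finite_ualg (two_element_alg S u v)"
  by unfold_locales (simp_all add: is_ualg_two_element_alg)

locale two_element_ualg = finite_ualg +
  assumes two: "card (univ A) = 2"
begin

lemma univ_pair: "u \<in> univ A \<Longrightarrow> v \<in> univ A \<Longrightarrow> u \<noteq> v \<Longrightarrow> univ A = {u, v}"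
  using two by (metis card_2_iff doubleton_eq_iff insertE singletonD)

lemma bij_pair:
  assumes "pol1 A f" "x \<in> univ A" "y \<in> univ A" "f x \<noteq> f y"
  shows "bij_betw f (univ A) (univ A)"
proof -
  have xy: "univ A = {x, y}" using assms univ_pair by blast
  moreover have "univ A = {f x, f y}" using assms pol1_closed univ_pair by blast
  ultimately show ?thesis unfolding bij_betw_def using assms by auto
qed

lemma min_unary_two: min_unary
  unfolding min_unary_def using bij_pair by blast

text \<open>A failure of the term condition is a constant row next to a non-constant one; inverting
  the latter, and then the non-constant column, turns it into a semilattice operation.\<close>

lemma meet_of_not_term_condition:
  assumes "\<not> term_condition A"
  obtains p q where "univ A = {p, q}" "p \<noteq> q" "has_meet A p q"
proof -
  obtain F x w y z where F: "pol A 2 F" and U: "x \<in> univ A" "w \<in> univ A" "y \<in> univ A" "z \<in> univ A"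
    and eq: "F [x, y] = F [x, z]" "F [w, y] \<noteq> F [w, z]"
    using assms unfolding term_condition_def by blast
  define g where "g s t = F [s, t]" for s t
  have g: "pol2 A g" using F unfolding g_def by (subst (asm) pol2_iff)
  have yz: "univ A = {y, z}" and xw: "univ A = {x, w}" "x \<noteq> w"
    using U eq univ_pair by metis+
  define p where "p = g x y"
  have const: "g x t = p" if "t \<in> univ A" for t using that yz eq by (auto simp: p_def g_def)
  have "pol1 A (g w)" by (rule pol1_pol2[OF g pol1_const[OF U(2)] pol1_id])
  moreover from this have "bij_betw (g w) (univ A) (univ A)"
    by (rule bij_pair[OF _ U(3,4)]) (use eq in \<open>simp add: g_def\<close>)
  ultimately obtain r where r: "pol1 A r" "\<And>x. x \<in> univ A \<Longrightarrow> r x \<in> univ A"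
    "\<And>x. x \<in> univ A \<Longrightarrow> g w (r x) = x"
    using pol1_inverse[OF _ subset_refl, of "g w"] by metis
  have pU: "p \<in> univ A" unfolding p_def using pol2_closed[OF g] U by blast
  obtain q where q: "q \<in> univ A" "p \<noteq> q" using pU two by (metis card_2_iff insertCI)
  have pq: "univ A = {p, q}" by (rule univ_pair[OF pU q])
  let ?s = "\<lambda>s. g s (r q)"
  have s1: "pol1 A ?s" by (rule pol1_pol2[OF g pol1_id pol1_const[OF r(2)[OF q(1)]]])
  have sv: "?s x = p" "?s w = q" using const[OF r(2)[OF q(1)]] r(3)[OF q(1)] by auto
  then have "bij_betw ?s (univ A) (univ A)"
    using bij_pair[OF s1 U(1,2)] q by simp
  then obtain s' where s': "pol1 A s'" "\<And>x. x \<in> univ A \<Longrightarrow> s' (?s x) = x"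
    using pol1_inverse[OF s1 subset_refl] by metis
  have s'v: "s' p = x" "s' q = w" using s'(2)[OF U(1)] s'(2)[OF U(2)] sv by auto
  let ?F = "\<lambda>xs. g (s' (xs ! 0)) (r (xs ! 1))"
  have "pol A 2 ?F"
    by (intro pol_pol2[OF g] pol_pol1[OF s'(1)] pol_pol1[OF r(1)] pol_proj[OF fin]) auto
  moreover have "?F [p, p] = p" "?F [p, q] = p" "?F [q, p] = p" "?F [q, q] = q"
    using s'v const r(2,3) pU q by auto
  ultimately have "has_meet A p q" unfolding has_meet_def by blast
  then show ?thesis using that pq q by blast
qed

text \<open>De Morgan: the meet is conjugated by the swap.\<close>

lemma has_meet_swap:
  assumes "has_swap A" "univ A = {p, q}" "p \<noteq> q" "has_meet A p q"
  shows "has_meet A q p"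
proof -
  obtain F x y where F: "pol A 1 F" "x \<in> univ A" "y \<in> univ A" "x \<noteq> y" "F [x] = y" "F [y] = x"
    using assms(1) unfolding has_swap_def by blast
  define f where "f x = F [x]" for x
  have f: "pol1 A f" "f p = q" "f q = p"
    using F assms(2,3) pol1_iff[of A F] unfolding f_def by auto
  obtain H where H: "pol A 2 H" "H [p, p] = p" "H [p, q] = p" "H [q, p] = p" "H [q, q] = q"
    using assms(4) unfolding has_meet_def by blast
  have "pol A 2 (\<lambda>xs. f (H [f (xs ! 0), f (xs ! 1)]))"
    by (intro pol_pol1[OF f(1)] pol_comp2[OF fin H(1) _ _ ualg] pol_proj[OF fin]) auto
  then show ?thesis unfolding has_meet_def
    by (intro exI[of _ "\<lambda>xs. f (H [f (xs ! 0), f (xs ! 1)])"] conjI) (use f H in auto)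
qed

lemma pol_meet:
  assumes "has_meet A u v" "univ A = {u, v}" "u \<noteq> v"
  shows "pol A 2 (bool_interp u v BMeet)"
proof -
  obtain H where H: "pol A 2 H" "H [u, u] = u" "H [u, v] = u" "H [v, u] = u" "H [v, v] = v"
    using assms(1) unfolding has_meet_def by blast
  show ?thesis
    by (rule pol_congI[OF H(1)]) (use H assms in \<open>auto simp: tuples_two numeral_2_eq_2\<close>)
qed

lemma pol_join:
  assumes "has_meet A v u" "univ A = {u, v}" "u \<noteq> v"
  shows "pol A 2 (bool_interp u v BJoin)"
proof -
  obtain H where H: "pol A 2 H" "H [v, v] = v" "H [v, u] = v" "H [u, v] = v" "H [u, u] = u"
    using assms(1) unfolding has_meet_def by blast
  show ?thesis
    by (rule pol_congI[OF H(1)]) (use H assms in \<open>auto simp: tuples_two numeral_2_eq_2\<close>)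
qed

lemma pol_not:
  assumes "has_swap A" "univ A = {u, v}" "u \<noteq> v"
  shows "pol A 1 (bool_interp u v BNot)"
proof -
  obtain F x y where F: "pol A 1 F" "x \<in> univ A" "y \<in> univ A" "x \<noteq> y" "F [x] = y" "F [y] = x"
    using assms(1) unfolding has_swap_def by blast
  then have "F [u] = v" "F [v] = u" using assms by auto
  then show ?thesis
    by (intro pol_congI[OF F(1)]) (use assms in \<open>auto simp: tuples_one\<close>)
qed

section \<open>The three non-affine clones on two elements, by expansion in the first
  variable\<close>

context
  fixes S u v D
  assumes D_def: "D = two_element_alg S u v" and uv: "univ A = {u, v}" "u \<noteq> v"
begin

interpretation D: finite_ualg D
  unfolding D_def by (rule finite_ualg_two_element_alg)

lemma univ_D: "univ D = univ A" by (simp add: D_def uv)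

lemma pol_D_split:
  assumes "\<And>G. pol A n G \<Longrightarrow> pol D n G" "pol A (Suc n) F" "c \<in> univ A"
  shows "pol D (Suc n) (\<lambda>xs. F (c # tl xs))"
  using pol_tl[OF D.fin assms(1)[OF pol_Cons[OF fin assms(2,3) ualg]] D.ualg] .

lemma pol_D_meet:
  assumes "BMeet \<in> S" "pol D n F" "pol D n G"
  shows "pol D n (\<lambda>xs. if F xs = v \<and> G xs = v then v else u)"
  using pol_comp2[OF D.fin _ assms(2,3) D.ualg, of "bool_interp u v BMeet"]
    pol_two_element_alg[OF assms(1), of u v] by (simp add: D_def)

lemma pol_D_join:
  assumes "BJoin \<in> S" "pol D n F" "pol D n G"
  shows "pol D n (\<lambda>xs. if F xs = v \<or> G xs = v then v else u)"
  using pol_comp2[OF D.fin _ assms(2,3) D.ualg, of "bool_interp u v BJoin"]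
    pol_two_element_alg[OF assms(1), of u v] by (simp add: D_def)

lemma pol_D_not:
  assumes "BNot \<in> S" "pol D n F"
  shows "pol D n (\<lambda>xs. if F xs = v then u else v)"
  using pol_comp1[OF D.fin _ assms(2) D.ualg, of "bool_interp u v BNot"]
    pol_two_element_alg[OF assms(1), of u v] by (simp add: D_def)

lemma pol_D_hd: "pol D (Suc n) (\<lambda>xs. xs ! 0)"
  by (rule pol_proj[OF D.fin]) simp

lemma pol_Cons_cases:
  assumes "pol A (Suc n) F" "xs \<in> tuples (univ D) (Suc n)"
  obtains x ys where "xs = x # ys" "ys \<in> tuples (univ A) n" "x = u \<or> x = v"
    "F (u # ys) = u \<or> F (u # ys) = v" "F (v # ys) = u \<or> F (v # ys) = v"
proof -
  from assms(2) obtain x ys where xs: "xs = x # ys" "x \<in> {u, v}" "ys \<in> tuples (univ A) n"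
    unfolding univ_D tuples_Suc uv by blast
  have "F (c # ys) \<in> univ A" if "c \<in> univ A" for c
    using that xs by (intro pol_closed[OF fin assms(1) ualg]) (simp add: tuples_Cons)
  then show ?thesis using that xs uv by auto
qed

text \<open>Shannon expansion: F is the join of x meet F(v, ...) and (not x) meet F(u, ...), where x
  is the first variable.\<close>

lemma poly_equivalent_boolean:
  assumes "S = {BBot, BTop, BNot, BMeet, BJoin}" "has_swap A" "has_meet A u v"
  shows "poly_equivalent A D"
proof (rule poly_equivalentI[OF D.finite_ualg_axioms univ_D])
  have m: "has_meet A v u" using has_meet_swap assms uv by blast
  fix f assume "f \<in> syms D"
  then show "pol A (arity D f) (interp D f)"
    using pol_meet[OF assms(3) uv] pol_join[OF m uv] pol_not[OF assms(2) uv]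
      pol_const[OF fin, of u 0] pol_const[OF fin, of v 0] uv
    by (cases f) (simp_all add: D_def two_element_alg_def pol_cong[of A 0 "bool_interp u v BBot" "\<lambda>_. u"]
        pol_cong[of A 0 "bool_interp u v BTop" "\<lambda>_. v"])
next
  show "pol D n F" if "pol A n F" for n F
    using D.finite_ualg_axioms univ_D _ that
  proof (rule pol_arity_induct)
    fix n F assume IH: "\<And>G. pol A n G \<Longrightarrow> pol D n G" and F: "pol A (Suc n) F"
    have c: "u \<in> univ A" "v \<in> univ A" using uv by auto
    have m: "BMeet \<in> S" "BJoin \<in> S" "BNot \<in> S" using assms by auto
    note s = pol_D_split[OF IH F c(1)] pol_D_split[OF IH F c(2)]
    from pol_D_join[OF m(2) pol_D_meet[OF m(1) pol_D_hd s(2)]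
        pol_D_meet[OF m(1) pol_D_not[OF m(3) pol_D_hd] s(1)]]
    show "pol D (Suc n) F"
    proof (rule pol_congI)
      fix xs assume "xs \<in> tuples (univ D) (Suc n)"
      from F this show "(if (if xs ! 0 = v \<and> F (v # tl xs) = v then v else u) = v \<or>
           (if (if xs ! 0 = v then u else v) = v \<and> F (u # tl xs) = v then v else u) = v then v else u) = F xs"
      proof (rule pol_Cons_cases)
        fix x ys assume xs: "xs = x # ys" "x = u \<or> x = v"
          "F (u # ys) = u \<or> F (u # ys) = v" "F (v # ys) = u \<or> F (v # ys) = v"
        from xs(2) show ?thesis
        proof
          assume "x = u"
          then show ?thesis using xs(1,3) uv(2) by simp metis
        next
          assume "x = v"
          then show ?thesis using xs(1,4) uv(2) by simp metis
        qed
      qed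
    qed
  qed
qed

text \<open>Where F is not monotone in its first variable, it restricts to a swap. So F is monotone
  there, and the expansion needs no negation: F is the join of F(u, ...) and x meet F(v,
  ...).\<close>

lemma poly_equivalent_lattice:
  assumes "S = {BMeet, BJoin}" "\<not> has_swap A" "has_meet A u v" "has_meet A v u"
  shows "poly_equivalent A D"
proof (rule poly_equivalentI[OF D.finite_ualg_axioms univ_D])
  fix f assume "f \<in> syms D"
  then show "pol A (arity D f) (interp D f)"
    using pol_meet[OF assms(3) uv] pol_join[OF assms(4) uv] assms(1)
    by (cases f) (auto simp: D_def two_element_alg_def)
next
  show "pol D n F" if "pol A n F" for n F
    using D.finite_ualg_axioms univ_D _ that
  proof (rule pol_arity_induct)
    fix n F assume IH: "\<And>G. pol A n G \<Longrightarrow> pol D n G" and F: "pol A (Suc n) F"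
    have c: "u \<in> univ A" "v \<in> univ A" using uv by auto
    have m: "BMeet \<in> S" "BJoin \<in> S" using assms by auto
    note s = pol_D_split[OF IH F c(1)] pol_D_split[OF IH F c(2)]
    from pol_D_join[OF m(2) s(1) pol_D_meet[OF m(1) pol_D_hd s(2)]]
    show "pol D (Suc n) F"
    proof (rule pol_congI)
      fix xs assume "xs \<in> tuples (univ D) (Suc n)"
      with F show "(if F (u # tl xs) = v \<or> (if xs ! 0 = v \<and> F (v # tl xs) = v then v else u) = v
          then v else u) = F xs"
      proof (rule pol_Cons_cases)
        fix x ys assume xs: "xs = x # ys" "ys \<in> tuples (univ A) n" "x = u \<or> x = v"
          "F (u # ys) = u \<or> F (u # ys) = v" "F (v # ys) = u \<or> F (v # ys) = v"
        have "F (v # ys) = v" if "F (u # ys) = v"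
        proof (rule ccontr)
          assume "F (v # ys) \<noteq> v"
          then have "F (v # ys) = u" using xs by blast
          moreover have "pol A 1 (\<lambda>zs. F ((u # ys)[0 := zs ! 0]))"
            by (rule pol_update[OF fin F ualg]) (use xs c pol1_id in \<open>auto simp: tuples_Cons\<close>)
          ultimately have "has_swap A" using that c uv(2) unfolding has_swap_def
            by (intro exI[of _ "\<lambda>zs. F ((u # ys)[0 := zs ! 0])"] conjI bexI[of _ u] bexI[of _ v]) auto
          then show False using assms by blast
        qed
        note mono = this
        from xs(3) show ?thesis
        proof
          assume "x = u"
          then show ?thesis using xs(1,4) uv(2) by simp metis
        next
          assume "x = v"
          then show ?thesis using xs(1,4,5) uv(2) mono by simp metis
        qed
      qed
    qed
  qed
qed

text \<open>The sections F(u, ...) and F(v, ...) have the semilattice normal form. If the first is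
  constantly \<open>u\<close>, then F is x meet F(v, ...); if the second is, monotonicity makes F
  constantly \<open>u\<close>. If both are meets of variables they must agree, as otherwise a join
  could be extracted, and then F ignores its first variable.\<close>

lemma poly_equivalent_semilattice:
  assumes "S = {BMeet}" "\<not> has_swap A" "has_meet A u v" "\<not> has_meet A v u"
  shows "poly_equivalent A D"
proof (rule poly_equivalentI[OF D.finite_ualg_axioms univ_D])
  fix f assume "f \<in> syms D"
  then show "pol A (arity D f) (interp D f)"
    using pol_meet[OF assms(3) uv] assms(1)
    by (cases f) (auto simp: D_def two_element_alg_def)
next
  show "pol D n F" if "pol A n F" for n F
    using D.finite_ualg_axioms univ_D _ that
  proof (rule pol_arity_induct)
    fix n F assume IH: "\<And>G. pol A n G \<Longrightarrow> pol D n G" and F: "pol A (Suc n) F"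
    have c: "u \<in> univ A" "v \<in> univ A" using uv by auto
    have m: "BMeet \<in> S" using assms by auto
    note s = pol_D_split[OF IH F c(1)] pol_D_split[OF IH F c(2)]
    have mono: "F (v # ys) = v" if "F (u # ys) = v" "ys \<in> tuples (univ A) n" for ys
    proof (rule ccontr)
      assume "F (v # ys) \<noteq> v"
      moreover have "F (v # ys) \<in> univ A"
        by (rule pol_closed[OF fin F ualg]) (use that c in \<open>auto simp: tuples_Cons\<close>)
      ultimately have "F (v # ys) = u" using uv by blast
      moreover have "pol A 1 (\<lambda>zs. F ((u # ys)[0 := zs ! 0]))"
        by (rule pol_update[OF fin F ualg]) (use that c pol1_id in \<open>auto simp: tuples_Cons\<close>)
      ultimately have "has_swap A" using that c uv(2) unfolding has_swap_def
        by (intro exI[of _ "\<lambda>zs. F ((u # ys)[0 := zs ! 0])"] conjI bexI[of _ u] bexI[of _ v]) auto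
      then show False using assms by blast
    qed
    have N: "(\<forall>xs\<in>tuples (univ A) n. F (x # xs) = u) \<or> (\<exists>J\<subseteq>{..<n}. \<forall>xs\<in>tuples (univ A) n.
        F (x # xs) = (if \<forall>j\<in>J. xs ! j = v then v else u))" if "x \<in> {u, v}" for x
    proof -
      have "pol (two_element_alg {BMeet} u v) n (\<lambda>xs. F (x # xs))"
        using IH pol_Cons[OF fin F _ ualg] that uv(1) assms(1) unfolding D_def by blast
      from pol_semilattice[OF uv(2) this] show ?thesis unfolding uv(1) .
    qed
    consider "\<forall>xs\<in>tuples (univ A) n. F (u # xs) = u" |
      "\<forall>xs\<in>tuples (univ A) n. F (v # xs) = u" |
      J J' where "J \<subseteq> {..<n}" "\<forall>xs\<in>tuples (univ A) n. F (u # xs) = (if \<forall>j\<in>J. xs ! j = v then v else u)"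
        "J' \<subseteq> {..<n}" "\<forall>xs\<in>tuples (univ A) n. F (v # xs) = (if \<forall>j\<in>J'. xs ! j = v then v else u)"
    proof (cases "(\<forall>xs\<in>tuples (univ A) n. F (u # xs) = u) \<or> (\<forall>xs\<in>tuples (univ A) n. F (v # xs) = u)")
      case True
      then show thesis using that(1,2) by satx
    next
      case False
      have uv': "u \<in> {u, v}" "v \<in> {u, v}" by auto
      from False N[OF uv'(1)] have "\<exists>J\<subseteq>{..<n}. \<forall>xs\<in>tuples (univ A) n.
        F (u # xs) = (if \<forall>j\<in>J. xs ! j = v then v else u)" by satx
      moreover from False N[OF uv'(2)] have "\<exists>J\<subseteq>{..<n}. \<forall>xs\<in>tuples (univ A) n.
        F (v # xs) = (if \<forall>j\<in>J. xs ! j = v then v else u)" by satx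
      ultimately show thesis by (elim exE conjE) (rule that(3))
    qed
    then show "pol D (Suc n) F"
    proof cases
      case 1
      from pol_D_meet[OF m pol_D_hd s(2)] show ?thesis
      proof (rule pol_congI)
        fix xs assume "xs \<in> tuples (univ D) (Suc n)"
        with F show "(if xs ! 0 = v \<and> F (v # tl xs) = v then v else u) = F xs"
        proof (rule pol_Cons_cases)
          fix x ys assume xs: "xs = x # ys" "ys \<in> tuples (univ A) n" "x = u \<or> x = v"
            "F (v # ys) = u \<or> F (v # ys) = v"
          from xs(3) show ?thesis
          proof
            assume "x = u"
            then show ?thesis using xs(1) uv(2) bspec[OF 1 xs(2)] by simp
          next
            assume "x = v"
            then show ?thesis using xs(1,4) by simp metis
          qed
        qed
      qed
    next
      case 2
      have "pol D (Suc n) (\<lambda>_. u)" using c univ_D by (intro pol_const[OF D.fin]) simp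
      then show ?thesis
      proof (rule pol_congI)
        fix xs assume "xs \<in> tuples (univ D) (Suc n)"
        with F show "u = F xs"
        proof (rule pol_Cons_cases)
          fix x ys assume xs: "xs = x # ys" "ys \<in> tuples (univ A) n" "x = u \<or> x = v"
            "F (u # ys) = u \<or> F (u # ys) = v"
          have "F (v # ys) = u" using 2 xs by blast
          moreover from this have "F (u # ys) = u" using mono[OF _ xs(2)] xs(4) uv(2) by metis
          ultimately show ?thesis using xs by metis
        qed
      qed
    next
      case 3
      have t: "replicate n v \<in> tuples (univ A) n" using c by (intro tuples_replicate)
      have "F (u # xs) = F (v # xs)" if xs: "xs \<in> tuples (univ A) n" for xs
      proof (rule ccontr)
        assume ne: "F (u # xs) \<noteq> F (v # xs)"
        have "\<not> (\<forall>j\<in>J. xs ! j = v)"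
          using ne mono[OF _ xs] bspec[OF 3(2) xs] by metis
        moreover from this have "\<forall>j\<in>J'. xs ! j = v"
          using ne bspec[OF 3(2) xs] bspec[OF 3(4) xs] by argo
        ultimately obtain j where j: "j \<in> J" "j \<notin> J'" by blast
        \<comment> \<open>fixing all coordinates but \<open>0\<close> and \<open>j\<close> to \<open>v\<close> makes \<open>F\<close> the join\<close>
        let ?z = "replicate n v"
        have jn: "j < n" using j 3(1) by auto
        have val: "F (u # ?z[j := y]) = y" "F (v # ?z[j := y]) = v" if "y \<in> univ A" for y
        proof -
          have z: "?z[j := y] \<in> tuples (univ A) n" using t that by (rule tuples_update)
          have nth: "?z[j := y] ! i = (if i = j then y else v)" if "i < n" for i
            using that by (simp add: nth_list_update)
          have "(\<forall>i\<in>J. ?z[j := y] ! i = v) \<longleftrightarrow> y = v" using 3(1) j jn nth by (metis lessThan_iff subsetD)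
          then show "F (u # ?z[j := y]) = y" using bspec[OF 3(2) z] that uv by auto
          have "(\<forall>i\<in>J'. ?z[j := y] ! i = v)" using 3(3) j nth by (metis lessThan_iff subsetD)
          then show "F (v # ?z[j := y]) = v" using bspec[OF 3(4) z] by simp
        qed
        have "pol A 2 (\<lambda>zs. F ((v # ?z)[0 := zs ! 0, Suc j := zs ! 1]))"
          by (rule pol_update2[OF fin F ualg]) (use t c pol_proj[OF fin] in \<open>auto simp: tuples_Cons\<close>)
        then have "has_meet A v u" unfolding has_meet_def
          by (intro exI[of _ "\<lambda>zs. F ((v # ?z)[0 := zs ! 0, Suc j := zs ! 1])"] conjI) (use val c in auto)
        then show False using assms by blast
      qed
      then show ?thesis
      proof (intro pol_congI[OF s(1)])
        fix xs assume eq: "\<And>xs. xs \<in> tuples (univ A) n \<Longrightarrow> F (u # xs) = F (v # xs)"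
          and "xs \<in> tuples (univ D) (Suc n)"
        from F this(2) show "F (u # tl xs) = F xs"
          by (rule pol_Cons_cases) (metis eq list.sel(3))
      qed
    qed
  qed
qed

end

end

section \<open>Affine algebras modulo 2 and 3\<close>

definition zmod_ring :: "nat \<Rightarrow> nat ring" where
  "zmod_ring p = \<lparr>carrier = {..<p}, monoid.mult = (\<lambda>x y. x * y mod p), one = 1, zero = 0,
     add = (\<lambda>x y. (x + y) mod p)\<rparr>"

lemma field_zmod_ring:
  assumes "p = 2 \<or> p = 3"
  shows "Ring.field (zmod_ring p)"
proof -
  have p: "p > 1" using assms by auto
  have ag: "abelian_group (zmod_ring p)"
  proof (rule abelian_groupI)
    fix x assume "x \<in> carrier (zmod_ring p)"
    then show "\<exists>y\<in>carrier (zmod_ring p). y \<oplus>\<^bsub>zmod_ring p\<^esub> x = \<zero>\<^bsub>zmod_ring p\<^esub>"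
      by (intro bexI[of _ "(p - x) mod p"]) (auto simp: zmod_ring_def mod_add_left_eq)
  qed (use p in \<open>auto simp: zmod_ring_def mod_add_left_eq mod_add_right_eq ac_simps\<close>)
  have cm: "Group.comm_monoid (zmod_ring p)"
    by (rule comm_monoidI) (use p in \<open>auto simp: zmod_ring_def mod_mult_left_eq mod_mult_right_eq ac_simps\<close>)
  have cr: "cring (zmod_ring p)"
    by (rule cringI[OF ag cm]) (auto simp: zmod_ring_def mod_simps algebra_simps)
  show ?thesis
  proof (rule cring.cring_fieldI2[OF cr])
    show "\<zero>\<^bsub>zmod_ring p\<^esub> \<noteq> \<one>\<^bsub>zmod_ring p\<^esub>" by (simp add: zmod_ring_def)
    fix a assume "a \<in> carrier (zmod_ring p)" "a \<noteq> \<zero>\<^bsub>zmod_ring p\<^esub>"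
    then have a: "a < p" "a = 1 \<or> (p = 3 \<and> a = 2)" using assms by (auto simp: zmod_ring_def)
    \<comment> \<open>Modulo 2 and modulo 3 every unit is its own inverse.\<close>
    then have "a * a mod p = 1" using p by auto
    then show "\<exists>b\<in>carrier (zmod_ring p). a \<otimes>\<^bsub>zmod_ring p\<^esub> b = \<one>\<^bsub>zmod_ring p\<^esub>"
      using a(1) by (intro bexI[of _ a]) (simp_all add: zmod_ring_def)
  qed
qed

lemma mod_cancel:
  fixes u s t w r p :: nat
  assumes "(u + s) mod p = (t + w) mod p" "t mod p = (s + r) mod p"
  shows "u mod p = (w + r) mod p"
proof -
  have "(int u + int s) mod int p = (int t + int w) mod int p"
    "int t mod int p = (int s + int r) mod int p"
    using assms by (metis of_nat_add of_nat_mod)+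
  then have "int p dvd (int u + int s) - (int t + int w)" "int p dvd int t - (int s + int r)"
    by (simp_all add: mod_eq_dvd_iff)
  from dvd_add[OF this] have "int u mod int p = (int w + int r) mod int p"
    by (simp add: mod_eq_dvd_iff algebra_simps)
  then show ?thesis by (metis of_nat_add of_nat_eq_iff of_nat_mod)
qed

text \<open>The abstract affine situation: \<phi> labels elements by residues, adding labels is a
  polynomial, unary polynomials are affine and binary ones obey the parallelogram law. The outcome
  is a one-dimensional space over the field with p elements.\<close>

locale affine_ualg = finite_ualg +
  fixes p :: nat and \<phi> :: "'b \<Rightarrow> nat" and \<psi> :: "nat \<Rightarrow> 'b"
  assumes p: "p = 2 \<or> p = 3"
    and phi: "\<And>x. x \<in> univ A \<Longrightarrow> \<phi> x < p" "\<And>x. x \<in> univ A \<Longrightarrow> \<psi> (\<phi> x) = x"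
    and psi: "\<And>i. i < p \<Longrightarrow> \<psi> i \<in> univ A" "\<And>i. i < p \<Longrightarrow> \<phi> (\<psi> i) = i"
    and add: "pol2 A (\<lambda>x y. \<psi> ((\<phi> x + \<phi> y) mod p))"
    and unary: "\<And>f. pol1 A f \<Longrightarrow> \<exists>a c. \<forall>x\<in>univ A. \<phi> (f x) = (a * \<phi> x + c) mod p"
    and binary: "\<And>g x y w z. pol2 A g \<Longrightarrow> x \<in> univ A \<Longrightarrow> y \<in> univ A \<Longrightarrow> w \<in> univ A \<Longrightarrow> z \<in> univ A \<Longrightarrow>
      (\<phi> (g x y) + \<phi> (g w z)) mod p = (\<phi> (g x z) + \<phi> (g w y)) mod p"
begin

text \<open>The record of modules extends that of rings; its multiplication and unit have no meaning
  for a module and stay \<open>undefined\<close>.\<close>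

definition zmod_module :: "(nat, 'b) module" where
  "zmod_module = \<lparr>carrier = univ A, monoid.mult = undefined, one = undefined, zero = \<psi> 0,
     add = (\<lambda>x y. \<psi> ((\<phi> x + \<phi> y) mod p)), module.smult = (\<lambda>k x. \<psi> (k * \<phi> x mod p))\<rparr>"

lemma p_pos: "0 < p" using p by auto

lemma phi_psi_mod: "\<phi> (\<psi> (i mod p)) = i mod p" "\<psi> (i mod p) \<in> univ A"
  using psi p_pos by simp_all

lemma module_zmod: "Module.module (zmod_ring p) zmod_module"
proof -
  have ag: "abelian_group zmod_module"
  proof (rule abelian_groupI)
    fix x assume x: "x \<in> carrier zmod_module"
    then have "\<phi> x < p" using phi by (simp add: zmod_module_def)
    then show "\<exists>y\<in>carrier zmod_module. y \<oplus>\<^bsub>zmod_module\<^esub> x = \<zero>\<^bsub>zmod_module\<^esub>"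
      by (intro bexI[of _ "\<psi> ((p - \<phi> x) mod p)"])
        (simp_all add: zmod_module_def phi_psi_mod mod_add_left_eq)
  qed (use psi phi p_pos in \<open>auto simp: zmod_module_def phi_psi_mod mod_add_left_eq mod_add_right_eq ac_simps\<close>)
  have cr: "cring (zmod_ring p)" using field_zmod_ring[OF p] by (simp add: field_def domain_def)
  show ?thesis
    by (rule moduleI[OF cr ag])
      (use phi p_pos p in \<open>auto simp: zmod_module_def zmod_ring_def phi_psi_mod mod_simps algebra_simps\<close>)
qed

lemma pol1_scale: "pol1 A (\<lambda>x. \<psi> (k * \<phi> x mod p))"
proof (induction k)
  case 0
  then show ?case using pol1_const[of "\<psi> 0"] psi p_pos by simp
next
  case (Suc k)
  have "pol1 A (\<lambda>x. \<psi> ((\<phi> x + \<phi> (\<psi> (k * \<phi> x mod p))) mod p))"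
    by (rule pol1_pol2[OF add pol1_id Suc])
  then show ?case by (simp add: phi_psi_mod mod_add_right_eq)
qed

lemma minus_zmod:
  assumes "x \<in> univ A"
  shows "\<ominus>\<^bsub>zmod_module\<^esub> x = \<psi> ((p - 1) * \<phi> x mod p)"
proof -
  interpret Module.module "zmod_ring p" zmod_module by (rule module_zmod)
  have "(p - 1) * \<phi> x + \<phi> x = p * \<phi> x" using p_pos by (simp add: diff_mult_distrib)
  then have "\<psi> ((p - 1) * \<phi> x mod p) \<oplus>\<^bsub>zmod_module\<^esub> x = \<zero>\<^bsub>zmod_module\<^esub>"
    by (simp add: zmod_module_def phi_psi_mod mod_add_left_eq)
  then show ?thesis
    by (rule M.minus_equality) (use assms phi_psi_mod in \<open>auto simp: zmod_module_def\<close>)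
qed

lemma poly_equivalent_vector_space: "poly_equivalent A (vector_space_alg (zmod_ring p) zmod_module)"
proof -
  let ?D = "vector_space_alg (zmod_ring p) zmod_module"
  have U: "univ ?D = univ A" by (simp add: vector_space_alg_def zmod_module_def)
  interpret D: finite_ualg ?D
    by unfold_locales (use U fin is_ualg_vector_space_alg[OF module_zmod] in auto)
  show ?thesis
  proof (rule poly_equivalentI[OF D.finite_ualg_axioms U])
    fix f assume f: "f \<in> syms ?D"
    show "pol A (arity ?D f) (interp ?D f)"
    proof (cases f)
      case VZero
      have "pol A 0 (\<lambda>_. \<psi> 0)" using pol_const[OF fin] psi p_pos by simp
      then show ?thesis unfolding VZero vector_space_alg_def
        by (simp, rule pol_congI) (simp add: zmod_module_def)
    next
      case VNeg
      show ?thesis unfolding VNeg vector_space_alg_def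
        by (simp, rule pol_congI[OF pol1_scale[of "p - 1", unfolded One_nat_def]])
          (auto simp: tuples_one minus_zmod)
    next
      case VAdd
      show ?thesis unfolding VAdd vector_space_alg_def
        by (simp, rule pol_congI[OF add]) (simp add: zmod_module_def)
    next
      case (VScale k)
      show ?thesis unfolding VScale vector_space_alg_def
        by (simp, rule pol_congI[OF pol1_scale[of k, unfolded One_nat_def]]) (simp add: zmod_module_def)
    qed
  next
    have addD: "pol2 ?D (\<lambda>x y. \<psi> ((\<phi> x + \<phi> y) mod p))"
    proof -
      have "pol ?D (arity ?D VAdd) (interp ?D VAdd)"
        by (rule pol_basic[OF D.fin _ D.ualg]) (simp add: vector_space_alg_def)
      then have "pol ?D 2 (vs_interp zmod_module VAdd)" by (simp add: vector_space_alg_def)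
      then show ?thesis by (rule pol_congI) (simp add: zmod_module_def)
    qed
    have scaleD: "pol1 ?D (\<lambda>x. \<psi> (k * \<phi> x mod p))" for k
    proof -
      have "VScale (k mod p) \<in> syms ?D" using p_pos by (simp add: vector_space_alg_def zmod_ring_def)
      then have "pol ?D (arity ?D (VScale (k mod p))) (interp ?D (VScale (k mod p)))"
        by (rule pol_basic[OF D.fin _ D.ualg])
      then have "pol ?D 1 (vs_interp zmod_module (VScale (k mod p)))" by (simp add: vector_space_alg_def)
      then show ?thesis by (rule pol_congI) (simp add: zmod_module_def mod_mult_left_eq)
    qed
    show "pol ?D n F" if "pol A n F" for n F
      using D.finite_ualg_axioms U _ that
    proof (rule pol_arity_induct)
      fix n F assume IH: "\<And>G. pol A n G \<Longrightarrow> pol ?D n G" and F: "pol A (Suc n) F"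
      define z where "z = \<psi> 0"
      have z: "z \<in> univ A" "\<phi> z = 0" using psi p_pos by (auto simp: z_def)
      have zs: "replicate n z \<in> tuples (univ A) n" using z by (intro tuples_replicate)
      have "pol1 A (\<lambda>x. F ((z # replicate n z)[0 := x]))"
        by (rule pol_update[OF fin F ualg]) (use z zs pol1_id in \<open>auto simp: tuples_Cons\<close>)
      from unary[OF this] obtain a c
        where ac: "\<And>x. x \<in> univ A \<Longrightarrow> \<phi> (F (x # replicate n z)) = (a * \<phi> x + c) mod p" by auto
      \<comment> \<open>The increment from F(z, xs) to F(x, xs) does not depend on
        \<open>xs\<close>. At the zero tuple it is a times the label of x, and changing one
        coordinate of \<open>xs\<close> preserves it by the parallelogram law. So the first variable
        splits off as a summand.\<close>
      have key: "\<phi> (F (x # xs)) mod p = (\<phi> (F (z # xs)) + a * \<phi> x) mod p"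
        if x: "x \<in> univ A" and xs: "xs \<in> tuples (univ A) n" for x xs
        using zs xs
      proof (rule tuples_change_induct)
        show "\<phi> (F (x # replicate n z)) mod p = (\<phi> (F (z # replicate n z)) + a * \<phi> x) mod p"
          using ac[OF x] ac[OF z(1)] z(2) by (simp add: mod_simps add.commute)
      next
        fix xs j y assume xs: "xs \<in> tuples (univ A) n" and j: "j < n" and y: "y \<in> univ A"
          and P: "\<phi> (F (x # xs)) mod p = (\<phi> (F (z # xs)) + a * \<phi> x) mod p"
        have "pol2 A (\<lambda>s t. F ((z # xs)[0 := s, Suc j := t]))"
          by (rule pol_update2[OF fin F ualg]) (use z xs pol_proj[OF fin] in \<open>auto simp: tuples_Cons\<close>)
        from binary[OF this x y z(1) tuples_nth[OF xs j]]
        have "(\<phi> (F (x # xs[j := y])) + \<phi> (F (z # xs))) mod p =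
              (\<phi> (F (x # xs)) + \<phi> (F (z # xs[j := y]))) mod p" by simp
        then show "\<phi> (F (x # xs[j := y])) mod p = (\<phi> (F (z # xs[j := y])) + a * \<phi> x) mod p"
          using P by (rule mod_cancel)
      qed
      have "pol ?D (Suc n) (\<lambda>xs. F (z # tl xs))"
        by (rule pol_tl[OF D.fin IH[OF pol_Cons[OF fin F z(1) ualg]] D.ualg])
      moreover have "pol ?D (Suc n) (\<lambda>xs. \<psi> (a * \<phi> (xs ! 0) mod p))"
        by (rule D.pol_pol1[OF scaleD]) (rule pol_proj[OF D.fin], simp)
      ultimately have "pol ?D (Suc n) (\<lambda>xs. \<psi> ((\<phi> (F (z # tl xs)) + \<phi> (\<psi> (a * \<phi> (xs ! 0) mod p))) mod p))"
        by (rule D.pol_pol2[OF addD])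
      then show "pol ?D (Suc n) F"
      proof (rule pol_congI)
        fix xs assume "xs \<in> tuples (univ ?D) (Suc n)"
        then obtain x ys where xs: "xs = x # ys" "x \<in> univ A" "ys \<in> tuples (univ A) n"
          unfolding U tuples_Suc by blast
        have FU: "F (x # ys) \<in> univ A"
          by (rule pol_closed[OF fin F ualg]) (use xs in \<open>simp add: tuples_Cons\<close>)
        have "(\<phi> (F (z # ys)) + a * \<phi> x) mod p = \<phi> (F (x # ys))"
          using key[OF xs(2,3)] phi(1)[OF FU] by simp
        then show "\<psi> ((\<phi> (F (z # tl xs)) + \<phi> (\<psi> (a * \<phi> (xs ! 0) mod p))) mod p) = F xs"
          using xs phi(2)[OF FU] by (simp add: phi_psi_mod mod_add_right_eq)
      qed
    qed
  qed
qed

lemma minimal_alg_type_affine: "minimal_alg_type A 2"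
  by (rule minimal_alg_type.vector_space[OF field_zmod_ring[OF p] _ module_zmod poly_equivalent_vector_space])
    (simp add: zmod_ring_def)

end

section \<open>Latin squares and permutations of order 2 and 3 are affine\<close>

definition latin :: "'a set \<Rightarrow> ('a \<Rightarrow> 'a \<Rightarrow> 'a) \<Rightarrow> bool" where
  "latin N g \<longleftrightarrow> (\<forall>c\<in>N. inj_on (g c) N) \<and> (\<forall>c\<in>N. inj_on (\<lambda>x. g x c) N)"

text \<open>Two rows of a Latin square of order 3 differ by a permutation of the symbols without
  fixed points. On three symbols this is a 3-cycle, i.e. a translation modulo 3, so both columns
  show the same difference. The entries \<open>u\<close> and \<open>v\<close> in the third column
  make this visible to the case analysis.\<close>

lemma latin_square_three:
  fixes f :: "nat \<Rightarrow> nat \<Rightarrow> nat"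
  assumes "\<And>i j. i < 3 \<Longrightarrow> j < 3 \<Longrightarrow> f i j < 3" "latin {..<3} f"
    and "i < 3" "j < 3" "k < 3" "l < 3"
  shows "(f i j + f k l) mod 3 = (f i l + f k j) mod 3"
proof (cases "i = k \<or> j = l")
  case False
  have row: "f i j \<noteq> f i k" if "i < 3" "j < 3" "k < 3" "j \<noteq> k" for i j k
    using assms(2) that unfolding latin_def by (meson inj_onD lessThan_iff)
  have col: "f j i \<noteq> f k i" if "i < 3" "j < 3" "k < 3" "j \<noteq> k" for i j k
    using assms(2) that unfolding latin_def by (meson inj_onD lessThan_iff)
  have "\<exists>m<3. m \<noteq> j \<and> m \<noteq> l" by (rule exI[of _ "if j \<noteq> 0 \<and> l \<noteq> 0 then 0 else if j \<noteq> 1 \<and> l \<noteq> 1 then 1 else 2"]) auto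
  then obtain m where m: "m < 3" "m \<noteq> j" "m \<noteq> l" by blast
  define a b c d u v where abc: "a = f i j" "b = f i l" "c = f k j" "d = f k l" "u = f i m" "v = f k m"
  have "a < 3" "b < 3" "c < 3" "d < 3" "u < 3" "v < 3"
    unfolding abc using assms m by auto
  then have vals: "a = 0 \<or> a = 1 \<or> a = 2" "b = 0 \<or> b = 1 \<or> b = 2" "c = 0 \<or> c = 1 \<or> c = 2"
    "d = 0 \<or> d = 1 \<or> d = 2" "u = 0 \<or> u = 1 \<or> u = 2" "v = 0 \<or> v = 1 \<or> v = 2" by linarith+
  have ne: "a \<noteq> b" "a \<noteq> u" "b \<noteq> u" "c \<noteq> d" "c \<noteq> v" "d \<noteq> v" "a \<noteq> c" "b \<noteq> d" "u \<noteq> v"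
    unfolding abc using row col assms m False by auto
  have "(a + d) mod 3 = (b + c) mod 3"
    using vals(1) vals(2)
  proof (elim disjE)
  qed (use ne vals(3-6) in auto)
  then show ?thesis by (simp add: abc)
qed (auto simp: add.commute)

lemma latin_square_affine:
  fixes f :: "nat \<Rightarrow> nat \<Rightarrow> nat"
  assumes "p = 2 \<or> p = 3" "\<And>i j. i < p \<Longrightarrow> j < p \<Longrightarrow> f i j < p" "latin {..<p} f"
    and "i < p" "j < p" "k < p" "l < p"
  shows "(f i j + f k l) mod p = (f i l + f k j) mod p"
  using assms(1)
proof
  assume p: "p = 3"
  then show ?thesis using latin_square_three[of f i j k l] assms by simp
next
  assume p: "p = 2"
  have row: "f i j \<noteq> f i k" if "i < 2" "j < 2" "k < 2" "j \<noteq> k" for i j k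
    using assms(3) that unfolding latin_def p by (meson inj_onD lessThan_iff)
  have col: "f j i \<noteq> f k i" if "i < 2" "j < 2" "k < 2" "j \<noteq> k" for i j k
    using assms(3) that unfolding latin_def p by (meson inj_onD lessThan_iff)
  have b: "f i j < 2" "f k l < 2" "f i l < 2" "f k j < 2" using assms p by auto
  show ?thesis
  proof (cases "i = k \<or> j = l")
    case False
    then have "f i j \<noteq> f i l" "f k l \<noteq> f i l" "f k j \<noteq> f i j"
      using row col assms p by auto
    moreover have "f k l = f i j"
      using calculation b by linarith
    moreover have "f k j = f i l"
      using calculation b by linarith
    ultimately show ?thesis by (simp add: p mult_2[symmetric])
  qed (auto simp: add.commute)
qed

text \<open>There are p! permutations and p (p - 1) affine bijections, and these numbers agree for p
  = 2 and p = 3. For p = 3 the slope is f 1 - f 0, with 3 added to stay clear of truncated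
  subtraction.\<close>

lemma permutation_affine:
  fixes f :: "nat \<Rightarrow> nat"
  assumes "p = 2 \<or> p = 3" "\<And>i. i < p \<Longrightarrow> f i < p" "inj_on f {..<p}"
  shows "\<exists>a c. \<forall>i<p. f i = (a * i + c) mod p"
  using assms(1)
proof
  assume p: "p = 3"
  have "f i \<noteq> f j" if "i < 3" "j < 3" "i \<noteq> j" for i j
    using assms(3) that unfolding p by (meson inj_onD lessThan_iff)
  from this[of 0 1] this[of 0 2] this[of 1 2] have "f 0 \<noteq> f 1" "f 0 \<noteq> f 2" "f 1 \<noteq> f 2" by auto
  moreover have lt: "f 0 < 3" "f 1 < 3" "f 2 < 3" using assms(2) p by auto
  moreover have perm: "z = (2 * (y + 3 - x) + x) mod 3 \<and> y = (y + 3 - x + x) mod 3"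
    if "x \<noteq> y" "x \<noteq> z" "y \<noteq> z" "x < 3" "y < 3" "z < 3" for x y z :: nat
  proof -
    have "x = 0 \<or> x = 1 \<or> x = 2" "y = 0 \<or> y = 1 \<or> y = 2" "z = 0 \<or> z = 1 \<or> z = 2"
      using that by linarith+
    then show ?thesis using that by auto
  qed
  ultimately have "f 2 = (2 * (f 1 + 3 - f 0) + f 0) mod 3 \<and> f 1 = (f 1 + 3 - f 0 + f 0) mod 3"
    by blast
  then have "\<forall>i\<in>{0, 1, 2}. f i = ((f 1 + 3 - f 0) * i + f 0) mod 3"
    using lt by (auto simp: mult.commute)
  moreover have "i \<in> {0, 1, 2}" if "i < 3" for i :: nat using that by auto
  ultimately show ?thesis unfolding p by blast
next
  assume p: "p = 2"
  have "f 0 \<noteq> f 1" using assms(3) unfolding p inj_on_def by force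
  moreover have "f 0 < 2" "f 1 < 2" using assms(2) p by auto
  ultimately have "\<forall>i\<in>{0, 1}. f i = (1 * i + f 0) mod 2" by (auto; presburger)
  moreover have "i \<in> {0, 1}" if "i < 2" for i :: nat using that by auto
  ultimately show ?thesis unfolding p by blast
qed

lemma ex_labelling:
  assumes "finite N" "e \<in> N"
  obtains \<phi> \<psi> where "\<And>x. x \<in> N \<Longrightarrow> \<phi> x < card N" "\<And>x. x \<in> N \<Longrightarrow> \<psi> (\<phi> x) = x"
    "\<And>i. i < card N \<Longrightarrow> \<psi> i \<in> N" "\<And>i. i < card N \<Longrightarrow> \<phi> (\<psi> i) = (i::nat)" "\<phi> e = 0" "\<psi> 0 = e"
proof -
  obtain xs where xs: "distinct xs" "set xs = N - {e}"
    using finite_distinct_list[of "N - {e}"] assms(1) by blast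
  let ?ys = "e # xs"
  have ys: "distinct ?ys" "set ?ys = N" using xs assms by auto
  then have len: "length ?ys = card N" by (metis distinct_card)
  have bij: "bij_betw ((!) ?ys) {..<card N} N" by (rule bij_betw_nth) (use ys len in auto)
  define \<phi> where "\<phi> = the_inv_into {..<card N} ((!) ?ys)"
  have inj: "inj_on ((!) ?ys) {..<card N}" and im: "(!) ?ys ` {..<card N} = N"
    using bij by (auto simp: bij_betw_def)
  have z: "0 < card N" using len by simp
  have 1: "\<phi> (?ys ! i) = i" if "i < card N" for i
    unfolding \<phi>_def using that the_inv_into_f_f[OF inj] by simp
  show ?thesis
  proof (rule that[of \<phi> "(!) ?ys"])
    show "\<phi> x < card N" if "x \<in> N" for x using that im 1 by (metis imageE lessThan_iff)
    show "?ys ! \<phi> x = x" if "x \<in> N" for x using that im 1 by (metis imageE lessThan_iff)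
    show "?ys ! i \<in> N" if "i < card N" for i using that im by auto
    show "\<phi> e = 0" using 1[OF z] by simp
  qed (use 1 in auto)
qed

section \<open>Minimal algebras whose binary polynomials are quasigroups\<close>

context finite_ualg
begin

lemma pol2_inj_bij:
  assumes "pol2 A g" "latin (univ A) g" "c \<in> univ A"
  shows "bij_betw (g c) (univ A) (univ A)" "bij_betw (\<lambda>x. g x c) (univ A) (univ A)"
proof -
  have "g c ` univ A \<subseteq> univ A" "(\<lambda>x. g x c) ` univ A \<subseteq> univ A"
    using pol2_closed[OF assms(1)] assms(3) by auto
  then show "bij_betw (g c) (univ A) (univ A)" "bij_betw (\<lambda>x. g x c) (univ A) (univ A)"
    using assms(2,3) endo_inj_surj[OF fin] by (auto simp: latin_def bij_betw_def)
qed

text \<open>Every quasigroup is isotopic to a loop: dividing by the row and the column of a fixed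
  \<open>c\<close> turns g c c into the unit. Both divisions are polynomials by
  \<open>pol1_inverse\<close>.\<close>

lemma loop_of_latin:
  assumes "pol2 A g" "latin (univ A) g"
  obtains q e where "pol2 A q" "latin (univ A) q" "e \<in> univ A"
    "\<And>x. x \<in> univ A \<Longrightarrow> q e x = x" "\<And>x. x \<in> univ A \<Longrightarrow> q x e = x"
proof -
  obtain c where c: "c \<in> univ A" using ualg by (auto simp: is_ualg_def)
  have s: "pol1 A (g c)" "pol1 A (\<lambda>x. g x c)"
    by (rule pol1_pol2[OF assms(1) pol1_const[OF c] pol1_id], rule pol1_pol2[OF assms(1) pol1_id pol1_const[OF c]])
  obtain t' where t': "pol1 A t'" "\<And>x. x \<in> univ A \<Longrightarrow> t' x \<in> univ A"
    "\<And>x. x \<in> univ A \<Longrightarrow> t' (g c x) = x" "\<And>x. x \<in> univ A \<Longrightarrow> g c (t' x) = x"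
    using pol1_inverse[OF s(1) subset_refl pol2_inj_bij(1)[OF assms c]] by metis
  obtain s' where s': "pol1 A s'" "\<And>x. x \<in> univ A \<Longrightarrow> s' x \<in> univ A"
    "\<And>x. x \<in> univ A \<Longrightarrow> s' (g x c) = x" "\<And>x. x \<in> univ A \<Longrightarrow> g (s' x) c = x"
    using pol1_inverse[OF s(2) subset_refl pol2_inj_bij(2)[OF assms c]] by metis
  have inj: "inj_on t' (univ A)" "inj_on s' (univ A)"
    using t'(4) s'(4) by (metis inj_onI)+
  show ?thesis
  proof (rule that[of "\<lambda>x y. g (s' x) (t' y)" "g c c"])
    show "pol2 A (\<lambda>x y. g (s' x) (t' y))"
      by (intro pol_pol2[OF assms(1)] pol_pol1[OF s'(1)] pol_pol1[OF t'(1)] pol_proj[OF fin]) auto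
    show "latin (univ A) (\<lambda>x y. g (s' x) (t' y))"
      unfolding latin_def
    proof (intro conjI ballI inj_onI)
      fix d x y assume d: "d \<in> univ A" "x \<in> univ A" "y \<in> univ A"
      show "x = y" if "g (s' d) (t' x) = g (s' d) (t' y)"
        using that d assms(2) s' t' inj unfolding latin_def by (meson inj_onD)
      show "x = y" if "g (s' x) (t' d) = g (s' y) (t' d)"
      proof -
        have "inj_on (\<lambda>x. g x (t' d)) (univ A)" using assms(2) t'(2) d unfolding latin_def by blast
        from inj_onD[OF this that] s'(2) d have "s' x = s' y" by blast
        then show ?thesis using inj(2) d by (meson inj_onD)
      qed
    qed
    show "g c c \<in> univ A" using pol2_closed[OF assms(1) c c] .
  qed (use s' t' c in auto)
qed

text \<open>A loop of order 2 or 3 is the cyclic group, by the parallelogram law for Latin squares.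
  The second conclusion keeps the polynomial addition and its labelling for counting homomorphisms
  later.\<close>

lemma minimal_alg_type_latin:
  assumes p: "card (univ A) = 2 \<or> card (univ A) = 3" and min_unary
    and dich: "\<And>F. pol A 2 F \<Longrightarrow> \<not> one_var (univ A) F \<Longrightarrow> latin (univ A) (\<lambda>x y. F [x, y])"
    and "\<not> ess_unary A"
  shows "minimal_alg_type A 2"
    and "\<exists>(\<phi> :: 'a \<Rightarrow> nat) q e. pol2 A q \<and> e \<in> univ A \<and> \<phi> e = 0 \<and> inj_on \<phi> (univ A) \<and>
      (\<forall>x\<in>univ A. \<phi> x < card (univ A)) \<and>
      (\<forall>x\<in>univ A. \<forall>y\<in>univ A. \<phi> (q x y) = (\<phi> x + \<phi> y) mod card (univ A))"
proof -
  obtain F where F: "pol A 2 F" "\<not> one_var (univ A) F"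
    using assms(4) unfolding ess_unary_def by blast
  obtain q e where q: "pol2 A q" "latin (univ A) q" "e \<in> univ A"
    "\<And>x. x \<in> univ A \<Longrightarrow> q e x = x" "\<And>x. x \<in> univ A \<Longrightarrow> q x e = x"
    using loop_of_latin[of "\<lambda>x y. F [x, y]", OF _ dich[OF F]] F(1) unfolding pol2_iff[of A F] by blast
  let ?p = "card (univ A)"
  obtain \<phi> \<psi> where \<phi>: "\<And>x. x \<in> univ A \<Longrightarrow> \<phi> x < ?p" "\<And>x. x \<in> univ A \<Longrightarrow> \<psi> (\<phi> x) = x"
    and \<psi>: "\<And>i. i < ?p \<Longrightarrow> \<psi> i \<in> univ A" "\<And>i. i < ?p \<Longrightarrow> \<phi> (\<psi> i) = i"
    and e: "\<phi> e = 0" "\<psi> 0 = e"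
    using ex_labelling[OF fin q(3)] by metis
  have inj\<phi>: "inj_on \<phi> (univ A)" using \<phi>(2) by (metis inj_onI)
  have p0: "0 < ?p" using p by auto
  have lat: "(\<phi> (g x y) + \<phi> (g w z)) mod ?p = (\<phi> (g x z) + \<phi> (g w y)) mod ?p"
    if g: "pol2 A g" "latin (univ A) g" and U: "x \<in> univ A" "y \<in> univ A" "w \<in> univ A" "z \<in> univ A" for g x y w z
  proof -
    let ?f = "\<lambda>i j. \<phi> (g (\<psi> i) (\<psi> j))"
    have cl: "g (\<psi> i) (\<psi> j) \<in> univ A" if "i < ?p" "j < ?p" for i j
      using that \<psi> pol2_closed[OF g(1)] by blast
    have eq: "\<psi> i = \<psi> j \<longleftrightarrow> i = j" if "i < ?p" "j < ?p" for i j using that \<psi>(2) by metis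
    have l: "latin {..<?p} ?f" unfolding latin_def
    proof (intro conjI ballI inj_onI)
      fix c i j assume c: "c \<in> {..<?p}" "i \<in> {..<?p}" "j \<in> {..<?p}"
      show "i = j" if "?f c i = ?f c j"
      proof -
        have "g (\<psi> c) (\<psi> i) = g (\<psi> c) (\<psi> j)" using that c cl inj\<phi> by (simp add: inj_on_eq_iff)
        then have "\<psi> i = \<psi> j" using g(2) c \<psi>(1) unfolding latin_def by (meson inj_onD lessThan_iff)
        then show ?thesis using eq c by simp
      qed
      show "i = j" if "?f i c = ?f j c"
      proof -
        have "g (\<psi> i) (\<psi> c) = g (\<psi> j) (\<psi> c)" using that c cl inj\<phi> by (simp add: inj_on_eq_iff)
        then have "\<psi> i = \<psi> j" using g(2) c \<psi>(1) unfolding latin_def by (metis (no_types, lifting) inj_onD lessThan_iff)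
        then show ?thesis using eq c by simp
      qed
    qed
    have "(?f (\<phi> x) (\<phi> y) + ?f (\<phi> w) (\<phi> z)) mod ?p = (?f (\<phi> x) (\<phi> z) + ?f (\<phi> w) (\<phi> y)) mod ?p"
      by (rule latin_square_affine[OF p _ l]) (use \<phi> cl U in auto)
    then show ?thesis using \<phi>(2) U by simp
  qed
  \<comment> \<open>The parallelogram law with opposite corner (e, e): the unit has label 0, so the
    law becomes additivity of labels.\<close>
  have add: "\<phi> (q x y) = (\<phi> x + \<phi> y) mod ?p" if "x \<in> univ A" "y \<in> univ A" for x y
    using lat[OF q(1,2) that q(3) q(3)] q(3,4,5) that e pol2_closed[OF q(1) that] \<phi>(1) by simp
  then show "\<exists>(\<phi> :: 'a \<Rightarrow> nat) q e. pol2 A q \<and> e \<in> univ A \<and> \<phi> e = 0 \<and> inj_on \<phi> (univ A) \<and>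
      (\<forall>x\<in>univ A. \<phi> x < ?p) \<and>
      (\<forall>x\<in>univ A. \<forall>y\<in>univ A. \<phi> (q x y) = (\<phi> x + \<phi> y) mod ?p)"
    using q(1,3) e inj\<phi> \<phi>(1) by blast
  interpret affine_ualg A ?p \<phi> \<psi>
  proof unfold_locales
    show "pol2 A (\<lambda>x y. \<psi> ((\<phi> x + \<phi> y) mod ?p))"
    proof (rule pol_congI[OF q(1)])
      fix xs assume "xs \<in> tuples (univ A) 2"
      then have "xs ! 0 \<in> univ A" "xs ! 1 \<in> univ A" by (auto intro: tuples_nth)
      then show "q (xs ! 0) (xs ! 1) = \<psi> ((\<phi> (xs ! 0) + \<phi> (xs ! 1)) mod ?p)"
        using add[of "xs ! 0" "xs ! 1"] \<phi>(2) pol2_closed[OF q(1)] by metis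
    qed
  next
    fix f assume f: "pol1 A f"
    show "\<exists>a c. \<forall>x\<in>univ A. \<phi> (f x) = (a * \<phi> x + c) mod ?p"
    proof (cases "\<forall>x\<in>univ A. \<forall>y\<in>univ A. f x = f y")
      case True
      have "\<phi> (f e) < ?p" using \<phi>(1) pol1_closed[OF f q(3)] by blast
      moreover have "f x = f e" if "x \<in> univ A" for x using True that q(3) by blast
      ultimately have "\<forall>x\<in>univ A. \<phi> (f x) = (0 * \<phi> x + \<phi> (f e)) mod ?p" by simp
      then show ?thesis by blast
    next
      case False
      then have b: "bij_betw f (univ A) (univ A)" using \<open>min_unary\<close> f unfolding min_unary_def by blast
      have "\<exists>a c. \<forall>i<?p. \<phi> (f (\<psi> i)) = (a * i + c) mod ?p"
      proof (rule permutation_affine[OF p])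
        show "\<phi> (f (\<psi> i)) < ?p" if "i < ?p" for i using that \<psi> \<phi> pol1_closed[OF f] by blast
        show "inj_on (\<lambda>i. \<phi> (f (\<psi> i))) {..<?p}"
        proof (rule inj_onI)
          fix i j assume ij: "i \<in> {..<?p}" "j \<in> {..<?p}" "\<phi> (f (\<psi> i)) = \<phi> (f (\<psi> j))"
          have i: "\<psi> i \<in> univ A" "\<psi> j \<in> univ A" using ij \<psi>(1) by auto
          then have "f (\<psi> i) = f (\<psi> j)" using inj_onD[OF inj\<phi> ij(3)] pol1_closed[OF f] by blast
          then have "\<psi> i = \<psi> j" using inj_onD[OF bij_betw_imp_inj_on[OF b]] i by blast
          then show "i = j" using \<psi>(2) ij by (metis lessThan_iff)
        qed
      qed
      then show ?thesis using \<phi> by metis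
    qed
  next
    fix g x y w z assume g: "pol2 A g" and U: "x \<in> univ A" "y \<in> univ A" "w \<in> univ A" "z \<in> univ A"
    show "(\<phi> (g x y) + \<phi> (g w z)) mod ?p = (\<phi> (g x z) + \<phi> (g w y)) mod ?p"
    proof (cases "one_var (univ A) (\<lambda>xs. g (xs ! 0) (xs ! 1))")
      case True
      then have "g x y = g w y \<and> g x z = g w z \<or> g x y = g x z \<and> g w y = g w z"
        using U unfolding one_var_def by auto
      then show ?thesis by (auto simp: add.commute)
    next
      case False
      from dich[OF g False] have "latin (univ A) g" by simp
      then show ?thesis by (rule lat[OF g _ U])
    qed
  qed (use p \<phi> \<psi> in auto)
  show "minimal_alg_type A 2" by (rule minimal_alg_type_affine)
qed

text \<open>If some column were constant and another one not, then up to permutations the operation would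
  be multiplication modulo 3, whose diagonal is neither constant nor a permutation.\<close>

lemma no_constant_column:
  assumes min_unary and three: "card (univ A) = 3" and g: "pol2 A g"
    and c: "c \<in> univ A" "\<And>x. x \<in> univ A \<Longrightarrow> g x c = k"
    and d: "d \<in> univ A" "x \<in> univ A" "x' \<in> univ A" "g x d \<noteq> g x' d"
  shows False
proof -
  have min: "bij_betw f (univ A) (univ A)"
    if "pol1 A f" "a \<in> univ A" "b \<in> univ A" "f a \<noteq> f b" for f a b
    using assms(1) that unfolding min_unary_def by blast
  have k: "k \<in> univ A" using c pol2_closed[OF g] by metis
  let ?t = "\<lambda>x. g x d"
  have t: "pol1 A ?t" by (rule pol1_pol2[OF g pol1_id pol1_const[OF d(1)]])
  then have tb: "bij_betw ?t (univ A) (univ A)" by (rule min[OF _ d(2,3,4)])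
  then obtain a0 where a0: "a0 \<in> univ A" "g a0 d = k" using k by (metis bij_betw_iff_bijections)
  have row: "pol1 A (g a)" if "a \<in> univ A" for a
    by (rule pol1_pol2[OF g pol1_const[OF that] pol1_id])
  have cd: "c \<noteq> d" using c d by metis
  \<comment> \<open>A non-constant row would be a permutation, but this one takes the value
    \<open>k\<close> at both \<open>c\<close> and \<open>d\<close>.\<close>
  have zero: "g a0 y = k" if "y \<in> univ A" for y
  proof (rule ccontr)
    assume "g a0 y \<noteq> k"
    then have "bij_betw (g a0) (univ A) (univ A)" using min[OF row[OF a0(1)] that d(1)] a0 by simp
    then show False using cd c d a0 by (metis bij_betw_imp_inj_on inj_onD)
  qed
  have "card (univ A - {a0}) = 2" using three a0 by simp
  then obtain a1 where a1: "a1 \<in> univ A" "a1 \<noteq> a0"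
    by (metis card.empty DiffE ex_in_conv insertI1 zero_neq_numeral)
  define l where "l = g a1 d"
  have l: "l \<in> univ A" "l \<noteq> k"
    using a0 a1 tb d pol2_closed[OF g] unfolding l_def by (auto simp: bij_betw_def dest: inj_onD)
  have "bij_betw (g a1) (univ A) (univ A)"
    using min[OF row[OF a1(1)] c(1) d(1)] c(2)[OF a1(1)] l by (simp add: l_def)
  then obtain s' where s': "pol1 A s'" "\<And>x. x \<in> univ A \<Longrightarrow> s' x \<in> univ A"
    "\<And>x. x \<in> univ A \<Longrightarrow> s' (g a1 x) = x" "\<And>x. x \<in> univ A \<Longrightarrow> g a1 (s' x) = x"
    using pol1_inverse[OF row[OF a1(1)] subset_refl] by metis
  obtain t' where t': "pol1 A t'" "\<And>x. x \<in> univ A \<Longrightarrow> t' x \<in> univ A"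
    "\<And>x. x \<in> univ A \<Longrightarrow> t' (?t x) = x" "\<And>x. x \<in> univ A \<Longrightarrow> ?t (t' x) = x"
    using pol1_inverse[OF t subset_refl tb] by metis
  have inv: "s' k = c" "s' l = d" "t' k = a0" "t' l = a1"
    using s'(3)[OF c(1)] s'(3)[OF d(1)] t'(3)[OF a0(1)] t'(3)[OF a1(1)] c(2)[OF a1(1)] a0 by (auto simp: l_def)
  \<comment> \<open>In these coordinates \<open>k\<close> is an absorbing zero and \<open>l\<close>
    is a unit.\<close>
  define G where "G x y = g (t' x) (s' y)" for x y
  have G: "pol2 A G" unfolding G_def
    by (intro pol_pol2[OF g] pol_pol1[OF s'(1)] pol_pol1[OF t'(1)] pol_proj[OF fin]) auto
  have Gk: "G k y = k" "G y k = k" if "y \<in> univ A" for y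
    using that inv zero s' t' c by (auto simp: G_def)
  have Gl: "G l y = y" "G y l = y" if "y \<in> univ A" for y
    using that inv s' t' by (auto simp: G_def)
  obtain m where m: "m \<in> univ A" "m \<noteq> k" "m \<noteq> l" "univ A = {k, l, m}"
  proof -
    have "card (univ A - {k, l}) = 1" using three k l by (simp add: card_Diff_subset)
    then obtain m where m: "univ A - {k, l} = {m}" by (metis card_1_singletonE)
    then have "m \<in> univ A" "m \<noteq> k" "m \<noteq> l" by auto
    moreover have "univ A = {k, l, m}" using m k l by blast
    ultimately show ?thesis using that by blast
  qed
  have "pol1 A (G m)" by (rule pol1_pol2[OF G pol1_const[OF m(1)] pol1_id])
  then have "bij_betw (G m) (univ A) (univ A)"
    using min[of "G m" k l] k l Gk Gl m by simp
  then have "G m m \<noteq> G m k" "G m m \<noteq> G m l"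
    using m k l by (metis bij_betw_imp_inj_on inj_onD)+
  then have mm: "G m m = l" using Gk Gl m pol2_closed[OF G m(1) m(1)] by auto
  \<comment> \<open>The diagonal separates \<open>k\<close> from \<open>l\<close>, so minimality
    would make it a permutation; but it sends both \<open>l\<close> and \<open>m\<close> to
    \<open>l\<close>.\<close>
  have "pol1 A (\<lambda>x. G x x)" by (rule pol1_pol2[OF G pol1_id pol1_id])
  from min[OF this k l(1)] have "bij_betw (\<lambda>x. G x x) (univ A) (univ A)"
    using Gk[OF k] Gl[OF l(1)] l by simp
  then have "inj_on (\<lambda>x. G x x) (univ A)" by (rule bij_betw_imp_inj_on)
  moreover have "G m m = G l l" using mm Gl l by simp
  ultimately show False using m l by (metis (no_types, lifting) inj_onD)
qed

text \<open>Dependence on both variables gives one non-constant row and one non-constant column.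
  Then \<open>no_constant_column\<close>, used for g and for its transpose, leaves no constant row
  or column, and by minimality the non-constant ones are permutations.\<close>

lemma latin_of_not_one_var:
  assumes min_unary and three: "card (univ A) = 3" and F: "pol A 2 F" "\<not> one_var (univ A) F"
  shows "latin (univ A) (\<lambda>x y. F [x, y])"
proof -
  define g where "g x y = F [x, y]" for x y
  have g: "pol2 A g" using F(1) unfolding g_def by (subst (asm) pol2_iff)
  have g': "pol2 A (\<lambda>x y. g y x)" by (rule pol_pol2[OF g]) (auto intro: pol_proj[OF fin])
  obtain x x' d where x: "x \<in> univ A" "x' \<in> univ A" "d \<in> univ A" "g x d \<noteq> g x' d"
    using F(2) unfolding one_var_def g_def by blast
  obtain y y' e where y: "y \<in> univ A" "y' \<in> univ A" "e \<in> univ A" "g e y \<noteq> g e y'"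
    using F(2) unfolding one_var_def g_def by blast
  have "inj_on (g c) (univ A)" "inj_on (\<lambda>x. g x c) (univ A)" if c: "c \<in> univ A" for c
  proof -
    have "pol1 A (g c)" "pol1 A (\<lambda>x. g x c)"
      by (rule pol1_pol2[OF g pol1_const[OF c] pol1_id], rule pol1_pol2[OF g pol1_id pol1_const[OF c]])
    note m = this[THEN mp[OF spec[OF assms(1)[unfolded min_unary_def]]]]
    show "inj_on (g c) (univ A)"
    proof (rule ccontr)
      assume "\<not> inj_on (g c) (univ A)"
      then have "\<forall>x\<in>univ A. \<forall>y\<in>univ A. g c x = g c y" using m(1) bij_betw_imp_inj_on by blast
      then show False using no_constant_column[OF assms(1) three g' c, of "g c c"] y c by blast
    qed
    show "inj_on (\<lambda>x. g x c) (univ A)"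
    proof (rule ccontr)
      assume "\<not> inj_on (\<lambda>x. g x c) (univ A)"
      then have "\<forall>x\<in>univ A. \<forall>y\<in>univ A. g x c = g y c" using m(2) bij_betw_imp_inj_on by blast
      then show False using no_constant_column[OF assms(1) three g c, of "g c c"] x c by blast
    qed
  qed
  then have "latin (univ A) g" by (simp add: latin_def)
  moreover have "g = (\<lambda>x y. F [x, y])" by (simp add: g_def fun_eq_iff)
  ultimately show ?thesis by simp
qed

end

text \<open>The term condition spreads non-constancy from one row to all rows and, with the
  arguments exchanged, from one column to all columns. On two elements non-constant means
  injective.\<close>

lemma (in two_element_ualg) latin_of_term_condition:
  assumes "term_condition A" and F: "pol A 2 F" "\<not> one_var (univ A) F"
  shows "latin (univ A) (\<lambda>x y. F [x, y])"
proof -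
  obtain x x' d where x: "x \<in> univ A" "x' \<in> univ A" "d \<in> univ A" "F [x, d] \<noteq> F [x', d]"
    using F(2) unfolding one_var_def by blast
  obtain y y' e where y: "y \<in> univ A" "y' \<in> univ A" "e \<in> univ A" "F [e, y] \<noteq> F [e, y']"
    using F(2) unfolding one_var_def by blast
  have U: "univ A = {x, x'}" "univ A = {y, y'}" using x y univ_pair by metis+
  have "pol A 2 (\<lambda>xs. F [xs ! 1, xs ! 0])"
    by (rule pol_comp2[OF fin F(1) _ _ ualg]) (auto intro: pol_proj[OF fin])
  note F' = this
  have tc: "F [a, c] = F [b, c] \<Longrightarrow> F [a, c'] = F [b, c']"
    if "a \<in> univ A" "b \<in> univ A" "c \<in> univ A" "c' \<in> univ A" for a b c c'
    using assms(1)[unfolded term_condition_def, rule_format, OF F' that(3,4,1,2)] by simp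
  have "F [c, y] \<noteq> F [c, y']" "F [x, c] \<noteq> F [x', c]" if "c \<in> univ A" for c
    using assms(1) F(1) that y x tc unfolding term_condition_def by metis+
  then show ?thesis unfolding latin_def inj_on_def using U by (metis insertE singletonD)
qed

lemma (in two_element_ualg) classification_two: "minimal_alg_type A (kind A)"
proof (cases "ess_unary A")
  case True
  then show ?thesis using minimal_alg_type_unary min_unary_two by (simp add: kind_def)
next
  case ess: False
  show ?thesis
  proof (cases "term_condition A")
    case True
    have "minimal_alg_type A 2"
      by (rule minimal_alg_type_latin(1)) (use two min_unary_two latin_of_term_condition True ess in auto)
    then show ?thesis using ess True by (simp add: kind_def)
  next
    case tc: False
    obtain p q where pq: "univ A = {p, q}" "p \<noteq> q" "has_meet A p q"
      using meet_of_not_term_condition[OF tc] by blast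
    show ?thesis
    proof (cases "has_swap A")
      case True
      have "minimal_alg_type A 3"
        by (rule minimal_alg_type.boolean[OF pq(2)]) (rule poly_equivalent_boolean[OF refl pq(1,2) refl True pq(3)])
      then show ?thesis using ess tc True by (simp add: kind_def)
    next
      case sw: False
      show ?thesis
      proof (cases "has_meet A q p")
        case True
        have "minimal_alg_type A 4"
          by (rule minimal_alg_type.lattice[OF pq(2)]) (rule poly_equivalent_lattice[OF refl pq(1,2) refl sw pq(3) True])
        moreover have "lattice_like A" unfolding lattice_like_def using pq True by auto
        ultimately show ?thesis using ess tc sw by (simp add: kind_def)
      next
        case False
        have "minimal_alg_type A 5"
          by (rule minimal_alg_type.semilattice[OF pq(2)]) (rule poly_equivalent_semilattice[OF refl pq(1,2) refl sw pq(3) False])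
        moreover have "\<not> lattice_like A" unfolding lattice_like_def using pq False by auto
        ultimately show ?thesis using ess tc sw by (simp add: kind_def)
      qed
    qed
  qed
qed

text \<open>With three elements only the unary and the affine case remain, since a binary polynomial
  depending on both variables is a quasigroup. That the type found is \<open>kind\<close> follows
  from uniqueness.\<close>

lemma (in finite_ualg) classification_three:
  assumes "card (univ A) = 3" min_unary
  shows "minimal_alg_type A (kind A)"
proof -
  have "minimal_alg_type A 1 \<or> minimal_alg_type A 2"
    using minimal_alg_type_unary[OF _ assms(2)] minimal_alg_type_latin(1)[OF disjI2[OF assms(1)] assms(2)
        latin_of_not_one_var[OF assms(2,1)]] by blast
  then show ?thesis using minimal_alg_type_kind[of A] assms(1) by auto
qed

section \<open>Minimal sets and traces\<close>

lemma list_all2_replace_induct: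
  assumes "list_all2 R xs ys" "P xs"
    and "\<And>zs i. length zs = length xs \<Longrightarrow> i < length xs \<Longrightarrow> set zs \<subseteq> set xs \<union> set ys \<Longrightarrow>
      zs ! i = xs ! i \<Longrightarrow> P zs \<Longrightarrow> R (xs ! i) (ys ! i) \<Longrightarrow> P (zs[i := ys ! i])"
  shows "P ys"
proof -
  have len: "length xs = length ys" using assms(1) by (rule list_all2_lengthD)
  have "k \<le> length xs \<Longrightarrow> P (take k ys @ drop k xs)" for k
  proof (induction k)
    case 0
    then show ?case using assms by simp
  next
    case (Suc k)
    let ?zs = "take k ys @ drop k xs"
    have "P (?zs[k := ys ! k])"
    proof (rule assms(3))
      show "set ?zs \<subseteq> set xs \<union> set ys" by (auto dest: in_set_takeD in_set_dropD)
      show "R (xs ! k) (ys ! k)" using assms(1) Suc.prems by (simp add: list_all2_conv_all_nth)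
    qed (use Suc len in \<open>auto simp: nth_append\<close>)
    moreover have "?zs[k := ys ! k] = take (Suc k) ys @ drop (Suc k) xs"
      using Suc.prems len
      by (intro nth_equalityI) (auto simp: nth_append nth_list_update less_Suc_eq min_def)
    ultimately show ?case by simp
  qed
  from this[of "length xs"] show ?thesis using len by simp
qed

context finite_ualg
begin

lemma congruence_pol:
  assumes "congruence A \<alpha>" "pol A n F" "xs \<in> tuples (univ A) n" "ys \<in> tuples (univ A) n"
    "list_all2 (\<lambda>x y. (x, y) \<in> \<alpha>) xs ys"
  shows "(F xs, F ys) \<in> \<alpha>"
proof -
  have refl: "(x, x) \<in> \<alpha>" if "x \<in> univ A" for x
    using assms(1) that by (auto simp: congruence_def equiv_def refl_on_def)
  have "\<forall>xs\<in>tuples (univ A) n. \<forall>ys\<in>tuples (univ A) n.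
      list_all2 (\<lambda>x y. (x, y) \<in> \<alpha>) xs ys \<longrightarrow> (F xs, F ys) \<in> \<alpha>"
    using fin assms(2)
  proof (induction rule: pol_induct)
    case (proj i)
    then show ?case by (auto simp: list_all2_conv_all_nth tuples_length)
  next
    case (const c)
    then show ?case using refl by blast
  next
    case (app f G)
    show ?case
    proof (intro ballI impI)
      fix xs ys assume xs: "xs \<in> tuples (univ A) n" "ys \<in> tuples (univ A) n"
        "list_all2 (\<lambda>x y. (x, y) \<in> \<alpha>) xs ys"
      have cl: "map (\<lambda>i. G i zs) [0..<arity A f] \<in> tuples (univ A) (arity A f)"
        if "zs \<in> tuples (univ A) n" for zs
        using pol_closed[OF fin app(2) ualg that] by (intro tuples_map_upt)
      have "list_all2 (\<lambda>x y. (x, y) \<in> \<alpha>) (map (\<lambda>i. G i xs) [0..<arity A f]) (map (\<lambda>i. G i ys) [0..<arity A f])"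
        using app(3) xs by (simp add: list_all2_conv_all_nth)
      then show "(interp A f (map (\<lambda>i. G i xs) [0..<arity A f]), interp A f (map (\<lambda>i. G i ys) [0..<arity A f])) \<in> \<alpha>"
        using assms(1) app(1) cl[OF xs(1)] cl[OF xs(2)] unfolding congruence_def by blast
    qed
  next
    case (cong F G)
    then show ?case by simp
  qed
  then show ?thesis using assms by blast
qed

lemma congruence_pol1:
  assumes "congruence A \<alpha>" "pol1 A f" "(x, y) \<in> \<alpha>"
  shows "(f x, f y) \<in> \<alpha>"
proof -
  have "x \<in> univ A" "y \<in> univ A" using assms by (auto simp: congruence_def)
  then show ?thesis
    using congruence_pol[OF assms(1,2), of "[x]" "[y]"] assms(3) by (simp add: tuples_one)
qed

lemma congruence_pol2:
  assumes "congruence A \<alpha>" "pol2 A g" "(x, y) \<in> \<alpha>" "(x', y') \<in> \<alpha>"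
  shows "(g x x', g y y') \<in> \<alpha>"
proof -
  have "x \<in> univ A" "y \<in> univ A" "x' \<in> univ A" "y' \<in> univ A" using assms by (auto simp: congruence_def)
  then show ?thesis
    using congruence_pol[OF assms(1,2), of "[x, x']" "[y, y']"] assms(3,4)
    by (simp add: tuples_two numeral_2_eq_2)
qed

text \<open>The arguments of a basic operation are exchanged one at a time; each exchange is a unary
  polynomial, and transitivity joins them.\<close>

lemma congruenceI_pol1:
  assumes "equiv (univ A) \<theta>" and "\<And>f x y. pol1 A f \<Longrightarrow> (x, y) \<in> \<theta> \<Longrightarrow> (f x, f y) \<in> \<theta>"
  shows "congruence A \<theta>"
proof -
  have sub: "\<theta> \<subseteq> univ A \<times> univ A" and refl: "\<And>x. x \<in> univ A \<Longrightarrow> (x, x) \<in> \<theta>" and trans: "trans \<theta>"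
    using assms(1) by (auto simp: equiv_def refl_on_def)
  have "(interp A f xs, interp A f ys) \<in> \<theta>"
    if f: "f \<in> syms A" and xs: "xs \<in> tuples (univ A) (arity A f)" and ys: "ys \<in> tuples (univ A) (arity A f)"
      and r: "list_all2 (\<lambda>x y. (x, y) \<in> \<theta>) xs ys" for f xs ys
    using r
  proof (rule list_all2_replace_induct)
    show "(interp A f xs, interp A f xs) \<in> \<theta>"
      using f xs ualg refl by (auto simp: is_ualg_def)
    fix zs i assume z: "length zs = length xs" "i < length xs" "set zs \<subseteq> set xs \<union> set ys"
      "zs ! i = xs ! i" "(interp A f xs, interp A f zs) \<in> \<theta>" "(xs ! i, ys ! i) \<in> \<theta>"
    have zs: "zs \<in> tuples (univ A) (arity A f)" using z xs ys by (auto simp: tuples_def)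
    have "pol1 A (\<lambda>x. interp A f (zs[i := x]))"
      by (rule pol_update[OF fin pol_basic[OF fin f ualg] ualg zs pol1_id])
    from assms(2)[OF this z(6)] have "(interp A f zs, interp A f (zs[i := ys ! i])) \<in> \<theta>"
      using z(4) by (metis list_update_id)
    then show "(interp A f xs, interp A f (zs[i := ys ! i])) \<in> \<theta>"
      using z(5) trans by (meson transD)
  qed
  then show ?thesis using assms(1) sub unfolding congruence_def by blast
qed

text \<open>The largest congruence below \<alpha> inside the kernels of the maps in R. Testing after
  every unary polynomial makes the relation invariant under unary polynomials.\<close>

lemma congruence_kernel:
  assumes "congruence A \<alpha>"
  shows "congruence A {(x, y) \<in> \<alpha>. \<forall>r\<in>R. \<forall>f. pol1 A f \<longrightarrow> r (f x) = r (f y)}" (is "congruence A ?\<theta>")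
proof (rule congruenceI_pol1)
  have eq: "equiv (univ A) \<alpha>" using assms by (simp add: congruence_def)
  then have "refl_on (univ A) ?\<theta>" "sym ?\<theta>"
    unfolding equiv_def refl_on_def sym_def by auto
  moreover have "trans ?\<theta>"
    using eq unfolding equiv_def by (intro transI) (auto dest: transD)
  ultimately show "equiv (univ A) ?\<theta>" using eq unfolding equiv_def by blast
  fix f x y assume f: "pol1 A f" and "(x, y) \<in> ?\<theta>"
  then show "(f x, f y) \<in> ?\<theta>"
  proof (clarify, intro conjI ballI allI impI)
    assume xy: "(x, y) \<in> \<alpha>" "\<forall>r\<in>R. \<forall>f. pol1 A f \<longrightarrow> r (f x) = r (f y)"
    show "(f x, f y) \<in> \<alpha>" using congruence_pol1[OF assms f xy(1)] .
    fix r h assume "r \<in> R" "pol1 A h"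
    then show "r (h (f x)) = r (h (f y))"
      using mp[OF spec[OF bspec[OF xy(2)], of r "\<lambda>x. h (f x)"] pol1_comp[OF _ f]] by blast
  qed
qed

lemma separating_images_iff:
  assumes "congruence A \<alpha>"
  shows "V \<in> separating_images A \<alpha> \<longleftrightarrow>
    (\<exists>f. pol1 A f \<and> V = f ` univ A \<and> (\<exists>x y. (x, y) \<in> \<alpha> \<and> f x \<noteq> f y))"
proof
  assume "V \<in> separating_images A \<alpha>"
  then obtain p x y where "p \<in> polys A 1" "V = (\<lambda>x. p [x]) ` univ A" "(x, y) \<in> \<alpha>" "p [x] \<noteq> p [y]"
    unfolding separating_images_def by blast
  then show "\<exists>f. pol1 A f \<and> V = f ` univ A \<and> (\<exists>x y. (x, y) \<in> \<alpha> \<and> f x \<noteq> f y)"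
    using polys_pol[of p A 1] unfolding pol1_iff[of A p] by (intro exI[of _ "\<lambda>x. p [x]"]) auto
next
  assume "\<exists>f. pol1 A f \<and> V = f ` univ A \<and> (\<exists>x y. (x, y) \<in> \<alpha> \<and> f x \<noteq> f y)"
  then obtain f x y where f: "pol1 A f" "V = f ` univ A" "(x, y) \<in> \<alpha>" "f x \<noteq> f y" by blast
  let ?p = "restrict (\<lambda>xs. f (xs ! 0)) (tuples (univ A) 1)"
  have p: "?p [z] = f z" if "z \<in> univ A" for z using that by (simp add: tuples_one)
  have U: "x \<in> univ A" "y \<in> univ A" using assms f(3) by (auto simp: congruence_def)
  show "V \<in> separating_images A \<alpha>" unfolding separating_images_def
  proof (intro CollectI exI conjI bexI[OF _ f(3)])
    show "?p \<in> polys A 1" by (rule pol_polys[OF f(1)])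
    show "V = (\<lambda>x. ?p [x]) ` univ A" using f(2) p by (metis (no_types, lifting) image_cong)
    show "case (x, y) of (x, y) \<Rightarrow> ?p [x] \<noteq> ?p [y]" using f(4) p U by simp
  qed
qed

end

section \<open>Minimal sets of a minimal congruence\<close>

locale minimal_cong = finite_ualg +
  fixes \<alpha>
  assumes minimal: "minimal_congruence A \<alpha>"
begin

lemma cong: "congruence A \<alpha>"
  using minimal by (simp add: minimal_congruence_def)

lemma alpha_univ: "(x, y) \<in> \<alpha> \<Longrightarrow> x \<in> univ A \<and> y \<in> univ A"
  using cong by (auto simp: congruence_def)

lemma alpha_refl: "x \<in> univ A \<Longrightarrow> (x, x) \<in> \<alpha>"
  and alpha_sym: "(x, y) \<in> \<alpha> \<Longrightarrow> (y, x) \<in> \<alpha>"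
  and alpha_trans: "(x, y) \<in> \<alpha> \<Longrightarrow> (y, z) \<in> \<alpha> \<Longrightarrow> (x, z) \<in> \<alpha>"
  using cong by (auto simp: congruence_def equiv_def refl_on_def dest: symD transD)

lemma ex_pair: "\<exists>x y. (x, y) \<in> \<alpha> \<and> x \<noteq> y"
proof (rule ccontr)
  assume "\<nexists>x y. (x, y) \<in> \<alpha> \<and> x \<noteq> y"
  then have "\<alpha> = Id_on (univ A)" using alpha_refl alpha_univ unfolding Id_on_def by fast
  then show False using minimal by (simp add: minimal_congruence_def)
qed

text \<open>The pairs of \<alpha> that q cannot tell apart after any unary polynomial form a
  congruence below \<alpha>. It misses (x, y), so by minimality of \<alpha> it is equality. All
  later uses of minimality of the congruence go through this fact or its consequences for minimal
  sets.\<close>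

lemma separate:
  assumes "(x, y) \<in> \<alpha>" "q x \<noteq> q y" "(a, b) \<in> \<alpha>" "a \<noteq> b"
  obtains r where "pol1 A r" "q (r a) \<noteq> q (r b)"
proof -
  let ?\<theta> = "{(x, y) \<in> \<alpha>. \<forall>r\<in>{q}. \<forall>f. pol1 A f \<longrightarrow> r (f x) = r (f y)}"
  have \<theta>: "congruence A ?\<theta>" "?\<theta> \<subseteq> \<alpha>" using congruence_kernel[OF cong, of "{q}"] by auto
  have "(x, y) \<notin> ?\<theta>" using assms(2) pol1_id by auto
  then have ne: "?\<theta> \<noteq> \<alpha>" using assms(1) by blast
  have "\<forall>\<beta>. congruence A \<beta> \<and> \<beta> \<subseteq> \<alpha> \<longrightarrow> \<beta> = Id_on (univ A) \<or> \<beta> = \<alpha>"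
    using minimal unfolding minimal_congruence_def by blast
  from mp[OF spec[OF this] conjI[OF \<theta>]] ne have "?\<theta> = Id_on (univ A)" by satx
  then have "(a, b) \<notin> ?\<theta>" using assms(4) by auto
  then show ?thesis using that assms(3) by auto
qed

lemma minimal_set_obtain:
  assumes "minimal_set A \<alpha> U"
  obtains f x y where "pol1 A f" "U = f ` univ A" "(x, y) \<in> \<alpha>" "f x \<noteq> f y"
  using assms unfolding minimal_set_def separating_images_iff[OF cong] by blast

lemma minimal_setD:
  assumes "minimal_set A \<alpha> U" "pol1 A f" "f ` univ A \<subseteq> U" "(x, y) \<in> \<alpha>" "f x \<noteq> f y"
  shows "f ` univ A = U"
proof -
  have "f ` univ A \<in> separating_images A \<alpha>"
    unfolding separating_images_iff[OF cong] using assms by (intro exI[of _ f]) auto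
  then show ?thesis using assms(1,3) unfolding minimal_set_def by simp
qed

lemma minimal_set_sub: "minimal_set A \<alpha> U \<Longrightarrow> U \<subseteq> univ A"
  by (erule minimal_set_obtain) (auto intro: pol1_closed)

text \<open>Between polynomials p onto U and q onto V, \<open>separate\<close> inserts an r such
  that q o r o p still splits a pair of \<alpha>. By minimality of V the composite is onto V, so q o
  r maps U onto V. Doing this in both directions equalises the cardinalities and yields a
  bijection.\<close>

lemma minimal_set_map:
  assumes U: "minimal_set A \<alpha> U" and V: "minimal_set A \<alpha> V"
  obtains f where "pol1 A f" "f ` univ A \<subseteq> V" "bij_betw f U V"
proof -
  have ex: "\<exists>f. pol1 A f \<and> f ` univ A \<subseteq> V \<and> f ` U = V"
    if UV: "minimal_set A \<alpha> U" "minimal_set A \<alpha> V" for U V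
  proof -
    obtain p x y where p: "pol1 A p" "U = p ` univ A" "(x, y) \<in> \<alpha>" "p x \<noteq> p y"
      using minimal_set_obtain[OF UV(1)] .
    obtain q x' y' where q: "pol1 A q" "V = q ` univ A" "(x', y') \<in> \<alpha>" "q x' \<noteq> q y'"
      using minimal_set_obtain[OF UV(2)] .
    obtain r where r: "pol1 A r" "q (r (p x)) \<noteq> q (r (p y))"
      using separate[OF q(3,4) congruence_pol1[OF cong p(1,3)] p(4)] by blast
    have "(\<lambda>x. q (r (p x))) ` univ A = V"
    proof (rule minimal_setD[OF UV(2) _ _ p(3) r(2)])
      show "pol1 A (\<lambda>x. q (r (p x)))" by (rule pol1_comp[OF q(1) pol1_comp[OF r(1) p(1)]])
      show "(\<lambda>x. q (r (p x))) ` univ A \<subseteq> V" using q(2) pol1_closed[OF r(1)] pol1_closed[OF p(1)] by blast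
    qed
    then have "(\<lambda>x. q (r x)) ` U = V" unfolding p(2) by (simp add: image_image)
    moreover have "pol1 A (\<lambda>x. q (r x))" by (rule pol1_comp[OF q(1) r(1)])
    moreover have "(\<lambda>x. q (r x)) ` univ A \<subseteq> V" using q(2) pol1_closed[OF r(1)] by auto
    ultimately show ?thesis by (intro exI[of _ "\<lambda>x. q (r x)"] conjI)
  qed
  have fU: "finite U" "finite V" using minimal_set_sub U V fin finite_subset by metis+
  obtain f where f: "pol1 A f" "f ` univ A \<subseteq> V" "f ` U = V" using ex[OF U V] by blast
  obtain g where "g ` V = U" using ex[OF V U] by blast
  then have "card U \<le> card V" using fU(2) card_image_le by blast
  moreover have "card V \<le> card U" using f(3) fU(1) card_image_le by blast
  ultimately have "inj_on f U" using f(3) fU by (metis eq_card_imp_inj_on le_antisym)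
  then show ?thesis using that f by (auto simp: bij_betw_def)
qed

text \<open>The bijections obtained in the two directions need not be inverse to each other. But f o
  g permutes V, its inverse on V is a polynomial h, and g o h inverts f.\<close>

lemma minimal_set_iso:
  assumes U: "minimal_set A \<alpha> U" and V: "minimal_set A \<alpha> V"
  obtains f g where "pol1 A f" "pol1 A g" "\<And>x. x \<in> univ A \<Longrightarrow> f x \<in> V" "\<And>x. x \<in> univ A \<Longrightarrow> g x \<in> U"
    "\<And>x. x \<in> U \<Longrightarrow> g (f x) = x" "\<And>x. x \<in> V \<Longrightarrow> f (g x) = x"
proof -
  obtain f where f: "pol1 A f" "f ` univ A \<subseteq> V" "bij_betw f U V" using minimal_set_map[OF U V] .
  obtain g where g: "pol1 A g" "g ` univ A \<subseteq> U" "bij_betw g V U" using minimal_set_map[OF V U] .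
  have sub: "U \<subseteq> univ A" "V \<subseteq> univ A" using minimal_set_sub U V by auto
  have "bij_betw (\<lambda>x. f (g x)) V V" using bij_betw_trans[OF g(3) f(3)] by (simp add: comp_def)
  then obtain h where h: "pol1 A h" "\<And>x. x \<in> V \<Longrightarrow> h x \<in> V" "\<And>x. x \<in> V \<Longrightarrow> f (g (h x)) = x"
    using pol1_inverse[OF pol1_comp[OF f(1) g(1)] sub(2)] by metis
  show ?thesis
  proof (rule that[of f "\<lambda>x. g (h x)"])
    show "pol1 A (\<lambda>x. g (h x))" by (rule pol1_comp[OF g(1) h(1)])
    show "g (h x) \<in> U" if "x \<in> univ A" for x using g(2) pol1_closed[OF h(1) that] by blast
    show "g (h (f x)) = x" if "x \<in> U" for x
    proof -
      have fx: "f x \<in> V" using f(3) that by (auto simp: bij_betw_def)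
      then have "f (g (h (f x))) = f x" using h(3) by blast
      moreover have "g (h (f x)) \<in> U" using fx h(2) g(3) by (auto simp: bij_betw_def)
      ultimately show ?thesis using f(3) that by (metis bij_betw_imp_inj_on inj_onD)
    qed
  qed (use f h in auto)
qed

text \<open>The idempotent polynomial onto a minimal set: apply \<open>minimal_set_iso\<close> with
  both sets equal to U and compose the two maps.\<close>

lemma retraction:
  assumes "minimal_set A \<alpha> U"
  obtains e where "pol1 A e" "\<And>x. x \<in> univ A \<Longrightarrow> e x \<in> U" "\<And>x. x \<in> U \<Longrightarrow> e x = x"
proof -
  obtain f g where f: "pol1 A f" "pol1 A g" "\<And>x. x \<in> univ A \<Longrightarrow> f x \<in> U" "\<And>x. x \<in> univ A \<Longrightarrow> g x \<in> U"
    "\<And>x. x \<in> U \<Longrightarrow> g (f x) = x" "\<And>x. x \<in> U \<Longrightarrow> f (g x) = x"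
    by (rule minimal_set_iso[OF assms assms], rule that)
  show ?thesis
  proof (rule that[of "\<lambda>x. g (f x)"])
    show "pol1 A (\<lambda>x. g (f x))" by (rule pol1_comp[OF f(2,1)])
  qed (use f pol1_closed in blast)+
qed

lemma ex_minimal_set: "\<exists>U. minimal_set A \<alpha> U"
proof -
  have "separating_images A \<alpha> \<subseteq> Pow (univ A)"
    unfolding separating_images_iff[OF cong] subset_iff using pol1_closed by (auto simp: separating_images_iff[OF cong])
  then have "finite (separating_images A \<alpha>)" using fin by (meson finite_Pow_iff finite_subset)
  moreover have "univ A \<in> separating_images A \<alpha>"
    unfolding separating_images_iff[OF cong] using ex_pair pol1_id by (intro exI[of _ "\<lambda>x. x"]) auto
  ultimately obtain U where "U \<in> separating_images A \<alpha>" "\<forall>V\<in>separating_images A \<alpha>. V \<subseteq> U \<longrightarrow> V = U"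
    using finite_has_minimal[of "separating_images A \<alpha>"] by (metis empty_iff)
  then show ?thesis unfolding minimal_set_def by blast
qed

lemma trace_of_minimal_set:
  assumes "minimal_set A \<alpha> U"
  shows "\<exists>a\<in>U. card (\<alpha> `` {a} \<inter> U) \<ge> 2"
proof -
  obtain f x y where f: "pol1 A f" "U = f ` univ A" "(x, y) \<in> \<alpha>" "f x \<noteq> f y"
    using minimal_set_obtain[OF assms] .
  have U: "x \<in> univ A" "y \<in> univ A" using f(3) alpha_univ by auto
  have "(f x, f y) \<in> \<alpha>" using congruence_pol1[OF cong f(1,3)] .
  then have "{f x, f y} \<subseteq> \<alpha> `` {f x} \<inter> U"
    using f(2) U alpha_refl pol1_closed[OF f(1)] by auto
  moreover have "finite (\<alpha> `` {f x} \<inter> U)" using f(2) fin by simp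
  ultimately have "card {f x, f y} \<le> card (\<alpha> `` {f x} \<inter> U)" by (rule card_mono[rotated])
  then show ?thesis using f(2,4) U by (intro bexI[of _ "f x"]) auto
qed

end

section \<open>Polynomial isomorphism of subsets and invariance of the kind\<close>

context finite_ualg
begin

definition poly_iso :: "'a set \<Rightarrow> 'a set \<Rightarrow> bool" where
  "poly_iso N N' \<longleftrightarrow> N \<subseteq> univ A \<and> N' \<subseteq> univ A \<and> N \<noteq> {} \<and> N' \<noteq> {} \<and>
     (\<exists>f g. pol1 A f \<and> pol1 A g \<and> (\<forall>x\<in>N. f x \<in> N' \<and> g (f x) = x) \<and> (\<forall>x\<in>N'. g x \<in> N \<and> f (g x) = x))"

lemma poly_iso_sym: "poly_iso N N' \<Longrightarrow> poly_iso N' N"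
  unfolding poly_iso_def by blast

lemma pol_transport:
  assumes "pol (induced A N) n F" "N \<subseteq> univ A" "N' \<subseteq> univ A" "N \<noteq> {}" "N' \<noteq> {}" "pol1 A f" "pol1 A g"
    "\<And>x. x \<in> N \<Longrightarrow> f x \<in> N'" "\<And>x. x \<in> N' \<Longrightarrow> g x \<in> N"
  shows "pol (induced A N') n (\<lambda>xs. f (F (map g xs)))"
proof -
  obtain p where p: "pol A n p" "\<And>xs. xs \<in> tuples N n \<Longrightarrow> p xs \<in> N \<and> F xs = p xs"
    using assms(1) unfolding pol_induced[OF fin ualg assms(2,4)] by blast
  have "pol A n (\<lambda>xs. g (xs ! i))" if "i < n" for i
    by (rule pol_pol1[OF assms(7) pol_proj[OF fin that]])
  then have "pol A n (\<lambda>xs. p (map (\<lambda>i. g (xs ! i)) [0..<n]))"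
    by (rule pol_comp[OF fin p(1) _ ualg])
  then have "pol A n (\<lambda>xs. p (map g xs))"
  proof (rule pol_congI)
    fix xs assume "xs \<in> tuples (univ A) n"
    then have "map (\<lambda>i. g (xs ! i)) [0..<n] = map g xs"
      by (intro nth_equalityI) (auto simp: tuples_length)
    then show "p (map (\<lambda>i. g (xs ! i)) [0..<n]) = p (map g xs)" by (rule arg_cong)
  qed
  then have q: "pol A n (\<lambda>xs. f (p (map g xs)))" by (rule pol_pol1[OF assms(6)])
  have "map g xs \<in> tuples N n" if "xs \<in> tuples N' n" for xs
    using that assms(9) by (auto simp: tuples_def)
  then show ?thesis
    unfolding pol_induced[OF fin ualg assms(3,5)]
    by (intro exI[of _ "\<lambda>xs. f (p (map g xs))"] conjI q ballI) (use p(2) assms(8) in auto)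
qed

text \<open>Conjugation by the isomorphism carries each of the four defining properties across, and
  the relation is symmetric.\<close>

lemma kind_iso:
  assumes "poly_iso N N'"
  shows "kind (induced A N) = kind (induced A N')"
proof -
  have "(ess_unary (induced A N) \<longrightarrow> ess_unary (induced A N')) \<and>
    (term_condition (induced A N) \<longrightarrow> term_condition (induced A N')) \<and>
    (has_swap (induced A N) \<longrightarrow> has_swap (induced A N')) \<and>
    (lattice_like (induced A N) \<longrightarrow> lattice_like (induced A N'))" if iso: "poly_iso N N'" for N N'
  proof -
    obtain f g where N: "N \<subseteq> univ A" "N' \<subseteq> univ A" "N \<noteq> {}" "N' \<noteq> {}" and fg: "pol1 A f" "pol1 A g"
      "\<And>x. x \<in> N \<Longrightarrow> f x \<in> N'" "\<And>x. x \<in> N \<Longrightarrow> g (f x) = x" "\<And>x. x \<in> N' \<Longrightarrow> g x \<in> N" "\<And>x. x \<in> N' \<Longrightarrow> f (g x) = x"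
      using iso unfolding poly_iso_def by blast
    have fwd: "pol (induced A N') n (\<lambda>xs. f (F (map g xs)))" if "pol (induced A N) n F" for n F
      by (rule pol_transport[OF that N(1,2,3,4) fg(1,2,3,5)])
    have bwd: "pol (induced A N) n (\<lambda>xs. g (F (map f xs)))" if "pol (induced A N') n F" for n F
      by (rule pol_transport[OF that N(2,1,4,3) fg(2,1,5,3)])
    have recover: "F [x, y] = f (g (F (map f [g x, g y])))"
      if F: "pol (induced A N') 2 F" and xy: "x \<in> N'" "y \<in> N'" for F x y
    proof -
      have "F [x, y] \<in> N'"
        using pol_closed[OF _ F is_ualg_induced[OF N(4)], of "[x, y]"] xy N(2) fin
        by (auto simp: numeral_2_eq_2 tuples_two dest: finite_subset)
      then show ?thesis using fg xy by simp
    qed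
    have "ess_unary (induced A N')" if e: "ess_unary (induced A N)"
      unfolding ess_unary_def univ_induced
    proof (intro allI impI)
      fix F assume F: "pol (induced A N') 2 F"
      have "one_var N (\<lambda>xs. g (F (map f xs)))" using e bwd[OF F] by (auto simp: ess_unary_def)
      then show "one_var N' F" unfolding one_var_def using recover[OF F] fg(5) by metis
    qed
    moreover have "term_condition (induced A N')" if e: "term_condition (induced A N)"
      unfolding term_condition_def univ_induced
    proof (intro allI impI ballI)
      fix F x w y z assume F: "pol (induced A N') 2 F" and U: "x \<in> N'" "w \<in> N'" "y \<in> N'" "z \<in> N'"
        and eq: "F [x, y] = F [x, z]"
      have gU: "g x \<in> N" "g w \<in> N" "g y \<in> N" "g z \<in> N" using U fg(5) by auto
      have "g (F (map f [g w, g y])) = g (F (map f [g w, g z]))"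
        using e[unfolded term_condition_def univ_induced, rule_format, OF bwd[OF F] gU] eq U fg(6) by simp
      then show "F [w, y] = F [w, z]" using recover[OF F] U by metis
    qed
    moreover have "has_swap (induced A N')" if e: "has_swap (induced A N)"
    proof -
      obtain F x y where F: "pol (induced A N) 1 F" "x \<in> N" "y \<in> N" "x \<noteq> y" "F [x] = y" "F [y] = x"
        using e unfolding has_swap_def by auto
      have "f x \<noteq> f y" using F fg(4) by metis
      then show ?thesis unfolding has_swap_def univ_induced
        by (intro exI[of _ "\<lambda>xs. f (F (map g xs))"] conjI fwd[OF F(1)] bexI[of _ "f x"] bexI[of _ "f y"])
          (use F fg in auto)
    qed
    moreover have "lattice_like (induced A N')" if e: "lattice_like (induced A N)"
    proof -
      obtain u v where uv: "u \<in> N" "v \<in> N" "u \<noteq> v" "has_meet (induced A N) u v" "has_meet (induced A N) v u"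
        using e unfolding lattice_like_def by auto
      have m: "has_meet (induced A N') (f u) (f v)" if "has_meet (induced A N) u v" "u \<in> N" "v \<in> N" for u v
      proof -
        obtain F where F: "pol (induced A N) 2 F" "F [u, u] = u \<and> F [u, v] = u \<and> F [v, u] = u \<and> F [v, v] = v"
          using \<open>has_meet (induced A N) u v\<close> unfolding has_meet_def by blast
        show ?thesis unfolding has_meet_def
          by (intro exI[of _ "\<lambda>xs. f (F (map g xs))"] conjI fwd[OF F(1)]) (use F that fg in auto)
      qed
      have "f u \<noteq> f v" using uv fg(4) by metis
      then show ?thesis unfolding lattice_like_def univ_induced
        using m[OF uv(4,1,2)] m[OF uv(5,2,1)] uv fg(3) by blast
    qed
    ultimately show ?thesis by blast
  qed
  from this[OF assms] this[OF poly_iso_sym[OF assms]] show ?thesis unfolding kind_def by presburger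
qed

end

section \<open>Traces in a three-element algebra\<close>

locale three_minimal = minimal_cong +
  assumes three: "card (univ A) = 3"
begin

lemma two_classes_meet:
  assumes "M \<subseteq> univ A" "N \<subseteq> univ A" "card M \<ge> 2" "card N \<ge> 2"
  shows "M \<inter> N \<noteq> {}"
proof
  assume "M \<inter> N = {}"
  moreover have "finite M" "finite N" using assms fin finite_subset by auto
  ultimately have "card (M \<union> N) \<ge> 4" using assms by (simp add: card_Un_disjoint)
  moreover have "card (M \<union> N) \<le> 3" using card_mono[OF fin, of "M \<union> N"] assms three by simp
  ultimately show False by simp
qed

text \<open>Two sets of two elements meet in a universe of three, so both classes share an element.
  Hence a minimal set contains only one trace.\<close>

lemma trace_class:
  assumes "a \<in> univ A" "U \<subseteq> univ A" "card (\<alpha> `` {a} \<inter> U) \<ge> 2" "b \<in> univ A" "card (\<alpha> `` {b} \<inter> U) \<ge> 2"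
  shows "\<alpha> `` {a} = \<alpha> `` {b}"
proof -
  have "(\<alpha> `` {a} \<inter> U) \<inter> (\<alpha> `` {b} \<inter> U) \<noteq> {}"
    by (rule two_classes_meet) (use assms in auto)
  then obtain c where "(a, c) \<in> \<alpha>" "(b, c) \<in> \<alpha>" by blast
  then show ?thesis using alpha_sym alpha_trans by blast
qed

text \<open>The isomorphism of the minimal sets respects \<alpha>, so it maps N into one class of V.
  That class has at least two elements in V, and V has only one such class.\<close>

lemma trace_iso:
  assumes "trace A \<alpha> N" "trace A \<alpha> N'"
  shows "poly_iso N N'"
proof -
  obtain U a where U: "minimal_set A \<alpha> U" "a \<in> U" "N = \<alpha> `` {a} \<inter> U" "card N \<ge> 2"
    using assms(1) unfolding trace_def by blast
  obtain V b where V: "minimal_set A \<alpha> V" "b \<in> V" "N' = \<alpha> `` {b} \<inter> V" "card N' \<ge> 2"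
    using assms(2) unfolding trace_def by blast
  have sub: "U \<subseteq> univ A" "V \<subseteq> univ A" using minimal_set_sub U V by auto
  obtain f g where fg: "pol1 A f" "pol1 A g" "\<And>x. x \<in> univ A \<Longrightarrow> f x \<in> V" "\<And>x. x \<in> univ A \<Longrightarrow> g x \<in> U"
    "\<And>x. x \<in> U \<Longrightarrow> g (f x) = x" "\<And>x. x \<in> V \<Longrightarrow> f (g x) = x"
    by (rule minimal_set_iso[OF U(1) V(1)], rule that)
  have aU: "a \<in> univ A" "b \<in> univ A" using U V sub by auto
  have fN: "f x \<in> \<alpha> `` {f a} \<inter> V" if "x \<in> N" for x
    using that U sub fg congruence_pol1[OF cong fg(1)] by auto
  have "inj_on f N" using fg(5) U(3) by (metis IntE inj_onI)
  moreover have "f ` N \<subseteq> \<alpha> `` {f a} \<inter> V" using fN by blast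
  moreover have "finite (\<alpha> `` {f a} \<inter> V)" using sub fin finite_subset by blast
  ultimately have "card (\<alpha> `` {f a} \<inter> V) \<ge> 2" using U(4) by (metis card_image card_mono le_trans)
  then have "\<alpha> `` {f a} = \<alpha> `` {b}"
    by (rule trace_class[rotated 2]) (use V aU fg sub in auto)
  then have N': "N' = \<alpha> `` {f a} \<inter> V" using V(3) by simp
  have gN: "g x \<in> N" if "x \<in> N'" for x
  proof -
    have "(g (f a), g x) \<in> \<alpha>" using that N' congruence_pol1[OF cong fg(2)] by blast
    then show ?thesis using that N' U(2,3) fg(4,5) sub by auto
  qed
  have "N \<subseteq> univ A" "N' \<subseteq> univ A" "N \<noteq> {}" "N' \<noteq> {}" using U V sub by auto
  moreover have "\<forall>x\<in>N. f x \<in> N' \<and> g (f x) = x" "\<forall>x\<in>N'. g x \<in> N \<and> f (g x) = x"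
    using fN gN fg(5,6) N' U(3) by auto
  ultimately show ?thesis unfolding poly_iso_def
    by (intro conjI exI[of _ f] exI[of _ g] fg(1,2))
qed

lemma trace_facts:
  assumes "trace A \<alpha> N"
  obtains U a where "minimal_set A \<alpha> U" "a \<in> U" "N = \<alpha> `` {a} \<inter> U" "U \<subseteq> univ A" "N \<subseteq> univ A"
    "card N = 2 \<or> (card N = 3 \<and> N = univ A \<and> U = univ A)"
proof -
  obtain U a where U: "minimal_set A \<alpha> U" "a \<in> U" "N = \<alpha> `` {a} \<inter> U" "card N \<ge> 2"
    using assms(1) unfolding trace_def by blast
  have sub: "U \<subseteq> univ A" using minimal_set_sub U by auto
  then have N: "N \<subseteq> univ A" using U by auto
  then have "card N \<le> 3" using card_mono[OF fin] three by metis
  moreover have "N = univ A \<and> U = univ A" if "card N = 3"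
  proof -
    have "N = univ A" using N that three fin by (metis card_subset_eq)
    then show ?thesis using U(3) sub by auto
  qed
  ultimately have "card N = 2 \<or> (card N = 3 \<and> N = univ A \<and> U = univ A)" using U(4) by linarith
  then show ?thesis using that U sub N by blast
qed

text \<open>The existence half for the type. On two elements every non-constant unary map is a
  permutation. A trace of three elements is the whole universe and a minimal set, so its
  non-constant unary polynomials are onto.\<close>

lemma trace_classification:
  assumes "trace A \<alpha> N"
  shows "minimal_alg_type (induced A N) (kind (induced A N))"
proof -
  obtain U a where U: "minimal_set A \<alpha> U" "a \<in> U" "N = \<alpha> `` {a} \<inter> U" "N \<subseteq> univ A"
    "card N = 2 \<or> (card N = 3 \<and> N = univ A \<and> U = univ A)"
    using trace_facts[OF assms] by metis
  have ne: "N \<noteq> {}" using U(5) by auto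
  interpret I: finite_ualg "induced A N"
    by unfold_locales (use U ne fin finite_subset in \<open>auto intro: is_ualg_induced\<close>)
  from U(5) show ?thesis
  proof
    assume "card N = 2"
    then interpret two_element_ualg "induced A N" by unfold_locales simp
    show ?thesis by (rule classification_two)
  next
    assume N: "card N = 3 \<and> N = univ A \<and> U = univ A"
    have "I.min_unary" unfolding I.min_unary_def univ_induced
    proof (intro allI impI)
      fix f assume "pol1 (induced A N) f"
      then obtain p where p: "pol A 1 p" "\<And>xs. xs \<in> tuples N 1 \<Longrightarrow> p xs \<in> N \<and> f (xs ! 0) = p xs"
        unfolding pol_induced[OF fin ualg U(4) ne] by blast
      have f: "pol1 A f" by (rule pol_congI[OF p(1)]) (use p(2) N in auto)
      show "(\<forall>x\<in>N. \<forall>y\<in>N. f x = f y) \<or> bij_betw f N N"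
      proof (rule disjCI)
        assume *: "\<not> bij_betw f N N"
        show "\<forall>x\<in>N. \<forall>y\<in>N. f x = f y"
        proof (rule ccontr)
        assume "\<not> (\<forall>x\<in>N. \<forall>y\<in>N. f x = f y)"
        then obtain x y where xy: "x \<in> N" "y \<in> N" "f x \<noteq> f y" by blast
        then have "(x, y) \<in> \<alpha>" using U(3) alpha_sym alpha_trans by blast
        from minimal_setD[OF U(1) f _ this xy(3)] have im: "f ` N = N"
          using N pol1_closed[OF f] by auto
        moreover have "finite N" using N fin by simp
        ultimately have "bij_betw f N N"
          by (simp add: bij_betw_def eq_card_imp_inj_on)
        then show False using * by blast
        qed
      qed
    qed
    then show ?thesis using I.classification_three N three by simp
  qed
qed

lemma ex_trace: "\<exists>N. trace A \<alpha> N"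
proof -
  obtain U where U: "minimal_set A \<alpha> U" using ex_minimal_set by blast
  obtain a where "a \<in> U" "card (\<alpha> `` {a} \<inter> U) \<ge> 2" using trace_of_minimal_set[OF U] by blast
  then have "trace A \<alpha> (\<alpha> `` {a} \<inter> U)" unfolding trace_def using U by blast
  then show ?thesis ..
qed

text \<open>Resolves the definite description: existence comes from
  \<open>trace_classification\<close>, uniqueness from \<open>minimal_alg_type_kind\<close> together
  with the isomorphism of any two traces.\<close>

lemma tct_type_trace:
  assumes "trace A \<alpha> N"
  shows "tct_type A \<alpha> = kind (induced A N)"
  unfolding tct_type_def
proof (rule the_equality)
  show "\<exists>N'. trace A \<alpha> N' \<and> minimal_alg_type (induced A N') (kind (induced A N))"
    using assms trace_classification by blast
next
  fix i assume "\<exists>N. trace A \<alpha> N \<and> minimal_alg_type (induced A N) i"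
  then obtain N' where N': "trace A \<alpha> N'" "minimal_alg_type (induced A N') i" by blast
  have "card N' \<ge> 2" using N'(1) unfolding trace_def by blast
  then have "i = kind (induced A N')" using minimal_alg_type_kind[OF N'(2)] by simp
  then show "i = kind (induced A N)" using kind_iso[OF trace_iso[OF N'(1) assms]] by simp
qed

lemma tct_type_1_iff:
  assumes "trace A \<alpha> N"
  shows "tct_type A \<alpha> = 1 \<longleftrightarrow> ess_unary (induced A N)"
  unfolding tct_type_trace[OF assms] by (simp add: kind_def)

end

section \<open>Polynomial bounds\<close>

text \<open>The base n + 1 is at least 1, so larger exponents dominate even at n = 0. All polynomial
  bounds below have this monotone shape over the natural numbers.\<close>

lemma poly_le_power:
  fixes p :: "real poly"
  shows "\<exists>c k. \<forall>n. poly p (real n) \<le> real (c * (n + 1) ^ k)"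
proof (induction p)
  case 0
  then show ?case by (intro exI[of _ 0]) auto
next
  case (pCons a p)
  then obtain c k where ck: "\<And>n. poly p (real n) \<le> real (c * (n + 1) ^ k)" by blast
  obtain b :: nat where b: "\<bar>a\<bar> \<le> real b" using real_arch_simple by blast
  have "poly (pCons a p) (real n) \<le> real ((b + c) * (n + 1) ^ Suc k)" for n
  proof -
    have "a \<le> real b * 1" using b by simp
    also have "\<dots> \<le> real b * real ((n + 1) ^ Suc k)"
      by (intro mult_left_mono) (auto simp: one_le_power simp del: of_nat_power power_Suc)
    finally have 1: "a \<le> real (b * (n + 1) ^ Suc k)" by simp
    have "real n * poly p (real n) \<le> real n * real (c * (n + 1) ^ k)"
      using ck by (intro mult_left_mono) auto
    also have "\<dots> \<le> real (n + 1) * real (c * (n + 1) ^ k)"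
      by (intro mult_right_mono) auto
    also have "\<dots> = real (c * (n + 1) ^ Suc k)" by (simp only: power_Suc of_nat_mult mult_ac)
    finally have "real n * poly p (real n) \<le> real (c * (n + 1) ^ Suc k)" .
    with 1 show ?thesis by (simp add: algebra_simps)
  qed
  then show ?case by blast
qed

lemma poly_power_bound: "poly ([:real c:] * [:1, 1:] ^ k) (real n) = real (c * (n + 1) ^ k)"
  by (simp add: add.commute)

definition surj_bound :: "('f, 'a) ualg \<Rightarrow> (nat \<Rightarrow> nat) \<Rightarrow> bool" where
  "surj_bound C b \<longleftrightarrow> (\<forall>X :: ('f, nat) ualg. is_ualg X \<and> finite (univ X) \<and> same_signature X C \<longrightarrow>
     card (surj_homs X C) \<le> b (card (univ X)))"

lemma in_K_surj_iff:
  fixes C :: "('f, 'a) ualg"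
  shows "in_K_surj C \<longleftrightarrow> is_ualg C \<and> finite (univ C) \<and> (\<exists>c k. surj_bound C (\<lambda>n. c * (n + 1) ^ k))"
proof -
  have "(\<exists>p :: real poly. \<forall>X :: ('f, nat) ualg.
        is_ualg X \<and> finite (univ X) \<and> same_signature X C \<longrightarrow>
          real (card (surj_homs X C)) \<le> poly p (real (card (univ X)))) \<longleftrightarrow>
     (\<exists>c k. surj_bound C (\<lambda>n. c * (n + 1) ^ k))" (is "?L \<longleftrightarrow> ?R")
  proof
    assume ?L
    then obtain p :: "real poly" where p: "\<forall>X :: ('f, nat) ualg.
        is_ualg X \<and> finite (univ X) \<and> same_signature X C \<longrightarrow>
          real (card (surj_homs X C)) \<le> poly p (real (card (univ X)))" by blast
    obtain c k where "\<And>n. poly p (real n) \<le> real (c * (n + 1) ^ k)" using poly_le_power by blast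
    then have "surj_bound C (\<lambda>n. c * (n + 1) ^ k)"
      using p unfolding surj_bound_def by (meson of_nat_le_iff order_trans)
    then show ?R by blast
  next
    assume ?R
    then obtain c k where ck: "surj_bound C (\<lambda>n. c * (n + 1) ^ k)" by blast
    show ?L
    proof (intro exI[of _ "[:real c:] * [:1, 1:] ^ k"] allI impI)
      fix X :: "('f, nat) ualg" assume "is_ualg X \<and> finite (univ X) \<and> same_signature X C"
      then have "card (surj_homs X C) \<le> c * (card (univ X) + 1) ^ k"
        using ck unfolding surj_bound_def by blast
      then show "real (card (surj_homs X C)) \<le> poly ([:real c:] * [:1, 1:] ^ k) (real (card (univ X)))"
        unfolding poly_power_bound using of_nat_le_iff by blast
    qed
  qed
  then show ?thesis unfolding in_K_surj_def by blast
qed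

lemma finite_surj_homs:
  assumes "finite (univ X)" "finite (univ C)"
  shows "finite (surj_homs X C)"
proof (rule finite_subset)
  show "surj_homs X C \<subseteq> univ X \<rightarrow>\<^sub>E univ C" unfolding surj_homs_def homs_def by blast
qed (use assms in \<open>auto intro: finite_PiE\<close>)

text \<open>The bound quantifies over algebras on natural numbers, but the counterexample for type 1
  lives on a set of functions. Its structure is moved along a bijection with an initial
  segment.\<close>

lemma surj_bound_any:
  fixes X :: "('f, 'b) ualg"
  assumes "surj_bound C b" "finite (univ C)" "is_ualg X" "finite (univ X)" "same_signature X C"
  shows "card (surj_homs X C) \<le> b (card (univ X))"
proof -
  let ?m = "card (univ X)"
  obtain \<psi> where \<psi>: "bij_betw \<psi> {0..<?m} (univ X)" using ex_bij_betw_nat_finite[OF assms(4)] by blast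
  define \<phi> where "\<phi> = the_inv_into {0..<?m} \<psi>"
  have inj: "inj_on \<psi> {0..<?m}" and im: "\<psi> ` {0..<?m} = univ X" using \<psi> by (auto simp: bij_betw_def)
  have \<phi>: "\<phi> x \<in> {0..<?m}" "\<psi> (\<phi> x) = x" if "x \<in> univ X" for x
    using that im the_inv_into_into[OF inj _ subset_refl] f_the_inv_into_f[OF inj] by (auto simp: \<phi>_def)
  define Y where "Y = \<lparr>syms = syms X, arity = arity X, univ = {0..<?m},
     interp = (\<lambda>f xs. \<phi> (interp X f (map \<psi> xs)))\<rparr>"
  have tup: "map \<psi> xs \<in> tuples (univ X) k" if "xs \<in> tuples {0..<?m} k" for xs k
    using that im by (auto simp: tuples_def)
  have "is_ualg Y"
    unfolding is_ualg_def
  proof (intro conjI ballI)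
    show "univ Y \<noteq> {}" using assms(3,4) by (auto simp: is_ualg_def Y_def)
    fix f xs assume "f \<in> syms Y" "xs \<in> tuples (univ Y) (arity Y f)"
    then have "interp X f (map \<psi> xs) \<in> univ X" using assms(3) tup by (auto simp: is_ualg_def Y_def)
    then show "interp Y f xs \<in> univ Y" using \<phi> by (simp add: Y_def)
  qed
  moreover have "finite (univ Y)" "card (univ Y) = ?m" by (simp_all add: Y_def)
  moreover have "same_signature Y C" using assms(5) by (simp add: same_signature_def Y_def)
  ultimately have bnd: "card (surj_homs Y C) \<le> b ?m" using assms(1) unfolding surj_bound_def by metis
  let ?t = "\<lambda>h. restrict (\<lambda>i. h (\<psi> i)) {0..<?m}"
  have "inj_on ?t (surj_homs X C)"
  proof (rule inj_onI)
    fix h h' assume h: "h \<in> surj_homs X C" "h' \<in> surj_homs X C" and eq: "?t h = ?t h'"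
    have "h x = h' x" for x
    proof (cases "x \<in> univ X")
      case True
      then show ?thesis using fun_cong[OF eq, of "\<phi> x"] \<phi> by simp
    next
      case False
      then show ?thesis using h by (auto simp: surj_homs_def homs_def PiE_def extensional_def)
    qed
    then show "h = h'" by blast
  qed
  moreover have "?t ` surj_homs X C \<subseteq> surj_homs Y C"
  proof clarify
    fix h assume h: "h \<in> surj_homs X C"
    have 1: "?t h \<in> univ Y \<rightarrow>\<^sub>E univ C" using h im by (auto simp: surj_homs_def homs_def Y_def)
    have 2: "?t h ` univ Y = univ C"
    proof -
      have "?t h ` univ Y = h ` (\<psi> ` {0..<?m})" by (auto simp: Y_def)
      then show ?thesis using h im by (simp add: surj_homs_def)
    qed
    have 3: "?t h (interp Y f xs) = interp C f (map (?t h) xs)"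
      if "f \<in> syms Y" and xs: "xs \<in> tuples (univ Y) (arity Y f)" for f xs
    proof -
      have f: "f \<in> syms X" "map \<psi> xs \<in> tuples (univ X) (arity X f)" using that tup by (auto simp: Y_def)
      have iX: "interp X f (map \<psi> xs) \<in> univ X" using assms(3) f by (auto simp: is_ualg_def)
      have "?t h (interp Y f xs) = h (interp X f (map \<psi> xs))" using \<phi>[OF iX] by (simp add: Y_def)
      also have "\<dots> = interp C f (map h (map \<psi> xs))"
        using h f by (simp add: surj_homs_def homs_def del: map_map)
      also have "map h (map \<psi> xs) = map (?t h) xs"
        using xs by (auto simp: Y_def tuples_def)
      finally show ?thesis .
    qed
    show "?t h \<in> surj_homs Y C" using 1 2 3 unfolding surj_homs_def homs_def by blast
  qed
  moreover have "finite (surj_homs Y C)"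
    by (rule finite_surj_homs) (use assms(2) in \<open>auto simp: Y_def\<close>)
  ultimately have "card (surj_homs X C) \<le> card (surj_homs Y C)" by (rule card_inj_on_le)
  then show ?thesis using bnd by simp
qed

text \<open>The factor 27 is that of \<open>trace_power_card\<close>. For k = 2 ^ m the left side is
  at most 2 ^ (c + (5 + m) d), because 27 k + 1 is at most 2 ^ (5 + m). With m = 4 s this exponent
  is at most 4 s^2 + s, less than (2 s + 1)^2, which is at most 2 ^ m.\<close>

lemma power_beats_polynomial: "\<exists>k>0. c * (27 * k + 1) ^ d < (2::nat) ^ k"
proof -
  define s t where "s = c + 5 * d + d + 1" and "t = 2 * s"
  define m k where "m = 2 * t" and "k = (2::nat) ^ m"
  have "c * (27 * k + 1) ^ d \<le> 2 ^ c * (2 ^ (5 + m)) ^ d"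
  proof (rule mult_mono)
    show "c \<le> 2 ^ c" using less_exp[of c] by simp
    have "1 \<le> k" by (simp add: k_def)
    then have "27 * k + 1 \<le> 32 * k" by linarith
    also have "\<dots> = 2 ^ (5 + m)" by (simp add: k_def power_add)
    finally show "(27 * k + 1) ^ d \<le> (2 ^ (5 + m)) ^ d" by (rule power_mono) simp
  qed auto
  also have "\<dots> = 2 ^ (c + (5 + m) * d)" by (simp add: power_add power_mult)
  also have "\<dots> < 2 ^ k"
  proof (rule power_strict_increasing)
    have "c + (5 + m) * d \<le> s * (m + 1)" by (simp add: s_def algebra_simps)
    also have "\<dots> < (t + 1) * (t + 1)" by (simp add: m_def t_def algebra_simps)
    also have "\<dots> \<le> 2 ^ t * 2 ^ t" using Suc_leI[OF less_exp[of t]] by (intro mult_mono) auto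
    also have "\<dots> = k" by (simp add: k_def m_def flip: power_add mult_2)
    finally show "c + (5 + m) * d < k" .
  qed simp
  finally show ?thesis by (intro exI[of _ k]) (simp add: k_def)
qed

section \<open>Type 1 gives exponentially many homomorphisms\<close>

context three_minimal
begin

text \<open>The values of p may leave N, so the hypothesis does not apply to p itself. But every
  difference of values is seen by some polynomial into N, and after it p depends on at most one
  variable. If p depended on both, one such polynomial u would see x against x' whatever the second
  argument, another one v would see w against w' whatever the first, and together they would tell
  four elements of A apart.\<close>

lemma pol2_one_var_on_trace:
  assumes tr: "trace A \<alpha> N" and ess: "ess_unary (induced A N)" and p: "pol2 A p"
  shows "one_var N (\<lambda>xs. p (xs ! 0) (xs ! 1))"
proof (rule ccontr)
  assume n: "\<not> one_var N (\<lambda>xs. p (xs ! 0) (xs ! 1))"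
  obtain U a where U: "minimal_set A \<alpha> U" "a \<in> U" "N = \<alpha> `` {a} \<inter> U" "U \<subseteq> univ A" "N \<subseteq> univ A"
    "card N = 2 \<or> (card N = 3 \<and> N = univ A \<and> U = univ A)" using trace_facts[OF tr] .
  have ne: "N \<noteq> {}" using U(6) by auto
  have c2: "card N \<ge> 2" using U(6) by auto
  obtain e where e: "pol1 A e" "\<And>x. x \<in> univ A \<Longrightarrow> e x \<in> U" "\<And>x. x \<in> U \<Longrightarrow> e x = x"
    by (rule retraction[OF U(1)], rule that)
  have Nrel: "(x, y) \<in> \<alpha>" if "x \<in> N" "y \<in> N" for x y
    using that U(3) alpha_sym alpha_trans by blast
  obtain b b' where b: "b \<in> N" "b' \<in> N" "b \<noteq> b'"
    using c2 by (metis One_nat_def card_le_Suc0_iff_eq card.infinite not_less_eq_eq numeral_2_eq_2 zero_le)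
  have eb: "e b \<noteq> e b'" using e(3) b U(3) by auto
  have prel: "(p x y, p x' y') \<in> \<alpha>" if "x \<in> N" "y \<in> N" "x' \<in> N" "y' \<in> N" for x y x' y'
    by (rule congruence_pol2[OF cong p]) (use that Nrel in auto)
  have sep: "\<exists>u :: 'b \<Rightarrow> 'b. u (p x y) \<noteq> u (p x' y') \<and> one_var N (\<lambda>xs. u (p (xs ! 0) (xs ! 1)))"
    if xy: "x \<in> N" "y \<in> N" "x' \<in> N" "y' \<in> N" "p x y \<noteq> p x' y'" for x y x' y'
  proof -
    obtain r where r: "pol1 A r" "e (r (p x y)) \<noteq> e (r (p x' y'))"
      by (rule separate[OF Nrel[OF b(1,2)] eb prel[OF xy(1-4)] xy(5)], rule that)
    \<comment> \<open>The map r keeps the two values apart for the retraction e onto U. The images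
      then give a class with two elements in U, which can only be N.\<close>
    define u where "u z = e (r z)" for z
    have u: "pol1 A u" unfolding u_def by (rule pol1_comp[OF e(1) r(1)])
    have uU: "u z \<in> U" if "z \<in> univ A" for z using e(2) pol1_closed[OF r(1) that] by (simp add: u_def)
    have pU: "p s t \<in> univ A" if "s \<in> N" "t \<in> N" for s t using that U(5) pol2_closed[OF p] by blast
    have urel: "(u (p x y), u (p s t)) \<in> \<alpha>" if "s \<in> N" "t \<in> N" for s t
      by (rule congruence_pol1[OF cong u]) (use prel xy that in auto)
    have "{u (p x y), u (p x' y')} \<subseteq> \<alpha> `` {u (p x y)} \<inter> U"
      using urel xy uU pU by auto
    moreover have "card {u (p x y), u (p x' y')} = 2" using r(2) by (simp add: u_def)
    moreover have "finite (\<alpha> `` {u (p x y)} \<inter> U)" using U(4) fin finite_subset by blast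
    ultimately have "card (\<alpha> `` {u (p x y)} \<inter> U) \<ge> 2" by (metis card_mono)
    then have cl: "\<alpha> `` {u (p x y)} = \<alpha> `` {a}"
      by (rule trace_class[rotated 2]) (use U uU pU xy c2 in auto)
    have uN: "u (p s t) \<in> N" if "s \<in> N" "t \<in> N" for s t
      using urel[OF that] uU[OF pU[OF that]] cl U(3) by blast
    have "pol2 A (\<lambda>s t. u (p s t))" by (rule pol_pol1[OF u p])
    then have "pol (induced A N) 2 (\<lambda>xs. u (p (xs ! 0) (xs ! 1)))"
      unfolding pol_induced[OF fin ualg U(5) ne]
      by (intro exI[of _ "\<lambda>xs. u (p (xs ! 0) (xs ! 1))"] conjI ballI)
        (use uN tuples_nth[of _ N 2 0] tuples_nth[of _ N 2 1] in auto)
    then have "one_var N (\<lambda>xs. u (p (xs ! 0) (xs ! 1)))" using ess by (simp add: ess_unary_def)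
    then show ?thesis using r(2) by (intro exI[of _ u]) (simp add: u_def)
  qed
  obtain x x' y where x: "x \<in> N" "x' \<in> N" "y \<in> N" "p x y \<noteq> p x' y"
    using n unfolding one_var_def by auto
  obtain z w w' where z: "z \<in> N" "w \<in> N" "w' \<in> N" "p z w \<noteq> p z w'"
    using n unfolding one_var_def by auto
  obtain u :: "'b \<Rightarrow> 'b" where u: "u (p x y) \<noteq> u (p x' y)" "one_var N (\<lambda>xs. u (p (xs ! 0) (xs ! 1)))"
    using sep[OF x(1,3,2,3,4)] by blast
  obtain v :: "'b \<Rightarrow> 'b" where v: "v (p z w) \<noteq> v (p z w')" "one_var N (\<lambda>xs. v (p (xs ! 0) (xs ! 1)))"
    using sep[OF z(1,2,1,3,4)] by blast
  have u': "u (p s t) = u (p s t')" if "s \<in> N" "t \<in> N" "t' \<in> N" for s t t'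
    using u x that unfolding one_var_def by auto
  have v': "v (p s t) = v (p s' t)" if "s \<in> N" "s' \<in> N" "t \<in> N" for s s' t
    using v z that unfolding one_var_def by auto
  have ud: "u (p x t) \<noteq> u (p x' t')" if "t \<in> N" "t' \<in> N" for t t'
    using u(1) u' x that by metis
  have vd: "v (p s w) \<noteq> v (p s' w')" if "s \<in> N" "s' \<in> N" for s s'
    using v(1) v' z that by metis
  let ?S = "{p x w, p x' w, p x w', p x' w'}"
  have "p x w \<noteq> p x' w" "p x w \<noteq> p x' w'" "p x w' \<noteq> p x' w" "p x w' \<noteq> p x' w'"
    "p x w \<noteq> p x w'" "p x' w \<noteq> p x' w'"
    using ud z vd x by metis+
  then have "card ?S = 4" by auto
  moreover have "?S \<subseteq> univ A" using x z U(5) pol2_closed[OF p] by auto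
  ultimately show False using card_mono[OF fin, of ?S] three by simp
qed

text \<open>The \<open>k\<close>-ary polynomial operations restricted to a trace \<open>N\<close>; evaluation at the points of
  \<open>N\<^sup>k\<close> gives its surjective homomorphisms.\<close>

definition trace_power :: "'b set \<Rightarrow> nat \<Rightarrow> ('a, 'b list \<Rightarrow> 'b) ualg" where
  "trace_power N k = \<lparr>syms = syms A, arity = arity A,
     univ = {restrict F (tuples N k) | F. pol A k F},
     interp = (\<lambda>f Fs. restrict (\<lambda>xs. interp A f (map (\<lambda>F. F xs) Fs)) (tuples N k))\<rparr>"

lemma is_ualg_trace_power: "is_ualg (trace_power N k)"
  unfolding is_ualg_def
proof (intro conjI ballI)
  obtain z where "z \<in> univ A" using ualg by (auto simp: is_ualg_def)
  then show "univ (trace_power N k) \<noteq> {}" using pol_const[OF fin] by (auto simp: trace_power_def)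
next
  fix f Fs assume f: "f \<in> syms (trace_power N k)"
    and Fs: "Fs \<in> tuples (univ (trace_power N k)) (arity (trace_power N k) f)"
  have "\<exists>G. pol A k G \<and> Fs ! i = restrict G (tuples N k)" if "i < arity A f" for i
    using tuples_nth[OF Fs] that by (auto simp: trace_power_def)
  then obtain G where G: "\<And>i. i < arity A f \<Longrightarrow> pol A k (G i) \<and> Fs ! i = restrict (G i) (tuples N k)"
    by metis
  have "pol A k (\<lambda>xs. interp A f (map (\<lambda>i. G i xs) [0..<arity A f]))"
    by (rule pol_app[OF fin]) (use f G in \<open>auto simp: trace_power_def\<close>)
  moreover have "interp (trace_power N k) f Fs = restrict (\<lambda>xs. interp A f (map (\<lambda>i. G i xs) [0..<arity A f])) (tuples N k)"
  proof -
    have "map (\<lambda>F. F xs) Fs = map (\<lambda>i. G i xs) [0..<arity A f]" if "xs \<in> tuples N k" for xs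
      by (rule nth_equalityI) (use tuples_length[OF Fs] G that in \<open>auto simp: trace_power_def\<close>)
    then show ?thesis unfolding trace_power_def by (auto intro!: restrict_ext arg_cong[where f = "interp A f"])
  qed
  ultimately show "interp (trace_power N k) f Fs \<in> univ (trace_power N k)"
    by (auto simp: trace_power_def)
qed

text \<open>A restricted polynomial is given by the coordinate it reads and a map from N to A; there
  are k coordinates and at most 3^3 maps.\<close>

lemma trace_power_card:
  assumes tr: "trace A \<alpha> N" and ess: "ess_unary (induced A N)" and k: "k > 0"
  shows "finite (univ (trace_power N k))" "card (univ (trace_power N k)) \<le> 27 * k"
proof -
  have NU: "N \<subseteq> univ A" and c2: "card N \<le> 3" using trace_facts[OF tr] three by (metis card_mono fin)+
  have finN: "finite N" using NU fin finite_subset by blast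
  have U3: "univ A \<noteq> {}" using three by auto
  let ?S = "\<Union>i<k. (\<lambda>g. restrict (\<lambda>xs. g (xs ! i)) (tuples N k)) ` (N \<rightarrow>\<^sub>E univ A)"
  have sub: "univ (trace_power N k) \<subseteq> ?S"
  proof
    fix R assume "R \<in> univ (trace_power N k)"
    then obtain F where F: "pol A k F" "R = restrict F (tuples N k)" by (auto simp: trace_power_def)
    have "one_var N (\<lambda>xs. F (zs[i := xs ! 0, j := xs ! 1]))" if zs: "zs \<in> tuples N k" for zs i j
    proof -
      have "pol2 A (\<lambda>x y. F (zs[i := x, j := y]))"
        by (rule pol_update2[OF fin F(1) ualg tuples_mono[OF NU zs]]) (auto intro: pol_proj[OF fin])
      then show ?thesis by (rule pol2_one_var_on_trace[OF tr ess])
    qed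
    then consider c where "\<forall>xs\<in>tuples N k. F xs = c" |
      i zs where "i < k" "zs \<in> tuples N k" "\<forall>xs\<in>tuples N k. F xs = F (zs[i := xs ! i])"
      using essentially_unary[of N k F] by blast
    then have "\<exists>i<k. \<exists>g. \<forall>xs\<in>tuples N k. F xs = g (xs ! i)"
    proof cases
      case 1
      \<comment> \<open>A constant is booked under coordinate 0, which exists because k is
        positive.\<close>
      then show ?thesis using k by (intro exI[of _ 0] conjI exI[of _ "\<lambda>_. c"]) auto
    next
      case 2
      then show ?thesis by (intro exI[of _ i] conjI exI[of _ "\<lambda>x. F (zs[i := x])"]) auto
    qed
    then obtain i g where i: "i < k" and g: "\<And>xs. xs \<in> tuples N k \<Longrightarrow> F xs = g (xs ! i)" by blast
    have "g x \<in> univ A" if "x \<in> N" for x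
      using pol_closed[OF fin F(1) ualg tuples_mono[OF NU tuples_replicate[OF that]]]
        g[OF tuples_replicate[OF that]] i by simp
    then have "restrict g N \<in> N \<rightarrow>\<^sub>E univ A" by auto
    moreover have "R = restrict (\<lambda>xs. restrict g N (xs ! i)) (tuples N k)"
      unfolding F(2) using g i by (intro restrict_ext) (auto simp: tuples_nth)
    ultimately show "R \<in> ?S" using i by blast
  qed
  have finS: "finite ?S" using finN fin by (intro finite_UN_I finite_imageI finite_PiE) auto
  then show "finite (univ (trace_power N k))" using sub finite_subset by blast
  have "card (univ (trace_power N k)) \<le> card ?S" using sub finS by (rule card_mono[rotated])
  also have "\<dots> \<le> (\<Sum>i<k. card ((\<lambda>g. restrict (\<lambda>xs. g (xs ! i)) (tuples N k)) ` (N \<rightarrow>\<^sub>E univ A)))"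
    by (rule card_UN_le) simp
  also have "\<dots> \<le> (\<Sum>i<k. 27)"
  proof (rule sum_mono)
    fix i
    have "card ((\<lambda>g. restrict (\<lambda>xs. g (xs ! i)) (tuples N k)) ` (N \<rightarrow>\<^sub>E univ A)) \<le> card (N \<rightarrow>\<^sub>E univ A)"
      using finN fin by (intro card_image_le finite_PiE) auto
    also have "\<dots> = 3 ^ card N" using finN three by (simp add: card_PiE)
    also have "\<dots> \<le> 3 ^ 3" using c2 by (intro power_increasing) auto
    finally show "card ((\<lambda>g. restrict (\<lambda>xs. g (xs ! i)) (tuples N k)) ` (N \<rightarrow>\<^sub>E univ A)) \<le> 27" by simp
  qed
  finally show "card (univ (trace_power N k)) \<le> 27 * k" by simp
qed

text \<open>Constant polynomials make each evaluation onto, and projections make evaluations at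
  different points different. There are card N ^ k points.\<close>

lemma trace_power_homs:
  assumes tr: "trace A \<alpha> N" and ess: "ess_unary (induced A N)" and k: "k > 0"
  shows "2 ^ k \<le> card (surj_homs (trace_power N k) A)"
proof -
  have NU: "N \<subseteq> univ A" using trace_facts[OF tr] by metis
  have c2: "card N \<ge> 2" using tr unfolding trace_def by blast
  have finN: "finite N" using NU fin finite_subset by blast
  let ?X = "trace_power N k"
  let ?ev = "\<lambda>z. restrict (\<lambda>F. F z) (univ ?X)"
  have mem: "restrict F (tuples N k) \<in> univ ?X" if "pol A k F" for F
    using that by (auto simp: trace_power_def)
  have "?ev z \<in> surj_homs ?X A" if z: "z \<in> tuples N k" for z
  proof -
    have val: "R z \<in> univ A" if "R \<in> univ ?X" for R
      using that z pol_closed[OF fin _ ualg tuples_mono[OF NU z]] by (auto simp: trace_power_def)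
    have 1: "?ev z \<in> univ ?X \<rightarrow>\<^sub>E univ A" using val by auto
    have 2: "?ev z ` univ ?X = univ A"
    proof
      show "?ev z ` univ ?X \<subseteq> univ A" using val by auto
      show "univ A \<subseteq> ?ev z ` univ ?X"
      proof
        fix c assume "c \<in> univ A"
        from mem[OF pol_const[OF fin this]] z show "c \<in> ?ev z ` univ ?X"
          by (intro image_eqI[of _ _ "restrict (\<lambda>_. c) (tuples N k)"]) auto
      qed
    qed
    have 3: "?ev z (interp ?X f Fs) = interp A f (map (?ev z) Fs)"
      if f: "f \<in> syms ?X" and Fs: "Fs \<in> tuples (univ ?X) (arity ?X f)" for f Fs
    proof -
      have "interp ?X f Fs \<in> univ ?X" using is_ualg_trace_power f Fs unfolding is_ualg_def by blast
      then have "?ev z (interp ?X f Fs) = interp A f (map (\<lambda>F. F z) Fs)"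
        using z by (simp add: trace_power_def)
      moreover have "map (\<lambda>F. F z) Fs = map (?ev z) Fs" using Fs by (auto simp: tuples_def)
      ultimately show ?thesis by metis
    qed
    show ?thesis using 1 2 3 unfolding surj_homs_def homs_def by blast
  qed
  then have sub: "?ev ` tuples N k \<subseteq> surj_homs ?X A" by blast
  have inj: "inj_on ?ev (tuples N k)"
  proof (rule inj_onI)
    fix z z' assume z: "z \<in> tuples N k" "z' \<in> tuples N k" and eq: "?ev z = ?ev z'"
    show "z = z'"
    proof (rule nth_equalityI)
      fix i assume "i < length z"
      then have "i < k" using z by (simp add: tuples_length)
      from mem[OF pol_proj[OF fin this]] fun_cong[OF eq, of "restrict (\<lambda>xs. xs ! i) (tuples N k)"]
      show "z ! i = z' ! i" using z by simp
    qed (use z in \<open>simp add: tuples_length\<close>)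
  qed
  have "(2::nat) ^ k \<le> card N ^ k" using c2 by (rule power_mono) simp
  also have "\<dots> = card (tuples N k)"
    using card_lists_length_eq[OF finN, of k] by (simp add: tuples_def conj_commute)
  also have "\<dots> \<le> card (surj_homs ?X A)"
    by (rule card_inj_on_le[OF inj sub finite_surj_homs[OF trace_power_card(1)[OF tr ess k] fin]])
  finally show ?thesis .
qed

theorem type_1_not_in_K_surj:
  assumes "tct_type A \<alpha> = 1"
  shows "\<not> in_K_surj A"
proof
  assume "in_K_surj A"
  then obtain c d where b: "surj_bound A (\<lambda>n. c * (n + 1) ^ d)" unfolding in_K_surj_iff by blast
  obtain N where tr: "trace A \<alpha> N" using ex_trace by blast
  then have ess: "ess_unary (induced A N)" using assms tct_type_1_iff by blast
  obtain k where k: "k > 0" "c * (27 * k + 1) ^ d < 2 ^ k" using power_beats_polynomial by blast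
  have "2 ^ k \<le> card (surj_homs (trace_power N k) A)" by (rule trace_power_homs[OF tr ess k(1)])
  also have "\<dots> \<le> c * (card (univ (trace_power N k)) + 1) ^ d"
    by (rule surj_bound_any[OF b fin is_ualg_trace_power trace_power_card(1)[OF tr ess k(1)]])
      (simp add: same_signature_def trace_power_def)
  also have "\<dots> \<le> c * (27 * k + 1) ^ d"
    using trace_power_card(2)[OF tr ess k(1)] by (intro mult_left_mono power_mono) auto
  finally show False using k(2) by simp
qed

end

section \<open>Counting homomorphisms\<close>

lemma card_image_le_key:
  assumes "\<And>h h'. h \<in> H \<Longrightarrow> h' \<in> H \<Longrightarrow> k h = k h' \<Longrightarrow> r h = r h'" "k ` H \<subseteq> S" "finite S"
  shows "card (r ` H) \<le> card S"
proof -
  have "r h = r (inv_into H k (k h))" if "h \<in> H" for h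
    using assms(1)[OF that, of "inv_into H k (k h)"] that by (simp add: f_inv_into_f inv_into_into)
  then have "r ` H = (\<lambda>s. r (inv_into H k s)) ` (k ` H)" by (force simp: image_image)
  then have "card (r ` H) \<le> card (k ` H)" using card_image_le assms(2,3) finite_subset by metis
  also have "\<dots> \<le> card S" using assms card_mono by blast
  finally show ?thesis .
qed

lemma card_le_fibers:
  assumes "finite H" "card (k ` H) \<le> a" "\<And>h. h \<in> H \<Longrightarrow> card {h' \<in> H. k h' = k h} \<le> b"
  shows "card H \<le> a * b"
proof -
  have "H = (\<Union>\<kappa>\<in>k ` H. {h \<in> H. k h = \<kappa>})" by auto
  then have "card H \<le> (\<Sum>\<kappa>\<in>k ` H. card {h \<in> H. k h = \<kappa>})"
    using card_UN_le[of "k ` H" "\<lambda>\<kappa>. {h \<in> H. k h = \<kappa>}"] assms(1) by simp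
  also have "\<dots> \<le> card (k ` H) * b"
    using sum_bounded_above[of "k ` H" "\<lambda>\<kappa>. card {h \<in> H. k h = \<kappa>}" b] assms(3) by auto
  also have "\<dots> \<le> a * b" using assms(2) by simp
  finally show ?thesis .
qed

text \<open>A homomorphism is determined by the set it sends to \<open>e\<close>. If nonempty, this
  finite filter is principal in effect: a product \<open>m\<close> of its members goes to
  \<open>e\<close> exactly under those maps that send the whole filter there. So \<open>m\<close>
  recovers the filter, and the extra 1 counts the empty one.\<close>

lemma count_semilattice:
  assumes "finite Y" and cl: "\<And>x y. x \<in> Y \<Longrightarrow> y \<in> Y \<Longrightarrow> G x y \<in> Y"
    and val: "\<And>h y. h \<in> H \<Longrightarrow> y \<in> Y \<Longrightarrow> h y = e \<or> h y = d"
    and hom: "\<And>h x y. h \<in> H \<Longrightarrow> x \<in> Y \<Longrightarrow> y \<in> Y \<Longrightarrow> h (G x y) = e \<longleftrightarrow> h x = e \<and> h y = e"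
  shows "card ((\<lambda>h. restrict h Y) ` H) \<le> card Y + 1"
proof -
  have ex: "\<exists>m\<in>Y. \<forall>h\<in>H. h m = e \<longleftrightarrow> (\<forall>y\<in>F. h y = e)" if "finite F" "F \<noteq> {}" "F \<subseteq> Y" for F
    using that
  proof (induction rule: finite_ne_induct)
    case (singleton x)
    then show ?case by auto
  next
    case (insert x F)
    then obtain m where m: "m \<in> Y" "\<forall>h\<in>H. h m = e \<longleftrightarrow> (\<forall>y\<in>F. h y = e)" by auto
    then show ?case using insert.prems cl hom by (intro bexI[of _ "G x m"]) auto
  qed
  have "\<exists>m. \<forall>h\<in>H. (\<exists>y\<in>Y. h y = e) \<longrightarrow> m h \<in> Y \<and> (\<forall>h'\<in>H. h' (m h) = e \<longleftrightarrow> (\<forall>y\<in>Y. h y = e \<longrightarrow> h' y = e))"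
  proof (rule bchoice, rule ballI)
    fix h
    show "\<exists>m. (\<exists>y\<in>Y. h y = e) \<longrightarrow> m \<in> Y \<and> (\<forall>h'\<in>H. h' m = e \<longleftrightarrow> (\<forall>y\<in>Y. h y = e \<longrightarrow> h' y = e))"
    proof (cases "\<exists>y\<in>Y. h y = e")
      case True
      then have "\<exists>m\<in>Y. \<forall>h'\<in>H. h' m = e \<longleftrightarrow> (\<forall>y\<in>{y \<in> Y. h y = e}. h' y = e)"
        by (intro ex) (use assms(1) in auto)
      then show ?thesis by fastforce
    qed simp
  qed
  then obtain m where m: "\<And>h. h \<in> H \<Longrightarrow> \<exists>y\<in>Y. h y = e \<Longrightarrow> m h \<in> Y"
    "\<And>h h'. h \<in> H \<Longrightarrow> \<exists>y\<in>Y. h y = e \<Longrightarrow> h' \<in> H \<Longrightarrow> h' (m h) = e \<longleftrightarrow> (\<forall>y\<in>Y. h y = e \<longrightarrow> h' y = e)" by blast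
  let ?k = "\<lambda>h. if \<exists>y\<in>Y. h y = e then Some (m h) else None"
  have "card ((\<lambda>h. restrict h Y) ` H) \<le> card (insert None (Some ` Y))"
  proof (rule card_image_le_key[where k = ?k])
    fix h h' assume h: "h \<in> H" "h' \<in> H" and k: "?k h = ?k h'"
    have "h y = e \<longleftrightarrow> h' y = e" if "y \<in> Y" for y
    proof (cases "\<exists>y\<in>Y. h y = e")
      case True
      then have h': "\<exists>y\<in>Y. h' y = e" and mm: "m h = m h'" using k by (auto split: if_splits)
      have "h (m h) = e" "h' (m h') = e" using m(2)[OF h(1) True h(1)] m(2)[OF h(2) h' h(2)] by auto
      then have "\<forall>y\<in>Y. h y = e \<longrightarrow> h' y = e" "\<forall>y\<in>Y. h' y = e \<longrightarrow> h y = e"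
        using m(2)[OF h(1) True h(2)] m(2)[OF h(2) h' h(1)] mm by auto
      then show ?thesis using that by blast
    next
      case False
      then show ?thesis using k that by (auto split: if_splits)
    qed
    then have "h y = h' y" if "y \<in> Y" for y using val[OF h(1) that] val[OF h(2) that] that by metis
    then show "restrict h Y = restrict h' Y" by (intro restrict_ext) auto
  next
    show "?k ` H \<subseteq> insert None (Some ` Y)" using m(1) by auto
  qed (use assms in simp)
  also have "\<dots> \<le> card Y + 1"
    using card_insert_le_m1[of "card Y + 1" "Some ` Y" None] card_image[of Some Y] by simp
  finally show ?thesis .
qed

text \<open>A maximal set \<open>I\<close> whose subset sums are pairwise distinct under \<open>H\<close> has at most \<open>log\<close>-many
  elements and determines every element of \<open>H\<close>.\<close>

lemma count_group:
  fixes H :: "('x \<Rightarrow> nat) set"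
  assumes fin: "finite Y" and q: "q \<le> 4" and y0: "y0 \<in> Y" "\<And>h. h \<in> H \<Longrightarrow> h y0 = 0"
    and cl: "\<And>x y. x \<in> Y \<Longrightarrow> y \<in> Y \<Longrightarrow> G x y \<in> Y"
    and val: "\<And>h y. h \<in> H \<Longrightarrow> y \<in> Y \<Longrightarrow> h y < q"
    and hom: "\<And>h x y. h \<in> H \<Longrightarrow> x \<in> Y \<Longrightarrow> y \<in> Y \<Longrightarrow> h (G x y) = (h x + h y) mod q"
  shows "card ((\<lambda>h. restrict h Y) ` H) \<le> card Y ^ 2"
proof (cases "H = {}")
  case False
  then have q0: "0 < q" using val y0 by (metis bot.not_eq_extremum bot_nat_def equals0I less_nat_zero_code)
  have ex: "\<exists>m\<in>Y. \<forall>h\<in>H. h m = sum h J mod q" if "J \<subseteq> Y" for J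
  proof -
    have "finite J" using that fin finite_subset by blast
    then show ?thesis using that
    proof (induction rule: finite_induct)
      case empty
      then show ?case using y0 by (intro bexI[of _ y0]) auto
    next
      case (insert x J)
      then obtain m where m: "m \<in> Y" "\<forall>h\<in>H. h m = sum h J mod q" by auto
      have x: "x \<in> Y" using insert.prems by simp
      have "h (G x m) = sum h (insert x J) mod q" if "h \<in> H" for h
        using hom[OF that x m(1)] bspec[OF m(2) that] insert.hyps by (simp add: mod_add_right_eq)
      then show ?case using cl[OF x m(1)] by (intro bexI[of _ "G x m"]) auto
    qed
  qed
  define indep where "indep I \<longleftrightarrow> I \<subseteq> Y \<and> (\<forall>J J'. J \<subseteq> I \<longrightarrow> J' \<subseteq> I \<longrightarrow>
    (\<forall>h\<in>H. sum h J mod q = sum h J' mod q) \<longrightarrow> J = J')" for I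
  have "indep {}" by (auto simp: indep_def)
  moreover have "{I. indep I} \<subseteq> Pow Y" by (auto simp: indep_def)
  then have "finite {I. indep I}" using fin by (meson finite_Pow_iff finite_subset)
  ultimately obtain I where I: "indep I" and max: "\<And>I'. indep I' \<Longrightarrow> I \<subseteq> I' \<Longrightarrow> I' = I"
    using finite_has_maximal[of "{I. indep I}"] by (metis empty_iff mem_Collect_eq)
  have IY: "I \<subseteq> Y" using I by (simp add: indep_def)
  have finI: "finite I" using IY fin finite_subset by blast
  \<comment> \<open>Every subset sum over I is the value at some element of Y, and independence
    makes these elements distinct for distinct subsets.\<close>
  have small: "2 ^ card I \<le> card Y"
  proof -
    obtain m where m: "\<And>J. J \<subseteq> I \<Longrightarrow> m J \<in> Y \<and> (\<forall>h\<in>H. h (m J) = sum h J mod q)"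
      using ex IY by (metis order_trans)
    have "inj_on m (Pow I)"
    proof (rule inj_onI)
      fix J J' assume J: "J \<in> Pow I" "J' \<in> Pow I" and "m J = m J'"
      then have "\<forall>h\<in>H. sum h J mod q = sum h J' mod q" using m by (metis PowD)
      then show "J = J'" using I J unfolding indep_def by blast
    qed
    then have "card (Pow I) \<le> card Y" by (rule card_inj_on_le) (use m fin in auto)
    then show ?thesis using finI by (simp add: card_Pow)
  qed
  have det: "h y = h' y" if h: "h \<in> H" "h' \<in> H" and eq: "\<And>x. x \<in> I \<Longrightarrow> h x = h' x" and y: "y \<in> Y" for h h' y
  proof (cases "y \<in> I")
    case False
    then have "\<not> indep (insert y I)" using max by blast
    then obtain J J' where J: "J \<subseteq> insert y I" "J' \<subseteq> insert y I" "J \<noteq> J'"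
      and s: "\<And>h. h \<in> H \<Longrightarrow> sum h J mod q = sum h J' mod q"
      using y IY unfolding indep_def by blast
    have fJ: "finite J" "finite J'" using J finI finite_subset by blast+
    \<comment> \<open>A relation with y on one side only can be solved for the value at y in terms
      of values on I. If y lies on both sides it cancels, leaving a relation within I.\<close>
    have key: "h y = h' y"
      if K: "K \<subseteq> insert y I" "K' \<subseteq> insert y I" "y \<in> K" "y \<notin> K'"
        and sK: "\<And>h. h \<in> H \<Longrightarrow> sum h K mod q = sum h K' mod q" for K K'
    proof -
      have fK: "finite K" using K finI finite_subset by blast
      have K': "K - {y} \<subseteq> I" "K' \<subseteq> I" using K by auto
      have sum_eq: "sum h (K - {y}) = sum h' (K - {y})" "sum h K' = sum h' K'"
        by (rule sum.cong[OF refl]; use eq K' in auto)+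
      have "(h y + sum h (K - {y})) mod q = sum h K' mod q" "(h' y + sum h' (K - {y})) mod q = sum h' K' mod q"
        using sK h fK K(3) by (simp_all flip: sum.remove)
      then have "(h y + sum h (K - {y})) mod q = (h' y + sum h (K - {y})) mod q" using sum_eq by simp
      then have "h y mod q = h' y mod q"
        using mod_cancel[of "h y" "sum h (K - {y})" q "sum h (K - {y})" "h' y" 0] by (simp add: add.commute)
      then show ?thesis using val[OF h(1) y] val[OF h(2) y] by simp
    qed
    consider "y \<in> J" "y \<notin> J'" | "y \<in> J'" "y \<notin> J" | "y \<in> J" "y \<in> J'" | "y \<notin> J" "y \<notin> J'" by blast
    then show ?thesis
    proof cases
      case 1
      then show ?thesis using key[of J J'] J s by blast
    next
      case 2
      then show ?thesis using key[of J' J] J s by metis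
    next
      case 3
      have "\<forall>h\<in>H. sum h (J - {y}) mod q = sum h (J' - {y}) mod q"
      proof
        fix h assume "h \<in> H"
        have "(sum h (J - {y}) + h y) mod q = (h y + sum h (J' - {y})) mod q"
          using s[OF \<open>h \<in> H\<close>] fJ 3 by (simp add: sum.remove[of _ y] add.commute)
        then show "sum h (J - {y}) mod q = sum h (J' - {y}) mod q"
          using mod_cancel[of "sum h (J - {y})" "h y" q "h y" "sum h (J' - {y})" 0] by simp
      qed
      moreover have "J - {y} \<subseteq> I" "J' - {y} \<subseteq> I" using J by auto
      ultimately have "J - {y} = J' - {y}" using I unfolding indep_def by blast
      then show ?thesis using 3 J(3) by blast
    next
      case 4
      then have "J \<subseteq> I" "J' \<subseteq> I" using J by auto
      then show ?thesis using I s J(3) unfolding indep_def by blast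
    qed
  qed (use eq in blast)
  have "card ((\<lambda>h. restrict h Y) ` H) \<le> card (I \<rightarrow>\<^sub>E {..<q})"
  proof (rule card_image_le_key[where k = "\<lambda>h. restrict h I"])
    fix h h' assume h: "h \<in> H" "h' \<in> H" "restrict h I = restrict h' I"
    then have "h x = h' x" if "x \<in> I" for x using that by (metis restrict_apply')
    then show "restrict h Y = restrict h' Y" using det[OF h(1,2)] by (intro restrict_ext) auto
  next
    show "(\<lambda>h. restrict h I) ` H \<subseteq> I \<rightarrow>\<^sub>E {..<q}" using val IY by auto
    show "finite (I \<rightarrow>\<^sub>E {..<q})" using finI by (intro finite_PiE) auto
  qed
  also have "\<dots> = q ^ card I" using finI by (simp add: card_PiE)
  \<comment> \<open>This is where the bound 4 on q is used: it makes the count the square of 2 ^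
    card I.\<close>
  also have "\<dots> \<le> 4 ^ card I" using q by (rule power_mono) simp
  also have "\<dots> = (2 ^ card I) ^ 2" by (simp add: power2_eq_square flip: power_mult_distrib)
  also have "\<dots> \<le> card Y ^ 2" using small by (rule power_mono) simp
  finally show ?thesis .
qed simp

text \<open>A binary operation on {e, d} with unit \<open>e\<close> is fixed by its value at (d, d):
  it is a semilattice with top \<open>e\<close> or the group of order two, and each has its own
  count.\<close>

lemma count_unital:
  assumes fin: "finite Y" and y0: "y0 \<in> Y" "\<And>h. h \<in> H \<Longrightarrow> h y0 = e"
    and cl: "\<And>x y. x \<in> Y \<Longrightarrow> y \<in> Y \<Longrightarrow> G x y \<in> Y"
    and val: "\<And>h y. h \<in> H \<Longrightarrow> y \<in> Y \<Longrightarrow> h y = e \<or> h y = d"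
    and hom: "\<And>h x y. h \<in> H \<Longrightarrow> x \<in> Y \<Longrightarrow> y \<in> Y \<Longrightarrow> h (G x y) = g (h x) (h y)"
    and g: "e \<noteq> d" "g e e = e" "g e d = d" "g d e = d" "g d d = e \<or> g d d = d"
  shows "card ((\<lambda>h. restrict h Y) ` H) \<le> (card Y + 1) ^ 2"
  using g(5)
proof
  assume dd: "g d d = d"
  have "card ((\<lambda>h. restrict h Y) ` H) \<le> card Y + 1"
  proof (rule count_semilattice[where G = G and e = e and d = d])
    fix h x y assume h: "h \<in> H" "x \<in> Y" "y \<in> Y"
    show "h (G x y) = e \<longleftrightarrow> h x = e \<and> h y = e"
      using hom[OF h] val[OF h(1,2)] val[OF h(1,3)] g dd by (elim disjE) auto
  qed (use fin cl val in auto)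
  also have "\<dots> \<le> (card Y + 1) ^ 2" by (simp add: power2_eq_square)
  finally show ?thesis .
next
  assume dd: "g d d = e"
  let ?f = "\<lambda>h x. if h x = e then 0 else (1::nat)"
  have "card ((\<lambda>h. restrict h Y) ` H) \<le> card ((\<lambda>h. restrict h Y) ` (?f ` H))"
  proof (rule card_image_le_key[where k = "\<lambda>h. restrict (?f h) Y"])
    fix h h' assume h: "h \<in> H" "h' \<in> H" and eq: "restrict (?f h) Y = restrict (?f h') Y"
    have "h y = h' y" if "y \<in> Y" for y
      using fun_cong[OF eq, of y] that val[OF h(1) that] val[OF h(2) that] by (auto split: if_splits)
    then show "restrict h Y = restrict h' Y" by (intro restrict_ext) auto
  next
    have "(\<lambda>h. restrict h Y) ` (?f ` H) \<subseteq> Y \<rightarrow>\<^sub>E {..<2}" by auto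
    then show "finite ((\<lambda>h. restrict h Y) ` (?f ` H))" using fin by (meson finite_PiE finite_lessThan finite_subset)
  qed auto
  also have "\<dots> \<le> card Y ^ 2"
  proof (rule count_group[where q = 2 and G = G and ?y0.0 = y0])
    fix h x y assume "h \<in> ?f ` H" and xy: "x \<in> Y" "y \<in> Y"
    then obtain h' where h': "h = ?f h'" "h' \<in> H" by blast
    show "h (G x y) = (h x + h y) mod 2"
      unfolding h'(1) using hom[OF h'(2) xy] val[OF h'(2) xy(1)] val[OF h'(2) xy(2)] g dd by (elim disjE) auto
  qed (use y0 fin cl in auto)
  also have "\<dots> \<le> (card Y + 1) ^ 2" by (rule power_mono) auto
  finally show ?thesis .
qed

text \<open>Outside type 1 some polynomial always has a unit: addition with its zero, or a meet with
  its top. Thus the types 2 to 5 on two-element traces are counted together.\<close>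

lemma (in two_element_ualg) ex_unital:
  assumes "\<not> ess_unary A"
  obtains e d g where "univ A = {e, d}" "e \<noteq> d" "pol2 A g" "g e e = e" "g e d = d" "g d e = d"
proof (cases "term_condition A")
  case False
  obtain p q where pq: "univ A = {p, q}" "p \<noteq> q" "has_meet A p q"
    using meet_of_not_term_condition[OF False] by blast
  obtain F where F: "pol A 2 F" "F [p, p] = p" "F [p, q] = p" "F [q, p] = p" "F [q, q] = q"
    using pq(3) unfolding has_meet_def by blast
  show ?thesis
  proof (rule that[of q p "\<lambda>x y. F [x, y]"])
    show "pol2 A (\<lambda>x y. F [x, y])" using F(1) by (subst (asm) pol2_iff)
  qed (use pq F in auto)
next
  case True
  obtain \<phi> :: "'b \<Rightarrow> nat" and q e where q: "pol2 A q" "e \<in> univ A" "\<phi> e = 0" "inj_on \<phi> (univ A)"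
    "\<And>x. x \<in> univ A \<Longrightarrow> \<phi> x < 2" "\<And>x y. x \<in> univ A \<Longrightarrow> y \<in> univ A \<Longrightarrow> \<phi> (q x y) = (\<phi> x + \<phi> y) mod 2"
    using minimal_alg_type_latin(2)[OF disjI1[OF two] min_unary_two latin_of_term_condition[OF True] assms] two by auto
  obtain d where d: "d \<in> univ A" "e \<noteq> d" using q(2) two by (metis card_2_iff insertCI)
  have "\<phi> d \<noteq> \<phi> e" using q(4) d q(2) by (metis inj_onD)
  then have \<phi>d: "\<phi> d = 1" using q(3) q(5)[OF d(1)] by simp
  have eqI: "x = y" if "\<phi> x = \<phi> y" "x \<in> univ A" "y \<in> univ A" for x y using q(4) that by (meson inj_onD)
  have cl: "q x y \<in> univ A" if "x \<in> univ A" "y \<in> univ A" for x y using pol2_closed[OF q(1) that] .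
  show ?thesis
  proof (rule that[of e d q])
    show "univ A = {e, d}" using univ_pair q d by blast
    show "q e e = e" by (rule eqI) (use q cl in auto)
    show "q e d = d" by (rule eqI) (use q cl d \<phi>d in auto)
    show "q d e = d" by (rule eqI) (use q cl d \<phi>d in auto)
  qed (use q d in auto)
qed

section \<open>No type 1 gives polynomially many homomorphisms\<close>

definition homs_at :: "('f, 'x) ualg \<Rightarrow> ('f, 'a) ualg \<Rightarrow> ('a \<Rightarrow> 'x) \<Rightarrow> ('x \<Rightarrow> 'a) set" where
  "homs_at X A \<sigma> = {h \<in> homs X A. \<forall>a\<in>univ A. h (\<sigma> a) = a}"

locale pointed = finite_ualg +
  fixes X :: "('a, 'x) ualg" and \<sigma> :: "'b \<Rightarrow> 'x"
  assumes X: "is_ualg X" "finite (univ X)" "same_signature X A"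
    and \<sigma>: "\<And>a. a \<in> univ A \<Longrightarrow> \<sigma> a \<in> univ X"
begin

abbreviation H where "H \<equiv> homs_at X A \<sigma>"

lemma finite_H: "finite H"
proof (rule finite_subset)
  show "H \<subseteq> univ X \<rightarrow>\<^sub>E univ A" by (auto simp: homs_at_def homs_def)
qed (use X fin in \<open>auto intro: finite_PiE\<close>)

lemma H_val: "h \<in> H \<Longrightarrow> x \<in> univ X \<Longrightarrow> h x \<in> univ A"
  by (auto simp: homs_at_def homs_def)

lemma H_\<sigma>: "h \<in> H \<Longrightarrow> a \<in> univ A \<Longrightarrow> h (\<sigma> a) = a"
  by (auto simp: homs_at_def)

lemma H_ext:
  assumes "h \<in> H" "h' \<in> H" "\<And>x. x \<in> univ X \<Longrightarrow> h x = h' x"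
  shows "h = h'"
  by (rule PiE_ext[of _ "univ X" "\<lambda>_. univ A"]) (use assms in \<open>auto simp: homs_at_def homs_def\<close>)

text \<open>Every constant c of a term for F is replaced by \<sigma> c. The lift does not depend on
  h, so one operation on X serves all of \<open>H\<close> at once.\<close>

lemma lift:
  assumes "pol A n F"
  shows "\<exists>F'. \<forall>xs\<in>tuples (univ X) n. F' xs \<in> univ X \<and> (\<forall>h\<in>H. h (F' xs) = F (map h xs))"
  using fin assms
proof (induction rule: pol_induct)
  case (proj i)
  then show ?case by (intro exI[of _ "\<lambda>xs. xs ! i"]) (auto simp: tuples_nth tuples_length)
next
  case (const c)
  then show ?case using \<sigma> H_\<sigma> by (intro exI[of _ "\<lambda>_. \<sigma> c"]) auto
next
  case (app f G)
  have "\<forall>i. \<exists>F'. i < arity A f \<longrightarrow> (\<forall>xs\<in>tuples (univ X) n. F' xs \<in> univ X \<and> (\<forall>h\<in>H. h (F' xs) = G i (map h xs)))"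
    using app(3) by blast
  then obtain G' where G': "\<And>i xs. i < arity A f \<Longrightarrow> xs \<in> tuples (univ X) n \<Longrightarrow> G' i xs \<in> univ X"
    "\<And>i xs h. i < arity A f \<Longrightarrow> xs \<in> tuples (univ X) n \<Longrightarrow> h \<in> H \<Longrightarrow> h (G' i xs) = G i (map h xs)"
    by metis
  have f: "f \<in> syms X" "arity X f = arity A f" using X(3) app(1) by (auto simp: same_signature_def)
  show ?case
  proof (intro exI[of _ "\<lambda>xs. interp X f (map (\<lambda>i. G' i xs) [0..<arity A f])"] ballI conjI)
    fix xs assume xs: "xs \<in> tuples (univ X) n"
    have t: "map (\<lambda>i. G' i xs) [0..<arity A f] \<in> tuples (univ X) (arity X f)"
      unfolding f(2) by (rule tuples_map_upt) (use G' xs in blast)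
    then show "interp X f (map (\<lambda>i. G' i xs) [0..<arity A f]) \<in> univ X" using X(1) f by (auto simp: is_ualg_def)
    fix h assume h: "h \<in> H"
    have "h (interp X f (map (\<lambda>i. G' i xs) [0..<arity A f])) = interp A f (map h (map (\<lambda>i. G' i xs) [0..<arity A f]))"
      using h t f by (simp add: homs_at_def homs_def del: map_map)
    also have "map h (map (\<lambda>i. G' i xs) [0..<arity A f]) = map (\<lambda>i. G i (map h xs)) [0..<arity A f]"
      using G'(2)[OF _ xs h] by simp
    finally show "h (interp X f (map (\<lambda>i. G' i xs) [0..<arity A f])) = interp A f (map (\<lambda>i. G i (map h xs)) [0..<arity A f])" .
  qed
next
  case (cong F G)
  then obtain F' where F': "\<And>xs. xs \<in> tuples (univ X) n \<Longrightarrow> F' xs \<in> univ X"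
    "\<And>xs h. xs \<in> tuples (univ X) n \<Longrightarrow> h \<in> H \<Longrightarrow> h (F' xs) = F (map h xs)" by blast
  have "map h xs \<in> tuples (univ A) n" if "h \<in> H" "xs \<in> tuples (univ X) n" for h xs
    using that H_val by (auto simp: tuples_def)
  then show ?case using F' cong(2) by (intro exI[of _ F']) auto
qed

lemma lift1:
  assumes "pol1 A f"
  obtains f' where "\<And>x. x \<in> univ X \<Longrightarrow> f' x \<in> univ X" "\<And>x h. x \<in> univ X \<Longrightarrow> h \<in> H \<Longrightarrow> h (f' x) = f (h x)"
proof -
  obtain F' where F': "\<forall>xs\<in>tuples (univ X) 1. F' xs \<in> univ X \<and> (\<forall>h\<in>H. h (F' xs) = f (map h xs ! 0))"
    using lift[OF assms] by blast
  have "F' [x] \<in> univ X \<and> (\<forall>h\<in>H. h (F' [x]) = f (h x))" if "x \<in> univ X" for x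
    using bspec[OF F', of "[x]"] that by (simp add: tuples_one)
  then show ?thesis by (intro that[of "\<lambda>x. F' [x]"]) blast+
qed

lemma lift2:
  assumes "pol2 A g"
  obtains g' where "\<And>x y. x \<in> univ X \<Longrightarrow> y \<in> univ X \<Longrightarrow> g' x y \<in> univ X"
    "\<And>x y h. x \<in> univ X \<Longrightarrow> y \<in> univ X \<Longrightarrow> h \<in> H \<Longrightarrow> h (g' x y) = g (h x) (h y)"
proof -
  obtain F' where F': "\<forall>xs\<in>tuples (univ X) 2. F' xs \<in> univ X \<and>
      (\<forall>h\<in>H. h (F' xs) = g (map h xs ! 0) (map h xs ! 1))"
    using lift[OF assms] by blast
  have "F' [x, y] \<in> univ X \<and> (\<forall>h\<in>H. h (F' [x, y]) = g (h x) (h y))" if "x \<in> univ X" "y \<in> univ X" for x y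
    using bspec[OF F', of "[x, y]"] that by (simp add: tuples_two numeral_2_eq_2)
  then show ?thesis by (intro that[of "\<lambda>x y. F' [x, y]"]) blast+
qed

text \<open>The homomorphisms are few modulo \<theta>: a key with polynomially many values fixes h
  up to \<theta> at every point. The exponent 4 comes from \<open>few_full\<close>, where two
  quadratic counts are multiplied.\<close>

definition few :: "('b \<times> 'b) set \<Rightarrow> bool" where
  "few \<theta> \<longleftrightarrow> (\<exists>k :: ('x \<Rightarrow> 'b) \<Rightarrow> ('x \<Rightarrow> 'b). card (k ` H) \<le> (card (univ X) + 1) ^ 4 \<and>
     (\<forall>h\<in>H. \<forall>h'\<in>H. k h = k h' \<longrightarrow> (\<forall>x\<in>univ X. (h x, h' x) \<in> \<theta>)))"

lemma few_two:
  assumes "few \<theta>" "few \<theta>'" "\<theta> \<inter> \<theta>' \<subseteq> Id"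
  shows "card H \<le> (card (univ X) + 1) ^ 8"
proof -
  obtain k :: "('x \<Rightarrow> 'b) \<Rightarrow> ('x \<Rightarrow> 'b)" where k: "card (k ` H) \<le> (card (univ X) + 1) ^ 4"
    "\<forall>h\<in>H. \<forall>h'\<in>H. k h = k h' \<longrightarrow> (\<forall>x\<in>univ X. (h x, h' x) \<in> \<theta>)" using assms(1) unfolding few_def by blast
  obtain k' :: "('x \<Rightarrow> 'b) \<Rightarrow> ('x \<Rightarrow> 'b)" where k': "card (k' ` H) \<le> (card (univ X) + 1) ^ 4"
    "\<forall>h\<in>H. \<forall>h'\<in>H. k' h = k' h' \<longrightarrow> (\<forall>x\<in>univ X. (h x, h' x) \<in> \<theta>')" using assms(2) unfolding few_def by blast
  have "card ((\<lambda>h. h) ` H) \<le> card ((k ` H) \<times> (k' ` H))"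
  proof (rule card_image_le_key[where k = "\<lambda>h. (k h, k' h)"])
    fix h h' assume h: "h \<in> H" "h' \<in> H" and "(k h, k' h) = (k h', k' h')"
    then have "h x = h' x" if "x \<in> univ X" for x using k(2) k'(2) assms(3) that by blast
    then show "h = h'" using H_ext[OF h] by blast
  qed (use finite_H in auto)
  also have "\<dots> \<le> (card (univ X) + 1) ^ 4 * (card (univ X) + 1) ^ 4"
    unfolding card_cartesian_product using k k' by (intro mult_mono) auto
  finally show ?thesis by (simp flip: power_add)
qed

end

locale three_pointed = pointed + three_minimal
begin

text \<open>A trace of three elements is all of A, and A is then a minimal algebra with a polynomial
  addition modulo 3, so \<open>count_group\<close> applies to the labels of h.\<close>

lemma few_affine:
  assumes tr: "trace A \<alpha> N" and "\<not> ess_unary (induced A N)" "card N = 3"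
  shows "few Id"
proof -
  obtain U a where U: "minimal_set A \<alpha> U" "a \<in> U" "N = \<alpha> `` {a} \<inter> U" "U \<subseteq> univ A" "N \<subseteq> univ A"
    "card N = 2 \<or> (card N = 3 \<and> N = univ A \<and> U = univ A)" using trace_facts[OF tr] .
  then have N: "N = univ A" "U = univ A" using assms(3) by auto
  have pol_eq: "pol (induced A N) n F \<longleftrightarrow> pol A n F" for n F
    unfolding N(1) using pol_induced[OF fin ualg, of "univ A" n F] ualg pol_closed[OF fin _ ualg]
    by (auto simp: is_ualg_def intro: pol_congI)
  have one: "ess_unary A \<longleftrightarrow> ess_unary (induced A N)" unfolding ess_unary_def pol_eq using N by simp
  have min: "min_unary" unfolding min_unary_def
  proof (intro allI impI, rule disjCI)
    fix f assume f: "pol1 A f" and nb: "\<not> bij_betw f (univ A) (univ A)"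
    show "\<forall>x\<in>univ A. \<forall>y\<in>univ A. f x = f y"
    proof (intro ballI, rule ccontr)
      fix x y assume xy: "x \<in> univ A" "y \<in> univ A" "f x \<noteq> f y"
      then have "(x, y) \<in> \<alpha>" using U(3) N alpha_sym alpha_trans by blast
      from minimal_setD[OF U(1) f _ this xy(3)] have "f ` univ A = univ A"
        using N pol1_closed[OF f] by auto
      then have "bij_betw f (univ A) (univ A)" using fin by (simp add: bij_betw_def eq_card_imp_inj_on)
      then show False using nb by blast
    qed
  qed
  obtain \<phi> :: "'b \<Rightarrow> nat" and q e where q: "pol2 A q" "e \<in> univ A" "\<phi> e = 0" "inj_on \<phi> (univ A)"
    "\<And>x. x \<in> univ A \<Longrightarrow> \<phi> x < 3" "\<And>x y. x \<in> univ A \<Longrightarrow> y \<in> univ A \<Longrightarrow> \<phi> (q x y) = (\<phi> x + \<phi> y) mod 3"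
    using minimal_alg_type_latin(2)[OF disjI2[OF three] min latin_of_not_one_var[OF min three]] assms(2) one three by auto
  obtain q' where q': "\<And>x y. x \<in> univ X \<Longrightarrow> y \<in> univ X \<Longrightarrow> q' x y \<in> univ X"
    "\<And>x y h. x \<in> univ X \<Longrightarrow> y \<in> univ X \<Longrightarrow> h \<in> H \<Longrightarrow> h (q' x y) = q (h x) (h y)"
    by (rule lift2[OF q(1)], rule that)
  let ?r = "\<lambda>h. restrict h (univ X)" and ?f = "\<lambda>h x. \<phi> (h x)"
  have "card ((\<lambda>h. h) ` H) \<le> card (?r ` (?f ` H))"
  proof (rule card_image_le_key[where k = "\<lambda>h. ?r (?f h)"])
    fix h h' assume h: "h \<in> H" "h' \<in> H" and eq: "?r (?f h) = ?r (?f h')"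
    have "h x = h' x" if "x \<in> univ X" for x
      using fun_cong[OF eq, of x] that q(4) H_val[OF h(1) that] H_val[OF h(2) that] by (simp add: inj_on_eq_iff)
    then show "h = h'" using H_ext[OF h] by blast
  qed (use finite_H in auto)
  also have "\<dots> \<le> card (univ X) ^ 2"
  proof (rule count_group[where q = 3 and G = q' and ?y0.0 = "\<sigma> e"])
    fix h assume "h \<in> ?f ` H"
    then obtain h' where h': "h = ?f h'" "h' \<in> H" by blast
    show "h (\<sigma> e) = 0" using H_\<sigma>[OF h'(2) q(2)] q(3) h'(1) by simp
    fix x assume x: "x \<in> univ X"
    show "h x < 3" using q(5) H_val[OF h'(2) x] h'(1) by simp
    fix y assume y: "y \<in> univ X"
    show "h (q' x y) = (h x + h y) mod 3"
      using q'(2)[OF x y h'(2)] q(6) H_val[OF h'(2)] x y h'(1) by simp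
  qed (use X q' \<sigma>[OF q(2)] in auto)
  also have "\<dots> \<le> (card (univ X) + 1) ^ 2" by (rule power_mono) auto
  also have "\<dots> \<le> (card (univ X) + 1) ^ 4" by (rule power_increasing) auto
  finally show ?thesis unfolding few_def by (intro exI[of _ "\<lambda>h. h"]) auto
qed

text \<open>Here \<alpha> has the class N = {e, d} and a singleton class {c}, and no polynomial
  retracts A onto N. Instead, the unital polynomial p of N has \<open>c\<close> as an absorbing
  element against N. The count first records where h takes the value \<open>c\<close>, and then, for
  a fixed such pattern, the values in N.\<close>

lemma few_full:
  assumes tr: "trace A \<alpha> N" and ess: "\<not> ess_unary (induced A N)" and c2: "card N = 2"
    and U: "minimal_set A \<alpha> (univ A)" "a \<in> univ A" "N = \<alpha> `` {a}"
  shows "few Id"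
proof -
  have NU: "N \<subseteq> univ A" "N \<noteq> {}" using U(2,3) alpha_univ alpha_refl by auto
  interpret I: two_element_ualg "induced A N"
    by unfold_locales (use NU fin c2 finite_subset in \<open>auto intro: is_ualg_induced\<close>)
  obtain e d g0 where N: "N = {e, d}" "e \<noteq> d" and g0: "pol2 (induced A N) g0" "g0 e e = e" "g0 e d = d" "g0 d e = d"
    using I.ex_unital[OF ess] by auto
  obtain P where P: "pol A 2 P" "\<And>xs. xs \<in> tuples N 2 \<Longrightarrow> P xs \<in> N \<and> g0 (xs ! 0) (xs ! 1) = P xs"
    using g0(1) unfolding pol_induced[OF fin ualg NU] by blast
  define p where "p x y = P [x, y]" for x y
  have p: "pol2 A p" using P(1) unfolding p_def by (subst (asm) pol2_iff)
  have pN: "p x y \<in> N \<and> p x y = g0 x y" if "x \<in> N" "y \<in> N" for x y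
    using P(2)[of "[x, y]"] that by (simp add: tuples_two numeral_2_eq_2 p_def)
  have pv: "p e e = e" "p e d = d" "p d e = d" using pN[of e e] pN[of e d] pN[of d e] g0 N by auto
  have eU: "e \<in> univ A" "d \<in> univ A" using N NU by auto
  have ed: "(e, d) \<in> \<alpha>" using U(3) N alpha_sym alpha_trans by blast
  have "card (univ A - N) = 1"
    using three c2 NU(1) finite_subset[OF NU(1) fin] by (simp add: card_Diff_subset)
  then obtain c where "univ A - N = {c}" by (metis card_1_singletonE)
  then have c: "c \<in> univ A" "c \<notin> N" "\<And>x. x \<in> univ A \<Longrightarrow> x \<in> N \<or> x = c" by auto
  have cclass: "x = c" if "(x, c) \<in> \<alpha>" for x
  proof (rule ccontr)
    assume "x \<noteq> c"
    then have "x \<in> N" using c(3) alpha_univ that by blast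
    then show False using c(2) that U(3) alpha_trans by blast
  qed
  \<comment> \<open>Such an f splits the pair (e, d) of \<alpha>, so by minimality of A as a minimal
    set it is onto, and only \<open>c\<close> is left for the value at \<open>c\<close>.\<close>
  have fixc: "f c = c" if f: "pol1 A f" "f e = e" "f d = d" for f
  proof (rule ccontr)
    assume "f c \<noteq> c"
    then have "f c = e \<or> f c = d" using c(3) pol1_closed[OF f(1) c(1)] N by blast
    then have "f ` univ A \<subseteq> N" using f c(3) N by blast
    moreover have "f ` univ A = univ A"
      by (rule minimal_setD[OF U(1) f(1) _ ed]) (use f N pol1_closed[OF f(1)] in auto)
    ultimately show False using c by blast
  qed
  have ce: "p c e = c" "p e c = c"
    by (rule fixc[of "\<lambda>x. p x e"], rule pol1_pol2[OF p pol1_id pol1_const[OF eU(1)]]; use pv in simp)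
      (rule fixc[of "\<lambda>x. p e x"], rule pol1_pol2[OF p pol1_const[OF eU(1)] pol1_id]; use pv in simp)
  have cN: "p c x = c" "p x c = c" if "x \<in> N" for x
  proof -
    have "(x, e) \<in> \<alpha>" using that U(3) N alpha_sym alpha_trans by blast
    then have "(p c x, p c e) \<in> \<alpha>" "(p x c, p e c) \<in> \<alpha>"
      using congruence_pol2[OF cong p] alpha_refl[OF c(1)] by auto
    then show "p c x = c" "p x c = c" using cclass ce by auto
  qed
  obtain q where q: "\<And>x y. x \<in> univ X \<Longrightarrow> y \<in> univ X \<Longrightarrow> q x y \<in> univ X"
    "\<And>x y h. x \<in> univ X \<Longrightarrow> y \<in> univ X \<Longrightarrow> h \<in> H \<Longrightarrow> h (q x y) = p (h x) (h y)"
    by (rule lift2[OF p], rule that)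
  \<comment> \<open>Collapsing N to \<open>e\<close> turns p into an operation on {e, c} with unit
    \<open>e\<close>. Whichever value p c c has, \<open>count_unital\<close> covers the
    result.\<close>
  define \<chi> where "\<chi> x = (if x = c then c else e)" for x
  have ec: "e \<noteq> c" "d \<noteq> c" using c N by auto
  let ?n = "card (univ X)"
  let ?k = "\<lambda>h. restrict (\<lambda>x. \<chi> (h x)) (univ X)"
  have "card ((\<lambda>h. restrict h (univ X)) ` ((\<lambda>h x. \<chi> (h x)) ` H)) \<le> (?n + 1) ^ 2"
  proof (rule count_unital[where G = q and ?y0.0 = "\<sigma> e" and e = e and d = c and
        g = "\<lambda>x y. \<chi> (p x y)"])
    fix h assume "h \<in> (\<lambda>h x. \<chi> (h x)) ` H"
    then obtain h' where h': "h = (\<lambda>x. \<chi> (h' x))" "h' \<in> H" by blast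
    show "h (\<sigma> e) = e" using H_\<sigma>[OF h'(2) eU(1)] h'(1) ec by (simp add: \<chi>_def)
    fix x assume x: "x \<in> univ X"
    show "h x = e \<or> h x = c" using h'(1) by (simp add: \<chi>_def)
    fix y assume y: "y \<in> univ X"
    have "\<chi> (p s t) = \<chi> (p (\<chi> s) (\<chi> t))" if "s \<in> univ A" "t \<in> univ A" for s t
    proof -
      have "s \<in> N \<or> s = c" "t \<in> N \<or> t = c" using that c(3) by auto
      moreover have "p s t \<noteq> c" if "s \<in> N" "t \<in> N" using pN[OF that] c(2) by auto
      moreover have "s \<noteq> c" if "s \<in> N" using that c(2) by auto
      moreover have "t \<noteq> c" if "t \<in> N" using that c(2) by auto
      ultimately show ?thesis using cN ce pv ec by (auto simp: \<chi>_def)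
    qed
    then show "h (q x y) = \<chi> (p (h x) (h y))"
      using q(2)[OF x y h'(2)] H_val[OF h'(2)] x y h'(1) by simp
  qed (use X q(1) \<sigma>[OF eU(1)] pv ce ec in \<open>auto simp: \<chi>_def\<close>)
  then have k1: "card (?k ` H) \<le> (?n + 1) ^ 2" by (simp add: image_image)
  \<comment> \<open>Within a fibre all maps send the same set \<open>?Y\<close> into N and
    everything else to \<open>c\<close>, so only their restrictions to \<open>?Y\<close> need
    counting, and there p has unit \<open>e\<close>.\<close>
  have k2: "card {h' \<in> H. ?k h' = ?k h} \<le> (?n + 1) ^ 2" if h: "h \<in> H" for h
  proof -
    let ?Y = "{x \<in> univ X. \<chi> (h x) = e}" and ?H = "{h' \<in> H. ?k h' = ?k h}"
    have same: "\<chi> (h' x) = \<chi> (h x)" if "h' \<in> ?H" "x \<in> univ X" for h' x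
    proof -
      have "?k h' = ?k h" using that(1) by blast
      from fun_cong[OF this, of x] show ?thesis using that(2) by simp
    qed
    have inN: "h' x \<in> N \<longleftrightarrow> x \<in> ?Y" if "h' \<in> ?H" "x \<in> univ X" for h' x
      using same[OF that] that c H_val[of h' x] ec by (auto simp: \<chi>_def split: if_splits)
    have "card ((\<lambda>h. h) ` ?H) \<le> card ((\<lambda>h. restrict h ?Y) ` ?H)"
    proof (rule card_image_le_key[where k = "\<lambda>h. restrict h ?Y"])
      fix f f' assume f: "f \<in> ?H" "f' \<in> ?H" and eq: "restrict f ?Y = restrict f' ?Y"
      have "f x = f' x" if x: "x \<in> univ X" for x
      proof (cases "x \<in> ?Y")
        case True
        then show ?thesis using fun_cong[OF eq, of x] by simp
      next
        case False
        then have "f x = c" "f' x = c" using inN[OF f(1) x] inN[OF f(2) x] c(3) H_val f x by blast+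
        then show ?thesis by simp
      qed
      then show "f = f'" using H_ext f by blast
    qed (use finite_H in auto)
    also have "\<dots> \<le> (card ?Y + 1) ^ 2"
    proof (rule count_unital[where G = q and e = e and d = d and g = p and ?y0.0 = "\<sigma> e"])
      show "\<sigma> e \<in> ?Y" using \<sigma>[OF eU(1)] H_\<sigma>[OF h eU(1)] ec by (simp add: \<chi>_def)
      show "q x y \<in> ?Y" if "x \<in> ?Y" "y \<in> ?Y" for x y
      proof -
        have xy: "x \<in> univ X" "y \<in> univ X" using that by auto
        have hH: "h \<in> ?H" using h by simp
        have "h x \<in> N" "h y \<in> N" using inN[OF hH] xy that by blast+
        then have "h (q x y) \<in> N" using q(2)[OF xy h] pN by metis
        then show ?thesis using inN[OF hH q(1)[OF xy]] by blast
      qed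
      show "h' x = e \<or> h' x = d" if "h' \<in> ?H" "x \<in> ?Y" for h' x using inN[OF that(1)] that N by blast
      show "p d d = e \<or> p d d = d" using pN[of d d] N by auto
      show "h' (q x y) = p (h' x) (h' y)" if "h' \<in> ?H" "x \<in> ?Y" "y \<in> ?Y" for h' x y
        using q(2) that by auto
      show "h' (\<sigma> e) = e" if "h' \<in> ?H" for h' using that H_\<sigma> eU by blast
    qed (use X N pv in auto)
    also have "\<dots> \<le> (?n + 1) ^ 2" using card_mono[OF X(2), of ?Y] by (intro power_mono) auto
    finally show ?thesis by simp
  qed
  have "card H \<le> (?n + 1) ^ 2 * (?n + 1) ^ 2" by (rule card_le_fibers[OF finite_H k1 k2])
  then have "card H \<le> (?n + 1) ^ 4" by (simp flip: power_add)
  then show ?thesis unfolding few_def by (intro exI[of _ "\<lambda>h. h"]) auto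
qed

text \<open>A retraction r onto N exists, and its lift s has an image on which every h takes values
  in N only; there the unital operation, followed by s, gives a quadratic count. These values
  determine h modulo the congruence of pairs that r never separates.\<close>

lemma few_retract:
  assumes tr: "trace A \<alpha> N" and ess: "\<not> ess_unary (induced A N)" and c2: "card N = 2"
    and U: "minimal_set A \<alpha> N"
  shows "\<exists>\<theta>. congruence A \<theta> \<and> few \<theta> \<and> \<theta> \<inter> \<alpha> \<subseteq> Id"
proof -
  have NU: "N \<subseteq> univ A" "N \<noteq> {}" using minimal_set_sub[OF U] c2 by auto
  interpret I: two_element_ualg "induced A N"
    by unfold_locales (use NU fin c2 finite_subset in \<open>auto intro: is_ualg_induced\<close>)
  obtain e d g0 where N: "N = {e, d}" "e \<noteq> d" and g0: "pol2 (induced A N) g0" "g0 e e = e" "g0 e d = d" "g0 d e = d"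
    using I.ex_unital[OF ess] by auto
  obtain P where P: "pol A 2 P" "\<And>xs. xs \<in> tuples N 2 \<Longrightarrow> P xs \<in> N \<and> g0 (xs ! 0) (xs ! 1) = P xs"
    using g0(1) unfolding pol_induced[OF fin ualg NU] by blast
  define p where "p x y = P [x, y]" for x y
  have p: "pol2 A p" using P(1) unfolding p_def by (subst (asm) pol2_iff)
  have pN: "p x y \<in> N \<and> p x y = g0 x y" if "x \<in> N" "y \<in> N" for x y
    using P(2)[of "[x, y]"] that by (simp add: tuples_two numeral_2_eq_2 p_def)
  have pv: "p e e = e" "p e d = d" "p d e = d" using pN[of e e] pN[of e d] pN[of d e] g0 N by auto
  have eU: "e \<in> univ A" "d \<in> univ A" using N NU by auto
  obtain r where r: "pol1 A r" "\<And>x. x \<in> univ A \<Longrightarrow> r x \<in> N" "\<And>x. x \<in> N \<Longrightarrow> r x = x"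
    by (rule retraction[OF U], rule that)
  obtain q where q: "\<And>x y. x \<in> univ X \<Longrightarrow> y \<in> univ X \<Longrightarrow> q x y \<in> univ X"
    "\<And>x y h. x \<in> univ X \<Longrightarrow> y \<in> univ X \<Longrightarrow> h \<in> H \<Longrightarrow> h (q x y) = p (h x) (h y)"
    by (rule lift2[OF p], rule that)
  obtain s where s: "\<And>x. x \<in> univ X \<Longrightarrow> s x \<in> univ X" "\<And>x h. x \<in> univ X \<Longrightarrow> h \<in> H \<Longrightarrow> h (s x) = r (h x)"
    by (rule lift1[OF r(1)], rule that)
  let ?Y = "s ` univ X" and ?n = "card (univ X)"
  \<comment> \<open>The largest congruence inside the kernel of r. By \<open>separate\<close> it
    contains no pair of \<alpha> except equal ones, since r splits the trace.\<close>
  define \<theta> where "\<theta> = {(x, y) \<in> univ A \<times> univ A. \<forall>r\<in>{r}. \<forall>f. pol1 A f \<longrightarrow> r (f x) = r (f y)}"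
  have "congruence A (univ A \<times> univ A)"
    by (rule congruenceI_pol1) (auto simp: equiv_def refl_on_def sym_def trans_def intro: pol1_closed)
  from congruence_kernel[OF this, of "{r}"] have cong\<theta>: "congruence A \<theta>" by (simp add: \<theta>_def)
  have YX: "?Y \<subseteq> univ X" using s(1) by auto
  have hY: "h y \<in> N" if hy: "h \<in> H" "y \<in> ?Y" for h y
  proof -
    obtain x where x: "x \<in> univ X" "y = s x" using hy(2) by blast
    then show ?thesis using s(2)[OF x(1) hy(1)] r(2)[OF H_val[OF hy(1) x(1)]] by simp
  qed
  have "card ((\<lambda>h. restrict h ?Y) ` H) \<le> (card ?Y + 1) ^ 2"
  proof (rule count_unital[where G = "\<lambda>x y. s (q x y)" and e = e and d = d and g = p and ?y0.0 = "s (\<sigma> e)"])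
    show "s (\<sigma> e) \<in> ?Y" using \<sigma> eU by blast
    show "h (s (\<sigma> e)) = e" if "h \<in> H" for h
      using s(2)[OF \<sigma>[OF eU(1)] that] H_\<sigma>[OF that eU(1)] r(3) N by simp
    show "s (q x y) \<in> ?Y" if "x \<in> ?Y" "y \<in> ?Y" for x y using that YX q(1) by blast
    show "h y = e \<or> h y = d" if "h \<in> H" "y \<in> ?Y" for h y using hY[OF that] N by blast
    show "p d d = e \<or> p d d = d" using pN[of d d] N by auto
    fix h x y assume h: "h \<in> H" and xy: "x \<in> ?Y" "y \<in> ?Y"
    then have X': "x \<in> univ X" "y \<in> univ X" using YX by auto
    have "h (s (q x y)) = r (p (h x) (h y))" using s(2)[OF q(1)[OF X'] h] q(2)[OF X' h] by simp
    also have "\<dots> = p (h x) (h y)" using r(3) pN hY[OF h] xy by blast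
    finally show "h (s (q x y)) = p (h x) (h y)" .
  qed (use X N pv in auto)
  also have "\<dots> \<le> (?n + 1) ^ 2" using card_image_le[OF X(2), of s] by (intro power_mono) auto
  also have "\<dots> \<le> (?n + 1) ^ 4" by (rule power_increasing) auto
  finally have cnt: "card ((\<lambda>h. restrict h ?Y) ` H) \<le> (?n + 1) ^ 4" .
  have "few \<theta>" unfolding few_def
  proof (intro exI[of _ "\<lambda>h. restrict h ?Y"] conjI cnt ballI impI)
    fix h h' x assume h: "h \<in> H" "h' \<in> H" and eq: "restrict h ?Y = restrict h' ?Y" and x: "x \<in> univ X"
    have "r (f (h x)) = r (f (h' x))" if f: "pol1 A f" for f
    proof -
      obtain f' where f': "\<And>x. x \<in> univ X \<Longrightarrow> f' x \<in> univ X" "\<And>x h. x \<in> univ X \<Longrightarrow> h \<in> H \<Longrightarrow> h (f' x) = f (h x)"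
        by (rule lift1[OF f], rule that)
      \<comment> \<open>The lift of r after f lands in \<open>?Y\<close>, so agreement on
        \<open>?Y\<close> tests h x and h' x under every unary polynomial.\<close>
      have "h (s (f' x)) = h' (s (f' x))" using fun_cong[OF eq, of "s (f' x)"] f'(1)[OF x] by simp
      then show ?thesis using s(2)[OF f'(1)[OF x]] f'(2)[OF x] h by simp
    qed
    then show "(h x, h' x) \<in> \<theta>" using H_val h x by (simp add: \<theta>_def)
  qed
  moreover have "\<theta> \<inter> \<alpha> \<subseteq> Id"
  proof clarify
    fix x y assume \<theta>: "(x, y) \<in> \<theta>" and \<alpha>: "(x, y) \<in> \<alpha>"
    show "x = y"
    proof (rule ccontr)
      assume ne: "x \<noteq> y"
      obtain V b where V: "N = \<alpha> `` {b} \<inter> V" using tr unfolding trace_def by blast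
      then have "(e, d) \<in> \<alpha>" using N alpha_sym alpha_trans by blast
      moreover have "r e \<noteq> r d" using r(3) N by simp
      ultimately obtain f where "pol1 A f" "r (f x) \<noteq> r (f y)" using separate[OF _ _ \<alpha> ne] by metis
      then show False using \<theta> by (simp add: \<theta>_def)
    qed
  qed
  ultimately show ?thesis using cong\<theta> by blast
qed

text \<open>Three shapes are possible: the trace is all of A; the minimal set is A and the trace a
  class of two elements; or minimal set and trace coincide. In the first two \<theta> is
  equality.\<close>

lemma few_cases:
  assumes "tct_type A \<alpha> \<noteq> 1"
  shows "\<exists>\<theta>. congruence A \<theta> \<and> few \<theta> \<and> \<theta> \<inter> \<alpha> \<subseteq> Id"
proof -
  obtain N where tr: "trace A \<alpha> N" using ex_trace by blast
  then have ess: "\<not> ess_unary (induced A N)" using assms tct_type_1_iff by blast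
  obtain U a where U: "minimal_set A \<alpha> U" "a \<in> U" "N = \<alpha> `` {a} \<inter> U" "U \<subseteq> univ A" "N \<subseteq> univ A"
    "card N = 2 \<or> (card N = 3 \<and> N = univ A \<and> U = univ A)" using trace_facts[OF tr] .
  have "few Id \<Longrightarrow> few (Id_on (univ A))"
    unfolding few_def using H_val by (metis (no_types, lifting) Id_onI pair_in_Id_conv)
  moreover have "congruence A (Id_on (univ A))"
    by (rule congruenceI_pol1) (auto simp: equiv_def refl_on_def sym_def trans_def intro: pol1_closed)
  ultimately have Id: "few Id \<Longrightarrow> ?thesis" by (intro exI[of _ "Id_on (univ A)"]) auto
  show ?thesis
  proof (cases "card N = 3")
    case True
    then show ?thesis using Id few_affine[OF tr ess] by blast
  next
    case False
    then have c2: "card N = 2" using U(6) by blast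
    show ?thesis
    proof (cases "U = univ A")
      case True
      have "N = \<alpha> `` {a}" using U(3) True alpha_univ by auto
      then show ?thesis using Id few_full[OF tr ess c2] U(1,2) True by blast
    next
      case False
      have finU: "finite U" using U(4) fin finite_subset by blast
      have "card U < 3" using psubset_card_mono[OF fin, of U] False U(4) three by auto
      moreover have "N \<subseteq> U" using U(3) by blast
      ultimately have "N = U" using c2 card_seteq[OF finU] by simp
      then show ?thesis using few_retract[OF tr ess c2] U(1) by blast
    qed
  qed
qed

end

lemma (in finite_ualg) ex_minimal_congruence:
  assumes "card (univ A) \<ge> 2"
  shows "\<exists>\<alpha>. minimal_congruence A \<alpha>"
proof -
  let ?C = "{\<alpha>. congruence A \<alpha> \<and> \<alpha> \<noteq> Id_on (univ A)}"
  have "congruence A (univ A \<times> univ A)"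
    by (rule congruenceI_pol1) (auto simp: equiv_def refl_on_def sym_def trans_def intro: pol1_closed)
  moreover obtain x y where "x \<in> univ A" "y \<in> univ A" "x \<noteq> y"
    using assms by (metis One_nat_def card_le_Suc0_iff_eq fin not_less_eq_eq numeral_2_eq_2)
  ultimately have "univ A \<times> univ A \<in> ?C" by auto
  moreover have "?C \<subseteq> Pow (univ A \<times> univ A)" by (auto simp: congruence_def)
  then have "finite ?C" using fin by (meson finite_Pow_iff finite_SigmaI finite_subset)
  ultimately obtain \<alpha> where "\<alpha> \<in> ?C" "\<forall>\<beta>\<in>?C. \<beta> \<subseteq> \<alpha> \<longrightarrow> \<beta> = \<alpha>"
    using finite_has_minimal[of ?C] by (metis (lifting) empty_iff)
  then show ?thesis unfolding minimal_congruence_def by blast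
qed

text \<open>On three elements a congruence that is neither equality nor total has a single
  nontrivial class, of two elements, so only equality lies strictly below it.\<close>

lemma (in finite_ualg) minimal_congruence_three:
  assumes three: "card (univ A) = 3" and \<theta>: "congruence A \<theta>" "\<not> \<theta> \<subseteq> Id"
    and ab: "a \<in> univ A" "b \<in> univ A" "(a, b) \<notin> \<theta>"
  shows "minimal_congruence A \<theta>"
proof -
  have eq: "equiv (univ A) \<theta>" "\<theta> \<subseteq> univ A \<times> univ A" using \<theta>(1) by (auto simp: congruence_def)
  have "\<beta> = \<theta>" if \<beta>: "congruence A \<beta>" "\<beta> \<subseteq> \<theta>" "\<beta> \<noteq> Id_on (univ A)" for \<beta>
  proof
    have eqb: "equiv (univ A) \<beta>" "\<beta> \<subseteq> univ A \<times> univ A" using \<beta>(1) by (auto simp: congruence_def)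
    have "\<exists>x y. (x, y) \<in> \<beta> \<and> x \<noteq> y"
      using eqb \<beta>(3) unfolding equiv_def refl_on_def Id_on_def by fast
    then obtain x y where xy: "(x, y) \<in> \<beta>" "x \<noteq> y" by blast
    then have xyU: "x \<in> univ A" "y \<in> univ A" using eqb by auto
    have "card (univ A - {x, y}) = 1" using three xy xyU by (simp add: card_Diff_subset)
    then obtain z where "univ A - {x, y} = {z}" by (metis card_1_singletonE)
    then have U: "univ A = {x, y, z}" "z \<noteq> x" "z \<noteq> y" using xyU by auto
    have sym: "\<And>u v. (u, v) \<in> \<theta> \<Longrightarrow> (v, u) \<in> \<theta>" and tr: "\<And>u v w. (u, v) \<in> \<theta> \<Longrightarrow> (v, w) \<in> \<theta> \<Longrightarrow> (u, w) \<in> \<theta>"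
      and rf: "\<And>u. u \<in> univ A \<Longrightarrow> (u, u) \<in> \<theta>"
      using eq by (auto simp: equiv_def refl_on_def dest: symD transD)
    have xy\<theta>: "(x, y) \<in> \<theta>" using xy \<beta>(2) by blast
    have nz: "(x, z) \<notin> \<theta>" "(y, z) \<notin> \<theta>"
    proof -
      have "(u, v) \<in> \<theta>" if "(x, z) \<in> \<theta> \<or> (y, z) \<in> \<theta>" "u \<in> univ A" "v \<in> univ A" for u v
        using that xy\<theta> sym tr rf unfolding U(1) by blast
      then show "(x, z) \<notin> \<theta>" "(y, z) \<notin> \<theta>" using ab by blast+
    qed
    show "\<theta> \<subseteq> \<beta>"
    proof clarify
      fix u v assume uv: "(u, v) \<in> \<theta>"
      then have "u \<in> {x, y, z}" "v \<in> {x, y, z}" using eq(2) U(1) by auto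
      then have "u = v \<or> {u, v} = {x, y}" using nz sym uv by blast
      moreover have "(y, x) \<in> \<beta>" "\<And>u. u \<in> univ A \<Longrightarrow> (u, u) \<in> \<beta>"
        using eqb xy by (auto simp: equiv_def refl_on_def dest: symD)
      ultimately show "(u, v) \<in> \<beta>" using xy uv eq(2) by (auto simp: doubleton_eq_iff)
    qed
  qed (use \<beta> in blast)
  moreover have "\<theta> \<noteq> Id_on (univ A)" using \<theta>(2) by auto
  ultimately show ?thesis using \<theta>(1) unfolding minimal_congruence_def by blast
qed

lemma (in pointed) homs_at_bound:
  assumes three: "card (univ A) = 3" and ty: "\<And>\<alpha>. minimal_congruence A \<alpha> \<Longrightarrow> tct_type A \<alpha> \<noteq> 1"
  shows "card H \<le> (card (univ X) + 1) ^ 8"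
proof -
  obtain \<alpha> where \<alpha>: "minimal_congruence A \<alpha>" using ex_minimal_congruence three by auto
  interpret a: three_pointed A X \<sigma> \<alpha> by unfold_locales (use \<alpha> three in auto)
  obtain \<theta> where \<theta>: "congruence A \<theta>" "few \<theta>" "\<theta> \<inter> \<alpha> \<subseteq> Id" using a.few_cases[OF ty[OF \<alpha>]] by blast
  show ?thesis
  proof (cases "\<theta> \<subseteq> Id")
    case True
    then show ?thesis using few_two[OF \<theta>(2,2)] by blast
  next
    case False
    \<comment> \<open>A proper pair of \<alpha> lies outside \<theta>, so \<theta> is not
      total.\<close>
    obtain x y where xy: "(x, y) \<in> \<alpha>" "x \<noteq> y" using a.ex_pair by blast
    then have "(x, y) \<notin> \<theta>" using \<theta>(3) by auto
    then have m: "minimal_congruence A \<theta>"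
      using minimal_congruence_three[OF three \<theta>(1) False] a.alpha_univ[OF xy(1)] by blast
    interpret b: three_pointed A X \<sigma> \<theta> by unfold_locales (use m three in auto)
    obtain \<theta>' where "few \<theta>'" "\<theta>' \<inter> \<theta> \<subseteq> Id" using b.few_cases[OF ty[OF m]] by blast
    then show ?thesis using few_two[OF \<theta>(2)] by (metis Int_commute)
  qed
qed

theorem (in finite_ualg) not_type_1_in_K_surj:
  assumes three: "card (univ A) = 3" and ty: "\<And>\<alpha>. minimal_congruence A \<alpha> \<Longrightarrow> tct_type A \<alpha> \<noteq> 1"
  shows "in_K_surj A"
proof -
  \<comment> \<open>The exponent is 8 for fixed preimages plus 3 for choosing the three
    preimages.\<close>
  have "surj_bound A (\<lambda>n. 1 * (n + 1) ^ 11)" unfolding surj_bound_def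
  proof (intro allI impI)
    fix X :: "('f, nat) ualg"
    assume X: "is_ualg X \<and> finite (univ X) \<and> same_signature X A"
    let ?n = "card (univ X)" and ?S = "univ A \<rightarrow>\<^sub>E univ X"
    have finS: "finite ?S" using fin X by (intro finite_PiE) auto
    have "surj_homs X A \<subseteq> (\<Union>\<sigma>\<in>?S. homs_at X A \<sigma>)"
    proof
      fix h assume h: "h \<in> surj_homs X A"
      then have "\<forall>a\<in>h ` univ X. \<exists>x\<in>univ X. h x = a" "h ` univ X = univ A"
        unfolding surj_homs_def by blast+
      then have "\<forall>a\<in>univ A. \<exists>x\<in>univ X. h x = a" by metis
      then obtain s where s: "\<forall>a\<in>univ A. s a \<in> univ X \<and> h (s a) = a" by metis
      then have "restrict s (univ A) \<in> ?S" "h \<in> homs_at X A (restrict s (univ A))"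
        using h by (auto simp: homs_at_def surj_homs_def)
      then show "h \<in> (\<Union>\<sigma>\<in>?S. homs_at X A \<sigma>)" by blast
    qed
    moreover have fH: "finite (homs_at X A \<sigma>)" "card (homs_at X A \<sigma>) \<le> (?n + 1) ^ 8" if "\<sigma> \<in> ?S" for \<sigma>
    proof -
      interpret pointed A X \<sigma> by unfold_locales (use X that in auto)
      show "finite (homs_at X A \<sigma>)" by (rule finite_H)
      show "card (homs_at X A \<sigma>) \<le> (?n + 1) ^ 8" by (rule homs_at_bound[OF three ty])
    qed
    ultimately have "card (surj_homs X A) \<le> card (\<Union>\<sigma>\<in>?S. homs_at X A \<sigma>)"
      by (intro card_mono) (use finS in auto)
    also have "\<dots> \<le> (\<Sum>\<sigma>\<in>?S. card (homs_at X A \<sigma>))" by (rule card_UN_le[OF finS])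
    also have "\<dots> \<le> card ?S * (?n + 1) ^ 8"
      using sum_bounded_above[of ?S "\<lambda>\<sigma>. card (homs_at X A \<sigma>)" "(?n + 1) ^ 8"] fH(2) by simp
    also have "card ?S = ?n ^ 3" using three fin by (simp add: card_PiE)
    also have "?n ^ 3 * (?n + 1) ^ 8 \<le> (?n + 1) ^ 3 * (?n + 1) ^ 8"
      by (intro mult_right_mono power_mono) auto
    also have "\<dots> = 1 * (?n + 1) ^ 11" by (simp flip: power_add)
    finally show "card (surj_homs X A) \<le> 1 * (?n + 1) ^ 11" .
  qed
  then show ?thesis unfolding in_K_surj_iff using ualg fin by blast
qed

section \<open>Enumeration by extending partial homomorphisms\<close>

text \<open>Partial maps from \<open>{..<n}\<close> to the algebra are lists of codes, where 0 means undefined.\<close>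

definition below :: "nat list \<Rightarrow> nat list \<Rightarrow> bool" where
  "below h g \<longleftrightarrow> length h = length g \<and> (\<forall>j<length h. h ! j \<noteq> 0 \<longrightarrow> g ! j = h ! j)"

lemma below_refl: "below h h"
  by (simp add: below_def)

lemma below_trans: "below h g \<Longrightarrow> below g k \<Longrightarrow> below h k"
  by (auto simp: below_def)

lemma below_antisym: "below h g \<Longrightarrow> below g h \<Longrightarrow> h = g"
proof (rule nth_equalityI)
  fix i assume "below h g" "below g h" "i < length h"
  then show "h ! i = g ! i" unfolding below_def by metis
qed (simp add: below_def)

lemma belowD: "below h g \<Longrightarrow> j < length h \<Longrightarrow> h ! j \<noteq> 0 \<Longrightarrow> g ! j = h ! j"
  by (simp add: below_def)

text \<open>A state pairs a partial map with a conflict flag, where 0 means that no conflict was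
  seen. Both components only grow, which makes the closure procedure monotone.\<close>

definition st_le :: "nat list \<times> nat \<Rightarrow> nat list \<times> nat \<Rightarrow> bool" where
  "st_le s s' \<longleftrightarrow> below (fst s) (fst s') \<and> snd s \<le> snd s'"

lemma st_le_refl: "st_le s s"
  by (simp add: st_le_def below_refl)

lemma st_le_trans: "st_le s t \<Longrightarrow> st_le t u \<Longrightarrow> st_le s u"
  unfolding st_le_def using below_trans by fastforce

lemma st_le_antisym: "st_le s t \<Longrightarrow> st_le t s \<Longrightarrow> s = t"
  unfolding st_le_def using below_antisym by (metis le_antisym prod.expand)

lemma st_le_fold:
  assumes "\<And>x s. st_le s (F x s)"
  shows "st_le s (fold F xs s)"
proof (induction xs arbitrary: s)
  case (Cons x xs)
  show ?case using st_le_trans[OF assms[of s x] Cons[of "F x s"]] by simp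
qed (simp add: st_le_refl)

text \<open>A chain of inflationary steps that returns to its start has moved nowhere on the way, by
  antisymmetry.\<close>

lemma st_le_fold_fixed:
  assumes "\<And>x s. st_le s (F x s)" "fold F xs s = s" "x \<in> set xs"
  shows "F x s = s"
  using assms(2,3)
proof (induction xs)
  case (Cons y ys)
  have "st_le (F y s) s" using st_le_fold[of F "F y s" ys] assms(1) Cons.prems(1) by simp
  then have y: "F y s = s" using st_le_antisym assms(1) by blast
  then show ?case using Cons by auto
qed simp

definition defined :: "nat list \<Rightarrow> nat" where
  "defined h = card {j. j < length h \<and> h ! j \<noteq> 0}"

lemma defined_le: "defined h \<le> length h"
  unfolding defined_def using card_mono[of "{..<length h}" "{j. j < length h \<and> h ! j \<noteq> 0}"] by auto

lemma defined_less:
  assumes "below h g" "h \<noteq> g"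
  shows "defined h < defined g"
proof -
  have len: "length h = length g" using assms by (simp add: below_def)
  have "{j. j < length h \<and> h ! j \<noteq> 0} \<subseteq> {j. j < length g \<and> g ! j \<noteq> 0}"
    using assms(1) by (auto simp: below_def)
  moreover have "\<exists>j<length h. h ! j \<noteq> g ! j" using assms(2) len nth_equalityI by blast
  then obtain j where "j < length h" "h ! j \<noteq> g ! j" by blast
  then have "h ! j = 0" "g ! j \<noteq> 0" "j < length g" using assms(1) len by (auto simp: below_def)
  ultimately have "{j. j < length h \<and> h ! j \<noteq> 0} \<subset> {j. j < length g \<and> g ! j \<noteq> 0}" by blast
  then show ?thesis unfolding defined_def by (rule psubset_card_mono[rotated]) simp
qed

text \<open>As long as the flag stays 0, a round that changes the state defines at least one new
  entry. At most \<open>length h\<close> rounds can do so, and one more round is certain to be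
  stationary.\<close>

lemma funpow_st_le_fixed:
  assumes infl: "\<And>s. st_le s (F s)" and "snd ((F ^^ Suc (length h)) (h, b)) = 0"
  shows "F ((F ^^ Suc (length h)) (h, b)) = (F ^^ Suc (length h)) (h, b)"
proof -
  let ?s = "\<lambda>m. (F ^^ m) (h, b)"
  have len: "length (fst (?s m)) = length h" for m
  proof (induction m)
    case (Suc m)
    then show ?case using infl[of "?s m"] by (simp add: st_le_def below_def)
  qed simp
  have "snd (?s m) = 0 \<Longrightarrow> F (?s m) = ?s m \<or> m \<le> defined (fst (?s m))" for m
  proof (induction m)
    case (Suc m)
    have le: "st_le (?s m) (?s (Suc m))" using infl by simp
    then have "snd (?s m) = 0" using Suc.prems by (simp add: st_le_def)
    from Suc.IH[OF this] show ?case
    proof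
      assume m: "m \<le> defined (fst (?s m))"
      show ?case
      proof (cases "?s m = ?s (Suc m)")
        case False
        then have "fst (?s m) \<noteq> fst (?s (Suc m))"
          using \<open>snd (?s m) = 0\<close> Suc.prems by (metis prod.expand)
        then have "defined (fst (?s m)) < defined (fst (?s (Suc m)))"
          using le by (intro defined_less) (simp_all add: st_le_def)
        then show ?thesis using m by simp
      qed simp
    qed simp
  qed simp
  from this[OF assms(2)] defined_le[of "fst (?s (Suc (length h)))"] len[of "Suc (length h)"]
  show ?thesis by linarith
qed

abbreviation tups :: "nat \<Rightarrow> nat \<Rightarrow> nat list list" where
  "tups n k \<equiv> product_lists (replicate k [0..<n])"

lemma set_tups: "set (tups n k) = tuples {..<n} k"
proof -
  have "list_all2 (\<lambda>x ys. x \<in> set ys) xs (replicate k [0..<n]) \<longleftrightarrow> length xs = k \<and> set xs \<subseteq> {..<n}" for xs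
  proof -
    have "set xs \<subseteq> {..<n} \<longleftrightarrow> (\<forall>i<length xs. xs ! i < n)" unfolding subset_iff
      by (metis in_set_conv_nth lessThan_iff)
    then show ?thesis by (auto simp: list_all2_conv_all_nth)
  qed
  then show ?thesis unfolding product_lists_set tuples_def by blast
qed

lemma distinct_product_lists: "\<forall>xs\<in>set xss. distinct xs \<Longrightarrow> distinct (product_lists xss)"
proof (induction xss)
  case (Cons xs xss)
  have "distinct (concat (map (\<lambda>x. map (Cons x) P) xs))" if "distinct xs" "distinct P" for P
    using that(1) by (induction xs) (use that(2) in \<open>auto simp: distinct_map\<close>)
  then show ?case using Cons by simp
qed simp

section \<open>The three-element algebra coded by 1, 2, 3\<close>

locale coded_algebra =
  fixes A :: "('f, 'a) ualg" and fs :: "'f list" and code :: "'a \<Rightarrow> nat" and dec :: "nat \<Rightarrow> 'a"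
  assumes ualg: "is_ualg A" and fs: "set fs = syms A"
    and code: "\<And>a. a \<in> univ A \<Longrightarrow> code a \<in> {1, 2, 3}" "\<And>a. a \<in> univ A \<Longrightarrow> dec (code a) = a"
    and dec: "\<And>v. v \<in> {1, 2, 3} \<Longrightarrow> dec v \<in> univ A" "\<And>v. v \<in> {1, 2, 3} \<Longrightarrow> code (dec v) = v"
begin

text \<open>An undefined argument, coded by 0, makes the value 0. One comparison with 0 therefore
  tells whether a partial map forces a value.\<close>

definition tab :: "'f \<Rightarrow> nat list \<Rightarrow> nat" where
  "tab f vs = (if vs \<in> tuples {1, 2, 3} (arity A f) then code (interp A f (map dec vs)) else 0)"

lemma univ_A: "univ A = dec ` {1, 2, 3}"
proof
  show "univ A \<subseteq> dec ` {1, 2, 3}" using code by (metis image_eqI subsetI)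
  show "dec ` {1, 2, 3} \<subseteq> univ A" using dec(1) by blast
qed

lemma finite_A: "finite (univ A)"
  by (simp add: univ_A)

lemma tab_val:
  assumes "f \<in> syms A" "vs \<in> tuples {1, 2, 3} (arity A f)"
  shows "tab f vs \<in> {1, 2, 3}" "dec (tab f vs) = interp A f (map dec vs)"
proof -
  have "map dec vs \<in> tuples (univ A) (arity A f)" using assms(2) dec by (auto simp: tuples_def)
  then have "interp A f (map dec vs) \<in> univ A" using ualg assms(1) by (simp add: is_ualg_def)
  then show "tab f vs \<in> {1, 2, 3}" "dec (tab f vs) = interp A f (map dec vs)"
    using assms(2) code by (simp_all add: tab_def)
qed

lemma tab_le: "f \<in> syms A \<Longrightarrow> tab f vs \<le> 3"
  using tab_val(1)[of f vs] by (cases "vs \<in> tuples {1, 2, 3} (arity A f)") (auto simp: tab_def)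

lemma tab_nonzero: "tab f vs \<noteq> 0 \<Longrightarrow> vs \<in> tuples {1, 2, 3} (arity A f)"
  by (simp add: tab_def split: if_splits)

end

section \<open>Closing a partial homomorphism under the operations\<close>

locale enumeration = coded_algebra A fs code dec
  for A :: "('f, 'a) ualg" and fs code dec +
  fixes X :: "('f, nat) ualg" and n :: nat
  assumes X: "is_ualg X" "univ X = {..<n}" "same_signature X A"
begin

abbreviation T where "T \<equiv> op_table X"

lemma T_eq: "f \<in> syms A \<Longrightarrow> xs \<in> tuples {..<n} (arity A f) \<Longrightarrow> T f xs = interp X f xs"
  using X by (simp add: op_table_def same_signature_def)

lemma T_less: "f \<in> syms A \<Longrightarrow> xs \<in> tuples {..<n} (arity A f) \<Longrightarrow> T f xs < n"
  using T_eq[of f xs] X unfolding is_ualg_def same_signature_def by force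

text \<open>One propagation of a forced value: it is written, confirmed, or found in conflict. The
  term \<open>1 + (snd s - 1)\<close> is the maximum of 1 and the flag, so a raised flag never
  falls, as \<open>st_le\<close> demands.\<close>

definition step :: "'f \<Rightarrow> nat list \<Rightarrow> nat list \<times> nat \<Rightarrow> nat list \<times> nat" where
  "step f xs s = (let h = fst s; y = T f xs; v = tab f (map ((!) h) xs) in
     if v = 0 then s else if h ! y = 0 then (h[y := v], snd s)
     else if h ! y = v then s else (h, 1 + (snd s - 1)))"

definition pass_list :: "('f \<times> nat list) list" where
  "pass_list = concat (map (\<lambda>f. map (Pair f) (tups n (arity A f))) fs)"

definition pass :: "nat list \<times> nat \<Rightarrow> nat list \<times> nat" where
  "pass = fold (\<lambda>(f, xs). step f xs) pass_list"

definition close :: "nat list \<times> nat \<Rightarrow> nat list \<times> nat" where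
  "close s = (pass ^^ Suc n) s"

text \<open>More than compatibility where everything is defined: the forced value must itself be
  present, so the domain is closed under the operations.\<close>

definition phom :: "nat list \<Rightarrow> bool" where
  "phom h \<longleftrightarrow> (\<forall>f\<in>syms A. \<forall>xs\<in>tuples {..<n} (arity A f). tab f (map ((!) h) xs) \<noteq> 0 \<longrightarrow>
     h ! T f xs = tab f (map ((!) h) xs))"

lemma set_pass_list: "(f, xs) \<in> set pass_list \<longleftrightarrow> f \<in> syms A \<and> xs \<in> tuples {..<n} (arity A f)"
  by (auto simp: pass_list_def set_tups fs)

lemma step_infl: "st_le s (step f xs s)"
proof -
  have "below h (h[y := v])" if "h ! y = 0" for h y and v :: nat
    using that by (cases "y < length h") (auto simp: below_def nth_list_update)
  then show ?thesis by (auto simp: st_le_def step_def Let_def below_refl)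
qed

lemma pass_infl: "st_le s (pass s)"
  unfolding pass_def by (rule st_le_fold) (auto simp: step_infl)

lemma close_infl: "st_le s (close s)"
proof -
  have "st_le s ((pass ^^ m) s)" for m
  proof (induction m)
    case (Suc m)
    show ?case using st_le_trans[OF Suc pass_infl] by simp
  qed (simp add: st_le_refl)
  then show ?thesis unfolding close_def .
qed

lemma tab_below:
  assumes "below h g" "length h = n" "xs \<in> tuples {..<n} k" "tab f (map ((!) h) xs) \<noteq> 0"
  shows "tab f (map ((!) g) xs) = tab f (map ((!) h) xs)"
proof -
  have "map ((!) h) xs \<in> tuples {1, 2, 3} (arity A f)" by (rule tab_nonzero[OF assms(4)])
  then have "h ! x \<noteq> 0" if "x \<in> set xs" for x using that by (auto simp: tuples_def)
  then have "map ((!) g) xs = map ((!) h) xs"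
    using assms(1-3) by (auto simp: below_def tuples_def)
  then show ?thesis by (rule arg_cong)
qed

text \<open>Every value forced from a part of g is the value of g there, because g is closed. So
  propagation below g neither leaves g nor meets a conflict, and closing loses no solution.\<close>

lemma step_below:
  assumes g: "phom g" "length g = n" and f: "f \<in> syms A" "xs \<in> tuples {..<n} (arity A f)"
    and h: "below h g"
  shows "snd (step f xs (h, 0)) = 0" "below (fst (step f xs (h, 0))) g"
proof -
  let ?v = "tab f (map ((!) h) xs)"
  have len: "length h = n" using g h by (simp add: below_def)
  have gv: "g ! T f xs = ?v" if "?v \<noteq> 0"
    using g(1) f tab_below[OF h len f(2) that] that unfolding phom_def by metis
  have y: "T f xs < n" by (rule T_less[OF f])
  have hv: "h ! T f xs = 0 \<or> h ! T f xs = ?v" if "?v \<noteq> 0"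
    using gv[OF that] belowD[OF h, of "T f xs"] y len by metis
  show "snd (step f xs (h, 0)) = 0"
  proof (cases "?v = 0")
    case False
    from hv[OF False] show ?thesis
    proof
      assume "h ! T f xs = 0"
      then show ?thesis by (simp add: step_def Let_def)
    next
      assume "h ! T f xs = ?v"
      then show ?thesis unfolding step_def Let_def fst_conv snd_conv using False by (smt (verit) snd_conv)
    qed
  qed (simp add: step_def)
  show "below (fst (step f xs (h, 0))) g"
  proof -
    have "below (h[T f xs := ?v]) g" if "?v \<noteq> 0"
      using h gv[OF that] y len unfolding below_def by (metis length_list_update nth_list_update)
    then show ?thesis using h unfolding step_def Let_def fst_conv snd_conv by simp
  qed
qed

lemma fold_step_below:
  assumes g: "phom g" "length g = n" and "set ps \<subseteq> set pass_list" "below h g"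
  shows "snd (fold (\<lambda>(f, xs). step f xs) ps (h, 0)) = 0 \<and> below (fst (fold (\<lambda>(f, xs). step f xs) ps (h, 0))) g"
  using assms(3,4)
proof (induction ps arbitrary: h)
  case (Cons p ps)
  obtain f xs where p: "p = (f, xs)" by (cases p)
  then have f: "f \<in> syms A" "xs \<in> tuples {..<n} (arity A f)" using Cons.prems set_pass_list by auto
  have s: "step f xs (h, 0) = (fst (step f xs (h, 0)), 0)" "below (fst (step f xs (h, 0))) g"
    using step_below[OF g f Cons.prems(2)] by (simp_all add: prod_eq_iff)
  have "snd (fold (\<lambda>(f, xs). step f xs) ps (fst (step f xs (h, 0)), 0)) = 0 \<and>
      below (fst (fold (\<lambda>(f, xs). step f xs) ps (fst (step f xs (h, 0)), 0))) g"
    by (rule Cons.IH) (use Cons.prems s in auto)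
  then show ?case using p s(1) by simp
qed simp

lemma close_below:
  assumes g: "phom g" "length g = n" and h: "below h g"
  shows "snd (close (h, 0)) = 0" "below (fst (close (h, 0))) g"
proof -
  have "snd ((pass ^^ m) (h, 0)) = 0 \<and> below (fst ((pass ^^ m) (h, 0))) g" for m
  proof (induction m)
    case (Suc m)
    then have eq: "(pass ^^ m) (h, 0) = (fst ((pass ^^ m) (h, 0)), 0)" by (simp add: prod_eq_iff)
    have "snd (pass (fst ((pass ^^ m) (h, 0)), 0)) = 0 \<and> below (fst (pass (fst ((pass ^^ m) (h, 0)), 0))) g"
      using fold_step_below[OF g subset_refl, of "fst ((pass ^^ m) (h, 0))"] Suc unfolding pass_def by blast
    then show ?case using eq by simp
  qed (use h in simp)
  then show "snd (close (h, 0)) = 0" "below (fst (close (h, 0))) g" unfolding close_def by blast+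
qed

text \<open>A flag that is still 0 after n + 1 passes certifies a fixed point. At a fixed point
  every single propagation is idle, which is what \<open>phom\<close> asks for.\<close>

lemma close_phom:
  assumes "length h = n" "close (h, b) = (h', 0)"
  shows "phom h'" "below h h'" "b = 0"
proof -
  have le: "below h h'" "b = 0" using close_infl[of "(h, b)"] assms(2) by (auto simp: st_le_def)
  then show "below h h'" "b = 0" .
  have "snd ((pass ^^ Suc (length h)) (h, b)) = 0" using assms by (simp add: close_def)
  from funpow_st_le_fixed[of pass, OF pass_infl this]
  have "pass (h', 0) = (h', 0)" using assms unfolding close_def by simp
  then have fixd: "step f xs (h', 0) = (h', 0)"
    if "f \<in> syms A" "xs \<in> tuples {..<n} (arity A f)" for f xs
    using st_le_fold_fixed[of "\<lambda>(f, xs). step f xs" pass_list "(h', 0)" "(f, xs)"] that set_pass_list step_infl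
    unfolding pass_def by auto
  have len: "length h' = n" using le assms(1) by (simp add: below_def)
  show "phom h'" unfolding phom_def
  proof (intro ballI impI)
    fix f xs assume f: "f \<in> syms A" "xs \<in> tuples {..<n} (arity A f)" and v: "tab f (map ((!) h') xs) \<noteq> 0"
    have y: "T f xs < length h'" using T_less[OF f] len by simp
    show "h' ! T f xs = tab f (map ((!) h') xs)"
      using fixd[OF f] v nth_list_update_eq[OF y, of "tab f (map ((!) h') xs)"]
      by (auto simp: step_def Let_def split: if_splits)
  qed
qed

definition valued :: "nat list \<Rightarrow> bool" where
  "valued h \<longleftrightarrow> length h = n \<and> set h \<subseteq> {0, 1, 2, 3}"

lemma valued_nth:
  assumes "valued h" "j < n" "h ! j \<noteq> 0"
  shows "h ! j \<in> {1, 2, 3}"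
proof -
  have "h ! j \<in> {0, 1, 2, 3}" using assms(1,2) nth_mem[of j h] unfolding valued_def by blast
  then show ?thesis using assms(3) by simp
qed

lemma step_valued:
  assumes "f \<in> syms A" "valued (fst s)"
  shows "valued (fst (step f xs s))"
proof -
  have "tab f vs \<in> {0, 1, 2, 3}" for vs using tab_val(1)[OF assms(1)] by (auto simp: tab_def)
  then have "valued ((fst s)[T f xs := tab f (map ((!) (fst s)) xs)])"
    using assms(2) unfolding valued_def by (simp only: length_list_update set_update_subsetI simp_thms)
  then show ?thesis using assms(2) by (simp add: step_def Let_def)
qed

lemma close_valued:
  assumes "valued h"
  shows "valued (fst (close (h, b)))"
proof -
  have fold: "valued (fst (fold (\<lambda>(f, xs). step f xs) ps s))" if "set ps \<subseteq> set pass_list" "valued (fst s)" for ps s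
    using that
  proof (induction ps arbitrary: s)
    case (Cons p ps)
    obtain f xs where p: "p = (f, xs)" by (cases p)
    then have "f \<in> syms A" using Cons.prems set_pass_list by auto
    then show ?case using Cons p step_valued by simp
  qed simp
  have "valued (fst ((pass ^^ m) (h, b)))" for m
    by (induction m) (use assms fold in \<open>auto simp: pass_def\<close>)
  then show ?thesis unfolding close_def .
qed

section \<open>Partial homomorphisms as homomorphisms of subalgebras, and their levels\<close>

definition decode :: "nat list \<Rightarrow> nat \<Rightarrow> 'a" where
  "decode g = restrict (\<lambda>x. dec (g ! x)) {..<n}"

definition total :: "nat list \<Rightarrow> bool" where
  "total g \<longleftrightarrow> length g = n \<and> set g \<subseteq> {1, 2, 3}"

lemma total_nth: "total g \<Longrightarrow> j < n \<Longrightarrow> g ! j \<in> {1, 2, 3}"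
  unfolding total_def using nth_mem[of j g] by blast

definition subalg :: "nat set \<Rightarrow> ('f, nat) ualg" where
  "subalg S = \<lparr>syms = syms X, arity = arity X, univ = S, interp = interp X\<rparr>"

lemma phom_on_domain:
  assumes "phom h" "valued h" "\<And>x. x \<in> S \<Longrightarrow> x < n \<and> h ! x \<noteq> 0" "f \<in> syms A" "xs \<in> tuples S (arity A f)"
  shows "h ! interp X f xs \<noteq> 0" "dec (h ! interp X f xs) = interp A f (map (\<lambda>x. dec (h ! x)) xs)"
proof -
  have xs: "xs \<in> tuples {..<n} (arity A f)" using assms(3,5) by (auto simp: tuples_def)
  have "h ! x \<in> {1, 2, 3}" if "x \<in> S" for x
    using valued_nth[OF assms(2)] assms(3)[OF that] by blast
  then have vs: "map ((!) h) xs \<in> tuples {1, 2, 3} (arity A f)" using assms(5) by (auto simp: tuples_def)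
  note t = tab_val[OF assms(4) vs]
  then have "h ! T f xs = tab f (map ((!) h) xs)" using assms(1,4) xs unfolding phom_def by force
  then show "h ! interp X f xs \<noteq> 0" "dec (h ! interp X f xs) = interp A f (map (\<lambda>x. dec (h ! x)) xs)"
    using t T_eq[OF assms(4) xs] by (auto simp: comp_def)
qed

lemma same_sig: "syms X = syms A" "f \<in> syms A \<Longrightarrow> arity X f = arity A f"
  using X(3) by (auto simp: same_signature_def)

text \<open>The list \<open>x\<close> holds the chosen preimages; codes start at 1 and list
  positions at 0, hence the shift.\<close>

definition based :: "nat list \<Rightarrow> nat list \<Rightarrow> bool" where
  "based x h \<longleftrightarrow> (\<forall>a\<in>{1, 2, 3}. h ! (x ! (a - 1)) = a)"

lemma restrict_phom_surj_hom:
  assumes h: "phom h" "valued h" "based x h" and x: "x \<in> tuples {..<n} 3"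
    and S: "\<And>j. j \<in> S \<Longrightarrow> j < n \<and> h ! j \<noteq> 0" "\<And>j. j \<in> set x \<Longrightarrow> j \<in> S" "is_ualg (subalg S)"
  shows "restrict (\<lambda>j. dec (h ! j)) S \<in> surj_homs (subalg S) A" (is "?r \<in> _")
proof -
  have val: "h ! j \<in> {1, 2, 3}" if "j \<in> S" for j
    using valued_nth[OF h(2)] S(1)[OF that] by blast
  have "?r \<in> univ (subalg S) \<rightarrow>\<^sub>E univ A" using val dec by (auto simp: subalg_def)
  moreover have "?r ` univ (subalg S) = univ A"
  proof
    show "?r ` univ (subalg S) \<subseteq> univ A" using val dec by (auto simp: subalg_def)
    show "univ A \<subseteq> ?r ` univ (subalg S)"
    proof
      fix a assume "a \<in> univ A"
      then have c: "code a \<in> {1, 2, 3}" "dec (code a) = a" using code by auto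
      let ?j = "x ! (code a - 1)"
      have "?j \<in> S" using c(1) x by (intro S(2) nth_mem) (auto simp: tuples_length)
      moreover have "h ! ?j = code a" using h(3) c(1) unfolding based_def by blast
      ultimately show "a \<in> ?r ` univ (subalg S)" using c(2) by (auto simp: subalg_def image_iff intro!: bexI[of _ ?j])
    qed
  qed
  moreover have "?r (interp (subalg S) f xs) = interp A f (map ?r xs)"
    if f: "f \<in> syms (subalg S)" and xs: "xs \<in> tuples (univ (subalg S)) (arity (subalg S) f)" for f xs
  proof -
    have f': "f \<in> syms A" "xs \<in> tuples S (arity A f)" using f xs same_sig by (auto simp: subalg_def)
    have "interp X f xs \<in> S" using S(3) f xs by (auto simp: is_ualg_def subalg_def)
    then have "?r (interp (subalg S) f xs) = dec (h ! interp X f xs)" by (simp add: subalg_def)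
    also have "\<dots> = interp A f (map (\<lambda>x. dec (h ! x)) xs)" using phom_on_domain(2)[OF h(1,2) S(1) f'] by blast
    also have "map (\<lambda>x. dec (h ! x)) xs = map ?r xs" using f'(2) by (auto simp: tuples_def)
    finally show ?thesis .
  qed
  ultimately show ?thesis unfolding surj_homs_def homs_def by blast
qed

text \<open>The counter v runs from 0, so the code is \<open>Suc v\<close>. The update overwrites
  position i, so a different value already present there has to be entered as a conflict
  beforehand.\<close>

definition extend :: "nat \<Rightarrow> nat list \<Rightarrow> nat \<Rightarrow> nat list list" where
  "extend i h v = (let s = close (h[i := Suc v], if h ! i \<noteq> 0 \<and> h ! i \<noteq> Suc v then 1 else 0) in
     if snd s = 0 then [fst s] else [])"

definition next_level :: "nat \<Rightarrow> nat list list \<Rightarrow> nat list list" where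
  "next_level i L = concat (map (\<lambda>h. concat (map (extend i h) [0..<3])) L)"

definition start :: "nat list \<Rightarrow> nat list" where
  "start x = (replicate n 0)[x ! 0 := 1, x ! 1 := 2, x ! 2 := 3]"

text \<open>In \<open>start\<close> the codes 1, 2, 3 are written in this order and later writes
  win. The third entry is therefore always intact, and the first two survive exactly if the three
  positions are distinct.\<close>

primrec level :: "nat list \<Rightarrow> nat \<Rightarrow> nat list list" where
  "level x 0 = (if start x ! (x ! 0) = 1 \<and> start x ! (x ! 1) = 2 then [start x] else [])"
| "level x (Suc i) = next_level i (level x i)"

text \<open>Together with \<open>based\<close> this singles out the triple of least preimages, so
  that a homomorphism reached from many triples is printed once.\<close>

definition canon :: "nat list \<Rightarrow> nat list \<Rightarrow> bool" where
  "canon x g \<longleftrightarrow> (\<forall>j<n. x ! (g ! j - 1) \<le> j)"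

definition result :: "nat list list" where
  "result = concat (map (\<lambda>x. filter (canon x) (level x n)) (tups n 3))"

lemma based_below: "based x h \<Longrightarrow> below h g \<Longrightarrow> x \<in> tuples {..<n} 3 \<Longrightarrow> length h = n \<Longrightarrow> based x g"
  unfolding based_def
proof
  fix a :: nat assume h: "\<forall>a\<in>{1, 2, 3}. h ! (x ! (a - 1)) = a" "below h g" "x \<in> tuples {..<n} 3" "length h = n"
    and a: "a \<in> {1, 2, 3}"
  have "x ! (a - 1) < n" using tuples_nth[OF h(3), of "a - 1"] a by auto
  moreover have "h ! (x ! (a - 1)) = a" "a \<noteq> 0" using h(1) a by auto
  ultimately show "g ! (x ! (a - 1)) = a" using h(2,4) by (simp add: below_def)
qed

lemma start_below:
  assumes "based x g" "x \<in> tuples {..<n} 3" "length g = n"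
  shows "below (start x) g" "start x ! (x ! 0) = 1 \<and> start x ! (x ! 1) = 2"
proof -
  have lt: "x ! 0 < n" "x ! 1 < n" "x ! 2 < n" using tuples_nth[OF assms(2)] by auto
  have g: "g ! (x ! 0) = 1" "g ! (x ! 1) = 2" "g ! (x ! 2) = 3" using assms(1) by (auto simp: based_def)
  show "below (start x) g" unfolding below_def start_def
    using lt g assms(3) by (auto simp: nth_list_update split: if_splits)
  have "x ! 0 \<noteq> x ! 1" "x ! 0 \<noteq> x ! 2" "x ! 1 \<noteq> x ! 2" using g by auto
  then show "start x ! (x ! 0) = 1 \<and> start x ! (x ! 1) = 2" using lt by (simp add: start_def)
qed

lemma extend_props:
  assumes h: "valued h" "based x h" "\<And>j. j < i \<Longrightarrow> h ! j \<noteq> 0" and i: "i < n" and x: "x \<in> tuples {..<n} 3"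
    and h': "h' \<in> set (extend i h v)" "v < 3"
  shows "valued h'" "based x h'" "\<And>j. j < Suc i \<Longrightarrow> h' ! j \<noteq> 0" "phom h'" "take (Suc i) h' = take i h @ [Suc v]" "below h h'"
proof -
  define b where "b = (if h ! i \<noteq> 0 \<and> h ! i \<noteq> Suc v then 1 else (0::nat))"
  have c: "close (h[i := Suc v], b) = (h', 0)"
    using h'(1) by (auto simp: extend_def Let_def b_def prod_eq_iff split: if_splits)
  have len: "length h = n" using h(1) by (simp add: valued_def)
  have v: "valued (h[i := Suc v])" using h(1) h'(2) set_update_subset_insert[of h i "Suc v"]
    by (fastforce simp: valued_def)
  note p = close_phom[OF _ c]
  have len': "length (h[i := Suc v]) = n" using len by simp
  show ph: "phom h'" by (rule p(1)[OF len'])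
  have b0: "b = 0" by (rule p(3)[OF len'])
  have bel: "below (h[i := Suc v]) h'" by (rule p(2)[OF len'])
  have hi: "below h (h[i := Suc v])" using b0 i len by (auto simp: below_def b_def nth_list_update split: if_splits)
  show hh: "below h h'" using hi bel below_trans by blast
  show "valued h'" using close_valued[OF v, of b] c by simp
  show "based x h'" using based_below[OF h(2) hh x len] .
  have lh': "length h' = n" using bel len by (simp add: below_def)
  have hij: "h' ! i = Suc v" using belowD[OF bel, of i] i len by simp
  have eqj: "h' ! j = h ! j" if "j < i" for j using belowD[OF hh, of j] h(3)[OF that] that i len by simp
  show "h' ! j \<noteq> 0" if "j < Suc i" for j using that hij eqj h(3) by (cases "j = i") auto
  show "take (Suc i) h' = take i h @ [Suc v]"
    by (rule nth_equalityI) (use i len lh' hij eqj in \<open>auto simp: nth_append less_Suc_eq\<close>)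
qed

text \<open>Distinctness is demanded of the prefixes of length i, since these positions lie in every
  domain and thus survive restriction to the common domain. Closedness starts with level 1 because
  \<open>start\<close> has not been closed yet.\<close>

definition level_inv :: "nat list \<Rightarrow> nat \<Rightarrow> nat list list \<Rightarrow> bool" where
  "level_inv x i L \<longleftrightarrow> distinct (map (take i) L) \<and>
     (\<forall>h\<in>set L. valued h \<and> based x h \<and> (\<forall>j<i. h ! j \<noteq> 0) \<and> (0 < i \<longrightarrow> phom h)) \<and>
     (\<forall>g. phom g \<and> total g \<and> based x g \<longrightarrow> (\<exists>h\<in>set L. below h g))"

text \<open>Two members of the next level differ in the new entry if they have the same parent, and
  in the prefix of the parents otherwise. A total solution g above h stays above the extension of h
  by the value of g at i.\<close>

lemma level_inv_level:
  assumes x: "x \<in> tuples {..<n} 3"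
  shows "i \<le> n \<Longrightarrow> level_inv x i (level x i)"
proof (induction i)
  case 0
  have lt: "x ! 0 < n" "x ! 1 < n" "x ! 2 < n" using tuples_nth[OF x] by auto
  have v: "valued (start x)"
  proof -
    have "set (start x) \<subseteq> {0, 1, 2, 3}"
    proof
      fix y assume "y \<in> set (start x)"
      then obtain j where "j < n" "y = start x ! j" by (auto simp: in_set_conv_nth start_def)
      then show "y \<in> {0, 1, 2, 3}" using lt by (auto simp: start_def nth_list_update)
    qed
    then show ?thesis by (simp add: valued_def start_def)
  qed
  show ?case
  proof (cases "start x ! (x ! 0) = 1 \<and> start x ! (x ! 1) = 2")
    case True
    have "start x ! (x ! 2) = 3" using lt by (simp add: start_def)
    then have "based x (start x)" using True by (simp add: based_def)
    then show ?thesis using True v start_below(1)[OF _ x] by (simp add: level_inv_def total_def)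
  next
    case False
    then have "\<not> based x g" if "total g" for g using start_below(2)[OF _ x] that unfolding total_def by blast
    moreover have "level x 0 = []" unfolding level.simps(1) using False by (rule if_not_P)
    ultimately show ?thesis unfolding level_inv_def by simp
  qed
next
  case (Suc i)
  let ?L = "level x i"
  have IH: "distinct (map (take i) ?L)"
    "\<And>h. h \<in> set ?L \<Longrightarrow> valued h" "\<And>h. h \<in> set ?L \<Longrightarrow> based x h" "\<And>h j. h \<in> set ?L \<Longrightarrow> j < i \<Longrightarrow> h ! j \<noteq> 0"
    "\<And>g. phom g \<Longrightarrow> total g \<Longrightarrow> based x g \<Longrightarrow> \<exists>h\<in>set ?L. below h g"
    using Suc unfolding level_inv_def by auto
  have i: "i < n" using Suc.prems by simp
  have props: "valued h'" "based x h'" "\<And>j. j < Suc i \<Longrightarrow> h' ! j \<noteq> 0" "phom h'" "take (Suc i) h' = take i h @ [Suc v]"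
    if "h \<in> set ?L" "h' \<in> set (extend i h v)" "v < 3" for h h' v
    using extend_props[OF IH(2)[OF that(1)] IH(3)[OF that(1)] IH(4)[OF that(1)] i x that(2,3)] by auto
  have short: "length (extend i h v) \<le> 1" for h v by (simp add: extend_def Let_def)
  have dist_h: "distinct (map (take (Suc i)) (concat (map (extend i h) vs)))"
    if h: "h \<in> set ?L" and vs: "distinct vs" "set vs \<subseteq> {..<3}" for h vs
    using vs
  proof (induction vs)
    case (Cons v vs)
    have "distinct (map (take (Suc i)) (extend i h v))"
      using short[of h v] by (cases "extend i h v") auto
    moreover have "take (Suc i) a \<noteq> take (Suc i) b"
      if "a \<in> set (extend i h v)" "b \<in> set (extend i h w)" "w \<in> set vs" for a b w
      using props(5)[OF h that(1)] props(5)[OF h that(2)] Cons.prems that(3) by auto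
    ultimately show ?case using Cons by fastforce
  qed simp
  have dist: "distinct (map (take (Suc i)) (concat (map (\<lambda>h. concat (map (extend i h) [0..<3])) L)))"
    if "distinct (map (take i) L)" "set L \<subseteq> set ?L" for L
    using that
  proof (induction L)
    case (Cons h L)
    have 1: "distinct (map (take (Suc i)) (concat (map (extend i h) [0..<3])))"
      by (rule dist_h) (use Cons.prems in auto)
    have 2: "distinct (map (take (Suc i)) (concat (map (\<lambda>h. concat (map (extend i h) [0..<3])) L)))"
      using Cons by simp
    have 3: "take (Suc i) a \<noteq> take (Suc i) b"
      if ab: "a \<in> set (concat (map (extend i h) [0..<3]))"
        "b \<in> set (concat (map (\<lambda>h. concat (map (extend i h) [0..<3])) L))" for a b
    proof -
      obtain v where v: "v < 3" "a \<in> set (extend i h v)" using ab(1) by auto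
      obtain k w where k: "k \<in> set L" "w < 3" "b \<in> set (extend i k w)" using ab(2) by auto
      have "take (Suc i) a = take i h @ [Suc v]" "take (Suc i) b = take i k @ [Suc w]"
        using props(5)[OF _ v(2,1)] props(5)[OF _ k(3,2)] Cons.prems k(1) by auto
      moreover have "take i h \<noteq> take i k" using Cons.prems(1) k(1) by auto
      ultimately show ?thesis by simp
    qed
    have "distinct (map (take (Suc i)) (concat (map (extend i h) [0..<3])) @
       map (take (Suc i)) (concat (map (\<lambda>h. concat (map (extend i h) [0..<3])) L)))"
      unfolding distinct_append using 1 2 3 by (auto simp del: set_concat)
    then show ?case by (simp del: upt_Suc)
  qed simp
  show ?case unfolding level_inv_def level.simps
  proof (intro conjI ballI allI impI)
    show "distinct (map (take (Suc i)) (next_level i ?L))" unfolding next_level_def by (rule dist[OF IH(1)]) simp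
  next
    fix h' assume "h' \<in> set (next_level i ?L)"
    then obtain h v where h: "h \<in> set ?L" "v < 3" "h' \<in> set (extend i h v)" by (auto simp: next_level_def)
    show "valued h'" "based x h'" "phom h'" using props[OF h(1,3,2)] by auto
    show "h' ! j \<noteq> 0" if "j < Suc i" for j using props(3)[OF h(1,3,2) that] .
  next
    fix g assume g: "phom g \<and> total g \<and> based x g"
    then obtain h where h: "h \<in> set ?L" "below h g" using IH(5) by blast
    have len: "length g = n" "length h = n" using g h(2) by (auto simp: total_def below_def)
    have "g ! i \<in> {1, 2, 3}" using total_nth[OF _ i] g by blast
    then obtain v where v: "g ! i = Suc v" "v < 3" by fastforce
    have b: "h ! i = 0 \<or> h ! i = Suc v" using belowD[OF h(2), of i] i len(2) v(1) by metis
    have bel: "below (h[i := Suc v]) g" using h(2) v i len by (auto simp: below_def nth_list_update)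
    note c = close_below[OF _ len(1) bel]
    have "extend i h v = [fst (close (h[i := Suc v], 0))]"
      using c(1) g b by (auto simp: extend_def Let_def)
    moreover have "below (fst (close (h[i := Suc v], 0))) g" using c(2) g by blast
    ultimately show "\<exists>h\<in>set (next_level i ?L). below h g"
      using h(1) v(2) by (intro bexI[of _ "fst (close (h[i := Suc v], 0))"])
        (auto simp: next_level_def intro!: bexI[of _ h] bexI[of _ v])
  qed
qed

text \<open>Restricting to the common domain, a subalgebra, turns the members of a level into distinct
  surjective homomorphisms.\<close>

lemma level_length:
  assumes x: "x \<in> tuples {..<n} 3" and i: "i \<le> n" and b: "surj_bound A b" "mono b"
  shows "length (level x i) \<le> b n + 1"
\<comment> \<open>Level 0 has at most one member and that one is not closed; the summand 1 of the
  bound accounts for it.\<close>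
proof (cases "i = 0 \<or> level x i = []")
  case True
  then show ?thesis by auto
next
  case False
  let ?L = "level x i"
  have inv: "distinct (map (take i) ?L)" "\<And>h. h \<in> set ?L \<Longrightarrow> valued h" "\<And>h. h \<in> set ?L \<Longrightarrow> based x h"
    "\<And>h j. h \<in> set ?L \<Longrightarrow> j < i \<Longrightarrow> h ! j \<noteq> 0" "\<And>h. h \<in> set ?L \<Longrightarrow> phom h"
    using level_inv_level[OF x i] False unfolding level_inv_def by auto
  \<comment> \<open>All domains are closed under the operations, hence so is S. It contains the
    triple, which keeps the restrictions surjective, and the first i positions, which keep them
    distinct.\<close>
  define S where "S = {j. j < n \<and> (\<forall>h\<in>set ?L. h ! j \<noteq> 0)}"
  have xS: "j \<in> S" if jx: "j \<in> set x" for j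
  proof -
    obtain k where k: "k < 3" "x ! k = j" using jx x unfolding in_set_conv_nth tuples_def by auto
    have "h ! j \<noteq> 0" if "h \<in> set ?L" for h
    proof -
      have "Suc k \<in> {1, 2, 3}" using k(1) by auto
      then have "h ! (x ! (Suc k - 1)) = Suc k" using inv(3)[OF that] unfolding based_def by blast
      then show ?thesis using k by simp
    qed
    moreover have "j < n" using jx x by (auto simp: tuples_def)
    ultimately show ?thesis by (simp add: S_def)
  qed
  have Sn: "S \<subseteq> {..<n}" by (auto simp: S_def)
  have x0: "x ! 0 \<in> set x" using x by (intro nth_mem) (simp add: tuples_length)
  have sub: "is_ualg (subalg S)" unfolding is_ualg_def
  proof (intro conjI ballI)
    show "univ (subalg S) \<noteq> {}" using xS[OF x0] by (auto simp: subalg_def)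
    fix f xs assume f: "f \<in> syms (subalg S)" and xs: "xs \<in> tuples (univ (subalg S)) (arity (subalg S) f)"
    then have f': "f \<in> syms A" "xs \<in> tuples S (arity A f)" using same_sig by (auto simp: subalg_def)
    have "interp X f xs < n"
      using T_less[OF f'(1)] T_eq[OF f'(1)] tuples_mono[OF Sn f'(2)] by metis
    moreover have "h ! interp X f xs \<noteq> 0" if "h \<in> set ?L" for h
      using phom_on_domain(1)[OF inv(5)[OF that] inv(2)[OF that] _ f'] that by (auto simp: S_def)
    ultimately show "interp (subalg S) f xs \<in> univ (subalg S)" by (simp add: S_def subalg_def)
  qed
  let ?r = "\<lambda>h. restrict (\<lambda>j. dec (h ! j)) S"
  have img: "?r ` set ?L \<subseteq> surj_homs (subalg S) A"
  proof clarify
    fix h assume h: "h \<in> set ?L"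
    show "?r h \<in> surj_homs (subalg S) A"
      by (rule restrict_phom_surj_hom[OF inv(5,2,3)[OF h] x _ xS sub]) (use h in \<open>auto simp: S_def\<close>)
  qed
  have inj: "inj_on ?r (set ?L)"
  proof (rule inj_onI)
    fix h g assume h: "h \<in> set ?L" "g \<in> set ?L" and eq: "?r h = ?r g"
    have len: "length h = n" "length g = n" using inv(2) h by (auto simp: valued_def)
    have "h ! j = g ! j" if "j < i" for j
    proof -
      have jS: "j \<in> S" using that i inv(4) by (auto simp: S_def)
      then have "dec (h ! j) = dec (g ! j)" using fun_cong[OF eq, of j] by simp
      moreover have "h ! j \<in> {1, 2, 3}" "g ! j \<in> {1, 2, 3}"
        using valued_nth inv(2,4) h that i by (metis less_le_trans)+
      ultimately show ?thesis using dec(2) by metis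
    qed
    then have "take i h = take i g" using len i by (intro nth_equalityI) auto
    then show "h = g" using inv(1) h by (auto simp: distinct_map dest: inj_onD)
  qed
  have "finite S" using Sn finite_subset by blast
  have "length ?L = card (set ?L)" using inv(1) distinct_card by (metis distinct_map)
  also have "\<dots> \<le> card (surj_homs (subalg S) A)"
    by (rule card_inj_on_le[OF inj img finite_surj_homs]) (use \<open>finite S\<close> finite_A in \<open>auto simp: subalg_def\<close>)
  also have "\<dots> \<le> b (card S)"
    using b(1) sub \<open>finite S\<close> X(3) unfolding surj_bound_def same_signature_def
    by (auto simp: subalg_def dest!: spec[of _ "subalg S"])
  also have "\<dots> \<le> b n" using b(2) card_mono[OF _ Sn] by (simp add: monoD)
  finally show ?thesis by simp
qed

lemma total_valued: "total g \<Longrightarrow> valued g"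
  by (auto simp: total_def valued_def)

lemma level_top:
  assumes x: "x \<in> tuples {..<n} 3" and n: "0 < n"
  shows "distinct (level x n)" "set (level x n) = {g. phom g \<and> total g \<and> based x g}"
proof -
  have inv: "distinct (map (take n) (level x n))" "\<And>h. h \<in> set (level x n) \<Longrightarrow> valued h"
    "\<And>h. h \<in> set (level x n) \<Longrightarrow> based x h" "\<And>h j. h \<in> set (level x n) \<Longrightarrow> j < n \<Longrightarrow> h ! j \<noteq> 0"
    "\<And>h. h \<in> set (level x n) \<Longrightarrow> phom h" "\<And>g. phom g \<Longrightarrow> total g \<Longrightarrow> based x g \<Longrightarrow> \<exists>h\<in>set (level x n). below h g"
    using level_inv_level[OF x, of n] n unfolding level_inv_def by auto
  show "distinct (level x n)" using inv(1) by (simp add: distinct_map)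
  have tot: "total h" if "h \<in> set (level x n)" for h
  proof -
    have "set h \<subseteq> {0, 1, 2, 3}" "length h = n" using inv(2)[OF that] by (auto simp: valued_def)
    moreover have "0 \<notin> set h" using inv(4)[OF that] calculation(2) by (auto simp: in_set_conv_nth)
    ultimately show ?thesis by (auto simp: total_def)
  qed
  show "set (level x n) = {g. phom g \<and> total g \<and> based x g}"
  proof (intro equalityI subsetI CollectI)
    fix g assume "g \<in> {g. phom g \<and> total g \<and> based x g}"
    then have g: "phom g" "total g" "based x g" by auto
    obtain h where h: "h \<in> set (level x n)" "below h g" using inv(6)[OF g] by blast
    have "h = g"
      by (rule nth_equalityI) (use h inv(4)[OF h(1)] g(2) in \<open>auto simp: below_def total_def\<close>)
    then show "g \<in> set (level x n)" using h by simp
  qed (use inv tot in auto)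
qed

text \<open>Each entry of one triple is a preimage of its code, so \<open>canon\<close> for the
  other triple bounds the corresponding entry from above; by symmetry they are equal.\<close>

lemma canon_unique:
  assumes "x \<in> tuples {..<n} 3" "y \<in> tuples {..<n} 3" "total g" "based x g" "based y g" "canon x g" "canon y g"
  shows "x = y"
proof (rule nth_equalityI)
  have le: "x ! i \<le> y ! i" if "i < 3" "x \<in> tuples {..<n} 3" "y \<in> tuples {..<n} 3" "based y g" "canon x g" for x y i
  proof -
    have "Suc i \<in> {1, 2, 3}" using that(1) by auto
    then have "g ! (y ! (Suc i - 1)) = Suc i" using that(4) unfolding based_def by blast
    moreover have "y ! i < n" using tuples_nth[OF that(3,1)] by simp
    ultimately show ?thesis using that(5) unfolding canon_def by fastforce
  qed
  fix i assume "i < length x"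
  then have "i < 3" using assms(1) by (simp add: tuples_length)
  then show "x ! i = y ! i" using le[of i x y] le[of i y x] assms by (simp add: le_antisym)
qed (use assms in \<open>simp add: tuples_length\<close>)

lemma n_pos: "0 < n"
  using X unfolding is_ualg_def by auto

lemma decode_surj_hom:
  assumes g: "phom g" "total g" "based x g" and x: "x \<in> tuples {..<n} 3"
  shows "decode g \<in> surj_homs X A"
proof -
  have eq: "subalg {..<n} = \<lparr>syms = syms X, arity = arity X, univ = univ X, interp = interp X\<rparr>"
    by (simp add: subalg_def X)
  have "is_ualg (subalg {..<n})" using X(1) unfolding eq is_ualg_def by simp
  then have "restrict (\<lambda>j. dec (g ! j)) {..<n} \<in> surj_homs (subalg {..<n}) A"
    using restrict_phom_surj_hom[OF g(1) total_valued[OF g(2)] g(3) x, of "{..<n}"] total_nth[OF g(2)] x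
    by (fastforce simp: tuples_def)
  then show ?thesis unfolding decode_def eq surj_homs_def homs_def by simp
qed

lemma encode_surj_hom:
  assumes h: "h \<in> surj_homs X A"
  defines "g \<equiv> map (\<lambda>j. code (h j)) [0..<n]"
  obtains x where "x \<in> tuples {..<n} 3" "phom g" "total g" "based x g" "canon x g" "decode g = h"
proof -
  have hv: "h j \<in> univ A" if "j < n" for j using h that X by (auto simp: surj_homs_def homs_def)
  have gj: "g ! j = code (h j)" if "j < n" for j using that by (simp add: g_def)
  have cv: "code (h j) \<in> {1, 2, 3}" if "j < n" for j using code(1)[OF hv[OF that]] .
  then have "set g \<subseteq> {1, 2, 3}" unfolding g_def set_map by (intro image_subsetI) simp
  then have tot: "total g" by (simp add: total_def g_def)
  have ph: "phom g" unfolding phom_def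
  proof (intro ballI impI)
    fix f xs assume f: "f \<in> syms A" and xs: "xs \<in> tuples {..<n} (arity A f)"
    have eq: "map ((!) g) xs = map (\<lambda>j. code (h j)) xs" using xs gj by (auto simp: tuples_def)
    have t: "map (\<lambda>j. code (h j)) xs \<in> tuples {1, 2, 3} (arity A f)" using xs hv code(1) by (fastforce simp: tuples_def)
    have "map dec (map (\<lambda>j. code (h j)) xs) = map h xs" using xs hv code(2) by (auto simp: tuples_def)
    then have "tab f (map ((!) g) xs) = code (interp A f (map h xs))" unfolding eq using t by (simp add: tab_def del: map_map)
    also have "interp A f (map h xs) = h (interp X f xs)"
      using h f xs X(2) same_sig by (auto simp: surj_homs_def homs_def)
    also have "code (h (interp X f xs)) = g ! T f xs" using gj[OF T_less[OF f xs]] T_eq[OF f xs] by simp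
    finally show "g ! T f xs = tab f (map ((!) g) xs)" by simp
  qed
  \<comment> \<open>Surjectivity provides a preimage of every code, and the least ones form the
    canonical triple.\<close>
  define l where "l a = (LEAST j. j < n \<and> g ! j = a)" for a
  have l: "l a < n \<and> g ! l a = a" if "a \<in> {1, 2, 3}" for a
  proof -
    have "dec a \<in> h ` univ X" using h dec(1)[OF that] by (simp add: surj_homs_def)
    then obtain j where "j < n" "h j = dec a" using X(2) by auto
    then have "j < n \<and> g ! j = a" using gj dec(2)[OF that] by simp
    then show ?thesis unfolding l_def by (rule LeastI)
  qed
  let ?x = "[l 1, l 2, l 3]"
  have x: "?x \<in> tuples {..<n} 3" using l by (auto simp: tuples_def)
  moreover have "based ?x g" using l by (auto simp: based_def)
  moreover have "canon ?x g" unfolding canon_def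
  proof (intro allI impI)
    fix j assume j: "j < n"
    have "?x ! (g ! j - 1) = l (g ! j)" using total_nth[OF tot j] by auto
    also have "\<dots> \<le> j" unfolding l_def using j by (intro Least_le) simp
    finally show "?x ! (g ! j - 1) \<le> j" .
  qed
  moreover have "decode g = h"
  proof
    fix j
    show "decode g j = h j"
    proof (cases "j < n")
      case True
      then show ?thesis using gj code(2) hv by (simp add: decode_def)
    next
      case False
      then show ?thesis using h X(2) by (auto simp: decode_def surj_homs_def homs_def PiE_def extensional_def)
    qed
  qed
  ultimately show ?thesis using that ph tot by blast
qed

lemma result_correct:
  "distinct (map decode result)" "set (map decode result) = surj_homs X A"
  "g \<in> set result \<Longrightarrow> map (\<lambda>x. code (decode g x)) [0..<n] = g"
proof -
  have mem: "g \<in> set result \<longleftrightarrow> (\<exists>x\<in>tuples {..<n} 3. phom g \<and> total g \<and> based x g \<and> canon x g)" for g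
    unfolding result_def using level_top(2)[OF _ n_pos] by (auto simp: set_tups)
  have code_dec: "map (\<lambda>x. code (decode g x)) [0..<n] = g" if "total g" for g
    by (rule nth_equalityI) (use that dec(2)[OF total_nth[OF that]] in \<open>auto simp: decode_def total_def\<close>)
  then show "g \<in> set result \<Longrightarrow> map (\<lambda>x. code (decode g x)) [0..<n] = g" using mem by blast
  have dist: "distinct (concat (map (\<lambda>x. filter (canon x) (level x n)) xs))"
    if "distinct xs" "set xs \<subseteq> tuples {..<n} 3" for xs
    using that
  proof (induction xs)
    case (Cons x xs)
    have "set (filter (canon x) (level x n)) \<inter> set (filter (canon y) (level y n)) = {}" if "y \<in> set xs" for y
      using level_top(2)[OF _ n_pos] canon_unique[of x y] Cons.prems that by fastforce
    then show ?case using Cons level_top(1)[OF _ n_pos] by fastforce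
  qed simp
  have "distinct (tups n 3)" by (rule distinct_product_lists) auto
  moreover have "set (tups n 3) \<subseteq> tuples {..<n} 3" unfolding set_tups by (rule subset_refl)
  ultimately have "distinct result" unfolding result_def by (rule dist)
  moreover have "inj_on decode (set result)"
  proof (rule inj_onI)
    fix g g' assume g: "g \<in> set result" "g' \<in> set result" "decode g = decode g'"
    then have t: "total g" "total g'" using mem by blast+
    from code_dec[OF t(1)] have "map (\<lambda>x. code (decode g' x)) [0..<n] = g" unfolding g(3) .
    then show "g = g'" using code_dec[OF t(2)] by (rule trans[OF sym])
  qed
  ultimately show "distinct (map decode result)" by (simp add: distinct_map)
  show "set (map decode result) = surj_homs X A"
  proof
    show "set (map decode result) \<subseteq> surj_homs X A" using mem decode_surj_hom by auto
    show "surj_homs X A \<subseteq> set (map decode result)"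
    proof
      fix h assume h: "h \<in> surj_homs X A"
      let ?g = "map (\<lambda>j. code (h j)) [0..<n]"
      obtain x where x: "x \<in> tuples {..<n} 3" "phom ?g" "total ?g" "based x ?g" "canon x ?g" "decode ?g = h"
        using encode_surj_hom[OF h] .
      then have "?g \<in> set result" using mem by blast
      then show "h \<in> set (map decode result)" using x(6) by (metis image_eqI list.set_map)
    qed
  qed
qed

end

section \<open>A program logic with time bounds\<close>

text \<open>Total correctness with an upper bound on time instead of the exact time, so that costs
  may be rounded up.\<close>

definition wp :: "('f \<Rightarrow> nat list \<Rightarrow> nat) \<Rightarrow> 'f com \<Rightarrow> nat \<Rightarrow> (state \<Rightarrow> bool) \<Rightarrow> state \<Rightarrow> bool" where
  "wp T c t Q s \<longleftrightarrow> (\<exists>t' s'. exec T c s t' s' \<and> t' \<le> t \<and> Q s')"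

lemma wp_mono: "wp T c t Q s \<Longrightarrow> (\<And>s'. Q s' \<Longrightarrow> Q' s') \<Longrightarrow> t \<le> t' \<Longrightarrow> wp T c t' Q' s"
  unfolding wp_def by (meson order_trans)

lemma wp_le: "wp T c t Q s \<Longrightarrow> t \<le> t' \<Longrightarrow> wp T c t' Q s"
  by (rule wp_mono)

lemma wp_Skip: "Q s \<Longrightarrow> wp T Skip 1 Q s"
  unfolding wp_def using exec.Skip by blast

lemma wp_Assign: "Q (s\<lparr>regs := (regs s)(r := eval_exp T s e)\<rparr>) \<Longrightarrow> wp T (Assign r e) (1 + exp_cost e) Q s"
  unfolding wp_def using exec.Assign by blast

lemma wp_Store: "Q (s\<lparr>arrays := (arrays s)(a := (arrays s a)(map (eval_exp T s) es := eval_exp T s e))\<rparr>) \<Longrightarrow>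
    wp T (Store a es e) (1 + sum_list (map exp_cost es) + exp_cost e) Q s"
  unfolding wp_def using exec.Store by blast

lemma wp_Output: "Q (s\<lparr>outp := outp s @ [eval_exp T s e]\<rparr>) \<Longrightarrow> wp T (Output e) (1 + exp_cost e) Q s"
  unfolding wp_def using exec.Output by blast

lemma wp_Seq: "wp T c1 t1 (\<lambda>s1. wp T c2 t2 Q s1) s \<Longrightarrow> wp T (Seq c1 c2) (t1 + t2) Q s"
  unfolding wp_def by (meson add_mono exec.Seq)

text \<open>Both branches are charged, an overestimate that avoids maxima in the cost
  expressions.\<close>

lemma wp_Cond:
  assumes "eval_exp T s b \<noteq> 0 \<Longrightarrow> wp T c1 t1 Q s" "eval_exp T s b = 0 \<Longrightarrow> wp T c2 t2 Q s"
  shows "wp T (Cond b c1 c2) (1 + exp_cost b + (t1 + t2)) Q s"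
proof (cases "eval_exp T s b = 0")
  case True
  then obtain t s' where "exec T c2 s t s'" "t \<le> t2" "Q s'" using assms(2) unfolding wp_def by blast
  then show ?thesis unfolding wp_def using exec.CondFalse[OF True] by fastforce
next
  case False
  then obtain t s' where "exec T c1 s t s'" "t \<le> t1" "Q s'" using assms(1) unfolding wp_def by blast
  then show ?thesis unfolding wp_def using exec.CondTrue[OF False] by fastforce
qed

text \<open>Truncated subtraction serves as the comparison: the guard vanishes once the counter
  reaches the bound.\<close>

definition For :: "nat \<Rightarrow> 'f exp \<Rightarrow> 'f com \<Rightarrow> 'f com" where
  "For r e c = Seq (Assign r (Num 0)) (While (Monus e (Reg r)) (Seq c (Assign r (Plus (Reg r) (Num 1)))))"

text \<open>One round costs c + 3 for the loop test, t for the body and 4 for the increment. The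
  remaining c + 5 are the last test and the initial assignment.\<close>

definition for_cost :: "nat \<Rightarrow> nat \<Rightarrow> nat \<Rightarrow> nat" where
  "for_cost m c t = m * (t + c + 7) + c + 5"

lemma wp_For:
  fixes T :: "'f \<Rightarrow> nat list \<Rightarrow> nat"
  assumes I0: "I 0 (s\<lparr>regs := (regs s)(r := 0)\<rparr>)"
    and bound: "\<And>i s'. I i s' \<Longrightarrow> eval_exp T s' e = N"
    and body: "\<And>i s'. i < N \<Longrightarrow> I i s' \<Longrightarrow> regs s' r = i \<Longrightarrow>
       wp T c t (\<lambda>s''. regs s'' r = i \<and> I (Suc i) (s''\<lparr>regs := (regs s'')(r := Suc i)\<rparr>)) s'"
    and Q: "\<And>s'. I N s' \<Longrightarrow> regs s' r = N \<Longrightarrow> Q s'"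
  shows "wp T (For r e c) (for_cost N (exp_cost e) t) Q s"
proof -
  let ?W = "While (Monus e (Reg r)) (Seq c (Assign r (Plus (Reg r) (Num 1))))"
  have loop: "i + m = N \<Longrightarrow> I i s' \<Longrightarrow> regs s' r = i \<Longrightarrow>
      wp T ?W (m * (t + exp_cost e + 7) + exp_cost e + 3) Q s'" for m i s'
  proof (induction m arbitrary: i s')
    case 0
    then have "exec T ?W s' (1 + exp_cost (Monus e (Reg r))) s'"
      by (intro exec.WhileFalse) (use bound[OF 0(2)] in simp)
    moreover have "Q s'" using 0 Q by simp
    ultimately show ?case unfolding wp_def by fastforce
  next
    case (Suc m)
    obtain t1 s1 where s1: "exec T c s' t1 s1" "t1 \<le> t" "regs s1 r = i"
      "I (Suc i) (s1\<lparr>regs := (regs s1)(r := Suc i)\<rparr>)"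
      using body[OF _ Suc.prems(2,3)] Suc.prems(1) unfolding wp_def by auto
    let ?s2 = "s1\<lparr>regs := (regs s1)(r := Suc i)\<rparr>"
    have a: "exec T (Assign r (Plus (Reg r) (Num 1))) s1 4 ?s2"
      using exec.Assign[of T r "Plus (Reg r) (Num 1)" s1] s1(3) by (simp add: eval_nat_numeral)
    have "wp T ?W (m * (t + exp_cost e + 7) + exp_cost e + 3) Q ?s2"
      by (rule Suc.IH[OF _ s1(4)]) (use Suc.prems in auto)
    then obtain t2 s3 where s3: "exec T ?W ?s2 t2 s3" "t2 \<le> m * (t + exp_cost e + 7) + exp_cost e + 3" "Q s3"
      unfolding wp_def by blast
    have "exec T ?W s' (1 + exp_cost (Monus e (Reg r)) + (t1 + 4) + t2) s3"
      by (rule exec.WhileTrue[OF _ exec.Seq[OF s1(1) a] s3(1)])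
        (use bound[OF Suc.prems(2)] Suc.prems in simp)
    moreover have "1 + exp_cost (Monus e (Reg r)) + (t1 + 4) + t2 \<le>
        Suc m * (t + exp_cost e + 7) + exp_cost e + 3" using s1(2) s3(2) by simp
    ultimately show ?case unfolding wp_def using s3(3) by blast
  qed
  have "wp T (For r e c) (1 + exp_cost (Num 0 :: 'f exp) + (N * (t + exp_cost e + 7) + exp_cost e + 3)) Q s"
    unfolding For_def by (rule wp_Seq, rule wp_Assign, rule loop[of 0]) (use I0 in auto)
  then show ?thesis by (rule wp_le) (simp add: for_cost_def)
qed

text \<open>R and B are the registers and arrays that may change. The output is left out, because
  each rule describes it explicitly.\<close>

definition frame :: "nat set \<Rightarrow> nat set \<Rightarrow> state \<Rightarrow> state \<Rightarrow> bool" where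
  "frame R B s s' \<longleftrightarrow> (\<forall>r. r \<notin> R \<longrightarrow> regs s' r = regs s r) \<and> (\<forall>a. a \<notin> B \<longrightarrow> arrays s' a = arrays s a)"

lemma frame_refl: "frame R B s s"
  by (simp add: frame_def)

lemma frame_trans: "frame R B s s' \<Longrightarrow> frame R B s' s'' \<Longrightarrow> frame R B s s''"
  by (simp add: frame_def)

lemma frame_mono: "frame R B s s' \<Longrightarrow> R \<subseteq> R' \<Longrightarrow> B \<subseteq> B' \<Longrightarrow> frame R' B' s s'"
  unfolding frame_def by blast

lemma frame_regs: "frame R B s s' \<Longrightarrow> r \<in> R \<Longrightarrow> frame R B s (s'\<lparr>regs := (regs s')(r := v)\<rparr>)"
  by (auto simp: frame_def)

lemma frame_arrays: "frame R B s s' \<Longrightarrow> a \<in> B \<Longrightarrow> frame R B s (s'\<lparr>arrays := (arrays s')(a := v)\<rparr>)"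
  by (auto simp: frame_def)

lemma frame_outp: "frame R B s s' \<Longrightarrow> frame R B s (s'\<lparr>outp := v\<rparr>)"
  by (simp add: frame_def)

lemma frameD: "frame R B s s' \<Longrightarrow> r \<notin> R \<Longrightarrow> regs s' r = regs s r"
  "frame R B s s' \<Longrightarrow> a \<notin> B \<Longrightarrow> arrays s' a = arrays s a"
  by (auto simp: frame_def)

text \<open>Loops over the registers from b upwards, the first coordinate outermost; this is the
  lexicographic order of \<open>product_lists\<close>.\<close>

primrec nest :: "nat \<Rightarrow> nat \<Rightarrow> 'f com \<Rightarrow> 'f com" where
  "nest b 0 c = c"
| "nest b (Suc k) c = For b (Reg 0) (nest (Suc b) k c)"

primrec nest_cost :: "nat \<Rightarrow> nat \<Rightarrow> nat \<Rightarrow> nat" where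
  "nest_cost n 0 t = t"
| "nest_cost n (Suc k) t = for_cost n 1 (nest_cost n k t)"

text \<open>The abstraction \<open>st\<close> extracts from the machine state the value that is
  folded over the tuples. In the induction the counter of the outer loop becomes part of the
  invariant of the inner loops.\<close>

lemma wp_nest:
  fixes T :: "'f \<Rightarrow> nat list \<Rightarrow> nat"
  assumes "0 < b" and inv0: "\<And>s. Inv s \<Longrightarrow> regs s 0 = n"
    and insens: "\<And>s r v. b \<le> r \<Longrightarrow> r < b + k \<Longrightarrow> Inv s \<Longrightarrow>
      Inv (s\<lparr>regs := (regs s)(r := v)\<rparr>) \<and> st (s\<lparr>regs := (regs s)(r := v)\<rparr>) = st s"
    and body: "\<And>s xs. Inv s \<Longrightarrow> xs \<in> tuples {..<n} k \<Longrightarrow> (\<And>j. j < k \<Longrightarrow> regs s (b + j) = xs ! j) \<Longrightarrow>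
      wp T c t (\<lambda>s'. Inv s' \<and> st s' = f xs (st s) \<and> (\<forall>j<k. regs s' (b + j) = regs s (b + j))) s"
    and "Inv s"
  shows "wp T (nest b k c) (nest_cost n k t) (\<lambda>s'. Inv s' \<and> st s' = fold f (tups n k) (st s)) s"
  using assms
proof (induction k arbitrary: b Inv f s)
  case 0
  then show ?case
    by (simp, intro wp_mono[OF "0.prems"(4)[of s "[]"]]) (auto simp: tuples_Nil)
next
  case (Suc k)
  note inv0 = Suc.prems(2) and insens = Suc.prems(3) and body = Suc.prems(4)
  have ins: "Inv (s\<lparr>regs := (regs s)(b := v)\<rparr>)" "st (s\<lparr>regs := (regs s)(b := v)\<rparr>) = st s" if "Inv s" for s v
    by (rule conjunct1[OF insens] conjunct2[OF insens]; use that in simp)+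
  let ?P = "\<lambda>i. concat (map (\<lambda>i. map (Cons i) (tups n k)) [0..<i])"
  have "wp T (For b (Reg 0) (nest (Suc b) k c)) (for_cost n (exp_cost (Reg 0 :: 'f exp)) (nest_cost n k t))
      (\<lambda>s'. Inv s' \<and> st s' = fold f (?P n) (st s)) s"
  proof (rule wp_For[where I = "\<lambda>i s'. Inv s' \<and> st s' = fold f (?P i) (st s)"])
    show "Inv (s\<lparr>regs := (regs s)(b := 0)\<rparr>) \<and> st (s\<lparr>regs := (regs s)(b := 0)\<rparr>) = fold f (?P 0) (st s)"
      using ins[OF Suc.prems(5)] by (auto simp del: fun_upd_apply)
  next
    fix i s' assume i: "i < n" and I: "Inv s' \<and> st s' = fold f (?P i) (st s)" and r: "regs s' b = i"
    have "wp T (nest (Suc b) k c) (nest_cost n k t)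
        (\<lambda>s''. (Inv s'' \<and> regs s'' b = i) \<and> st s'' = fold (\<lambda>xs. f (i # xs)) (tups n k) (st s')) s'"
    proof (rule Suc.IH)
      fix s and xs assume s: "Inv s \<and> regs s b = i" and xs: "xs \<in> tuples {..<n} k"
        and j: "\<And>j. j < k \<Longrightarrow> regs s (Suc b + j) = xs ! j"
      have "wp T c t (\<lambda>s'. Inv s' \<and> st s' = f (i # xs) (st s) \<and> (\<forall>j<Suc k. regs s' (b + j) = regs s (b + j))) s"
      proof (rule body)
        show "i # xs \<in> tuples {..<n} (Suc k)" using i xs by (simp add: tuples_Cons)
        show "regs s (b + j) = (i # xs) ! j" if "j < Suc k" for j
          using that s assms(3) j by (cases j) auto
      qed (use s in blast)
      then show "wp T c t (\<lambda>s'. (Inv s' \<and> regs s' b = i) \<and> st s' = f (i # xs) (st s) \<and>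
          (\<forall>j<k. regs s' (Suc b + j) = regs s (Suc b + j))) s"
      proof (rule wp_mono)
        fix s' assume s': "Inv s' \<and> st s' = f (i # xs) (st s) \<and> (\<forall>j<Suc k. regs s' (b + j) = regs s (b + j))"
        then have "regs s' (b + 0) = regs s (b + 0)" "\<forall>j<k. regs s' (b + Suc j) = regs s (b + Suc j)" by blast+
        then show "(Inv s' \<and> regs s' b = i) \<and> st s' = f (i # xs) (st s) \<and>
          (\<forall>j<k. regs s' (Suc b + j) = regs s (Suc b + j))" using s s' by simp
      qed simp
    qed (use inv0 insens I r in auto)
    then show "wp T (nest (Suc b) k c) (nest_cost n k t) (\<lambda>s''. regs s'' b = i \<and>
        Inv (s''\<lparr>regs := (regs s'')(b := Suc i)\<rparr>) \<and>
        st (s''\<lparr>regs := (regs s'')(b := Suc i)\<rparr>) = fold f (?P (Suc i)) (st s)) s'"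
    proof (rule wp_mono)
      fix s'' assume s'': "(Inv s'' \<and> regs s'' b = i) \<and> st s'' = fold (\<lambda>xs. f (i # xs)) (tups n k) (st s')"
      have "fold (\<lambda>xs. f (i # xs)) (tups n k) = fold f (map (Cons i) (tups n k))"
        by (simp add: fold_map comp_def)
      then show "regs s'' b = i \<and> Inv (s''\<lparr>regs := (regs s'')(b := Suc i)\<rparr>) \<and>
        st (s''\<lparr>regs := (regs s'')(b := Suc i)\<rparr>) = fold f (?P (Suc i)) (st s)"
        using ins[of s'' "Suc i"] s'' I by (auto simp del: fun_upd_apply)
    qed simp
  qed (use inv0 in auto)
  then show ?case by simp
qed

section \<open>The enumeration program\<close>

text \<open>The distance of the two values, as one of the truncated differences is always 0.\<close>

definition neq :: "'f exp \<Rightarrow> 'f exp \<Rightarrow> 'f exp" where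
  "neq e e' = Plus (Monus e e') (Monus e' e)"

lemma eval_neq: "eval_exp T s (neq e e') = 0 \<longleftrightarrow> eval_exp T s e = eval_exp T s e'"
  by (auto simp: neq_def)

primrec mismatch :: "'f exp list \<Rightarrow> nat list \<Rightarrow> 'f exp" where
  "mismatch es [] = Num 0"
| "mismatch es (v # vs) = Plus (neq (hd es) (Num v)) (mismatch (tl es) vs)"

lemma eval_mismatch:
  "length es = length vs \<Longrightarrow> eval_exp T s (mismatch es vs) = 0 \<longleftrightarrow> map (eval_exp T s) es = vs"
  by (induction es vs rule: list_induct2) (auto simp: eval_neq)

section \<open>The program and its cost\<close>

context coded_algebra
begin

text \<open>The operation tables of the fixed algebra are expressions: the summand of \<open>vs\<close> is cut down to
  zero by truncated subtraction unless the arguments are \<open>vs\<close>.\<close>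

definition tab_exp :: "'f \<Rightarrow> 'f exp list \<Rightarrow> 'f exp" where
  "tab_exp f es = foldr (\<lambda>vs. Plus (Monus (Num (code (interp A f (map dec vs))))
     (Plus (mismatch es vs) (Plus (mismatch es vs) (mismatch es vs)))))
     (product_lists (replicate (arity A f) [1, 2, 3])) (Num 0)"

text \<open>Codes are at most 3 and a mismatch is at least 1, so subtracting it three times removes
  every summand except that of the actual arguments.\<close>

lemma eval_tab_exp:
  assumes f: "f \<in> syms A" and es: "length es = arity A f"
  shows "eval_exp T s (tab_exp f es) = tab f (map (eval_exp T s) es)"
proof -
  let ?ws = "map (eval_exp T s) es" and ?c = "\<lambda>vs. code (interp A f (map dec vs))"
  let ?F = "\<lambda>vs. Plus (Monus (Num (?c vs)) (Plus (mismatch es vs) (Plus (mismatch es vs) (mismatch es vs))))"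
  have sum: "eval_exp T s (foldr ?F Vs (Num 0)) = (if ?ws \<in> set Vs then ?c ?ws else 0)"
    if "distinct Vs" "set Vs \<subseteq> tuples {1, 2, 3} (arity A f)" for Vs
    using that
  proof (induction Vs)
    case (Cons vs Vs)
    have vs: "vs \<in> tuples {1, 2, 3} (arity A f)" using Cons.prems by simp
    have c: "?c vs \<le> 3" using tab_le[OF f, of vs] vs by (simp add: tab_def)
    have m: "eval_exp T s (mismatch es vs) = 0 \<longleftrightarrow> ?ws = vs"
      by (rule eval_mismatch) (use es vs in \<open>simp add: tuples_length\<close>)
    have IH: "eval_exp T s (foldr ?F Vs (Num 0)) = (if ?ws \<in> set Vs then ?c ?ws else 0)" using Cons by simp
    show ?case
    proof (cases "?ws = vs")
      case True
      then have "?ws \<notin> set Vs" using Cons.prems by simp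
      then show ?thesis using IH m True by simp
    next
      case False
      then have "1 \<le> eval_exp T s (mismatch es vs)" using m by simp
      then show ?thesis using IH False c by simp
    qed
  qed simp
  let ?Vs = "product_lists (replicate (arity A f) [1, 2, 3::nat])"
  have set: "set ?Vs = tuples {1, 2, 3} (arity A f)"
  proof -
    have "list_all2 (\<lambda>x ys. x \<in> set ys) xs (replicate k [1, 2, 3::nat]) \<longleftrightarrow> xs \<in> tuples {1, 2, 3} k" for xs k
    proof -
      have "set xs \<subseteq> {1, 2, 3::nat} \<longleftrightarrow> (\<forall>i<length xs. xs ! i \<in> {1, 2, 3})" unfolding subset_iff
        by (metis in_set_conv_nth)
      then show ?thesis by (auto simp: list_all2_conv_all_nth tuples_def)
    qed
    then show ?thesis unfolding product_lists_set by blast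
  qed
  have "distinct ?Vs" by (rule distinct_product_lists) auto
  from sum[OF this] show ?thesis unfolding tab_exp_def tab_def set by simp
qed

text \<open>Register layout: 0 holds n, 1 the level, 2 the index of a member, 3 and 4 the sizes of
  the current and the next level, 5 the value tried, 6 a position, 7 the pass, 8 and 9 the target
  and value of a step, 10 the conflict flag, 11 the canonicity flag, 12 to 14 the triple, 20 onwards
  the arguments. Array 1 holds the current map, array 2 the levels by level, member and position,
  array 4 the triple by code.\<close>

definition arg_regs :: "'f \<Rightarrow> nat list" where
  "arg_regs f = [20..<20 + arity A f]"

definition step_com :: "'f \<Rightarrow> 'f com" where
  "step_com f = Seq (Assign 8 (Lookup f (map Reg (arg_regs f))))
    (Seq (Assign 9 (tab_exp f (map (\<lambda>r. Read 1 [Reg r]) (arg_regs f))))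
    (Cond (Reg 9) (Cond (Read 1 [Reg 8])
        (Cond (neq (Read 1 [Reg 8]) (Reg 9)) (Assign 10 (Plus (Num 1) (Monus (Reg 10) (Num 1)))) Skip)
        (Store 1 [Reg 8] (Reg 9)))
      Skip))"

definition step_cost :: "'f \<Rightarrow> nat" where
  "step_cost f = exp_cost (Lookup f (map Reg (arg_regs f))) +
     exp_cost (tab_exp f (map (\<lambda>r. Read 1 [Reg r]) (arg_regs f))) + 40"

definition pass_com :: "'f com" where
  "pass_com = foldr (\<lambda>f. Seq (nest 20 (arity A f) (step_com f))) fs Skip"

definition pass_cost :: "nat \<Rightarrow> nat" where
  "pass_cost n = (\<Sum>f\<leftarrow>fs. nest_cost n (arity A f) (step_cost f)) + 1"

definition close_com :: "'f com" where
  "close_com = For 7 (Plus (Reg 0) (Num 1)) pass_com"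

definition close_cost :: "nat \<Rightarrow> nat" where
  "close_cost n = for_cost (Suc n) 3 (pass_cost n)"

definition extend_com :: "'f com" where
  "extend_com = Seq (For 6 (Reg 0) (Store 1 [Reg 6] (Read 2 [Reg 1, Reg 2, Reg 6])))
    (Seq (Assign 10 (Num 0))
    (Seq (Cond (Read 1 [Reg 1])
        (Cond (neq (Read 1 [Reg 1]) (Plus (Reg 5) (Num 1))) (Assign 10 (Num 1)) Skip) Skip)
    (Seq (Store 1 [Reg 1] (Plus (Reg 5) (Num 1)))
    (Seq close_com
    (Cond (Reg 10) Skip
      (Seq (For 6 (Reg 0) (Store 2 [Plus (Reg 1) (Num 1), Reg 4, Reg 6] (Read 1 [Reg 6])))
        (Assign 4 (Plus (Reg 4) (Num 1)))))))))"

definition extend_cost :: "nat \<Rightarrow> nat" where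
  "extend_cost n = close_cost n + 2 * for_cost n 1 20 + 100"

definition level_com :: "'f com" where
  "level_com = Seq (Assign 4 (Num 0)) (Seq (For 2 (Reg 3) (For 5 (Num 3) extend_com)) (Assign 3 (Reg 4)))"

definition level_cost :: "nat \<Rightarrow> nat \<Rightarrow> nat" where
  "level_cost P n = for_cost P 1 (for_cost 3 1 (extend_cost n)) + 10"

text \<open>Register 0 doubles as the index of the last level. The difference in the first loop is
  positive exactly if position j precedes the chosen preimage of its value, a violation of
  \<open>canon\<close>.\<close>

definition final_com :: "'f com" where
  "final_com = Seq (Assign 11 (Num 0))
    (Seq (For 6 (Reg 0) (Cond (Monus (Read 4 [Read 2 [Reg 0, Reg 2, Reg 6]]) (Reg 6)) (Assign 11 (Num 1)) Skip))
    (Cond (Reg 11) Skip (For 6 (Reg 0) (Output (Read 2 [Reg 0, Reg 2, Reg 6])))))"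

definition final_cost :: "nat \<Rightarrow> nat" where
  "final_cost n = 2 * for_cost n 1 20 + 20"

text \<open>Register 3 receives the size of level 0: 1 minus the total distance is 1 if the first
  two codes survived and truncates to 0 otherwise.\<close>

definition init_com :: "'f com" where
  "init_com = Seq (Store 4 [Num 1] (Reg 12)) (Seq (Store 4 [Num 2] (Reg 13)) (Seq (Store 4 [Num 3] (Reg 14))
    (Seq (For 6 (Reg 0) (Store 2 [Num 0, Num 0, Reg 6] (Num 0)))
    (Seq (Store 2 [Num 0, Num 0, Reg 12] (Num 1)) (Seq (Store 2 [Num 0, Num 0, Reg 13] (Num 2))
    (Seq (Store 2 [Num 0, Num 0, Reg 14] (Num 3))
    (Assign 3 (Monus (Num 1) (Plus (neq (Read 2 [Num 0, Num 0, Reg 12]) (Num 1))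
      (neq (Read 2 [Num 0, Num 0, Reg 13]) (Num 2)))))))))))"

definition init_cost :: "nat \<Rightarrow> nat" where
  "init_cost n = for_cost n 1 20 + 100"

definition triple_com :: "'f com" where
  "triple_com = Seq init_com (Seq (For 1 (Reg 0) level_com) (For 2 (Reg 3) final_com))"

definition triple_cost :: "nat \<Rightarrow> nat \<Rightarrow> nat" where
  "triple_cost P n = init_cost n + (for_cost n 1 (level_cost P n) + for_cost P 1 (final_cost n))"

definition enum_com :: "'f com" where
  "enum_com = nest 12 3 triple_com"

definition enum_cost :: "nat \<Rightarrow> nat \<Rightarrow> nat" where
  "enum_cost P n = nest_cost n 3 (triple_cost P n)"

end

section \<open>Verification of the program against the list functions\<close>

definition hvec :: "nat \<Rightarrow> state \<Rightarrow> nat list" where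
  "hvec n s = map (\<lambda>j. arrays s 1 [j]) [0..<n]"

definition lvec :: "nat \<Rightarrow> state \<Rightarrow> nat \<Rightarrow> nat \<Rightarrow> nat list" where
  "lvec n s i k = map (\<lambda>j. arrays s 2 [i, k, j]) [0..<n]"

lemma lvec_cong: "arrays s 2 = arrays s' 2 \<Longrightarrow> lvec n s i k = lvec n s' i k"
  by (simp add: lvec_def)

lemma hvec_nth: "j < n \<Longrightarrow> hvec n s ! j = arrays s 1 [j]"
  by (simp add: hvec_def)

lemma lvec_nth: "j < n \<Longrightarrow> lvec n s i k ! j = arrays s 2 [i, k, j]"
  by (simp add: lvec_def)

lemma hvec_length [simp]: "length (hvec n s) = n"
  by (simp add: hvec_def)

lemma lvec_length [simp]: "length (lvec n s i k) = n"
  by (simp add: lvec_def)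

lemma hvec_store:
  "y < n \<Longrightarrow> hvec n (s\<lparr>arrays := (arrays s)(1 := (arrays s 1)([y] := v))\<rparr>) = (hvec n s)[y := v]"
  by (rule nth_equalityI) (auto simp: hvec_nth nth_list_update)

lemma hvec_regs [simp]: "hvec n (s\<lparr>regs := r\<rparr>) = hvec n s"
  by (simp add: hvec_def)

lemma lvec_regs [simp]: "lvec n (s\<lparr>regs := r\<rparr>) = lvec n s"
  by (intro ext) (simp add: lvec_def)

context enumeration
begin

lemma wp_step:
  assumes f: "f \<in> syms A" and xs: "xs \<in> tuples {..<n} (arity A f)"
    and r: "\<And>j. j < arity A f \<Longrightarrow> regs s (20 + j) = xs ! j"
  shows "wp T (step_com f) (step_cost f) (\<lambda>s'. (hvec n s', regs s' 10) = step f xs (hvec n s, regs s 10) \<and>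
    frame {8, 9, 10} {1} s s' \<and> outp s' = outp s) s"
proof -
  define h where "h = hvec n s"
  define y where "y = T f xs"
  define v where "v = tab f (map ((!) h) xs)"
  have y: "y < n" unfolding y_def by (rule T_less[OF f xs])
  have regs_xs: "map (regs s) (arg_regs f) = xs"
    by (rule nth_equalityI) (use r xs in \<open>auto simp: arg_regs_def tuples_length\<close>)
  have e1: "eval_exp T s (Lookup f (map Reg (arg_regs f))) = y"
    using regs_xs by (simp add: y_def comp_def)
  let ?s1 = "s\<lparr>regs := (regs s)(8 := y)\<rparr>"
  have regs1: "map (regs ?s1) (arg_regs f) = xs" unfolding regs_xs[symmetric] by (auto simp: arg_regs_def)
  have "map (\<lambda>r. arrays s 1 [regs ?s1 r]) (arg_regs f) = map (\<lambda>x. arrays s 1 [x]) (map (regs ?s1) (arg_regs f))"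
    by (simp add: comp_def)
  also have "\<dots> = map ((!) h) xs"
    unfolding regs1 using xs by (auto simp: h_def hvec_nth tuples_def)
  finally have "map (\<lambda>r. arrays s 1 [regs ?s1 r]) (arg_regs f) = map ((!) h) xs" .
  then have e2: "eval_exp T ?s1 (tab_exp f (map (\<lambda>r. Read 1 [Reg r]) (arg_regs f))) = v"
    by (subst eval_tab_exp[OF f]) (simp_all add: arg_regs_def v_def comp_def)
  let ?s2 = "?s1\<lparr>regs := (regs ?s1)(9 := v)\<rparr>"
  have step: "step f xs (h, b) = (if v = 0 then (h, b) else if h ! y = 0 then (h[y := v], b)
     else if h ! y = v then (h, b) else (h, 1 + (b - 1)))" for b
    by (simp add: step_def Let_def v_def y_def)
  have hy: "arrays s 1 [y] = h ! y" using y by (simp add: h_def hvec_nth)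
  define Q where "Q s' \<longleftrightarrow> (hvec n s', regs s' 10) = step f xs (h, regs s 10) \<and>
    frame {8, 9, 10} {1} s s' \<and> outp s' = outp s" for s'
  have fr: "frame {8, 9, 10} {1} s ?s2" by (auto simp: frame_def)
  have h2: "hvec n ?s2 = h" "arrays ?s2 1 [y] = h ! y" "regs ?s2 8 = y" "regs ?s2 9 = v" "regs ?s2 10 = regs s 10"
    using hy by (simp_all add: h_def)
  have Q0: "Q ?s2" if "v = 0 \<or> h ! y = v \<and> h ! y \<noteq> 0"
    using that fr h2 unfolding Q_def step by auto
  have Q1: "Q (?s2\<lparr>regs := (regs ?s2)(10 := 1 + (regs s 10 - 1))\<rparr>)" if "v \<noteq> 0" "h ! y \<noteq> v" "h ! y \<noteq> 0"
    using that frame_regs[OF fr, of 10 "1 + (regs s 10 - 1)"] h2(1) unfolding Q_def step by simp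
  have Q2: "Q (?s2\<lparr>arrays := (arrays ?s2)(1 := (arrays ?s2 1)([y] := v))\<rparr>)" if "v \<noteq> 0" "h ! y = 0"
    using that frame_arrays[OF fr, of 1] hvec_store[OF y, of ?s2 v] h2(1) unfolding Q_def step by simp
  \<comment> \<open>The cost is spelled out in the shape in which the rules for \<open>wp\<close>
    produce it, and is rounded to \<open>step_cost\<close> only at the end.\<close>
  have "wp T (step_com f) (1 + exp_cost (Lookup f (map Reg (arg_regs f))) +
    (1 + exp_cost (tab_exp f (map (\<lambda>r. Read 1 [Reg r]) (arg_regs f))) +
     (1 + exp_cost (Reg 9 :: 'f exp) + ((1 + exp_cost (Read 1 [Reg 8] :: 'f exp) +
       ((1 + exp_cost (neq (Read 1 [Reg 8]) (Reg 9) :: 'f exp) +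
         ((1 + exp_cost (Plus (Num 1) (Monus (Reg 10) (Num 1)) :: 'f exp)) + 1)) +
       (1 + sum_list (map exp_cost [Reg 8 :: 'f exp]) + exp_cost (Reg 9 :: 'f exp)))) + 1)))) Q s"
    unfolding step_com_def
  proof (rule wp_Seq, rule wp_Assign, unfold e1, rule wp_Seq, rule wp_Assign, unfold e2, rule wp_Cond)
    assume v: "eval_exp T ?s2 (Reg 9) \<noteq> 0"
    show "wp T (Cond (Read 1 [Reg 8])
        (Cond (neq (Read 1 [Reg 8]) (Reg 9)) (Assign 10 (Plus (Num 1) (Monus (Reg 10) (Num 1)))) Skip)
        (Store 1 [Reg 8] (Reg 9))) (1 + exp_cost (Read 1 [Reg 8] :: 'f exp) +
       ((1 + exp_cost (neq (Read 1 [Reg 8]) (Reg 9) :: 'f exp) +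
         ((1 + exp_cost (Plus (Num 1) (Monus (Reg 10) (Num 1)) :: 'f exp)) + 1)) +
       (1 + sum_list (map exp_cost [Reg 8 :: 'f exp]) + exp_cost (Reg 9 :: 'f exp)))) Q ?s2"
    proof (rule wp_Cond)
      assume n0: "eval_exp T ?s2 (Read 1 [Reg 8]) \<noteq> 0"
      show "wp T (Cond (neq (Read 1 [Reg 8]) (Reg 9)) (Assign 10 (Plus (Num 1) (Monus (Reg 10) (Num 1)))) Skip)
         (1 + exp_cost (neq (Read 1 [Reg 8]) (Reg 9) :: 'f exp) +
         ((1 + exp_cost (Plus (Num 1) (Monus (Reg 10) (Num 1)) :: 'f exp)) + 1)) Q ?s2"
      proof (rule wp_Cond)
        assume "eval_exp T ?s2 (neq (Read 1 [Reg 8]) (Reg 9)) \<noteq> 0"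
        then have "h ! y \<noteq> v" using h2 by (simp add: eval_neq)
        then show "wp T (Assign 10 (Plus (Num 1) (Monus (Reg 10) (Num 1))))
           (1 + exp_cost (Plus (Num 1) (Monus (Reg 10) (Num 1)) :: 'f exp)) Q ?s2"
          using Q1 v n0 h2 by (intro wp_Assign) simp
      next
        assume "eval_exp T ?s2 (neq (Read 1 [Reg 8]) (Reg 9)) = 0"
        then have "h ! y = v" using h2 by (simp add: eval_neq)
        then show "wp T Skip 1 Q ?s2" using Q0 v h2 by (intro wp_Skip) simp
      qed
    next
      assume "eval_exp T ?s2 (Read 1 [Reg 8]) = 0"
      then show "wp T (Store 1 [Reg 8] (Reg 9)) (1 + sum_list (map exp_cost [Reg 8 :: 'f exp]) + exp_cost (Reg 9 :: 'f exp)) Q ?s2"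
        using Q2 v h2 by (intro wp_Store) simp
    qed
  next
    assume "eval_exp T ?s2 (Reg 9) = 0"
    then show "wp T Skip 1 Q ?s2" using Q0 by (intro wp_Skip) simp
  qed
  then show ?thesis unfolding Q_def h_def
    by (rule wp_le) (simp add: step_cost_def neq_def)
qed

lemma wp_pass:
  assumes "regs s 0 = n"
  shows "wp T pass_com (pass_cost n) (\<lambda>s'. (hvec n s', regs s' 10) = pass (hvec n s, regs s 10) \<and>
    frame ({8, 9, 10} \<union> {20..}) {1} s s' \<and> outp s' = outp s) s"
proof -
  let ?R = "{8, 9, 10} \<union> {20..} :: nat set"
  have one: "wp T (nest 20 (arity A f) (step_com f)) (nest_cost n (arity A f) (step_cost f))
      (\<lambda>s'. (frame ?R {1} s s' \<and> outp s' = outp s \<and> regs s' 0 = n) \<and>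
        (hvec n s', regs s' 10) = fold (step f) (tups n (arity A f)) (hvec n s, regs s 10)) s"
    if f: "f \<in> syms A" and s0: "regs s 0 = n" for f s
  proof (rule wp_nest[where Inv = "\<lambda>s'. frame ?R {1} s s' \<and> outp s' = outp s \<and> regs s' 0 = n"
        and st = "\<lambda>s'. (hvec n s', regs s' 10)"])
    fix s' xs assume I: "frame ?R {1} s s' \<and> outp s' = outp s \<and> regs s' 0 = n" and xs: "xs \<in> tuples {..<n} (arity A f)"
      and r: "\<And>j. j < arity A f \<Longrightarrow> regs s' (20 + j) = xs ! j"
    from wp_step[OF f xs r]
    show "wp T (step_com f) (step_cost f) (\<lambda>s''. (frame ?R {1} s s'' \<and> outp s'' = outp s \<and> regs s'' 0 = n) \<and>
      (hvec n s'', regs s'' 10) = step f xs (hvec n s', regs s' 10) \<and>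
      (\<forall>j<arity A f. regs s'' (20 + j) = regs s' (20 + j))) s'"
    proof (rule wp_mono)
      fix s'' assume s'': "(hvec n s'', regs s'' 10) = step f xs (hvec n s', regs s' 10) \<and>
        frame {8, 9, 10} {1} s' s'' \<and> outp s'' = outp s'"
      then have "frame ?R {1} s' s''" by (auto elim: frame_mono)
      then have "frame ?R {1} s s''" using I frame_trans by blast
      moreover have "regs s'' r = regs s' r" if "r \<notin> {8, 9, 10}" for r using s'' that frameD(1) by blast
      ultimately show "(frame ?R {1} s s'' \<and> outp s'' = outp s \<and> regs s'' 0 = n) \<and>
        (hvec n s'', regs s'' 10) = step f xs (hvec n s', regs s' 10) \<and>
        (\<forall>j<arity A f. regs s'' (20 + j) = regs s' (20 + j))" using I s'' by simp
    qed simp_all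
  qed (use s0 in \<open>auto intro: frame_refl frame_regs\<close>)
  have fold_eq: "fold (\<lambda>(f, xs). step f xs) (concat (map (\<lambda>f. map (Pair f) (tups n (arity A f))) gs)) st =
      fold (\<lambda>f. fold (step f) (tups n (arity A f))) gs st" for gs st
    by (induction gs arbitrary: st) (simp_all add: fold_map comp_def)
  have "wp T (foldr (\<lambda>f. Seq (nest 20 (arity A f) (step_com f))) gs Skip)
      ((\<Sum>f\<leftarrow>gs. nest_cost n (arity A f) (step_cost f)) + 1)
      (\<lambda>s'. (hvec n s', regs s' 10) = fold (\<lambda>f. fold (step f) (tups n (arity A f))) gs (hvec n s, regs s 10) \<and>
        frame ?R {1} s s' \<and> outp s' = outp s) s"
    if "set gs \<subseteq> syms A" "regs s 0 = n" for gs s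
    using that
  proof (induction gs arbitrary: s)
    case Nil
    then show ?case using wp_Skip[of _ s T] by (simp add: frame_refl)
  next
    case (Cons f gs)
    have "wp T (Seq (nest 20 (arity A f) (step_com f)) (foldr (\<lambda>f. Seq (nest 20 (arity A f) (step_com f))) gs Skip))
      (nest_cost n (arity A f) (step_cost f) + ((\<Sum>f\<leftarrow>gs. nest_cost n (arity A f) (step_cost f)) + 1))
      (\<lambda>s'. (hvec n s', regs s' 10) = fold (\<lambda>f. fold (step f) (tups n (arity A f))) (f # gs) (hvec n s, regs s 10) \<and>
        frame ?R {1} s s' \<and> outp s' = outp s) s"
    proof (rule wp_Seq, rule wp_mono[OF one])
      fix s1 assume s1: "(frame ?R {1} s s1 \<and> outp s1 = outp s \<and> regs s1 0 = n) \<and>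
        (hvec n s1, regs s1 10) = fold (step f) (tups n (arity A f)) (hvec n s, regs s 10)"
      show "wp T (foldr (\<lambda>f. Seq (nest 20 (arity A f) (step_com f))) gs Skip)
        ((\<Sum>f\<leftarrow>gs. nest_cost n (arity A f) (step_cost f)) + 1)
        (\<lambda>s'. (hvec n s', regs s' 10) = fold (\<lambda>f. fold (step f) (tups n (arity A f))) (f # gs) (hvec n s, regs s 10) \<and>
          frame ?R {1} s s' \<and> outp s' = outp s) s1"
        by (rule wp_mono[OF Cons.IH]) (use Cons.prems s1 in \<open>auto intro: frame_trans\<close>)
    qed (use Cons.prems in auto)
    then show ?case by (simp add: add.assoc)
  qed
  from this[of fs s] fs assms show ?thesis
    unfolding pass_com_def pass_cost_def pass_def pass_list_def fold_eq by simp
qed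

lemma wp_close:
  assumes "regs s 0 = n"
  shows "wp T close_com (close_cost n) (\<lambda>s'. (hvec n s', regs s' 10) = close (hvec n s, regs s 10) \<and>
    frame ({7, 8, 9, 10} \<union> {20..}) {1} s s' \<and> outp s' = outp s) s"
proof -
  let ?R = "{7, 8, 9, 10} \<union> {20..} :: nat set"
  let ?I = "\<lambda>m s'. (hvec n s', regs s' 10) = (pass ^^ m) (hvec n s, regs s 10) \<and> frame ?R {1} s s' \<and> outp s' = outp s"
  have "wp T close_com (for_cost (Suc n) (exp_cost (Plus (Reg 0) (Num 1) :: 'f exp)) (pass_cost n)) (?I (Suc n)) s"
    unfolding close_com_def
  proof (rule wp_For[where I = ?I])
    show "?I 0 (s\<lparr>regs := (regs s)(7 := 0)\<rparr>)" by (simp add: frame_regs[OF frame_refl])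
    show "eval_exp T s' (Plus (Reg 0) (Num 1)) = Suc n" if "?I i s'" for i s'
      using that assms frameD(1)[of ?R "{1}" s s' 0] by simp
    fix i s' assume I: "?I i s'" and r: "regs s' 7 = i"
    have "regs s' 0 = n" using I assms frameD(1)[of ?R "{1}" s s' 0] by simp
    from wp_pass[OF this]
    show "wp T pass_com (pass_cost n) (\<lambda>s''. regs s'' 7 = i \<and> ?I (Suc i) (s''\<lparr>regs := (regs s'')(7 := Suc i)\<rparr>)) s'"
    proof (rule wp_mono)
      fix s'' assume s'': "(hvec n s'', regs s'' 10) = pass (hvec n s', regs s' 10) \<and>
        frame ({8, 9, 10} \<union> {20..}) {1} s' s'' \<and> outp s'' = outp s'"
      then have "frame ?R {1} s' s''" by (auto elim: frame_mono)
      then have "frame ?R {1} s s''" using I frame_trans by blast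
      moreover have "regs s'' 7 = i" using s'' r frameD(1)[of "{8, 9, 10} \<union> {20..}" "{1}" s' s'' 7] by simp
      ultimately show "regs s'' 7 = i \<and> ?I (Suc i) (s''\<lparr>regs := (regs s'')(7 := Suc i)\<rparr>)"
        using s'' I by (simp add: frame_regs)
    qed simp
  qed auto
  then show ?thesis unfolding close_def by (rule wp_mono) (simp_all add: close_cost_def numeral_3_eq_3)
qed

end

lemma wp_StoreI: "s\<lparr>arrays := (arrays s)(a := (arrays s a)(map (eval_exp T s) es := eval_exp T s e))\<rparr> = s' \<Longrightarrow> Q s' \<Longrightarrow>
    wp T (Store a es e) (1 + sum_list (map exp_cost es) + exp_cost e) Q s"
  using wp_Store by blast

context enumeration
begin

lemma wp_load:
  assumes "regs s 0 = n"
  shows "wp T (For 6 (Reg 0) (Store 1 [Reg 6] (Read 2 [Reg 1, Reg 2, Reg 6]))) (for_cost n 1 20)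
    (\<lambda>s'. hvec n s' = lvec n s (regs s 1) (regs s 2) \<and> frame {6} {1} s s' \<and> outp s' = outp s) s"
proof -
  let ?I = "\<lambda>m s'. (\<forall>j<m. arrays s' 1 [j] = arrays s 2 [regs s 1, regs s 2, j]) \<and> frame {6} {1} s s' \<and> outp s' = outp s"
  have "wp T (For 6 (Reg 0) (Store 1 [Reg 6] (Read 2 [Reg 1, Reg 2, Reg 6]))) (for_cost n (exp_cost (Reg 0 :: 'f exp)) 20)
    (\<lambda>s'. hvec n s' = lvec n s (regs s 1) (regs s 2) \<and> frame {6} {1} s s' \<and> outp s' = outp s) s"
  proof (rule wp_For[where I = ?I])
    show "?I 0 (s\<lparr>regs := (regs s)(6 := 0)\<rparr>)" by (simp add: frame_regs[OF frame_refl])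
    show "eval_exp T s' (Reg 0) = n" if "?I i s'" for i s' using that assms frameD(1)[of "{6}" "{1}" s s' 0] by simp
    show "hvec n s' = lvec n s (regs s 1) (regs s 2) \<and> frame {6} {1} s s' \<and> outp s' = outp s" if "?I n s'" for s'
      using that by (auto simp: hvec_def lvec_def)
    fix m s' assume m: "?I m s'" "regs s' 6 = m"
    have fr: "frame {6} {1} s s'" using m by blast
    have "regs s' 1 = regs s 1" "regs s' 2 = regs s 2" "arrays s' 2 = arrays s 2" using frameD[OF fr] by simp_all
    moreover have "frame {6} {1} s (s'\<lparr>arrays := (arrays s')(1 := a), regs := (regs s')(6 := v)\<rparr>)" for a v
      using frame_regs[OF frame_arrays[OF fr, of 1 a], of 6 v] by simp
    ultimately show "wp T (Store 1 [Reg 6] (Read 2 [Reg 1, Reg 2, Reg 6])) 20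
        (\<lambda>s''. regs s'' 6 = m \<and> ?I (Suc m) (s''\<lparr>regs := (regs s'')(6 := Suc m)\<rparr>)) s'"
      using m by (intro wp_le[OF wp_Store]) (auto simp: less_Suc_eq)
  qed
  then show ?thesis by simp
qed

lemma wp_save:
  assumes "regs s 0 = n"
  shows "wp T (For 6 (Reg 0) (Store 2 [Plus (Reg 1) (Num 1), Reg 4, Reg 6] (Read 1 [Reg 6]))) (for_cost n 1 20)
    (\<lambda>s'. lvec n s' (Suc (regs s 1)) (regs s 4) = hvec n s \<and>
      (\<forall>a b. a \<noteq> Suc (regs s 1) \<or> b \<noteq> regs s 4 \<longrightarrow> lvec n s' a b = lvec n s a b) \<and>
      frame {6} {2} s s' \<and> outp s' = outp s) s"
proof -
  let ?i = "Suc (regs s 1)" and ?c = "regs s 4"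
  let ?I = "\<lambda>m s'. (\<forall>j<m. arrays s' 2 [?i, ?c, j] = arrays s 1 [j]) \<and>
    (\<forall>a b j. a \<noteq> ?i \<or> b \<noteq> ?c \<longrightarrow> arrays s' 2 [a, b, j] = arrays s 2 [a, b, j]) \<and> frame {6} {2} s s' \<and> outp s' = outp s"
  have "wp T (For 6 (Reg 0) (Store 2 [Plus (Reg 1) (Num 1), Reg 4, Reg 6] (Read 1 [Reg 6]))) (for_cost n (exp_cost (Reg 0 :: 'f exp)) 20)
    (\<lambda>s'. lvec n s' ?i ?c = hvec n s \<and> (\<forall>a b. a \<noteq> ?i \<or> b \<noteq> ?c \<longrightarrow> lvec n s' a b = lvec n s a b) \<and>
      frame {6} {2} s s' \<and> outp s' = outp s) s"
  proof (rule wp_For[where I = ?I])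
    show "?I 0 (s\<lparr>regs := (regs s)(6 := 0)\<rparr>)" by (simp add: frame_regs[OF frame_refl])
    show "eval_exp T s' (Reg 0) = n" if "?I i s'" for i s' using that assms frameD(1)[of "{6}" "{2}" s s' 0] by simp
    show "lvec n s' ?i ?c = hvec n s \<and> (\<forall>a b. a \<noteq> ?i \<or> b \<noteq> ?c \<longrightarrow> lvec n s' a b = lvec n s a b) \<and>
      frame {6} {2} s s' \<and> outp s' = outp s" if "?I n s'" for s'
      using that by (auto simp: hvec_def lvec_def)
    fix m s' assume m: "?I m s'" "regs s' 6 = m"
    have fr: "frame {6} {2} s s'" using m by blast
    have "regs s' 1 = regs s 1" "regs s' 4 = regs s 4" "arrays s' 1 = arrays s 1" using frameD[OF fr] by simp_all
    moreover have "frame {6} {2} s (s'\<lparr>arrays := (arrays s')(2 := a), regs := (regs s')(6 := v)\<rparr>)" for a v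
      using frame_regs[OF frame_arrays[OF fr, of 2 a], of 6 v] by simp
    ultimately show "wp T (Store 2 [Plus (Reg 1) (Num 1), Reg 4, Reg 6] (Read 1 [Reg 6])) 20
        (\<lambda>s''. regs s'' 6 = m \<and> ?I (Suc m) (s''\<lparr>regs := (regs s'')(6 := Suc m)\<rparr>)) s'"
      using m by (intro wp_le[OF wp_Store]) (auto simp: less_Suc_eq)
  qed
  then show ?thesis by simp
qed

abbreviation mark_com :: "'f com" where
  "mark_com \<equiv> Cond (Read 1 [Reg 1])
        (Cond (neq (Read 1 [Reg 1]) (Plus (Reg 5) (Num 1))) (Assign 10 (Num 1)) Skip) Skip"

lemma wp_mark:
  assumes "regs s 1 < n" "regs s 10 = 0"
  shows "wp T mark_com 40 (\<lambda>s'. hvec n s' = hvec n s \<and>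
      regs s' 10 = (if hvec n s ! regs s 1 \<noteq> 0 \<and> hvec n s ! regs s 1 \<noteq> Suc (regs s 5) then 1 else 0) \<and>
      frame {10} {} s s' \<and> outp s' = outp s) s" (is "wp _ _ _ ?Q s")
proof -
  have hi: "hvec n s ! regs s 1 = arrays s 1 [regs s 1]" using assms by (simp add: hvec_nth)
  have fr: "frame {10} {} s (s\<lparr>regs := (regs s)(10 := v)\<rparr>)" for v by (rule frame_regs[OF frame_refl]) simp
  have "wp T mark_com (1 + exp_cost (Read 1 [Reg 1] :: 'f exp) +
     ((1 + exp_cost (neq (Read 1 [Reg 1]) (Plus (Reg 5) (Num 1)) :: 'f exp) +
        ((1 + exp_cost (Num 1 :: 'f exp)) + 1)) + 1)) ?Q s"
  proof (rule wp_Cond, rule wp_Cond, rule wp_Assign, goal_cases)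
    case 1
    then show ?case using hi fr by (simp add: eval_neq)
  next
    case 2
    then show ?case using hi assms(2) by (intro wp_Skip) (simp add: eval_neq frame_refl)
  next
    case 3
    then show ?case using hi assms(2) by (intro wp_Skip) (simp add: frame_refl)
  qed
  then show ?thesis by (rule wp_le) (simp add: neq_def)
qed

definition ext_regs :: "nat set" where
  "ext_regs = {4, 6, 7, 8, 9, 10} \<union> {20..}"

text \<open>Since \<open>extend\<close> returns at most one list, appending it means storing one row
  and raising register 4. Rows of other levels are preserved, so level i can still be read while
  level i + 1 grows.\<close>

lemma wp_extend:
  assumes s0: "regs s 0 = n" and i: "regs s 1 < n"
  shows "wp T extend_com (extend_cost n) (\<lambda>s'.
    map (lvec n s' (Suc (regs s 1))) [0..<regs s' 4] = map (lvec n s (Suc (regs s 1))) [0..<regs s 4] @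
      extend (regs s 1) (lvec n s (regs s 1) (regs s 2)) (regs s 5) \<and>
    (\<forall>a b. a \<noteq> Suc (regs s 1) \<longrightarrow> lvec n s' a b = lvec n s a b) \<and>
    frame ext_regs {1, 2} s s' \<and> outp s' = outp s) s" (is "wp _ _ _ ?Q s")
proof -
  define i k c v where ikc: "i = regs s 1" "k = regs s 2" "c = regs s 4" "v = regs s 5"
  define h where "h = lvec n s i k"
  define b :: nat where "b = (if h ! i \<noteq> 0 \<and> h ! i \<noteq> Suc v then 1 else 0)"
  have inn: "i < n" using assms(2) by (simp add: ikc)
  let ?F = "\<lambda>s'. frame ext_regs {1, 2} s s' \<and> outp s' = outp s \<and> arrays s' 2 = arrays s 2 \<and> regs s' 4 = c"
  have keep: "regs s' 0 = n" "regs s' 1 = i" "regs s' 2 = k" "regs s' 5 = v" if "frame ext_regs {1, 2} s s'" for s'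
    using frameD(1)[OF that] s0 by (simp_all add: ext_regs_def ikc)
  have ext: "frame ext_regs {1, 2} s s''" if "frame ext_regs {1, 2} s s'" "frame R B s' s''" "R \<subseteq> ext_regs" "B \<subseteq> {1, 2}" for R B s' s''
    using frame_trans[OF that(1) frame_mono[OF that(2,3,4)]] .
  have sub: "{6} \<subseteq> ext_regs" "{10} \<subseteq> ext_regs" "{7, 8, 9, 10} \<union> {20..} \<subseteq> ext_regs" "{4} \<subseteq> ext_regs"
    by (auto simp: ext_regs_def)
  have "wp T extend_com (for_cost n 1 20 + (1 + exp_cost (Num 0 :: 'f exp) + (40 +
     ((1 + sum_list (map exp_cost [Reg 1 :: 'f exp]) + exp_cost (Plus (Reg 5) (Num 1) :: 'f exp)) +
     (close_cost n + (1 + exp_cost (Reg 10 :: 'f exp) + (1 + (for_cost n 1 20 + (1 + exp_cost (Plus (Reg 4) (Num 1) :: 'f exp)))))))))) ?Q s"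
    unfolding extend_com_def
  proof (rule wp_Seq, rule wp_mono[OF wp_load[OF s0]])
    fix s1 assume s1: "hvec n s1 = lvec n s (regs s 1) (regs s 2) \<and> frame {6} {1} s s1 \<and> outp s1 = outp s"
    then have F1: "?F s1" and h1: "hvec n s1 = h"
      using ext[OF frame_refl _ sub(1), of "{1}" s1] frameD[of "{6}" "{1}" s s1] by (simp_all add: ikc h_def)
    let ?s2 = "s1\<lparr>regs := (regs s1)(10 := 0)\<rparr>"
    have F2: "?F ?s2" and h2: "hvec n ?s2 = h"
      using F1 h1 frame_regs[of ext_regs "{1, 2}" s s1 10 0] by (simp_all add: ext_regs_def)
    show "wp T (Seq (Assign 10 (Num 0)) (Seq mark_com (Seq (Store 1 [Reg 1] (Plus (Reg 5) (Num 1)))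
       (Seq close_com (Cond (Reg 10) Skip (Seq (For 6 (Reg 0) (Store 2 [Plus (Reg 1) (Num 1), Reg 4, Reg 6] (Read 1 [Reg 6])))
        (Assign 4 (Plus (Reg 4) (Num 1)))))))))
      (1 + exp_cost (Num 0 :: 'f exp) + (40 +
     ((1 + sum_list (map exp_cost [Reg 1 :: 'f exp]) + exp_cost (Plus (Reg 5) (Num 1) :: 'f exp)) +
     (close_cost n + (1 + exp_cost (Reg 10 :: 'f exp) + (1 + (for_cost n 1 20 + (1 + exp_cost (Plus (Reg 4) (Num 1) :: 'f exp))))))))) ?Q s1"
    proof (rule wp_Seq, rule wp_Assign, unfold eval_exp.simps, rule wp_Seq, rule wp_mono[OF wp_mark])
      show "regs ?s2 1 < n" "regs ?s2 10 = 0" using keep(2)[of ?s2] F2 inn by simp_all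
      fix s3 assume s3: "hvec n s3 = hvec n ?s2 \<and>
        regs s3 10 = (if hvec n ?s2 ! regs ?s2 1 \<noteq> 0 \<and> hvec n ?s2 ! regs ?s2 1 \<noteq> Suc (regs ?s2 5) then 1 else 0) \<and>
        frame {10} {} ?s2 s3 \<and> outp s3 = outp ?s2"
      have fr3: "frame {10} {} ?s2 s3" using s3 by blast
      have F3: "?F s3" and h3: "hvec n s3 = h" and b3: "regs s3 10 = b"
        using s3 F2 h2 keep(2,4)[of ?s2] ext[of ?s2 "{10}" "{}" s3] sub(2) frameD(1)[OF fr3, of 4] frameD(2)[OF fr3, of 2]
        by (simp_all add: b_def)
      let ?s4 = "s3\<lparr>arrays := (arrays s3)(1 := (arrays s3 1)([i] := Suc v))\<rparr>"
      have F4: "?F ?s4" and h4: "hvec n ?s4 = h[i := Suc v]" and b4: "regs ?s4 10 = b"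
        using F3 h3 b3 frame_arrays[of ext_regs "{1, 2}" s s3 1] hvec_store[OF inn, of s3 "Suc v"] by simp_all
      have e4: "(arrays s3)(1 := (arrays s3 1)(map (eval_exp T s3) [Reg 1] := regs s3 5 + 1)) =
          (arrays s3)(1 := (arrays s3 1)([i] := Suc v))" using keep F3 by simp
      show "wp T (Seq (Store 1 [Reg 1] (Plus (Reg 5) (Num 1)))
       (Seq close_com (Cond (Reg 10) Skip (Seq (For 6 (Reg 0) (Store 2 [Plus (Reg 1) (Num 1), Reg 4, Reg 6] (Read 1 [Reg 6])))
        (Assign 4 (Plus (Reg 4) (Num 1)))))))
      ((1 + sum_list (map exp_cost [Reg 1 :: 'f exp]) + exp_cost (Plus (Reg 5) (Num 1) :: 'f exp)) +
     (close_cost n + (1 + exp_cost (Reg 10 :: 'f exp) + (1 + (for_cost n 1 20 + (1 + exp_cost (Plus (Reg 4) (Num 1) :: 'f exp))))))) ?Q s3"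
      proof (rule wp_Seq, rule wp_Store, unfold eval_exp.simps e4, rule wp_Seq, rule wp_mono[OF wp_close])
        show "regs ?s4 0 = n" using keep(1) F4 by blast
        fix s5 assume s5: "(hvec n s5, regs s5 10) = close (hvec n ?s4, regs ?s4 10) \<and>
          frame ({7, 8, 9, 10} \<union> {20..}) {1} ?s4 s5 \<and> outp s5 = outp ?s4"
        have fr5: "frame ({7, 8, 9, 10} \<union> {20..}) {1} ?s4 s5" using s5 by blast
        have r5: "regs s5 4 = regs ?s4 4" "arrays s5 2 = arrays ?s4 2"
          using frameD(1)[OF fr5, of 4] frameD(2)[OF fr5, of 2] by simp_all
        have F5: "?F s5"
          using s5 F4 ext[OF _ fr5 sub(3)] r5 by simp
        have c5: "(hvec n s5, regs s5 10) = close (h[i := Suc v], b)" using s5 h4 b4 by simp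
        have ext_eq: "extend i h v = (if regs s5 10 = 0 then [hvec n s5] else [])"
          unfolding extend_def Let_def b_def[symmetric] c5[symmetric] by simp
        have lv5: "lvec n s5 a d = lvec n s a d" for a d using F5 by (intro lvec_cong) simp
        show "wp T (Cond (Reg 10) Skip (Seq (For 6 (Reg 0) (Store 2 [Plus (Reg 1) (Num 1), Reg 4, Reg 6] (Read 1 [Reg 6])))
          (Assign 4 (Plus (Reg 4) (Num 1)))))
          (1 + exp_cost (Reg 10 :: 'f exp) + (1 + (for_cost n 1 20 + (1 + exp_cost (Plus (Reg 4) (Num 1) :: 'f exp))))) ?Q s5"
        proof (rule wp_Cond)
          assume "eval_exp T s5 (Reg 10) \<noteq> 0"
          then have "extend i h v = []" using ext_eq by simp
          then show "wp T Skip 1 ?Q s5" unfolding ikc[symmetric] h_def[symmetric] using F5 lv5 by (intro wp_Skip) simp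
        next
          assume "eval_exp T s5 (Reg 10) = 0"
          then have e: "extend i h v = [hvec n s5]" using ext_eq by simp
          have r5': "regs s5 0 = n" "regs s5 1 = i" "regs s5 4 = c" using keep F5 by blast+
          show "wp T (Seq (For 6 (Reg 0) (Store 2 [Plus (Reg 1) (Num 1), Reg 4, Reg 6] (Read 1 [Reg 6])))
            (Assign 4 (Plus (Reg 4) (Num 1)))) (for_cost n 1 20 + (1 + exp_cost (Plus (Reg 4) (Num 1) :: 'f exp))) ?Q s5"
          proof (rule wp_Seq, rule wp_mono[OF wp_save[OF r5'(1)]], rule wp_Assign)
            fix s6 assume s6: "lvec n s6 (Suc (regs s5 1)) (regs s5 4) = hvec n s5 \<and>
              (\<forall>a b. a \<noteq> Suc (regs s5 1) \<or> b \<noteq> regs s5 4 \<longrightarrow> lvec n s6 a b = lvec n s5 a b) \<and>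
              frame {6} {2} s5 s6 \<and> outp s6 = outp s5"
            have fr6: "frame ext_regs {1, 2} s s6" using ext[of s5 "{6}" "{2}" s6] F5 s6 sub(1) by simp
            have r6: "regs s6 4 = c" using s6 r5' frameD(1)[of "{6}" "{2}" s5 s6 4] by simp
            have l6: "lvec n s6 (Suc i) c = hvec n s5" "\<And>a b. a \<noteq> Suc i \<or> b \<noteq> c \<Longrightarrow> lvec n s6 a b = lvec n s a b"
              using s6 r5' lv5 by auto
            have "map (lvec n s6 (Suc i)) [0..<c] = map (lvec n s (Suc i)) [0..<c]" using l6(2) by simp
            then show "?Q (s6\<lparr>regs := (regs s6)(4 := eval_exp T s6 (Plus (Reg 4) (Num 1)))\<rparr>)"
              unfolding ikc[symmetric] h_def[symmetric]
              using l6 r6 e frame_regs[OF fr6, of 4 "Suc c"] s6 F5 sub(4) by simp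
          qed simp
        qed
      qed simp
    qed simp
  qed simp
  then show ?thesis by (rule wp_le) (simp add: extend_cost_def)
qed

lemma wp_extend_all:
  assumes s0: "regs s 0 = n" and i: "regs s 1 < n"
  shows "wp T (For 5 (Num 3) extend_com) (for_cost 3 1 (extend_cost n)) (\<lambda>s'.
    map (lvec n s' (Suc (regs s 1))) [0..<regs s' 4] = map (lvec n s (Suc (regs s 1))) [0..<regs s 4] @
      concat (map (extend (regs s 1) (lvec n s (regs s 1) (regs s 2))) [0..<3]) \<and>
    (\<forall>a b. a \<noteq> Suc (regs s 1) \<longrightarrow> lvec n s' a b = lvec n s a b) \<and>
    frame (insert 5 ext_regs) {1, 2} s s' \<and> outp s' = outp s) s"
proof -
  define i k where ik: "i = regs s 1" "k = regs s 2"
  define h where "h = lvec n s i k"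
  let ?R = "insert 5 ext_regs"
  let ?I = "\<lambda>m s'. map (lvec n s' (Suc i)) [0..<regs s' 4] = map (lvec n s (Suc i)) [0..<regs s 4] @
      concat (map (extend i h) [0..<m]) \<and> (\<forall>a b. a \<noteq> Suc i \<longrightarrow> lvec n s' a b = lvec n s a b) \<and>
    frame ?R {1, 2} s s' \<and> outp s' = outp s"
  have upd: "?I m (s'\<lparr>regs := (regs s')(5 := v)\<rparr>)" if "?I m s'" for m s' v
    using that frame_regs[of ?R "{1, 2}" s s' 5 v] by simp
  have "wp T (For 5 (Num 3) extend_com) (for_cost 3 (exp_cost (Num 3 :: 'f exp)) (extend_cost n)) (?I 3) s"
  proof (rule wp_For[where I = ?I])
    show "?I 0 (s\<lparr>regs := (regs s)(5 := 0)\<rparr>)" by (rule upd) (simp add: frame_refl)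
    fix v s' assume I: "?I v s'" and v: "regs s' 5 = v"
    have fr: "frame ?R {1, 2} s s'" using I by blast
    have r: "regs s' 0 = n" "regs s' 1 = i" "regs s' 2 = k" using frameD(1)[OF fr] s0 by (simp_all add: ext_regs_def ik)
    have i': "regs s' 1 < n" using r i ik by simp
    show "wp T extend_com (extend_cost n) (\<lambda>s''. regs s'' 5 = v \<and> ?I (Suc v) (s''\<lparr>regs := (regs s'')(5 := Suc v)\<rparr>)) s'"
    proof (rule wp_mono[OF wp_extend[OF r(1) i']])
      fix s'' assume s'': "map (lvec n s'' (Suc (regs s' 1))) [0..<regs s'' 4] = map (lvec n s' (Suc (regs s' 1))) [0..<regs s' 4] @
          extend (regs s' 1) (lvec n s' (regs s' 1) (regs s' 2)) (regs s' 5) \<and>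
        (\<forall>a b. a \<noteq> Suc (regs s' 1) \<longrightarrow> lvec n s'' a b = lvec n s' a b) \<and>
        frame ext_regs {1, 2} s' s'' \<and> outp s'' = outp s'"
      have "frame ?R {1, 2} s' s''" using s'' by (auto elim: frame_mono)
      then have fr'': "frame ?R {1, 2} s s''" using frame_trans[OF fr] by blast
      have "regs s'' 5 = v" using s'' v frameD(1)[of ext_regs "{1, 2}" s' s'' 5] by (simp add: ext_regs_def)
      moreover have "lvec n s' i k = h" using I by (simp add: h_def)
      then have "?I (Suc v) s''" using s'' I r v fr'' by simp
      ultimately show "regs s'' 5 = v \<and> ?I (Suc v) (s''\<lparr>regs := (regs s'')(5 := Suc v)\<rparr>)" using upd by blast
    qed simp
  qed simp_all
  then show ?thesis unfolding ik h_def by simp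
qed

definition level_regs :: "nat set" where
  "level_regs = {2, 3, 5} \<union> ext_regs"

lemma wp_level:
  assumes s0: "regs s 0 = n" and i: "regs s 1 < n" and P: "regs s 3 \<le> P"
  shows "wp T level_com (level_cost P n) (\<lambda>s'.
    map (lvec n s' (Suc (regs s 1))) [0..<regs s' 3] = next_level (regs s 1) (map (lvec n s (regs s 1)) [0..<regs s 3]) \<and>
    frame level_regs {1, 2} s s' \<and> outp s' = outp s) s" (is "wp _ _ _ ?Q s")
proof -
  define i N where iN: "i = regs s 1" "N = regs s 3"
  let ?E = "\<lambda>h. concat (map (extend i h) [0..<3])"
  let ?R = "insert 2 (insert 4 (insert 5 ext_regs))"
  let ?I = "\<lambda>m s'. map (lvec n s' (Suc i)) [0..<regs s' 4] = concat (map (\<lambda>k. ?E (lvec n s i k)) [0..<m]) \<and>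
    (\<forall>a b. a \<noteq> Suc i \<longrightarrow> lvec n s' a b = lvec n s a b) \<and> frame ?R {1, 2} s s' \<and> outp s' = outp s"
  have upd: "?I m (s'\<lparr>regs := (regs s')(2 := v)\<rparr>)" if "?I m s'" for m s' v
    using that frame_regs[of ?R "{1, 2}" s s' 2 v] by simp
  let ?s1 = "s\<lparr>regs := (regs s)(4 := 0)\<rparr>"
  have I0: "?I 0 ?s1" using frame_regs[OF frame_refl, of 4 ?R "{1, 2}" s 0] by simp
  have loop: "wp T (For 2 (Reg 3) (For 5 (Num 3) extend_com)) (for_cost N (exp_cost (Reg 3 :: 'f exp)) (for_cost 3 1 (extend_cost n))) (?I N) ?s1"
  proof (rule wp_For[where I = ?I])
    show "?I 0 (?s1\<lparr>regs := (regs ?s1)(2 := 0)\<rparr>)" by (rule upd[OF I0])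
    show "eval_exp T s' (Reg 3) = N" if "?I m s'" for m s'
      using that frameD(1)[of ?R "{1, 2}" s s' 3] by (simp add: iN ext_regs_def)
    fix k s' assume I: "?I k s'" and k: "regs s' 2 = k"
    have fr: "frame ?R {1, 2} s s'" using I by blast
    have r: "regs s' 0 = n" "regs s' 1 = i" using frameD(1)[OF fr] s0 by (simp_all add: ext_regs_def iN)
    have i': "regs s' 1 < n" using r i iN by simp
    show "wp T (For 5 (Num 3) extend_com) (for_cost 3 1 (extend_cost n))
      (\<lambda>s''. regs s'' 2 = k \<and> ?I (Suc k) (s''\<lparr>regs := (regs s'')(2 := Suc k)\<rparr>)) s'"
    proof (rule wp_mono[OF wp_extend_all[OF r(1) i']])
      fix s'' assume s'': "map (lvec n s'' (Suc (regs s' 1))) [0..<regs s'' 4] = map (lvec n s' (Suc (regs s' 1))) [0..<regs s' 4] @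
          concat (map (extend (regs s' 1) (lvec n s' (regs s' 1) (regs s' 2))) [0..<3]) \<and>
        (\<forall>a b. a \<noteq> Suc (regs s' 1) \<longrightarrow> lvec n s'' a b = lvec n s' a b) \<and>
        frame (insert 5 ext_regs) {1, 2} s' s'' \<and> outp s'' = outp s'"
      have "frame ?R {1, 2} s' s''" using s'' by (auto elim: frame_mono)
      then have fr'': "frame ?R {1, 2} s s''" using frame_trans[OF fr] by blast
      have "regs s'' 2 = k" using s'' k frameD(1)[of "insert 5 ext_regs" "{1, 2}" s' s'' 2] by (simp add: ext_regs_def)
      moreover have "lvec n s' i k = lvec n s i k" using I by simp
      then have "?I (Suc k) s''" using s'' I r k fr'' by (simp del: upt_rec_numeral)
      ultimately show "regs s'' 2 = k \<and> ?I (Suc k) (s''\<lparr>regs := (regs s'')(2 := Suc k)\<rparr>)" using upd by blast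
    qed simp
  qed simp_all
  have "wp T level_com (1 + exp_cost (Num 0 :: 'f exp) + (for_cost N (exp_cost (Reg 3 :: 'f exp)) (for_cost 3 1 (extend_cost n)) +
     (1 + exp_cost (Reg 4 :: 'f exp)))) ?Q s"
    unfolding level_com_def
  proof (rule wp_Seq, rule wp_Assign, unfold eval_exp.simps, rule wp_Seq, rule wp_mono[OF loop], rule wp_Assign)
    fix s2 assume s2: "?I N s2"
    have "frame level_regs {1, 2} s s2" using s2 by (elim conjE, elim frame_mono) (auto simp: level_regs_def ext_regs_def)
    then have "frame level_regs {1, 2} s (s2\<lparr>regs := (regs s2)(3 := v)\<rparr>)" for v
      by (rule frame_regs) (simp add: level_regs_def)
    then show "?Q (s2\<lparr>regs := (regs s2)(3 := eval_exp T s2 (Reg 4))\<rparr>)"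
      using s2 by (simp add: next_level_def iN comp_def del: upt_rec_numeral)
  qed simp
  \<comment> \<open>The loop runs over the actual size N of the level, while the cost is stated for
    the uniform bound P.\<close>
  moreover have "for_cost N 1 (for_cost 3 1 (extend_cost n)) \<le> for_cost P 1 (for_cost 3 1 (extend_cost n))"
    using P unfolding for_cost_def[of N] for_cost_def[of P] by (simp add: iN)
  ultimately show ?thesis by (elim wp_le) (simp add: level_cost_def)
qed

lemma wp_levels:
  assumes s0: "regs s 0 = n" and L: "map (lvec n s 0) [0..<regs s 3] = level x 0"
    and P: "\<And>i. i \<le> n \<Longrightarrow> length (level x i) \<le> P"
  shows "wp T (For 1 (Reg 0) level_com) (for_cost n 1 (level_cost P n)) (\<lambda>s'.
    map (lvec n s' n) [0..<regs s' 3] = level x n \<and> frame (insert 1 level_regs) {1, 2} s s' \<and> outp s' = outp s) s"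
proof -
  let ?R = "insert 1 level_regs"
  let ?I = "\<lambda>i s'. map (lvec n s' i) [0..<regs s' 3] = level x i \<and> frame ?R {1, 2} s s' \<and> outp s' = outp s"
  have upd: "?I m (s'\<lparr>regs := (regs s')(1 := v)\<rparr>)" if "?I m s'" for m s' v
    using that frame_regs[of ?R "{1, 2}" s s' 1 v] by simp
  have "wp T (For 1 (Reg 0) level_com) (for_cost n (exp_cost (Reg 0 :: 'f exp)) (level_cost P n)) (?I n) s"
  proof (rule wp_For[where I = ?I])
    show "?I 0 (s\<lparr>regs := (regs s)(1 := 0)\<rparr>)" by (rule upd) (use L in \<open>simp add: frame_refl\<close>)
    show "eval_exp T s' (Reg 0) = n" if "?I m s'" for m s'
      using that s0 frameD(1)[of ?R "{1, 2}" s s' 0] by (simp add: level_regs_def ext_regs_def)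
    fix i s' assume i: "i < n" and I: "?I i s'" and r: "regs s' 1 = i"
    have fr: "frame ?R {1, 2} s s'" using I by blast
    have r0: "regs s' 0 = n" using frameD(1)[OF fr, of 0] s0 by (simp add: level_regs_def ext_regs_def)
    have "length (map (lvec n s' i) [0..<regs s' 3]) \<le> P" using I P[of i] i by simp
    then have P': "regs s' 3 \<le> P" by simp
    have i': "regs s' 1 < n" using r i by simp
    show "wp T level_com (level_cost P n) (\<lambda>s''. regs s'' 1 = i \<and> ?I (Suc i) (s''\<lparr>regs := (regs s'')(1 := Suc i)\<rparr>)) s'"
    proof (rule wp_mono[OF wp_level[OF r0 i' P']])
      fix s'' assume s'': "map (lvec n s'' (Suc (regs s' 1))) [0..<regs s'' 3] =
          next_level (regs s' 1) (map (lvec n s' (regs s' 1)) [0..<regs s' 3]) \<and>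
        frame level_regs {1, 2} s' s'' \<and> outp s'' = outp s'"
      have "frame ?R {1, 2} s' s''" using s'' by (auto elim: frame_mono)
      then have fr'': "frame ?R {1, 2} s s''" using frame_trans[OF fr] by blast
      have "regs s'' 1 = i" using s'' r frameD(1)[of level_regs "{1, 2}" s' s'' 1] by (simp add: level_regs_def ext_regs_def)
      moreover have "?I (Suc i) s''" using s'' I r fr'' by simp
      ultimately show "regs s'' 1 = i \<and> ?I (Suc i) (s''\<lparr>regs := (regs s'')(1 := Suc i)\<rparr>)" using upd by blast
    qed simp
  qed simp_all
  then show ?thesis by simp
qed

lemma wp_final:
  assumes s0: "regs s 0 = n" and x: "\<And>a. a \<in> {1, 2, 3} \<Longrightarrow> arrays s 4 [a] = x ! (a - 1)"
    and g: "total (lvec n s n (regs s 2))"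
  shows "wp T final_com (final_cost n) (\<lambda>s'. outp s' = outp s @ (if canon x (lvec n s n (regs s 2)) then lvec n s n (regs s 2) else []) \<and>
    frame {6, 11} {} s s') s" (is "wp _ _ _ ?Q s")
proof -
  define k g where kg: "k = regs s 2" "g = lvec n s n (regs s 2)"
  let ?R = "{6, 11} :: nat set"
  \<comment> \<open>Register 11 is never reset within the loop, so it remembers any earlier
    violation of \<open>canon\<close>.\<close>
  let ?I = "\<lambda>m s'. (regs s' 11 = 0 \<longleftrightarrow> (\<forall>j<m. x ! (g ! j - 1) \<le> j)) \<and> frame ?R {} s s' \<and> outp s' = outp s"
  let ?J = "\<lambda>m s'. outp s' = outp s @ take m g \<and> frame ?R {} s s'"
  have keep: "regs s' 0 = n" "regs s' 2 = k" "arrays s' = arrays s" if "frame ?R {} s s'" for s'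
    using frameD[OF that] s0 by (auto simp: kg)
  have gj: "arrays s 2 [n, k, j] = g ! j" if "j < n" for j using that by (simp add: kg lvec_nth)
  have gx: "arrays s 4 [g ! j] = x ! (g ! j - 1)" if "j < n" for j
    using x total_nth[OF assms(3) that] by (simp add: kg)
  have len: "length g = n" by (simp add: kg)
  let ?s1 = "s\<lparr>regs := (regs s)(11 := 0)\<rparr>"
  have loop1: "wp T (For 6 (Reg 0) (Cond (Monus (Read 4 [Read 2 [Reg 0, Reg 2, Reg 6]]) (Reg 6)) (Assign 11 (Num 1)) Skip))
     (for_cost n (exp_cost (Reg 0 :: 'f exp)) 20) (?I n) ?s1"
  proof (rule wp_For[where I = ?I])
    show "?I 0 (?s1\<lparr>regs := (regs ?s1)(6 := 0)\<rparr>)"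
      using frame_regs[OF frame_regs[OF frame_refl, of 11 ?R "{}" s 0], of 6 0] by simp
    show "eval_exp T s' (Reg 0) = n" if "?I m s'" for m s' using keep that by simp
    fix m s' assume m: "m < n" and I: "?I m s'" and r: "regs s' 6 = m"
    have fr: "frame ?R {} s s'" using I by blast
    have e: "eval_exp T s' (Monus (Read 4 [Read 2 [Reg 0, Reg 2, Reg 6]]) (Reg 6)) = x ! (g ! m - 1) - m"
      using keep[OF fr] r gj[OF m] gx[OF m] by simp
    let ?Q = "\<lambda>s''. regs s'' 6 = m \<and> ?I (Suc m) (s''\<lparr>regs := (regs s'')(6 := Suc m)\<rparr>)"
    have all: "(\<forall>j<Suc m. x ! (g ! j - 1) \<le> j) \<longleftrightarrow> (\<forall>j<m. x ! (g ! j - 1) \<le> j) \<and> x ! (g ! m - 1) \<le> m"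
      by (auto simp: less_Suc_eq)
    have "wp T (Cond (Monus (Read 4 [Read 2 [Reg 0, Reg 2, Reg 6]]) (Reg 6)) (Assign 11 (Num 1)) Skip)
       (1 + exp_cost (Monus (Read 4 [Read 2 [Reg 0, Reg 2, Reg 6]]) (Reg 6) :: 'f exp) + ((1 + exp_cost (Num 1 :: 'f exp)) + 1)) ?Q s'"
    proof (rule wp_Cond)
      assume "eval_exp T s' (Monus (Read 4 [Read 2 [Reg 0, Reg 2, Reg 6]]) (Reg 6)) \<noteq> 0"
      then have "\<not> x ! (g ! m - 1) \<le> m" unfolding e by simp
      then show "wp T (Assign 11 (Num 1)) (1 + exp_cost (Num 1 :: 'f exp)) ?Q s'"
        using I r frame_regs[OF frame_regs[OF fr, of 11 1], of 6 "Suc m"] unfolding all by (intro wp_Assign) simp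
    next
      assume "eval_exp T s' (Monus (Read 4 [Read 2 [Reg 0, Reg 2, Reg 6]]) (Reg 6)) = 0"
      then have "x ! (g ! m - 1) \<le> m" unfolding e by simp
      then show "wp T Skip 1 ?Q s'"
        using I r frame_regs[OF fr, of 6 "Suc m"] unfolding all by (intro wp_Skip) simp
    qed
    then show "wp T (Cond (Monus (Read 4 [Read 2 [Reg 0, Reg 2, Reg 6]]) (Reg 6)) (Assign 11 (Num 1)) Skip) 20 ?Q s'"
      by (rule wp_le) simp
  qed simp_all
  have loop2: "wp T (For 6 (Reg 0) (Output (Read 2 [Reg 0, Reg 2, Reg 6]))) (for_cost n (exp_cost (Reg 0 :: 'f exp)) 20) (?J n) s2"
    if s2: "?I n s2" for s2
  proof (rule wp_For[where I = ?J])
    show "?J 0 (s2\<lparr>regs := (regs s2)(6 := 0)\<rparr>)" using s2 frame_regs[of ?R "{}" s s2 6 0] by simp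
    show "eval_exp T s' (Reg 0) = n" if "?J m s'" for m s' using keep that by simp
    fix m s' assume m: "m < n" and I: "?J m s'" and r: "regs s' 6 = m"
    have fr: "frame ?R {} s s'" using I by blast
    have "frame ?R {} s (s'\<lparr>outp := v, regs := (regs s')(6 := w)\<rparr>)" for v w
      using frame_regs[OF frame_outp[OF fr, of v], of 6 w] by simp
    then show "wp T (Output (Read 2 [Reg 0, Reg 2, Reg 6])) 20 (\<lambda>s''. regs s'' 6 = m \<and> ?J (Suc m) (s''\<lparr>regs := (regs s'')(6 := Suc m)\<rparr>)) s'"
      using I r keep[OF fr] gj[OF m] len m by (intro wp_le[OF wp_Output]) (simp_all add: take_Suc_conv_app_nth)
  qed simp_all
  have "wp T final_com (1 + exp_cost (Num 0 :: 'f exp) + (for_cost n (exp_cost (Reg 0 :: 'f exp)) 20 +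
     (1 + exp_cost (Reg 11 :: 'f exp) + (1 + for_cost n (exp_cost (Reg 0 :: 'f exp)) 20)))) ?Q s"
    unfolding final_com_def
  proof (rule wp_Seq, rule wp_Assign, unfold eval_exp.simps, rule wp_Seq, rule wp_mono[OF loop1], rule wp_Cond)
    fix s2 assume s2: "?I n s2" and "eval_exp T s2 (Reg 11) \<noteq> 0"
    then have "\<not> canon x g" unfolding canon_def by simp
    then show "wp T Skip 1 ?Q s2" using s2 unfolding kg by (intro wp_Skip) simp
  next
    fix s2 assume s2: "?I n s2" and "eval_exp T s2 (Reg 11) = 0"
    then have "canon x g" unfolding canon_def by simp
    then show "wp T (For 6 (Reg 0) (Output (Read 2 [Reg 0, Reg 2, Reg 6]))) (for_cost n (exp_cost (Reg 0 :: 'f exp)) 20) ?Q s2"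
      using len by (intro wp_mono[OF loop2[OF s2]]) (simp_all add: kg)
  qed simp
  then show ?thesis by (rule wp_le) (simp add: final_cost_def)
qed

lemma wp_finals:
  assumes s0: "regs s 0 = n" and x: "\<And>a. a \<in> {1, 2, 3} \<Longrightarrow> arrays s 4 [a] = x ! (a - 1)"
    and L: "map (lvec n s n) [0..<regs s 3] = L" "\<And>g. g \<in> set L \<Longrightarrow> total g" and P: "length L \<le> P"
  shows "wp T (For 2 (Reg 3) final_com) (for_cost P 1 (final_cost n)) (\<lambda>s'. outp s' = outp s @ concat (filter (canon x) L) \<and>
    frame {2, 6, 11} {} s s') s"
proof -
  define N where "N = regs s 3"
  let ?R = "{2, 6, 11} :: nat set"
  let ?o = "\<lambda>g. if canon x g then g else []"
  let ?I = "\<lambda>m s'. outp s' = outp s @ concat (map (\<lambda>k. ?o (lvec n s n k)) [0..<m]) \<and> frame ?R {} s s'"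
  have flt: "concat (filter (canon x) L') = concat (map ?o L')" for L' by (induction L') auto
  have N: "length L = N" using L(1) by (auto simp: N_def)
  have upd: "?I m (s'\<lparr>regs := (regs s')(2 := v)\<rparr>)" if "?I m s'" for m s' v
    using that frame_regs[of ?R "{}" s s' 2 v] by simp
  have main: "wp T (For 2 (Reg 3) final_com) (for_cost N (exp_cost (Reg 3 :: 'f exp)) (final_cost n)) (?I N) s"
  proof (rule wp_For[where I = ?I])
    show "?I 0 (s\<lparr>regs := (regs s)(2 := 0)\<rparr>)" by (rule upd) (simp add: frame_refl)
    show "eval_exp T s' (Reg 3) = N" if "?I m s'" for m s'
      using that frameD(1)[of ?R "{}" s s' 3] by (simp add: N_def)
    fix k s' assume k: "k < N" and I: "?I k s'" and r: "regs s' 2 = k"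
    have fr: "frame ?R {} s s'" using I by blast
    have r0: "regs s' 0 = n" and ar: "arrays s' = arrays s" using frameD[OF fr] s0 by auto
    have lv: "lvec n s' a b = lvec n s a b" for a b by (rule lvec_cong) (simp add: ar)
    have "lvec n s n k \<in> set L" using k unfolding L(1)[symmetric] by (simp add: N_def)
    then have t: "total (lvec n s' n (regs s' 2))" using L(2) lv r by simp
    show "wp T final_com (final_cost n) (\<lambda>s''. regs s'' 2 = k \<and> ?I (Suc k) (s''\<lparr>regs := (regs s'')(2 := Suc k)\<rparr>)) s'"
    proof (rule wp_mono[OF wp_final[OF r0 _ t]])
      show "arrays s' 4 [a] = x ! (a - 1)" if "a \<in> {1, 2, 3}" for a using x[OF that] ar by simp
      fix s'' assume s'': "outp s'' = outp s' @ (if canon x (lvec n s' n (regs s' 2)) then lvec n s' n (regs s' 2) else []) \<and>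
        frame {6, 11} {} s' s''"
      have "frame ?R {} s' s''" using s'' by (auto elim: frame_mono)
      then have fr'': "frame ?R {} s s''" using frame_trans[OF fr] by blast
      have "regs s'' 2 = k" using s'' r frameD(1)[of "{6, 11}" "{}" s' s'' 2] by simp
      moreover have "?I (Suc k) s''" using s'' I r fr'' lv by simp
      ultimately show "regs s'' 2 = k \<and> ?I (Suc k) (s''\<lparr>regs := (regs s'')(2 := Suc k)\<rparr>)" using upd by blast
    qed simp
  qed simp_all
  have out: "concat (map (\<lambda>k. ?o (lvec n s n k)) [0..<N]) = concat (filter (canon x) L)"
    unfolding flt L(1)[symmetric] N_def map_map comp_def ..
  have "for_cost N 1 (final_cost n) \<le> for_cost P 1 (final_cost n)" using P N by (simp add: for_cost_def)
  then show ?thesis using wp_mono[OF main] unfolding out by simp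
qed

lemma wp_init:
  assumes s0: "regs s 0 = n" and x: "x \<in> tuples {..<n} 3" "\<And>j. j < 3 \<Longrightarrow> regs s (12 + j) = x ! j"
  shows "wp T init_com (init_cost n) (\<lambda>s'. (\<forall>a\<in>{1, 2, 3}. arrays s' 4 [a] = x ! (a - 1)) \<and>
    map (lvec n s' 0) [0..<regs s' 3] = level x 0 \<and> frame {3, 6} {2, 4} s s' \<and> outp s' = outp s) s"
proof -
  have r: "regs s 12 = x ! 0" "regs s 13 = x ! 1" "regs s 14 = x ! 2" using x(2)[of 0] x(2)[of 1] x(2)[of 2] by simp_all
  have lt: "x ! 0 < n" "x ! 1 < n" "x ! 2 < n" using tuples_nth[OF x(1)] by auto
  let ?R = "{3, 6} :: nat set" and ?B = "{2, 4} :: nat set"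
  let ?A = "\<lambda>s'. \<forall>a\<in>{1, 2, 3}. arrays s' 4 [a] = x ! (a - 1)"
  let ?F = "\<lambda>s'. ?A s' \<and> frame ?R ?B s s' \<and> outp s' = outp s"
  have keep: "regs s' 0 = n" "regs s' 12 = x ! 0" "regs s' 13 = x ! 1" "regs s' 14 = x ! 2" if "frame ?R ?B s s'" for s'
    using frameD(1)[OF that] s0 r by simp_all
  define s1 where "s1 = s\<lparr>arrays := (arrays s)(4 := (arrays s 4)([1] := x ! 0))\<rparr>"
  define s2 where "s2 = s1\<lparr>arrays := (arrays s1)(4 := (arrays s1 4)([2] := x ! 1))\<rparr>"
  define s3 where "s3 = s2\<lparr>arrays := (arrays s2)(4 := (arrays s2 4)([3] := x ! 2))\<rparr>"
  have f1: "frame ?R ?B s s1" unfolding s1_def by (rule frame_arrays[OF frame_refl]) simp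
  have f2: "frame ?R ?B s s2" unfolding s2_def by (rule frame_arrays[OF f1]) simp
  have f3: "frame ?R ?B s s3" unfolding s3_def by (rule frame_arrays[OF f2]) simp
  have F3: "?F s3" using f3 by (simp add: s1_def s2_def s3_def)
  let ?I = "\<lambda>m s'. ?F s' \<and> (\<forall>j<m. arrays s' 2 [0, 0, j] = 0)"
  have loop: "wp T (For 6 (Reg 0) (Store 2 [Num 0, Num 0, Reg 6] (Num 0))) (for_cost n (exp_cost (Reg 0 :: 'f exp)) 20) (?I n) s3"
  proof (rule wp_For[where I = ?I])
    show "?I 0 (s3\<lparr>regs := (regs s3)(6 := 0)\<rparr>)" using F3 frame_regs[OF f3, of 6 0] by simp
    show "eval_exp T s' (Reg 0) = n" if "?I m s'" for m s' using keep that by simp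
    fix m s' assume I: "?I m s'" and m: "regs s' 6 = m"
    have "frame ?R ?B s (s'\<lparr>arrays := (arrays s')(2 := a), regs := (regs s')(6 := v)\<rparr>)" for a v
      using frame_regs[OF frame_arrays[of ?R ?B s s' 2 a], of 6 v] I by simp
    then show "wp T (Store 2 [Num 0, Num 0, Reg 6] (Num 0)) 20 (\<lambda>s''. regs s'' 6 = m \<and> ?I (Suc m) (s''\<lparr>regs := (regs s'')(6 := Suc m)\<rparr>)) s'"
      using I m by (intro wp_le[OF wp_Store]) (auto simp: less_Suc_eq)
  qed simp_all
  have store: "?F (s'\<lparr>arrays := (arrays s')(2 := (arrays s' 2)([0, 0, y] := v))\<rparr>) \<and>
      lvec n (s'\<lparr>arrays := (arrays s')(2 := (arrays s' 2)([0, 0, y] := v))\<rparr>) 0 0 = (lvec n s' 0 0)[y := v]"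
    if "?F s'" "y < n" for s' y v
    using that frame_arrays[of ?R ?B s s' 2] by (auto simp: lvec_nth nth_list_update intro!: nth_equalityI)
  have "wp T init_com ((1 + sum_list (map exp_cost [Num 1 :: 'f exp]) + exp_cost (Reg 12 :: 'f exp)) +
    ((1 + sum_list (map exp_cost [Num 2 :: 'f exp]) + exp_cost (Reg 13 :: 'f exp)) +
    ((1 + sum_list (map exp_cost [Num 3 :: 'f exp]) + exp_cost (Reg 14 :: 'f exp)) +
    (for_cost n (exp_cost (Reg 0 :: 'f exp)) 20 +
    ((1 + sum_list (map exp_cost [Num 0, Num 0, Reg 12 :: 'f exp]) + exp_cost (Num 1 :: 'f exp)) +
    ((1 + sum_list (map exp_cost [Num 0, Num 0, Reg 13 :: 'f exp]) + exp_cost (Num 2 :: 'f exp)) +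
    ((1 + sum_list (map exp_cost [Num 0, Num 0, Reg 14 :: 'f exp]) + exp_cost (Num 3 :: 'f exp)) +
    (1 + exp_cost (Monus (Num 1) (Plus (neq (Read 2 [Num 0, Num 0, Reg 12]) (Num 1))
      (neq (Read 2 [Num 0, Num 0, Reg 13]) (Num 2))) :: 'f exp)))))))))
    (\<lambda>s'. ?F s' \<and> map (lvec n s' 0) [0..<regs s' 3] = level x 0) s"
    unfolding init_com_def
  proof (rule wp_Seq, rule wp_StoreI[where s' = s1], goal_cases)
    case 1
    then show ?case using r by (simp add: s1_def)
  next
    case 2
    show ?case
    proof (rule wp_Seq, rule wp_StoreI[where s' = s2], goal_cases)
      case 1
      then show ?case using keep[OF f1] by (simp add: s2_def)
    next
      case 2
      show ?case
      proof (rule wp_Seq, rule wp_StoreI[where s' = s3], goal_cases)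
        case 1
        then show ?case using keep[OF f2] by (simp add: s3_def)
      next
        case 2
        show ?case
        proof (rule wp_Seq, rule wp_mono[OF loop], goal_cases)
          case (1 s4)
          then have F4: "?F s4" and z: "lvec n s4 0 0 = replicate n 0"
            by (auto simp: lvec_def intro!: nth_equalityI)
          define s5 where "s5 = s4\<lparr>arrays := (arrays s4)(2 := (arrays s4 2)([0, 0, x ! 0] := 1))\<rparr>"
          define s6 where "s6 = s5\<lparr>arrays := (arrays s5)(2 := (arrays s5 2)([0, 0, x ! 1] := 2))\<rparr>"
          define s7 where "s7 = s6\<lparr>arrays := (arrays s6)(2 := (arrays s6 2)([0, 0, x ! 2] := 3))\<rparr>"
          have F5: "?F s5" "lvec n s5 0 0 = (replicate n 0)[x ! 0 := 1]"
            using store[OF F4 lt(1), of 1] unfolding z s5_def by blast+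
          have F6: "?F s6" "lvec n s6 0 0 = (replicate n 0)[x ! 0 := 1, x ! 1 := 2]"
            using store[OF F5(1) lt(2), of 2] unfolding F5(2) s6_def by blast+
          have F7: "?F s7" "lvec n s7 0 0 = start x"
            using store[OF F6(1) lt(3), of 3] unfolding F6(2) s7_def start_def by blast+
          let ?e = "Monus (Num 1) (Plus (neq (Read 2 [Num 0, Num 0, Reg 12]) (Num 1)) (neq (Read 2 [Num 0, Num 0, Reg 13]) (Num 2))) :: 'f exp"
          have cnt: "eval_exp T s7 ?e = (if start x ! (x ! 0) = 1 \<and> start x ! (x ! 1) = 2 then 1 else 0)"
          proof -
            have a: "arrays s7 2 [0, 0, x ! 0] = start x ! (x ! 0)" "arrays s7 2 [0, 0, x ! 1] = start x ! (x ! 1)"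
              using lvec_nth[OF lt(1), of s7 0 0] lvec_nth[OF lt(2), of s7 0 0] F7(2) by simp_all
            have rr: "regs s7 12 = x ! 0" "regs s7 13 = x ! 1" using keep[of s7] F7(1) by blast+
            show ?thesis unfolding neq_def eval_exp.simps list.map rr a by auto
          qed
          have fin: "?F (s7\<lparr>regs := (regs s7)(3 := v)\<rparr>)" for v using F7(1) frame_regs[of ?R ?B s s7 3 v] by simp
          have lev: "map (lvec n s7 0) [0..<eval_exp T s7 ?e] = level x 0"
            unfolding cnt level.simps using F7(2) by simp
          show ?case
          proof (rule wp_Seq, rule wp_StoreI[where s' = s5], goal_cases)
            case 1
            then show ?case using keep[of s4] F4 by (simp add: s5_def)
          next
            case 2
            show ?case
            proof (rule wp_Seq, rule wp_StoreI[where s' = s6], goal_cases)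
              case 1
              then show ?case using keep[of s5] F5 by (simp add: s6_def)
            next
              case 2
              show ?case
              proof (rule wp_Seq, rule wp_StoreI[where s' = s7], goal_cases)
                case 1
                then show ?case using keep[of s6] F6 by (simp add: s7_def)
              next
                case 2
                show ?case
                proof (rule wp_Assign, rule conjI, rule fin)
                  have "lvec n (s7\<lparr>regs := r\<rparr>) 0 = lvec n s7 0" for r by (rule ext) simp
                  then show "map (lvec n (s7\<lparr>regs := (regs s7)(3 := eval_exp T s7 ?e)\<rparr>) 0)
                    [0..<regs (s7\<lparr>regs := (regs s7)(3 := eval_exp T s7 ?e)\<rparr>) 3] = level x 0"
                    using lev by (simp del: eval_exp.simps)
                qed
              qed
            qed
          qed
        qed simp
      qed
    qed
  qed
  then show ?thesis by (rule wp_mono) (auto simp: init_cost_def neq_def)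
qed

lemma wp_triple:
  assumes s0: "regs s 0 = n" and x: "x \<in> tuples {..<n} 3" "\<And>j. j < 3 \<Longrightarrow> regs s (12 + j) = x ! j"
    and P: "\<And>i. i \<le> n \<Longrightarrow> length (level x i) \<le> P"
  shows "wp T triple_com (triple_cost P n) (\<lambda>s'. regs s' 0 = n \<and>
    outp s' = outp s @ concat (filter (canon x) (level x n)) \<and> (\<forall>j<3. regs s' (12 + j) = regs s (12 + j))) s"
  unfolding triple_com_def triple_cost_def
proof (rule wp_Seq, rule wp_mono[OF wp_init[OF s0 x]])
  \<comment> \<open>The triple sits in the counters of the enclosing loops, so none of the three
    phases may touch these registers.\<close>
  have out: "12 + j \<notin> {3, 6::nat}" "12 + j \<notin> insert 1 level_regs" "12 + j \<notin> {2, 6, 11}" if "j < 3" for j :: nat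
    using that by (auto simp: level_regs_def ext_regs_def)
  have z: "0 \<notin> insert 1 level_regs" by (simp add: level_regs_def ext_regs_def)
  fix s1 assume s1: "(\<forall>a\<in>{1, 2, 3}. arrays s1 4 [a] = x ! (a - 1)) \<and>
    map (lvec n s1 0) [0..<regs s1 3] = level x 0 \<and> frame {3, 6} {2, 4} s s1 \<and> outp s1 = outp s"
  then have f1: "frame {3, 6} {2, 4} s s1" and L1: "map (lvec n s1 0) [0..<regs s1 3] = level x 0" by blast+
  have r1: "regs s1 0 = n" using frameD(1)[OF f1, of 0] s0 by simp
  show "wp T (Seq (For 1 (Reg 0) level_com) (For 2 (Reg 3) final_com))
     (for_cost n 1 (level_cost P n) + for_cost P 1 (final_cost n)) (\<lambda>s'. regs s' 0 = n \<and>
    outp s' = outp s @ concat (filter (canon x) (level x n)) \<and> (\<forall>j<3. regs s' (12 + j) = regs s (12 + j))) s1"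
  proof (rule wp_Seq, rule wp_mono[OF wp_levels[OF r1 L1 P]])
    fix s2 assume s2: "map (lvec n s2 n) [0..<regs s2 3] = level x n \<and> frame (insert 1 level_regs) {1, 2} s1 s2 \<and> outp s2 = outp s1"
    then have f2: "frame (insert 1 level_regs) {1, 2} s1 s2" and L2: "map (lvec n s2 n) [0..<regs s2 3] = level x n" by blast+
    have r2: "regs s2 0 = n" using frameD(1)[OF f2 z] r1 by simp
    have e: "arrays s2 4 = arrays s1 4" using frameD(2)[OF f2, of 4] by simp
    have A1: "\<forall>a\<in>{1, 2, 3}. arrays s1 4 [a] = x ! (a - 1)" using s1 by blast
    have a2: "arrays s2 4 [a] = x ! (a - 1)" if "a \<in> {1, 2, 3}" for a using bspec[OF A1 that] unfolding e .
    have tot: "total g" if "g \<in> set (level x n)" for g using level_top(2)[OF x(1) n_pos] that by blast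
    show "wp T (For 2 (Reg 3) final_com) (for_cost P 1 (final_cost n)) (\<lambda>s'. regs s' 0 = n \<and>
      outp s' = outp s @ concat (filter (canon x) (level x n)) \<and> (\<forall>j<3. regs s' (12 + j) = regs s (12 + j))) s2"
    proof (rule wp_mono[OF wp_finals[OF r2 a2 L2 tot P[OF order_refl]]])
      fix s3 assume s3: "outp s3 = outp s2 @ concat (filter (canon x) (level x n)) \<and> frame {2, 6, 11} {} s2 s3"
      then have f3: "frame {2, 6, 11} {} s2 s3" by blast
      have "regs s3 0 = n" using frameD(1)[OF f3, of 0] r2 by simp
      moreover have "regs s3 (12 + j) = regs s (12 + j)" if "j < 3" for j
        using frameD(1)[OF f3 out(3)[OF that]] frameD(1)[OF f2 out(2)[OF that]] frameD(1)[OF f1 out(1)[OF that]] by simp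
      ultimately show "regs s3 0 = n \<and> outp s3 = outp s @ concat (filter (canon x) (level x n)) \<and>
        (\<forall>j<3. regs s3 (12 + j) = regs s (12 + j))" using s1 s2 s3 by simp
    qed simp_all
  qed simp_all
qed simp_all

lemma wp_enum:
  assumes P: "\<And>x i. x \<in> tuples {..<n} 3 \<Longrightarrow> i \<le> n \<Longrightarrow> length (level x i) \<le> P"
  shows "wp T enum_com (enum_cost P n) (\<lambda>s'. outp s' = concat result) (init_state n)"
proof -
  let ?f = "\<lambda>x out. out @ concat (filter (canon x) (level x n))"
  have fold_eq: "fold ?f xs out = out @ concat (concat (map (\<lambda>x. filter (canon x) (level x n)) xs))" for xs out
    by (induction xs arbitrary: out) simp_all
  have "wp T (nest 12 3 triple_com) (nest_cost n 3 (triple_cost P n))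
     (\<lambda>s'. regs s' 0 = n \<and> outp s' = fold ?f (tups n 3) (outp (init_state n))) (init_state n)"
  proof (rule wp_nest[where Inv = "\<lambda>s' :: state. regs s' 0 = n" and st = outp])
    fix s :: state and xs assume s: "regs s 0 = n" and xs: "xs \<in> tuples {..<n} 3" and r: "\<And>j. j < 3 \<Longrightarrow> regs s (12 + j) = xs ! j"
    show "wp T triple_com (triple_cost P n) (\<lambda>s'. regs s' 0 = n \<and> outp s' = ?f xs (outp s) \<and>
        (\<forall>j<3. regs s' (12 + j) = regs s (12 + j))) s"
      by (rule wp_triple[OF s xs r P[OF xs]])
  qed (auto simp: init_state_def)
  then show ?thesis unfolding enum_com_def enum_cost_def fold_eq result_def
    by (rule wp_mono) (simp_all add: init_state_def)
qed

end

section \<open>Polynomial running time\<close>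

definition poly_bounded :: "(nat \<Rightarrow> nat) \<Rightarrow> bool" where
  "poly_bounded f \<longleftrightarrow> (\<exists>c k. \<forall>n. f n \<le> c * (n + 1) ^ k)"

lemma poly_bounded_const: "poly_bounded (\<lambda>_. c)"
  unfolding poly_bounded_def by (intro exI[of _ c] exI[of _ 0]) simp

lemma poly_bounded_id: "poly_bounded (\<lambda>n. n)"
  unfolding poly_bounded_def by (intro exI[of _ 1]) simp

lemma poly_bounded_power: "poly_bounded (\<lambda>n. c * (n + 1) ^ k)"
  unfolding poly_bounded_def by blast

lemma poly_bounded_add:
  assumes "poly_bounded f" "poly_bounded g"
  shows "poly_bounded (\<lambda>n. f n + g n)"
proof -
  obtain c k c' k' where ck: "\<And>n. f n \<le> c * (n + 1) ^ k" "\<And>n. g n \<le> c' * (n + 1) ^ k'"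
    using assms unfolding poly_bounded_def by blast
  have "f n + g n \<le> (c + c') * (n + 1) ^ (k + k')" for n
  proof -
    have "c * (n + 1) ^ k \<le> c * (n + 1) ^ (k + k')" "c' * (n + 1) ^ k' \<le> c' * (n + 1) ^ (k + k')"
      by (intro mult_left_mono power_increasing; simp)+
    then show ?thesis using ck[of n] unfolding distrib_right by linarith
  qed
  then show ?thesis unfolding poly_bounded_def by blast
qed

lemma poly_bounded_mult:
  assumes "poly_bounded f" "poly_bounded g"
  shows "poly_bounded (\<lambda>n. f n * g n)"
proof -
  obtain c k c' k' where ck: "\<And>n. f n \<le> c * (n + 1) ^ k" "\<And>n. g n \<le> c' * (n + 1) ^ k'"
    using assms unfolding poly_bounded_def by blast
  have "f n * g n \<le> (c * c') * (n + 1) ^ (k + k')" for n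
  proof -
    have "f n * g n \<le> (c * (n + 1) ^ k) * (c' * (n + 1) ^ k')" using ck[of n] by (rule mult_mono) auto
    then show ?thesis by (simp only: power_add mult_ac)
  qed
  then show ?thesis unfolding poly_bounded_def by blast
qed

lemma poly_bounded_for:
  "poly_bounded f \<Longrightarrow> poly_bounded g \<Longrightarrow> poly_bounded (\<lambda>n. for_cost (f n) c (g n))"
  unfolding for_cost_def by (intro poly_bounded_add poly_bounded_mult poly_bounded_const)

lemma poly_bounded_nest: "poly_bounded f \<Longrightarrow> poly_bounded (\<lambda>n. nest_cost n k (f n))"
  by (induction k) (auto intro: poly_bounded_for poly_bounded_id)

lemma poly_bounded_sum_list:
  "(\<And>x. poly_bounded (f x)) \<Longrightarrow> poly_bounded (\<lambda>n. \<Sum>x\<leftarrow>xs. f x n)"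
  by (induction xs) (auto intro: poly_bounded_add poly_bounded_const)

lemma (in coded_algebra) poly_bounded_enum_cost:
  assumes "poly_bounded P"
  shows "poly_bounded (\<lambda>n. enum_cost (P n) n)"
proof -
  have Suc: "poly_bounded (\<lambda>n. Suc n)" using poly_bounded_add[OF poly_bounded_id poly_bounded_const[of 1]] by simp
  have "poly_bounded pass_cost" unfolding pass_cost_def
    by (intro poly_bounded_add poly_bounded_const poly_bounded_sum_list poly_bounded_nest)
  then have "poly_bounded close_cost" unfolding close_cost_def by (intro poly_bounded_for Suc)
  then have "poly_bounded extend_cost" unfolding extend_cost_def
    by (intro poly_bounded_add poly_bounded_mult poly_bounded_const poly_bounded_for poly_bounded_id)
  then have "poly_bounded (\<lambda>n. level_cost (P n) n)" unfolding level_cost_def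
    by (intro poly_bounded_add poly_bounded_const poly_bounded_for assms)
  moreover have "poly_bounded final_cost" unfolding final_cost_def
    by (intro poly_bounded_add poly_bounded_mult poly_bounded_const poly_bounded_for poly_bounded_id)
  ultimately have "poly_bounded (\<lambda>n. triple_cost (P n) n)" unfolding triple_cost_def init_cost_def
    by (intro poly_bounded_add poly_bounded_const poly_bounded_for poly_bounded_id assms)
  then show ?thesis unfolding enum_cost_def by (rule poly_bounded_nest)
qed

text \<open>The number of surjective homomorphisms is itself the resource bound: by
  \<open>level_length\<close> it limits the size of every level, and all other loops have length at
  most n + 1 or fixed.\<close>

lemma (in coded_algebra) poly_time_enumerable:
  assumes "in_K_surj A"
  shows "surj_homs_poly_time_enumerable A"
proof -
  obtain c k where b: "surj_bound A (\<lambda>n. c * (n + 1) ^ k)" using assms unfolding in_K_surj_iff by blast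
  let ?b = "\<lambda>n. c * (n + 1) ^ k" and ?P = "\<lambda>n. c * (n + 1) ^ k + 1"
  have mono: "mono ?b" by (intro monoI mult_left_mono power_mono) auto
  have "poly_bounded (\<lambda>n. enum_cost (?P n) n)"
    by (intro poly_bounded_enum_cost poly_bounded_add poly_bounded_power poly_bounded_const)
  then obtain d m where d: "\<And>n. enum_cost (?P n) n \<le> d * (n + 1) ^ m" unfolding poly_bounded_def by blast
  show ?thesis unfolding surj_homs_poly_time_enumerable_def
  proof (intro exI[of _ enum_com] exI[of _ code] exI[of _ "[:real d:] * [:1, 1:] ^ m"] conjI allI impI)
    show "inj_on code (univ A)" using code(2) by (metis inj_onI)
    fix X :: "('f, nat) ualg" and n assume X: "is_ualg X \<and> univ X = {..<n} \<and> same_signature X A"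
    interpret enumeration A fs code dec X n by unfold_locales (use X in auto)
    have "wp T enum_com (enum_cost (?P n) n) (\<lambda>s'. outp s' = concat result) (init_state n)"
      by (rule wp_enum) (rule level_length[OF _ _ b mono])
    then obtain t s where ts: "exec T enum_com (init_state n) t s" "t \<le> enum_cost (?P n) n" "outp s = concat result"
      unfolding wp_def by blast
    have "t \<le> d * (n + 1) ^ m" using ts(2) d[of n] by simp
    then have time: "real t \<le> poly ([:real d:] * [:1, 1:] ^ m) (real n)"
      unfolding poly_power_bound by (rule of_nat_mono)
    have "map (\<lambda>h. map (\<lambda>x. code (h x)) [0..<n]) (map decode result) = result"
      using result_correct(3) by (simp add: map_idI)
    then show "\<exists>t s hs. exec T enum_com (init_state n) t s \<and> real t \<le> poly ([:real d:] * [:1, 1:] ^ m) (real n) \<and>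
        distinct hs \<and> set hs = surj_homs X A \<and>
        outp s = concat (map (\<lambda>h. map (\<lambda>x. code (h x)) [0..<n]) hs)"
      using ts time result_correct(1,2)
      by (intro exI[of _ t] exI[of _ s] exI[of _ "map decode result"]) (simp del: map_map)
  qed
qed

text \<open>The program has a piece of code for every operation symbol, so the signature must be
  listed in full as \<open>fs\<close>. The labels 0, 1, 2 are shifted by one to keep 0 for undefined
  entries.\<close>

lemma in_K_surj_imp_eff:
  fixes A :: "('f, 'a) ualg"
  assumes A: "is_ualg A" "card (univ A) = 3" and "finite (syms A)" "in_K_surj A"
  shows "in_K_surj_eff A"
proof -
  have fin: "finite (univ A)" using A(2) by (metis card.infinite zero_neq_numeral)
  obtain fs where fs: "set fs = syms A" using finite_list assms(3) by blast
  obtain e where "e \<in> univ A" using A(1) by (auto simp: is_ualg_def)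
  from ex_labelling[OF fin this] obtain \<phi> :: "'a \<Rightarrow> nat" and \<psi> where
    \<phi>: "\<And>x. x \<in> univ A \<Longrightarrow> \<phi> x < 3" "\<And>x. x \<in> univ A \<Longrightarrow> \<psi> (\<phi> x) = x"
    "\<And>i. i < 3 \<Longrightarrow> \<psi> i \<in> univ A" "\<And>i. i < 3 \<Longrightarrow> \<phi> (\<psi> i) = i"
    unfolding A(2) by metis
  have "Suc (\<phi> a) \<in> {1, 2, 3}" if "a \<in> univ A" for a using \<phi>(1)[OF that] by auto
  moreover have "v - 1 < 3 \<and> Suc (v - 1) = v" if "v \<in> {1, 2, 3}" for v :: nat using that by auto
  ultimately interpret coded_algebra A fs "\<lambda>a. Suc (\<phi> a)" "\<lambda>v. \<psi> (v - 1)"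
    using A(1) fs \<phi> by unfold_locales auto
  show ?thesis unfolding in_K_surj_eff_def using assms(4) poly_time_enumerable by blast
qed

theorem theorem29:
  fixes A :: "('f, 'a) ualg"
  assumes "is_ualg A" and "card (univ A) = 3"
  shows "(in_K_surj A \<longleftrightarrow> (\<forall>\<alpha>. minimal_congruence A \<alpha> \<longrightarrow> tct_type A \<alpha> \<noteq> 1)) \<and>
         (finite (syms A) \<longrightarrow> in_K_surj A \<longrightarrow> in_K_surj_eff A)"
proof -
  have fin: "finite (univ A)" using assms(2) by (metis card.infinite zero_neq_numeral)
  interpret finite_ualg A by unfold_locales (use assms fin in auto)
  have "tct_type A \<alpha> \<noteq> 1" if "in_K_surj A" "minimal_congruence A \<alpha>" for \<alpha>
  proof -
    interpret three_minimal A \<alpha> by unfold_locales (use that assms in auto)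
    show ?thesis using type_1_not_in_K_surj that by blast
  qed
  moreover have "in_K_surj A" if "\<forall>\<alpha>. minimal_congruence A \<alpha> \<longrightarrow> tct_type A \<alpha> \<noteq> 1"
    using not_type_1_in_K_surj[OF assms(2)] that by blast
  ultimately show ?thesis using in_K_surj_imp_eff[OF assms] by blast
qed

end
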